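(* Let $\mu_{\rm in},\mu_{\rm fin}\in\mathcal P_2(\mathbb R^m)$ and let $\Psi:\mathbb R^m\to\mathbb R$, $\Psi(x)=\|x\|^2/2$. Let $f_1:[0,T]\times\mathbb R^m\to\mathbb R$ be Borel measurable, continuously differentiable and convex in the second argument, nonnegative, with $f_1(t,0)=0$ for all $t$, and suppose there are $p>1$, $C_1\in\mathbb R$, $C_2,\ell_f>0$ such that $C_1+C_2\|a\|^p\le f_1(t,a)\le\ell_f+\ell_f\|a\|^2$ for all $(t,a)$. Assume moreover that $a\mapsto f_1(t,a)$ is uniformly strongly convex: there is $\lambda_{f_1}>0$ such that $(\partial_af_1(t,a)-\partial_af_1(t,a'))\cdot(a-a')\ge\lambda_{f_1}\|a-a'\|^2$ for all $t\in[0,T]$, $a,a'\in\mathbb R^m$. Suppose that $\mathcal V_c(\mu_{\rm in},\mu_{\rm fin})<\infty$ and $\mathcal V_c^N(\mu_{\rm in},\mu_{\rm fin})<\infty$ for all $N\ge1$, where these values are defined in the context. Then $$\lim_{N\to\infty}\mathcal V^N_c(\mu_{\rm in},\mu_{\rm fin})=\mathcal V_c(\mu_{\rm in},\mu_{\rm fin}).$$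
   Context: Fix $T>0$ and a positive integer $m$. $(\Omega,\mathcal F,\mathbb P)$ is a Polish probability space carrying independent $\mathbb R^m$-valued Brownian motions $(W^i)_{i\ge1}$ and an initial $\sigma$-field $\mathcal F_0$ independent of them; $\mathbb F^N$ is the $\mathbb P$-completion of the filtration generated by $W^1,\dots,W^N$ and $\mathcal F_0$; $W:=W^1$, $\mathbb F:=\mathbb F^1$. Initial values of state processes are $\mathcal F_0$-measurable. $\mathcal P_2(\mathbb R^m)$ is the set of probability measures with finite second moment; $\mathcal L$ denotes law; $X\sim\mu$ means $\mathcal L(X)=\mu$; $\mu\le_{\rm cvx}\nu$ means $\int\varphi\,d\mu\le\int\varphi\,d\nu$ for every convex $\varphi:\mathbb R^m\to\mathbb R$. Weak mean field problem: $$\mathcal V_c(\mu_{\rm in},\mu_{\rm fin}):=\inf\Big\{\mathbb E\Big[\int_0^Tf_1(t,\alpha_t)dt\Big]:\ dX_t=\Big(\alpha_t-\int_{\mathbb R^m}\nabla\Psi(X_t-z)\,\mathcal L(X_t)(dz)\Big)dt+dW_t,\ X_0\sim\mu_{\rm in},\ \mathcal L(X_T)\le_{\rm cvx}\mu_{\rm fin}\Big\},$$ over $\mathbb R^m$-valued $\mathbb F$-progressive $\alpha$ with $\mathbb E[\int_0^Tf_1(t,\alpha_t)dt]<\infty$. Weak $N$-particle problem: $$\mathcal V^N_c(\mu_{\rm in},\mu_{\rm fin}):=\inf\Big\{\mathbb E\Big[\frac1N\sum_{i=1}^N\int_0^Tf_1(t,\alpha^i_t)dt\Big]:\ dX^i_t=\Big(\alpha^i_t-\frac1N\sum_{j=1}^N\nabla\Psi(X^i_t-X^j_t)\Big)dt+dW^i_t,\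 X^i_0\sim\mu_{\rm in},\ \mathcal L(X^i_T)\le_{\rm cvx}\mu_{\rm fin},\ 1\le i\le N\Big\},$$ where $X^1_0,\dots,X^N_0$ are i.i.d. $\mathcal F_0$-measurable and the infimum is over vectors $(\alpha^1,\dots,\alpha^N)$ of $\mathbb R^m$-valued $\mathbb F^N$-progressive processes with $\mathbb E[\int_0^Tf_1(t,\alpha^i_t)dt]<\infty$. *)

theory Defs
  imports "HOL-Probability.Probability"
begin

section \<open>Convex order and gradient\<close>

definition P2 :: "(real ^ 'm) measure set" where
  "P2 = {\<mu>. prob_space \<mu> \<and> sets \<mu> = sets borel \<and> integrable \<mu> (\<lambda>x. (norm x)\<^sup>2)}"

text \<open>A convex function is bounded below by an affine one, so its integral against a measure with
  finite first moment is well defined in \<open>(-\<infinity>, \<infinity>]\<close>. The form \<open>\<infinity> - \<infinity>\<close>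
  (equal to \<open>\<infinity>\<close> in \<^typ>\<open>ereal\<close>) is met only without first moments.\<close>

definition ext_integral :: "'a measure \<Rightarrow> ('a \<Rightarrow> real) \<Rightarrow> ereal" where
  "ext_integral \<mu> \<phi> =
     enn2ereal (\<integral>\<^sup>+x. ennreal (\<phi> x) \<partial>\<mu>) - enn2ereal (\<integral>\<^sup>+x. ennreal (- \<phi> x) \<partial>\<mu>)"

definition cvx_le :: "(real ^ 'm) measure \<Rightarrow> (real ^ 'm) measure \<Rightarrow> bool"
    (infix \<open>\<le>\<^sub>c\<^sub>v\<^sub>x\<close> 50) where
  "\<mu> \<le>\<^sub>c\<^sub>v\<^sub>x \<nu> \<longleftrightarrow>
     (\<forall>\<phi> :: real ^ 'm \<Rightarrow> real. convex_on UNIV \<phi> \<longrightarrow> ext_integral \<mu> \<phi> \<le> ext_integral \<nu> \<phi>)"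

definition gradient :: "('a::real_inner \<Rightarrow> real) \<Rightarrow> 'a \<Rightarrow> 'a" where
  "gradient g x = (THE D. GDERIV g x :> D)"


section \<open>Brownian motions on a Polish probability space\<close>

text \<open>The \<open>\<sigma>\<close>-algebra on \<^term>\<open>space M\<close> generated by a family of random vectors.\<close>

definition generated :: "'w measure \<Rightarrow> 'i set \<Rightarrow> ('i \<Rightarrow> 'w \<Rightarrow> real ^ 'm) \<Rightarrow> 'w set set" where
  "generated M J Y = sigma_sets (space M) {Y j -` A \<inter> space M | j A. j \<in> J \<and> A \<in> sets borel}"

definition gaussian :: "real \<Rightarrow> (real ^ 'm) measure" where
  \<comment> \<open>centred, with covariance \<open>v\<close> times the identity matrix\<close>
  "gaussian v = density lborel (\<lambda>x. ennreal (\<Prod>i\<in>UNIV. normal_density 0 (sqrt v) (x $ i)))"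

definition brownian_motion :: "'w measure \<Rightarrow> real \<Rightarrow> (real \<Rightarrow> 'w \<Rightarrow> real ^ 'm) \<Rightarrow> bool" where
  "brownian_motion M T B \<longleftrightarrow>
     (\<forall>t\<in>{0..T}. B t \<in> borel_measurable M) \<and>
     (AE \<omega> in M. B 0 \<omega> = 0) \<and>
     (AE \<omega> in M. continuous_on {0..T} (\<lambda>t. B t \<omega>)) \<and>
     (\<forall>s t. 0 \<le> s \<and> s < t \<and> t \<le> T \<longrightarrow>
        distr M borel (\<lambda>\<omega>. B t \<omega> - B s \<omega>) = gaussian (t - s) \<and>
        prob_space.indep_set M (generated M {0..s} B)
          (generated M {()} (\<lambda>_ \<omega>. B t \<omega> - B s \<omega>)))"

text \<open>The Brownian motions are \<open>W 1, W 2, \<dots>\<close>; the entry \<open>W 0\<close> is never used. Only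
  times in \<open>[0, T]\<close> matter.\<close>

locale brownian_setup = prob_space M
  for M :: "'w::polish_space measure" +
  fixes F0 :: "'w measure"
    and W :: "nat \<Rightarrow> real \<Rightarrow> 'w \<Rightarrow> real ^ 'm"
    and T :: real
  assumes sets_M: "sets M = sets borel"
    and F0: "subalgebra M F0"
    and W: "\<And>i. i \<ge> 1 \<Longrightarrow> brownian_motion M T (W i)"
    and W_indep: "indep_sets (\<lambda>i. generated M {0..T} (W i)) {1..}"
    and F0_indep: "indep_set (sets F0) (generated M ({1..} \<times> {0..T}) (\<lambda>(i, t). W i t))"

text \<open>The completed filtration generated by \<open>F0\<close> and the first \<open>N\<close> Brownian motions. The null
  sets of \<^term>\<open>completion M\<close> are all the subsets of null sets of \<open>M\<close>.\<close>

definition filt :: "'w measure \<Rightarrow> 'w measure \<Rightarrow> (nat \<Rightarrow> real \<Rightarrow> 'w \<Rightarrow> real ^ 'm) \<Rightarrow> nat \<Rightarrow> real \<Rightarrow> 'w measure"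
  where
  "filt M F0 W N t = sigma (space M)
     (generated M ({1..N} \<times> {0..t}) (\<lambda>(i, s). W i s) \<union> sets F0 \<union> null_sets (completion M))"

definition progressive :: "(real \<Rightarrow> 'w measure) \<Rightarrow> real \<Rightarrow> (real \<Rightarrow> 'w \<Rightarrow> real ^ 'm) \<Rightarrow> bool" where
  "progressive F T \<alpha> \<longleftrightarrow> (\<forall>t\<in>{0..T}.
     (\<lambda>(s, \<omega>). \<alpha> s \<omega>) \<in> borel_measurable (restrict_space borel {0..t} \<Otimes>\<^sub>M F t))"

text \<open>Processes are measurable with respect to the completed filtration only, so laws and
  expectations are taken under \<^term>\<open>completion M\<close>.\<close>

definition law :: "'w measure \<Rightarrow> ('w \<Rightarrow> real ^ 'm) \<Rightarrow> (real ^ 'm) measure" where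
  "law M X = distr (completion M) borel X"

text \<open>Adapted solutions of \<open>dX = b dt + dB\<close> on \<open>[0, T]\<close>; the noise is additive, so no stochastic
  integral is involved.\<close>

definition solves_sde :: "'w measure \<Rightarrow> (real \<Rightarrow> 'w measure) \<Rightarrow> real \<Rightarrow> (real \<Rightarrow> 'w \<Rightarrow> real ^ 'm) \<Rightarrow>
    (real \<Rightarrow> 'w \<Rightarrow> real ^ 'm) \<Rightarrow> (real \<Rightarrow> 'w \<Rightarrow> real ^ 'm) \<Rightarrow> bool" where
  "solves_sde M F T B b X \<longleftrightarrow>
     (\<forall>t\<in>{0..T}. X t \<in> borel_measurable (F t)) \<and>
     (AE \<omega> in M. set_integrable lborel {0..T} (\<lambda>s. b s \<omega>) \<and>
        (\<forall>t\<in>{0..T}. X t \<omega> = X 0 \<omega> + (LINT s:{0..t}|lborel. b s \<omega>) + (B t \<omega> - B 0 \<omega>)))"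


section \<open>The weak control problems\<close>

text \<open>The running cost is nonnegative on \<open>[0, T]\<close> wherever these values are used, so the Lebesgue
  integral in \<^typ>\<open>ennreal\<close> truncates nothing, and an empty infimum is \<open>\<infinity>\<close>.\<close>

definition running_cost :: "real \<Rightarrow> (real \<Rightarrow> real ^ 'm \<Rightarrow> real) \<Rightarrow> (real \<Rightarrow> 'w \<Rightarrow> real ^ 'm) \<Rightarrow> 'w \<Rightarrow> ennreal"
  where
  "running_cost T f \<alpha> \<omega> = (\<integral>\<^sup>+t\<in>{0..T}. ennreal (f t (\<alpha> t \<omega>)) \<partial>lborel)"

definition mf_admissible where
  "mf_admissible M F0 W T \<Psi> f \<mu>_in \<mu>_fin = {\<alpha>.
     progressive (filt M F0 W 1) T \<alpha> \<and>
     (\<integral>\<^sup>+\<omega>. running_cost T f \<alpha> \<omega> \<partial>completion M) < \<infinity> \<and>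
     (\<exists>X. X 0 \<in> borel_measurable F0 \<and> law M (X 0) = \<mu>_in \<and>
        (\<forall>t\<in>{0..T}. AE \<omega> in M. integrable (law M (X t)) (\<lambda>z. gradient \<Psi> (X t \<omega> - z))) \<and>
        solves_sde M (filt M F0 W 1) T (W 1)
          (\<lambda>t \<omega>. \<alpha> t \<omega> - (\<integral>z. gradient \<Psi> (X t \<omega> - z) \<partial>law M (X t))) X \<and>
        law M (X T) \<le>\<^sub>c\<^sub>v\<^sub>x \<mu>_fin)}"

definition mf_value :: "'w measure \<Rightarrow> 'w measure \<Rightarrow> (nat \<Rightarrow> real \<Rightarrow> 'w \<Rightarrow> real ^ 'm) \<Rightarrow> real \<Rightarrow>
    (real ^ 'm \<Rightarrow> real) \<Rightarrow> (real \<Rightarrow> real ^ 'm \<Rightarrow> real) \<Rightarrow>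
    (real ^ 'm) measure \<Rightarrow> (real ^ 'm) measure \<Rightarrow> ennreal" where
  "mf_value M F0 W T \<Psi> f \<mu>_in \<mu>_fin =
     (INF \<alpha>\<in>mf_admissible M F0 W T \<Psi> f \<mu>_in \<mu>_fin. \<integral>\<^sup>+\<omega>. running_cost T f \<alpha> \<omega> \<partial>completion M)"

definition particle_admissible where
  "particle_admissible M F0 W T \<Psi> f \<mu>_in \<mu>_fin N = {\<alpha>.
     (\<forall>i\<in>{1..N}. progressive (filt M F0 W N) T (\<alpha> i) \<and>
        (\<integral>\<^sup>+\<omega>. running_cost T f (\<alpha> i) \<omega> \<partial>completion M) < \<infinity>) \<and>
     (\<exists>X. (\<forall>i\<in>{1..N}. X i 0 \<in> borel_measurable F0) \<and>
        prob_space.indep_vars M (\<lambda>_. borel) (\<lambda>i. X i 0) {1..N} \<and>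
        (\<forall>i\<in>{1..N}.
           law M (X i 0) = \<mu>_in \<and>
           solves_sde M (filt M F0 W N) T (W i)
             (\<lambda>t \<omega>. \<alpha> i t \<omega> - (1 / real N) *\<^sub>R (\<Sum>j=1..N. gradient \<Psi> (X i t \<omega> - X j t \<omega>))) (X i) \<and>
           law M (X i T) \<le>\<^sub>c\<^sub>v\<^sub>x \<mu>_fin))}"

definition particle_value :: "'w measure \<Rightarrow> 'w measure \<Rightarrow> (nat \<Rightarrow> real \<Rightarrow> 'w \<Rightarrow> real ^ 'm) \<Rightarrow> real \<Rightarrow>
    (real ^ 'm \<Rightarrow> real) \<Rightarrow> (real \<Rightarrow> real ^ 'm \<Rightarrow> real) \<Rightarrow>
    (real ^ 'm) measure \<Rightarrow> (real ^ 'm) measure \<Rightarrow> nat \<Rightarrow> ennreal" where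
  "particle_value M F0 W T \<Psi> f \<mu>_in \<mu>_fin N =
     (INF \<alpha>\<in>particle_admissible M F0 W T \<Psi> f \<mu>_in \<mu>_fin N.
        \<integral>\<^sup>+\<omega>. ennreal (1 / real N) * (\<Sum>i=1..N. running_cost T f (\<alpha> i) \<omega>) \<partial>completion M)"

end

theory Submission
 imports Defs
begin

text \<open>The state is \<open>X = Z + \<integral> b\<close>, where \<open>Z\<close> is the driving Brownian motion started at the initial
value and \<open>b\<close> is the whole drift. Since the gradient of \<open>\<Psi>\<close> is the identity, the control
that produces \<open>b\<close> is \<open>b + X - E X\<close> in the mean field problem, and \<open>b\<^sub>i + X\<^sub>i - Y\<close> for the
particle \<open>i\<close>, where \<open>Y\<close> is the barycenter of the particles. Both are affine in the drifts, and
this allows both problems to be compared with a third one, which lives on path space: minimise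
\<open>J \<beta>\<close>, the cost of \<open>feedback Q T \<beta>\<close>, over the drifts \<open>\<beta>\<close> that are progressive functions of the path,
under the law \<open>Q\<close> of \<open>Z\<close> (\<open>canonical_drift\<close>).

A drift is brought to path space by conditioning on the path of \<open>Z\<close>. This stays progressive,
because the future increments of \<open>Z\<close> are independent of the past (\<open>progressive_projection\<close>), and
by Jensen's inequality it keeps the terminal law below the target in convex order
(\<open>projected_state_cvx_le\<close>) and does not increase a convex cost. So the mean field problem has the same
value as the problem on path space (\<open>mf_to_canonical\<close>, \<open>canonical_to_mf\<close>).

For the upper bound on the particle values, each particle follows a given \<open>\<beta>\<close> along its own path.
The states are then i.i.d., their laws are the one of the canonical problem, and the controls
differ from \<open>feedback Q T \<beta>\<close> by \<open>Y - E Y\<close>, which is \<open>O(1 / sqrt N)\<close> in \<open>L\<^sup>2\<close>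
(\<open>canonical_to_particles\<close>).

For the lower bound, the drifts of the particles are projected onto their own paths and averaged over
the particles into one \<open>\<beta>\<close> (\<open>averaged_projection\<close>). Convexity at \<open>feedback Q T \<beta>\<close> bounds \<open>J \<beta>\<close> by
the cost of the particles plus the pairing of \<open>Y - E Y\<close> with the average, over the particles, of the gradient of
the cost along the paths. No independence is known about \<open>Y\<close>, so \<open>Y - E Y\<close> need not be small; but it is centered,
so only the fluctuation of the averaged gradient counts, and this average runs over functions
of independent paths: the error is again \<open>O(1 / sqrt N)\<close> (\<open>projected_cost\<close>, \<open>particles_to_canonical\<close>).

Strong convexity bounds the controls in \<open>L\<^sup>2\<close> by the cost, which makes the constants uniform. The
square integrability of the states follows from that of the controls by mean reversion
(\<open>mean_reverting_sq_int\<close>).\<close>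

section \<open>Square integrable functions\<close>

definition sq_int :: "'a measure => ('a => 'b::euclidean_space) => bool" where
 "sq_int R u \<longleftrightarrow> u \<in> borel_measurable R \<and> integrable R (%x. (norm (u x))\<^sup>2)"

definition nsq :: "'a measure => ('a => 'b::euclidean_space) => real" where
 "nsq R u = (\<integral>x. (norm (u x))\<^sup>2 \<partial>R)"

lemma sq_int_measurable: "sq_int R u ==> u \<in> borel_measurable R"
 by (simp add: sq_int_def)

lemma nsq_nonneg: "nsq R u \<ge> 0"
 by (simp add: nsq_def)

lemma norm_add_sq_le: "(norm (a + b :: 'b::euclidean_space))\<^sup>2 \<le> 2 * (norm a)\<^sup>2 + 2 * (norm b)\<^sup>2"
proof -
 have "(norm (a + b))\<^sup>2 \<le> (norm a + norm b)\<^sup>2"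
  by (intro power_mono norm_triangle_ineq) auto
 also have "\<dots> \<le> 2 * (norm a)\<^sup>2 + 2 * (norm b)\<^sup>2"
  using sum_squares_bound[of "norm a" "norm b"] by (simp add: power2_sum)
 finally show ?thesis .
qed

lemma sq_int_bound:
 assumes "u \<in> borel_measurable R" "integrable R h" "!!x. x \<in> space R ==> (norm (u x))\<^sup>2 \<le> h x"
 shows "sq_int R u"
 unfolding sq_int_def
proof (intro conjI assms(1) Bochner_Integration.integrable_bound[OF assms(2)])
 show "AE x in R. norm ((norm (u x))\<^sup>2) \<le> norm (h x)"
  using assms(3) by (intro AE_I2) (metis abs_ge_self order_trans power2_abs real_norm_def abs_norm_cancel abs_power2)
qed (use assms(1) in measurable)

lemma sq_int_add:
 assumes "sq_int R u" "sq_int R v"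
 shows "sq_int R (%x. u x + v x)"
proof (rule sq_int_bound)
 show "integrable R (%x. 2 * (norm (u x))\<^sup>2 + 2 * (norm (v x))\<^sup>2)"
  using assms by (auto simp: sq_int_def)
qed (use assms norm_add_sq_le in \<open>auto simp: sq_int_def\<close>)

lemma nsq_add:
 assumes "sq_int R u" "sq_int R v"
 shows "nsq R (%x. u x + v x) \<le> 2 * nsq R u + 2 * nsq R v"
proof -
 have "nsq R (%x. u x + v x) \<le> (\<integral>x. 2 * (norm (u x))\<^sup>2 + 2 * (norm (v x))\<^sup>2 \<partial>R)"
  unfolding nsq_def using assms sq_int_add[OF assms]
  by (intro integral_mono) (auto simp: sq_int_def norm_add_sq_le)
 also have "\<dots> = 2 * nsq R u + 2 * nsq R v"
  using assms by (simp add: nsq_def sq_int_def)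
 finally show ?thesis .
qed

lemma sq_int_scaleR: "sq_int R u ==> sq_int R (%x. c *\<^sub>R u x)"
 by (auto simp: sq_int_def power_mult_distrib)

lemma nsq_scaleR: "nsq R (%x. c *\<^sub>R u x) = c\<^sup>2 * nsq R u"
 by (simp add: nsq_def power_mult_distrib)

lemma sq_int_diff:
 assumes "sq_int R u" "sq_int R v"
 shows "sq_int R (%x. u x - v x)"
 using sq_int_add[OF assms(1) sq_int_scaleR[OF assms(2), of "-1"]] by simp

lemma nsq_diff:
 assumes "sq_int R u" "sq_int R v"
 shows "nsq R (%x. u x - v x) \<le> 2 * nsq R u + 2 * nsq R v"
 using nsq_add[OF assms(1) sq_int_scaleR[OF assms(2), of "-1"]]
 by (simp add: nsq_def)

lemma sq_int_zero: "sq_int R (%x. 0)"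
 by (simp add: sq_int_def)

lemma sq_int_sum: "(!!i. i \<in> I ==> sq_int R (u i)) ==> sq_int R (%x. \<Sum>i\<in>I. u i x)"
 by (induction I rule: infinite_finite_induct) (auto simp: sq_int_zero intro!: sq_int_add)

lemma (in finite_measure) sq_int_const: "sq_int M (%x. c)"
 by (simp add: sq_int_def)

lemma sq_int_norm: "sq_int R u ==> sq_int R (%x. norm (u x))"
 by (auto simp: sq_int_def)

lemma sq_int_inner:
 assumes "sq_int R u" "sq_int R v"
 shows "integrable R (%x. u x \<bullet> v x)"
proof (rule Bochner_Integration.integrable_bound)
 show "integrable R (%x. (norm (u x))\<^sup>2 + (norm (v x))\<^sup>2)"
  using assms by (auto simp: sq_int_def)
 show "AE x in R. norm (u x \<bullet> v x) \<le> norm ((norm (u x))\<^sup>2 + (norm (v x))\<^sup>2)"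
 proof (intro AE_I2)
  fix x
  have "\<bar>u x \<bullet> v x\<bar> \<le> norm (u x) * norm (v x)"
   by (rule Cauchy_Schwarz_ineq2)
  also have "\<dots> \<le> (norm (u x))\<^sup>2 + (norm (v x))\<^sup>2"
   using sum_squares_bound[of "norm (u x)" "norm (v x)"] mult_nonneg_nonneg[OF norm_ge_zero norm_ge_zero, of "u x" "v x"]
   by linarith
  finally show "norm (u x \<bullet> v x) \<le> norm ((norm (u x))\<^sup>2 + (norm (v x))\<^sup>2)"
   by simp
 qed
qed (use assms in \<open>auto simp: sq_int_def\<close>)

lemma (in finite_measure) sq_int_integrable:
 assumes "sq_int M u"
 shows "integrable M u"
proof -
 have "integrable M (%x. norm (u x) \<bullet> (1::real))"
  by (intro sq_int_inner sq_int_norm assms sq_int_const)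
 then show ?thesis
  using assms by (intro integrable_norm_cancel[of M u]) (auto simp: sq_int_def)
qed

lemma Cauchy_Schwarz_integral:
 assumes "sq_int R u" "sq_int R v"
 shows "\<bar>\<integral>x. u x \<bullet> v x \<partial>R\<bar> \<le> sqrt (nsq R u) * sqrt (nsq R v)"
proof -
 define I where "I = (\<integral>x. u x \<bullet> v x \<partial>R)"
 note i = sq_int_inner[OF assms]
 have q: "0 \<le> nsq R u - 2 * s * I + s\<^sup>2 * nsq R v" for s
 proof -
  have "0 \<le> nsq R (%x. u x - s *\<^sub>R v x)"
   by (rule nsq_nonneg)
  also have "\<dots> = (\<integral>x. (norm (u x))\<^sup>2 - 2 * s * (u x \<bullet> v x) + s\<^sup>2 * (norm (v x))\<^sup>2 \<partial>R)"
   unfolding nsq_def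
   by (intro Bochner_Integration.integral_cong refl)
    (simp add: power2_norm_eq_inner algebra_simps inner_commute power2_eq_square[of s])
  also have "\<dots> = nsq R u - 2 * s * I + s\<^sup>2 * nsq R v"
   using assms i by (simp add: nsq_def I_def sq_int_def)
  finally show ?thesis .
 qed
 have "I\<^sup>2 \<le> nsq R u * nsq R v"
 proof (cases "nsq R v = 0")
  case True
  have "I = 0"
  proof (rule ccontr)
   assume I: "I \<noteq> 0"
   have "2 * ((nsq R u + 1) / I) * I = 2 * (nsq R u + 1)"
    using I by simp
   then show False
    using q[of "(nsq R u + 1) / I"] True nsq_nonneg[of R u] by simp
  qed
  then show ?thesis using True by simp
 next
  case False
  then have "nsq R v > 0" using nsq_nonneg[of R v] by linarith
  then show ?thesis
   using q[of "I / nsq R v"] by (simp add: field_simps power2_eq_square)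
 qed
 then have "\<bar>I\<bar> \<le> sqrt (nsq R u * nsq R v)"
  using real_le_rsqrt[of "\<bar>I\<bar>"] by simp
 then show ?thesis
  by (simp add: I_def real_sqrt_mult)
qed

lemma (in prob_space) norm_expectation_sq_le:
 assumes "sq_int M u"
 shows "(norm (\<integral>x. u x \<partial>M))\<^sup>2 \<le> nsq M u"
proof -
 have "norm (\<integral>x. u x \<partial>M) \<le> (\<integral>x. norm (u x) \<partial>M)"
  by (rule integral_norm_bound)
 also have "\<dots> \<le> sqrt (nsq M u)"
 proof -
  have "\<bar>\<integral>x. norm (u x) \<bullet> (1::real) \<partial>M\<bar> \<le> sqrt (nsq M (%x. norm (u x))) * sqrt (nsq M (%x. 1::real))"
   by (intro Cauchy_Schwarz_integral sq_int_norm assms sq_int_const)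
  then show ?thesis
   by (simp add: nsq_def prob_space)
 qed
 finally have "(norm (\<integral>x. u x \<partial>M))\<^sup>2 \<le> (sqrt (nsq M u))\<^sup>2"
  by (intro power_mono) auto
 then show ?thesis
  by (simp add: nsq_nonneg)
qed

lemma sq_int_distr:
 assumes [measurable]: "h \<in> measurable R S" "g \<in> borel_measurable S"
 shows "sq_int (distr R S h) g \<longleftrightarrow> sq_int R (%x. g (h x))"
 using assms by (auto simp: sq_int_def integrable_distr_eq)

lemma nsq_distr:
 assumes [measurable]: "h \<in> measurable R S" "g \<in> borel_measurable S"
 shows "nsq (distr R S h) g = nsq R (%x. g (h x))"
 by (simp add: nsq_def integral_distr)

lemma nsq_cong: "(!!x. x \<in> space R ==> u x = v x) ==> nsq R u = nsq R v"
 unfolding nsq_def by (rule Bochner_Integration.integral_cong) auto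

lemma nsq_cong_AE:
 assumes "AE x in R. u x = v x" "u \<in> borel_measurable R" "v \<in> borel_measurable R"
 shows "nsq R u = nsq R v"
 unfolding nsq_def using assms by (intro integral_cong_AE) auto

lemma sq_int_cong_AE:
 assumes "AE x in R. u x = v x" "u \<in> borel_measurable R" "sq_int R v"
 shows "sq_int R u"
proof -
 have "integrable R (%x. (norm (u x))\<^sup>2)"
  using assms by (subst integrable_cong_AE[where g = "%x. (norm (v x))\<^sup>2"]) (auto simp: sq_int_def)
 then show ?thesis using assms by (simp add: sq_int_def)
qed

section \<open>Integrals over time\<close>

abbreviation time :: "real => real measure" where
 "time T \<equiv> restrict_space lborel {0..T}"

text \<open>For \<open>t\<close> in \<open>[0, T]\<close> this is the integral of \<open>h\<close> over \<open>[0, t]\<close>. The domain stays \<open>[0, T]\<close>, so that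
all times share one measure space and Fubini applies to processes at once.\<close>

definition prim :: "real => (real => 'b::euclidean_space) => real => 'b" where
 "prim T h t = (\<integral>s. indicator {0..t} s *\<^sub>R h s \<partial>time T)"

abbreviation timed :: "real => 'w measure => (real \<times> 'w) measure" (infixr "\<otimes>" 80) where
 "T \<otimes> R \<equiv> time T \<Otimes>\<^sub>M R"

abbreviation proc :: "(real => 'w => 'b) => real \<times> 'w => 'b" where
 "proc b \<equiv> %x. b (fst x) (snd x)"

lemma finite_measure_time: "finite_measure (time T)"
 by (intro finite_measureI)
  (simp add: emeasure_restrict_space space_restrict_space emeasure_lborel_Icc_eq)

lemma space_time: "space (time T) = {0..T}"
 by (simp add: space_restrict_space)

lemma sets_time: "sets (time T) = sets (restrict_space borel {0..T})"
 by (simp add: sets_restrict_space)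

lemma measure_time: "0 \<le> T ==> measure (time T) {0..T} = T"
 by (simp add: measure_restrict_space)

lemma id_time_measurable[measurable]: "(%s. s) \<in> borel_measurable (time T)"
 by (simp add: measurable_restrict_space1)

lemma prim_eq:
 assumes "t \<in> {0..T}"
 shows "prim T h t = (LINT s:{0..t}|lborel. h s)"
proof -
 have "prim T h t = (\<integral>s. indicator {0..T} s *\<^sub>R (indicator {0..t} s *\<^sub>R h s) \<partial>lborel)"
  unfolding prim_def by (subst integral_restrict_space) auto
 also have "\<dots> = (LINT s:{0..t}|lborel. h s)"
  unfolding set_lebesgue_integral_def using assms
  by (intro Bochner_Integration.integral_cong) (auto simp: indicator_def)
 finally show ?thesis .
qed

lemma integrable_time_iff:
 fixes h :: "real => 'b::euclidean_space"
 shows "integrable (time T) h \<longleftrightarrow> set_integrable lborel {0..T} h"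
 unfolding set_integrable_def by (rule integrable_restrict_space) auto

lemma integrable_time_indicator:
 assumes "integrable (time T) (h :: real => 'b::euclidean_space)"
 shows "integrable (time T) (%s. indicator {u..v} s *\<^sub>R h s)"
proof (rule Bochner_Integration.integrable_bound[OF assms])
 have "indicat_real {u..v} \<in> borel_measurable (time T)"
  by (simp add: measurable_restrict_space1)
 then show "(%s. indicator {u..v} s *\<^sub>R h s) \<in> borel_measurable (time T)"
  using assms by (intro borel_measurable_scaleR) auto
qed (auto simp: indicator_def)

lemma prim_add:
 assumes "integrable (time T) g" "integrable (time T) h"
 shows "prim T (%s. g s + h s) t = prim T g t + prim T h t"
 unfolding prim_def using assms
 by (simp add: scaleR_add_right Bochner_Integration.integral_add integrable_time_indicator)

lemma prim_diff:
 assumes "integrable (time T) g" "integrable (time T) h"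
 shows "prim T (%s. g s - h s) t = prim T g t - prim T h t"
 unfolding prim_def using assms
 by (simp add: scaleR_diff_right Bochner_Integration.integral_diff integrable_time_indicator)

lemma prim_scaleR: "prim T (%s. c *\<^sub>R g s) t = c *\<^sub>R prim T g t"
 unfolding prim_def by (subst integral_scaleR_right[symmetric]) (simp only: scaleR_left_commute)

lemma prim_sum:
 assumes "!!i. i \<in> I ==> integrable (time T) (g i)"
 shows "prim T (%s. \<Sum>i\<in>I. g i s) t = (\<Sum>i\<in>I. prim T (g i) t)"
 unfolding prim_def using assms
 by (simp add: scaleR_sum_right Bochner_Integration.integral_sum integrable_time_indicator)

lemma prim_zero_time: "prim T h 0 = 0"
proof -
 have "prim T h 0 = (\<integral>s. 0 \<partial>time T)"
  unfolding prim_def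
 proof (rule integral_cong_AE)
  have "AE s in lborel. s \<noteq> (0::real)"
   by (rule AE_lborel_singleton)
  then have "AE s in time T. s \<noteq> 0"
   by (subst AE_restrict_space_iff) auto
  then show "AE s in time T. indicator {0..0} s *\<^sub>R h s = 0"
   by eventually_elim auto
  have "(%s. indicator {0..0} s *\<^sub>R h s) = (%s. indicator {0} s *\<^sub>R h 0)"
   by (auto simp: indicator_def fun_eq_iff)
  then show "(%s. indicator {0..0} s *\<^sub>R h s) \<in> borel_measurable (time T)"
   by (simp add: measurable_restrict_space1)
 qed simp
 then show ?thesis by simp
qed

lemma norm_prim_le:
 assumes "integrable (time T) h"
 shows "norm (prim T h t) \<le> (\<integral>s. norm (h s) \<partial>time T)"
proof -
 have "norm (prim T h t) \<le> (\<integral>s. norm (indicator {0..t} s *\<^sub>R h s) \<partial>time T)"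
  unfolding prim_def by (rule integral_norm_bound)
 also have "\<dots> \<le> (\<integral>s. norm (h s) \<partial>time T)"
  using assms integrable_time_indicator[OF assms]
  by (intro integral_mono integrable_norm) (auto simp: indicator_def)
 finally show ?thesis .
qed

lemma continuous_on_prim:
 assumes "integrable (time T) h"
 shows "continuous_on {0..T} (prim T h)"
proof -
 have s: "set_integrable lborel {0..T} h"
  using assms by (simp add: integrable_time_iff)
 then have "h integrable_on {0..T}"
  by (rule set_borel_integral_eq_integral)
 then have c: "continuous_on {0..T} (%t. integral {0..t} h)"
  by (rule indefinite_integral_continuous_1)
 have "prim T h t = integral {0..t} h" if "t \<in> {0..T}" for t
 proof -
  have "set_integrable lborel {0..t} h"
   using that by (intro set_integrable_subset[OF s]) auto
  then show ?thesis
   using set_borel_integral_eq_integral(2)[of "{0..t}" h] that by (simp add: prim_eq)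
 qed
 then show ?thesis
  using c continuous_on_cong[OF refl, of "{0..T}" "prim T h" "%t. integral {0..t} h"] by blast
qed

lemma nsq_prim_path:
 assumes "sq_int (time T) h" and that: "T \<ge> 0"
 shows "(norm (prim T h t))\<^sup>2 \<le> T * nsq (time T) h"
proof -
 interpret finite_measure "time T" by (rule finite_measure_time)
 have "norm (prim T h t) \<le> (\<integral>s. norm (h s) \<partial>time T)"
  by (intro norm_prim_le sq_int_integrable assms)
 also have "\<dots> \<le> sqrt (nsq (time T) h) * sqrt T"
 proof -
  have "\<bar>\<integral>x. norm (h x) \<bullet> (1::real) \<partial>time T\<bar> \<le> sqrt (nsq (time T) (%x. norm (h x))) * sqrt (nsq (time T) (%x. 1::real))"
   by (intro Cauchy_Schwarz_integral sq_int_norm assms sq_int_const)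
  then show ?thesis
   using that by (simp add: nsq_def measure_time space_time)
 qed
 finally have "(norm (prim T h t))\<^sup>2 \<le> (sqrt (nsq (time T) h) * sqrt T)\<^sup>2"
  by (intro power_mono) auto
 then show ?thesis
  using that by (simp add: nsq_nonneg power_mult_distrib mult.commute)
qed

text \<open>The equation \<open>x = c - \<integral> x\<close> gives \<open>\<integral>\<^sub>0\<^sup>t x = \<integral>\<^sub>0\<^sup>t e\<^sup>s\<^sup>-\<^sup>t c\<^sub>s ds\<close>, and the exponential is at most one.
The damping makes the bound linear in \<open>c\<close>, without a constant that grows with \<open>T\<close>.\<close>

lemma volterra_bound:
 fixes x c :: "real => 'b::euclidean_space"
 assumes cx: "continuous_on {0..T} x" and cc: "continuous_on {0..T} c"
  and eq: "!!t. t \<in> {0..T} ==> x t = c t - prim T x t" and t: "t \<in> {0..T}"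
 shows "norm (x t) \<le> norm (c t) + (\<integral>s. norm (c s) \<partial>time T)"
proof -
 have p: "prim T g s = integral {0..s} g" if "continuous_on {0..T} g" "s \<in> {0..T}" for g :: "real => 'b" and s
 proof -
  have "set_integrable lborel {0..s} g"
   unfolding set_integrable_def using that
   by (intro borel_integrable_compact continuous_on_subset[OF that(1)]) auto
  then show ?thesis
   using set_borel_integral_eq_integral(2)[of "{0..s}" g] that by (simp add: prim_eq)
 qed
 define I where "I s = integral {0..s} x" for s
 have dI: "(I has_vector_derivative x s) (at s within {0..T})" if "s \<in> {0..T}" for s
  unfolding I_def by (rule integral_has_vector_derivative[OF cx that])
 have dE: "((%s. exp s *\<^sub>R I s) has_vector_derivative exp s *\<^sub>R c s) (at s within {0..t})" if "s \<in> {0..t}" for s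
 proof -
  have s: "s \<in> {0..T}" using that t by auto
  have "((%s. exp s *\<^sub>R I s) has_vector_derivative exp s *\<^sub>R x s + exp s *\<^sub>R I s) (at s within {0..T})"
   by (rule has_vector_derivative_scaleR[OF _ dI[OF s]]) (auto intro!: derivative_eq_intros)
  moreover have "exp s *\<^sub>R x s + exp s *\<^sub>R I s = exp s *\<^sub>R c s"
   using eq[OF s] p[OF cx s] by (simp add: I_def scaleR_add_right[symmetric])
  ultimately show ?thesis
   using t by (auto intro: has_vector_derivative_within_subset)
 qed
 have hi: "((%s. exp s *\<^sub>R c s) has_integral exp t *\<^sub>R I t - exp 0 *\<^sub>R I 0) {0..t}"
  using t by (intro fundamental_theorem_of_calculus dE) auto
 have I0: "I 0 = 0" by (simp add: I_def)
 have ct: "continuous_on {0..t} c"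
  using t by (intro continuous_on_subset[OF cc]) auto
 have "exp t * norm (I t) = norm (integral {0..t} (%s. exp s *\<^sub>R c s))"
  using integral_unique[OF hi] by (simp add: I0)
 also have "\<dots> \<le> integral {0..t} (%s. exp t * norm (c s))"
  by (intro integral_norm_bound_integral integrable_continuous_real continuous_intros ct)
   (auto intro!: mult_right_mono)
 also have "\<dots> = exp t * integral {0..t} (%s. norm (c s))"
  by simp
 finally have "norm (I t) \<le> integral {0..t} (%s. norm (c s))"
  by simp
 also have "\<dots> = (LINT s:{0..t}|lborel. norm (c s))"
  by (intro set_borel_integral_eq_integral(2)[symmetric])
   (unfold set_integrable_def, intro borel_integrable_compact continuous_intros ct, simp)
 also have "\<dots> = prim T (%s. norm (c s)) t"
  using t by (simp add: prim_eq)
 also have "\<dots> \<le> norm (prim T (%s. norm (c s)) t)" by simp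
 also have "\<dots> \<le> (\<integral>s. norm (norm (c s)) \<partial>time T)"
  unfolding integrable_time_iff set_integrable_def
  by (intro norm_prim_le, unfold integrable_time_iff set_integrable_def,
    intro borel_integrable_compact continuous_intros cc) auto
 finally have "norm (I t) \<le> (\<integral>s. norm (c s) \<partial>time T)" by simp
 moreover have "x t = c t - I t"
  using eq[OF t] p[OF cx t] by (simp add: I_def)
 ultimately show ?thesis
  using norm_triangle_ineq4[of "c t" "I t"] by simp
qed

section \<open>Gradients of convex functions\<close>

text \<open>In finite dimension every derivative is the inner product with a vector, so the definite
description in \<open>gradient\<close> denotes.\<close>

lemma GDERIV_gradient:
 fixes g :: "'a::euclidean_space => real"
 assumes "g differentiable at x"
 shows "GDERIV g x :> gradient g x"
proof -
 obtain g' where g': "(g has_derivative g') (at x)"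
  using assms by (auto simp: differentiable_def)
 interpret linear g' by (rule has_derivative_linear[OF g'])
 define D where "D = (\<Sum>b\<in>Basis. g' b *\<^sub>R b)"
 have g'_eq: "g' = (%h. h \<bullet> D)"
 proof
  fix h
  have "g' h = g' (\<Sum>b\<in>Basis. (h \<bullet> b) *\<^sub>R b)"
   by (simp add: euclidean_representation)
  also have "\<dots> = (\<Sum>b\<in>Basis. (h \<bullet> b) * g' b)"
   by (simp only: sum scale real_scaleR_def)
  also have "\<dots> = h \<bullet> D"
   by (simp add: D_def inner_sum_right mult.commute)
  finally show "g' h = h \<bullet> D" .
 qed
 have D: "GDERIV g x :> D"
  unfolding gderiv_def using g'[unfolded g'_eq] .
 have "D' = D" if "GDERIV g x :> D'" for D'
 proof -
  have eq: "(%h. h \<bullet> D') = (%h. h \<bullet> D)"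
   by (rule has_derivative_unique[OF that[unfolded gderiv_def] D[unfolded gderiv_def]])
  have "h \<bullet> D' = h \<bullet> D" for h
   using fun_cong[OF eq, of h] .
  then show ?thesis
   by (rule vector_eq_ldot[THEN iffD1, OF allI])
 qed
 from theI[of "%D. GDERIV g x :> D", OF D this] show ?thesis
  unfolding gradient_def .
qed

lemma gradient_eqI:
 fixes g :: "'a::euclidean_space => real"
 assumes "GDERIV g x :> D"
 shows "gradient g x = D"
proof -
 have "GDERIV g x :> gradient g x"
  using assms by (intro GDERIV_gradient) (auto simp: gderiv_def differentiable_def)
 then have eq: "(%h. h \<bullet> gradient g x) = (%h. h \<bullet> D)"
  using assms unfolding gderiv_def by (rule has_derivative_unique)
 have "h \<bullet> gradient g x = h \<bullet> D" for h
  using fun_cong[OF eq, of h] .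
 then show ?thesis
  by (rule vector_eq_ldot[THEN iffD1, OF allI])
qed

lemma gradient_half_norm_sq:
 "gradient (%x::'a::euclidean_space. (norm x)\<^sup>2 / 2) x = x"
proof (rule gradient_eqI)
 have "((%x. x \<bullet> x) has_derivative (%h. x \<bullet> h + h \<bullet> x)) (at x)"
  by (rule has_derivative_inner[OF has_derivative_ident has_derivative_ident])
 from has_derivative_mult_right[OF this, of "1/2"]
 have "((%x. (norm x)\<^sup>2 / 2) has_derivative (%h. h \<bullet> x)) (at x)"
  by (simp add: power2_norm_eq_inner inner_commute)
 then show "GDERIV (%x. (norm x)\<^sup>2 / 2) x :> x"
  by (simp add: gderiv_def)
qed

lemma GDERIV_line:
 fixes g :: "'a::euclidean_space => real"
 assumes "GDERIV g x :> D"
 shows "((%s. g (x + s *\<^sub>R h)) has_real_derivative D \<bullet> h) (at 0)"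
proof -
 have 1: "((%s. x + s *\<^sub>R h) has_derivative (%s. s *\<^sub>R h)) (at 0)"
  by (auto intro!: derivative_eq_intros)
 have 2: "(g has_derivative (%y. y \<bullet> D)) (at (x + 0 *\<^sub>R h))"
  using assms by (simp add: gderiv_def)
 have "((%s. g (x + s *\<^sub>R h)) has_derivative (%s. (s *\<^sub>R h) \<bullet> D)) (at 0)"
  by (rule has_derivative_compose[OF 1 2])
 then show ?thesis
  by (simp add: has_field_derivative_def inner_commute mult_commute_abs)
qed

text \<open>Along the segment the function is convex in one variable, where the tangent lies below the graph.\<close>

lemma convex_above_gradient:
 fixes g :: "'a::euclidean_space => real"
 assumes "convex_on UNIV g" "GDERIV g x :> D"
 shows "g y \<ge> g x + D \<bullet> (y - x)"
proof -
 let ?\<phi> = "%s. g (x + s *\<^sub>R (y - x))"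
 have "convex_on UNIV ?\<phi>"
 proof (rule convex_onI)
  fix t a b :: real assume t: "0 < t" "t < 1"
  have "x + ((1 - t) *\<^sub>R a + t *\<^sub>R b) *\<^sub>R (y - x) =
   (1 - t) *\<^sub>R (x + a *\<^sub>R (y - x)) + t *\<^sub>R (x + b *\<^sub>R (y - x))"
   by (simp add: algebra_simps)
  then show "?\<phi> ((1 - t) *\<^sub>R a + t *\<^sub>R b) \<le> (1 - t) * ?\<phi> a + t * ?\<phi> b"
   using convex_onD[OF assms(1), of t] t by simp
 qed simp
 then have "?\<phi> 1 - ?\<phi> 0 \<ge> (D \<bullet> (y - x)) * (1 - 0)"
  by (rule convex_on_imp_above_tangent) (use GDERIV_line[OF assms(2), of "y - x"] in auto)
 then show ?thesis by simp
qed

text \<open>The cost at a fixed time: \<open>G\<close> is its gradient. Comparing \<open>g a\<close> with the tangent at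
 \<open>a / 2\<close> bounds it below by a multiple of \<open>\<parallel>a\<parallel>\<^sup>2\<close>, and comparing the tangent
 at \<open>a\<close> with the quadratic upper bound at distance \<open>1 + \<parallel>a\<parallel>\<close> controls the gradient.\<close>

lemma strongly_convex_lower:
 fixes g :: "'a::euclidean_space => real"
 assumes cvx: "convex_on UNIV g" and G: "!!x. GDERIV g x :> G x"
  and nn: "!!x. 0 \<le> g x" and z: "g 0 = 0"
  and strong: "!!x y. (G x - G y) \<bullet> (x - y) \<ge> lam * (norm (x - y))\<^sup>2"
 shows "lam / 4 * (norm a)\<^sup>2 \<le> g a"
proof -
 have G0: "G 0 \<bullet> h = 0" for h
 proof (rule DERIV_local_min)
  show "((%s. g (0 + s *\<^sub>R h)) has_real_derivative G 0 \<bullet> h) (at 0)"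
   by (rule GDERIV_line[OF G])
 qed (use nn z in \<open>auto intro: zero_less_one\<close>)
 let ?b = "(1/2) *\<^sub>R a"
 have "lam * (norm (?b - 0))\<^sup>2 \<le> (G ?b - G 0) \<bullet> (?b - 0)"
  by (rule strong)
 also have "\<dots> = G ?b \<bullet> ?b"
  using G0[of ?b] by (simp add: inner_diff_left)
 also have "\<dots> = G ?b \<bullet> (a - ?b)"
 proof -
  have "a - ?b = ?b"
   by (rule euclidean_eqI) (simp add: inner_diff_left)
  then show ?thesis by simp
 qed
 also have "\<dots> \<le> g a - g ?b"
  using convex_above_gradient[OF cvx G, of ?b a] by simp
 also have "\<dots> \<le> g a"
  using nn by simp
 finally show ?thesis
  by (simp add: power2_eq_square)
qed

lemma quadratic_gradient_bound:
 fixes g :: "'a::euclidean_space => real"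
 assumes cvx: "convex_on UNIV g" and G: "GDERIV g a :> D"
  and nn: "!!x. 0 \<le> g x" and up: "!!x. g x \<le> L + L * (norm x)\<^sup>2" and L: "L > 0"
 shows "norm D \<le> 5 * L * (1 + norm a)"
proof (cases "D = 0")
 case False
 define r where "r = 1 + norm a"
 have r: "r \<ge> 1" by (simp add: r_def)
 define h where "h = (r / norm D) *\<^sub>R D"
 have nh: "norm h = r"
  using False r by (simp add: h_def)
 have "D \<bullet> h = r * norm D"
  using False by (simp add: h_def power2_norm_eq_inner[symmetric] power2_eq_square)
 moreover have "D \<bullet> h \<le> g (a + h)"
  using convex_above_gradient[OF cvx G, of "a + h"] nn[of a] by simp
 ultimately have "r * norm D \<le> L + L * (norm (a + h))\<^sup>2"
  using up[of "a + h"] by linarith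
 also have "\<dots> \<le> L * r\<^sup>2 + L * (2 * r)\<^sup>2"
 proof -
  have "norm (a + h) \<le> 2 * r"
   using norm_triangle_ineq[of a h] nh by (simp add: r_def)
  then have "(norm (a + h))\<^sup>2 \<le> (2 * r)\<^sup>2"
   by (intro power_mono) auto
  moreover have "1 \<le> r\<^sup>2"
   using r by simp
  ultimately show ?thesis
   using L mult_left_mono[of 1 "r\<^sup>2" L] by (intro add_mono mult_left_mono) auto
 qed
 also have "\<dots> = r * (5 * L * r)"
  by (simp add: power2_eq_square)
 finally have "norm D \<le> 5 * L * r"
  using r by (auto simp: mult_le_cancel_left)
 then show ?thesis
  by (simp add: r_def)
qed (use L in simp)

section \<open>Convex order and maxima of affine functions\<close>

text \<open>Maxima of finitely many affine functions are Lipschitz, hence integrable as soon as there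
 is a first moment, and they exhaust the convex functions from below.\<close>

primrec max_aff :: "(nat => real) => (nat => 'a::euclidean_space) => nat => 'a => real" where
 "max_aff c v 0 x = c 0 + v 0 \<bullet> x"
| "max_aff c v (Suc n) x = max (max_aff c v n x) (c (Suc n) + v (Suc n) \<bullet> x)"

lemma max_aff_ge: "k \<le> n ==> c k + v k \<bullet> x \<le> max_aff c v n x"
 by (induction n) (auto simp: le_Suc_eq)

lemma max_aff_le: "(!!k. k \<le> n ==> c k + v k \<bullet> x \<le> y) ==> max_aff c v n x \<le> y"
 by (induction n) auto

lemma max_aff_attained: "\<exists>k\<le>n. max_aff c v n x = c k + v k \<bullet> x"
proof (induction n)
 case (Suc n)
 then show ?case
  by (auto simp: max_def intro: exI[of _ "Suc n"] le_SucI)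
qed simp

lemma max_aff_mono: "mono (%n. max_aff c v n x)"
 unfolding mono_iff_le_Suc by simp

lemma convex_on_max_aff: "convex_on UNIV (max_aff c v n)"
proof (rule convex_onI)
 fix t :: real and x y :: 'a assume t: "0 < t" "t < 1"
 show "max_aff c v n ((1 - t) *\<^sub>R x + t *\<^sub>R y) \<le> (1 - t) * max_aff c v n x + t * max_aff c v n y"
 proof (rule max_aff_le)
  fix k assume k: "k \<le> n"
  have "c k + v k \<bullet> ((1 - t) *\<^sub>R x + t *\<^sub>R y) = (1 - t) * (c k + v k \<bullet> x) + t * (c k + v k \<bullet> y)"
   by (simp add: algebra_simps inner_add_right)
  also have "\<dots> \<le> (1 - t) * max_aff c v n x + t * max_aff c v n y"
   using t k by (intro add_mono mult_left_mono max_aff_ge) auto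
  finally show "c k + v k \<bullet> ((1 - t) *\<^sub>R x + t *\<^sub>R y) \<le> \<dots>" .
 qed
qed simp

lemma borel_measurable_max_aff[measurable]: "max_aff c v n \<in> borel_measurable borel"
proof (induction n)
 case (Suc n)
 note Suc[measurable]
 have "max_aff c v (Suc n) = (%x. max (max_aff c v n x) (c (Suc n) + v (Suc n) \<bullet> x))"
  by (simp add: fun_eq_iff)
 then show ?case by simp
next
 case 0
 have "max_aff c v 0 = (%x. c 0 + v 0 \<bullet> x)"
  by (simp add: fun_eq_iff)
 then show ?case by simp
qed

lemma (in finite_measure) integrable_max_aff:
 assumes U: "integrable M U"
 shows "integrable M (%x. max_aff c v n (U x))"
proof (induction n)
 case 0
 then show ?case using U by simp
next
 case (Suc n)
 then show ?case using U by (auto intro!: integrable_max)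
qed

text \<open>The epigraph is closed and convex, so a point below it is separated from it by a hyperplane; this
hyperplane is not vertical because the function is finite everywhere.\<close>

lemma convex_affine_minorant:
 fixes \<phi> :: "'a::euclidean_space => real"
 assumes cvx: "convex_on UNIV \<phi>" and e: "e > 0"
 shows "\<exists>c v. (\<forall>y. c + v \<bullet> y \<le> \<phi> y) \<and> \<phi> q - e \<le> c + v \<bullet> q"
proof -
 have cont: "continuous_on UNIV \<phi>"
  using convex_on_continuous[OF open_UNIV cvx] .
 have "convex (epigraph UNIV \<phi>)"
  using cvx by (simp add: convex_epigraph)
 moreover have "closed (epigraph UNIV \<phi>)"
 proof -
  have "continuous_on UNIV (%z::'a \<times> real. \<phi> (fst z))"
   by (rule continuous_on_compose2[OF cont]) (auto intro: continuous_intros)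
  then have "closed {z::'a \<times> real. \<phi> (fst z) \<le> snd z}"
   by (intro closed_Collect_le continuous_intros)
  then show ?thesis
   by (simp add: epigraph_def)
 qed
 moreover have "(q, \<phi> q - e) \<notin> epigraph UNIV \<phi>"
  using e by (simp add: epigraph_def)
 ultimately have "\<exists>a b. a \<bullet> (q, \<phi> q - e) < b \<and> (\<forall>x\<in>epigraph UNIV \<phi>. b < a \<bullet> x)"
  by (rule separating_hyperplane_closed_point)
 then obtain a b where ab: "a \<bullet> (q, \<phi> q - e) < b" "!!x. x \<in> epigraph UNIV \<phi> ==> a \<bullet> x > b"
  by blast
 obtain u r where a: "a = (u, r)" by (cases a)
 have epi: "b < u \<bullet> y + r * \<phi> y" for y
  using ab(2)[of "(y, \<phi> y)"] by (simp add: a epigraph_def)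
 have pt: "u \<bullet> q + r * (\<phi> q - e) < b"
  using ab(1) by (simp add: a)
 have "r * e > 0"
  using epi[of q] pt by (simp add: algebra_simps)
 then have r: "r > 0"
  using e by (simp add: zero_less_mult_iff)
 have "b / r + (- (1 / r) *\<^sub>R u) \<bullet> y \<le> \<phi> y" for y
  using epi[of y] r by (simp add: field_simps)
 moreover have "\<phi> q - e \<le> b / r + (- (1 / r) *\<^sub>R u) \<bullet> q"
  using pt r by (simp add: field_simps)
 ultimately show ?thesis by blast
qed

text \<open>Take affine minorants that almost touch the graph at the points of a countable dense set. Their
supremum agrees with the function there, and both are continuous.\<close>

lemma convex_max_aff_limit:
 fixes \<phi> :: "'a::euclidean_space => real"
 assumes cvx: "convex_on UNIV \<phi>"
 obtains c v where "!!n x. max_aff c v n x \<le> \<phi> x" "!!x. (%n. max_aff c v n x) \<longlonglongrightarrow> \<phi> x"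
proof -
 obtain D :: "'a set" where D: "countable D" "!!X. open X ==> X \<noteq> {} ==> \<exists>d\<in>D. d \<in> X"
  using countable_dense_setE by blast
 have ne: "D \<noteq> {}" using D(2)[of UNIV] by auto
 let ?I = "D \<times> (UNIV :: nat set)"
 have I: "countable ?I" "?I \<noteq> {}" using D(1) ne by auto
 have "\<exists>cv. (\<forall>y. fst cv + snd cv \<bullet> y \<le> \<phi> y) \<and>
   \<phi> (fst i) - 1 / real (Suc (snd i)) \<le> fst cv + snd cv \<bullet> fst i" for i :: "'a \<times> nat"
  using convex_affine_minorant[OF cvx, of "1 / real (Suc (snd i))" "fst i"] by auto
 then obtain cv where "\<forall>i. (\<forall>y. fst (cv i) + snd (cv i) \<bullet> y \<le> \<phi> y) \<and>
   \<phi> (fst i) - 1 / real (Suc (snd i)) \<le> fst (cv i) + snd (cv i) \<bullet> fst (i :: 'a \<times> nat)"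
  using choice[of "%(i :: 'a \<times> nat) cv. (\<forall>y. fst cv + snd cv \<bullet> y \<le> \<phi> y) \<and>
   \<phi> (fst i) - 1 / real (Suc (snd i)) \<le> fst cv + snd cv \<bullet> fst i"] by auto
 then have cv: "!!i y. fst (cv i) + snd (cv i) \<bullet> y \<le> \<phi> y"
  "!!i. \<phi> (fst i) - 1 / real (Suc (snd i)) \<le> fst (cv i) + snd (cv i) \<bullet> fst i"
  by auto
 define c where "c n = fst (cv (from_nat_into ?I n))" for n
 define v where "v n = snd (cv (from_nat_into ?I n))" for n
 have le: "max_aff c v n x \<le> \<phi> x" for n x
  by (rule max_aff_le) (simp add: c_def v_def cv(1))
 define \<psi> where "\<psi> x = lim (%n. max_aff c v n x)" for x
 have lim: "(%n. max_aff c v n x) \<longlonglongrightarrow> \<psi> x" for x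
 proof -
  obtain L where "(%n. max_aff c v n x) \<longlonglongrightarrow> L"
   by (rule incseq_convergent[of "%n. max_aff c v n x" "\<phi> x", OF max_aff_mono]) (simp add: le)
  then have "convergent (%n. max_aff c v n x)"
   by (auto simp: convergent_def)
  then show ?thesis
   unfolding \<psi>_def by (simp add: convergent_LIMSEQ_iff)
 qed
 have \<psi>\<phi>: "\<psi> x \<le> \<phi> x" for x
  using LIMSEQ_le_const2[OF lim] le by blast
 have "convex_on UNIV \<psi>"
 proof (rule convex_onI)
  fix t :: real and x y :: 'a assume t: "0 < t" "t < 1"
  show "\<psi> ((1 - t) *\<^sub>R x + t *\<^sub>R y) \<le> (1 - t) * \<psi> x + t * \<psi> y"
  proof (rule LIMSEQ_le[OF lim])
   show "(%n. (1 - t) * max_aff c v n x + t * max_aff c v n y) \<longlonglongrightarrow> (1 - t) * \<psi> x + t * \<psi> y"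
    by (intro tendsto_intros lim)
   show "\<exists>N. \<forall>n\<ge>N. max_aff c v n ((1 - t) *\<^sub>R x + t *\<^sub>R y) \<le> (1 - t) * max_aff c v n x + t * max_aff c v n y"
    by (intro exI allI impI convex_onD[OF convex_on_max_aff]) (use t in auto)
  qed
 qed simp
 then have c1: "continuous_on UNIV \<psi>"
  by (rule convex_on_continuous[OF open_UNIV])
 have c2: "continuous_on UNIV \<phi>"
  using convex_on_continuous[OF open_UNIV cvx] .
 have eqD: "\<psi> d = \<phi> d" if d: "d \<in> D" for d
 proof (rule antisym[OF \<psi>\<phi>])
  have "\<phi> d \<le> \<psi> d + e" if e: "e > 0" for e
  proof -
   obtain m where m: "1 / real (Suc m) < e"
    using nat_approx_posE[OF e] by blast
   obtain n where n: "from_nat_into ?I n = (d, m)"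
    using from_nat_into_surj[OF I(1), of "(d, m)"] d by blast
   have "\<phi> d - 1 / real (Suc m) \<le> c n + v n \<bullet> d"
    using cv(2)[of "(d, m)"] by (simp only: c_def v_def n fst_conv snd_conv)
   also have "\<dots> \<le> max_aff c v n d"
    by (rule max_aff_ge) simp
   also have "\<dots> \<le> \<psi> d"
    by (rule incseq_le[OF _ lim]) (rule max_aff_mono)
   finally show ?thesis using m by simp
  qed
  then show "\<phi> d \<le> \<psi> d"
   by (rule field_le_epsilon)
 qed
 have "\<psi> x = \<phi> x" for x
 proof (rule ccontr)
  assume x: "\<psi> x \<noteq> \<phi> x"
  have "open (- {x. \<psi> x = \<phi> x})"
   using closed_Collect_eq[OF c1 c2] by (simp add: open_closed)
  then show False
   using D(2)[of "- {x. \<psi> x = \<phi> x}"] x eqD by auto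
 qed
 then have "\<psi> = \<phi>" by auto
 then show ?thesis
  using that[of c v] le lim by simp
qed

lemma ext_integral_integrable:
 assumes "integrable \<mu> \<phi>"
 shows "ext_integral \<mu> \<phi> = ereal (\<integral>x. \<phi> x \<partial>\<mu>)"
proof -
 have "(\<integral>\<^sup>+x. ennreal (\<phi> x) \<partial>\<mu>) < \<infinity>" "(\<integral>\<^sup>+x. ennreal (- \<phi> x) \<partial>\<mu>) < \<infinity>"
  using assms by (auto simp: real_integrable_def top.not_eq_extremum)
 then obtain a b where ab: "a \<ge> 0" "b \<ge> 0" "(\<integral>\<^sup>+x. ennreal (\<phi> x) \<partial>\<mu>) = ennreal a" "(\<integral>\<^sup>+x. ennreal (- \<phi> x) \<partial>\<mu>) = ennreal b"
  by (auto simp: less_top_ennreal)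
 then show ?thesis
  unfolding ext_integral_def real_lebesgue_integral_def[OF assms]
  by (simp add: ab enn2ereal_ennreal)
qed

lemma ext_integral_lower:
 assumes "integrable \<mu> g" "!!x. g x \<le> \<phi> x"
 shows "ereal (\<integral>x. g x \<partial>\<mu>) \<le> ext_integral \<mu> \<phi>"
 unfolding ext_integral_integrable[OF assms(1), symmetric] ext_integral_def
 by (intro ereal_minus_mono) (auto simp: less_eq_ennreal.rep_eq[symmetric] intro!: nn_integral_mono ennreal_leI assms(2))

text \<open>Monotone convergence along the maxima of affine functions, after an affine minorant is
subtracted to make the integrands nonnegative.\<close>

lemma cvx_leI:
 fixes \<mu> \<nu> :: "(real ^ 'm) measure"
 assumes "finite_measure \<mu>" "finite_measure \<nu>" "sets \<mu> = sets borel"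
  and m1: "integrable \<mu> (%x. x)" and m2: "integrable \<nu> (%x. x)"
  and le: "!!c v n. (\<integral>x. max_aff c v n x \<partial>\<mu>) \<le> (\<integral>x. max_aff c v n x \<partial>\<nu>)"
 shows "\<mu> \<le>\<^sub>c\<^sub>v\<^sub>x \<nu>"
 unfolding cvx_le_def
proof (intro allI impI)
 interpret m: finite_measure \<mu> by fact
 interpret n: finite_measure \<nu> by fact
 fix \<phi> :: "real ^ 'm => real" assume cvx: "convex_on UNIV \<phi>"
 obtain c v where cv: "!!n x. max_aff c v n x \<le> \<phi> x" "!!x. (%n. max_aff c v n x) \<longlonglongrightarrow> \<phi> x"
  by (rule convex_max_aff_limit[OF cvx]) (assumption | rule)+
 have i1: "integrable \<mu> (max_aff c v n)" for n
  using m.integrable_max_aff[OF m1] by simp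
 have i2: "integrable \<nu> (max_aff c v n)" for n
  using n.integrable_max_aff[OF m2] by simp
 have b: "ereal (\<integral>x. max_aff c v n x \<partial>\<mu>) \<le> ext_integral \<nu> \<phi>" for n
 proof -
  have "ereal (\<integral>x. max_aff c v n x \<partial>\<mu>) \<le> ereal (\<integral>x. max_aff c v n x \<partial>\<nu>)"
   using le by simp
  also have "\<dots> \<le> ext_integral \<nu> \<phi>"
   by (rule ext_integral_lower[OF i2 cv(1)])
  finally show ?thesis .
 qed
 show "ext_integral \<mu> \<phi> \<le> ext_integral \<nu> \<phi>"
 proof (cases "ext_integral \<nu> \<phi>")
  case (real r)
  have b': "(\<integral>x. max_aff c v n x \<partial>\<mu>) \<le> r" for n
   using b[of n] real by simp
  have mi: "mono (%n. \<integral>x. max_aff c v n x \<partial>\<mu>)"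
   unfolding mono_iff_le_Suc by (intro allI integral_mono i1) simp
  obtain l where l: "(%n. \<integral>x. max_aff c v n x \<partial>\<mu>) \<longlonglongrightarrow> l"
   by (rule incseq_convergent[OF mi, of r]) (use b' in auto)
  have meas: "\<phi> \<in> borel_measurable \<mu>"
   by (rule borel_measurable_LIMSEQ_real[OF cv(2)]) (use i1 in auto)
  have "has_bochner_integral \<mu> \<phi> l"
   by (rule has_bochner_integral_monotone_convergence[OF i1 _ _ l meas])
    (use max_aff_mono[of c v] cv(2) in auto)
  then have "integrable \<mu> \<phi>" "(\<integral>x. \<phi> x \<partial>\<mu>) = l"
   by (auto simp: has_bochner_integral_iff)
  moreover have "l \<le> r"
   by (rule LIMSEQ_le_const2[OF l]) (use b' in blast)
  ultimately show ?thesis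
   using real by (simp add: ext_integral_integrable)
 qed (use b[of 0] in auto)
qed

lemma cvx_leD:
 fixes \<mu> \<nu> :: "(real ^ 'm) measure"
 assumes "finite_measure \<mu>" "finite_measure \<nu>"
  and "integrable \<mu> (%x. x)" and "integrable \<nu> (%x. x)" and "\<mu> \<le>\<^sub>c\<^sub>v\<^sub>x \<nu>"
 shows "(\<integral>x. max_aff c v n x \<partial>\<mu>) \<le> (\<integral>x. max_aff c v n x \<partial>\<nu>)"
proof -
 interpret m: finite_measure \<mu> by fact
 interpret n: finite_measure \<nu> by fact
 have "ext_integral \<mu> (max_aff c v n) \<le> ext_integral \<nu> (max_aff c v n)"
  using assms(5) convex_on_max_aff by (auto simp: cvx_le_def)
 then show ?thesis
  using m.integrable_max_aff[OF assms(3), of c v n] n.integrable_max_aff[OF assms(4), of c v n]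
  by (simp add: ext_integral_integrable)
qed

section \<open>Gaussian increments\<close>

lemma space_gaussian[simp]: "space (gaussian v) = UNIV"
 by (simp add: gaussian_def)

lemma sets_gaussian[simp, measurable_cong]: "sets (gaussian v) = sets borel"
 by (simp add: gaussian_def)

lemma prod_Basis_vec: "(\<Prod>b\<in>(Basis :: (real ^ 'm) set). h b) = (\<Prod>i\<in>UNIV. h (axis i 1))"
proof -
 have "bij_betw (%i. axis i 1) UNIV (Basis :: (real ^ 'm) set)"
  by (auto simp: bij_betw_def inj_on_def axis_eq_axis Basis_vec_def)
 then show ?thesis
  by (rule prod.reindex_bij_betw[symmetric])
qed

lemma gaussian_eq_prod_Basis:
 "gaussian v = density lborel (%x :: real ^ 'm. \<Prod>b\<in>Basis. ennreal (normal_density 0 (sqrt v) (x \<bullet> b)))"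
 unfolding gaussian_def
 by (simp add: prod_Basis_vec inner_axis prod_ennreal)

lemma nn_integral_normal_moment:
 assumes "\<sigma> > 0"
 shows "(\<integral>\<^sup>+y. ennreal (normal_density 0 \<sigma> y) \<partial>lborel) = 1"
  and "(\<integral>\<^sup>+y. ennreal (y\<^sup>2) * ennreal (normal_density 0 \<sigma> y) \<partial>lborel) = ennreal (\<sigma>\<^sup>2)"
proof -
 show "(\<integral>\<^sup>+y. ennreal (normal_density 0 \<sigma> y) \<partial>lborel) = 1"
  using assms by (subst nn_integral_eq_integral) auto
 have "has_bochner_integral lborel (%y. normal_density 0 \<sigma> y * (y - 0) ^ (2 * 1)) (fact (2 * 1) / ((2 / \<sigma>\<^sup>2) ^ 1 * fact 1))"
  by (rule normal_moment_even[OF assms])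
 then have "integrable lborel (%y. y\<^sup>2 * normal_density 0 \<sigma> y)" "(\<integral>y. y\<^sup>2 * normal_density 0 \<sigma> y \<partial>lborel) = \<sigma>\<^sup>2"
  by (simp_all add: mult.commute has_bochner_integral_iff)
 then have "(\<integral>\<^sup>+y. ennreal (y\<^sup>2 * normal_density 0 \<sigma> y) \<partial>lborel) = ennreal (\<sigma>\<^sup>2)"
  by (subst nn_integral_eq_integral) auto
 then show "(\<integral>\<^sup>+y. ennreal (y\<^sup>2) * ennreal (normal_density 0 \<sigma> y) \<partial>lborel) = ennreal (\<sigma>\<^sup>2)"
  by (simp add: ennreal_mult)
qed

lemma prob_space_gaussian:
 assumes "v > 0"
 shows "prob_space (gaussian v :: (real ^ 'm) measure)"
proof
 have "emeasure (gaussian v) (space (gaussian v :: (real ^ 'm) measure)) =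
  (\<integral>\<^sup>+x. (\<Prod>b\<in>Basis. ennreal (normal_density 0 (sqrt v) (x \<bullet> b))) \<partial>(lborel :: (real ^ 'm) measure))"
  unfolding gaussian_eq_prod_Basis by (simp add: emeasure_density)
 also have "\<dots> = 1"
  using assms
  by (subst nn_integral_lborel_prod) (simp_all add: nn_integral_normal_moment del: nn_integral_density)
 finally show "emeasure (gaussian v) (space (gaussian v :: (real ^ 'm) measure)) = 1" .
qed

lemma gaussian_second_moment:
 assumes "v > 0"
 shows "(\<integral>\<^sup>+x. ennreal ((norm x)\<^sup>2) \<partial>(gaussian v :: (real ^ 'm) measure)) = ennreal (real CARD('m) * v)"
proof -
 let ?n = "normal_density 0 (sqrt v)"
 have s: "sqrt v > 0" using assms by simp
 have one: "(\<integral>\<^sup>+x. (\<Prod>b'\<in>Basis. ennreal (?n (x \<bullet> b'))) * ennreal ((x \<bullet> b)\<^sup>2) \<partial>(lborel :: (real ^ 'm) measure)) = ennreal v"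
  if b: "b \<in> Basis" for b :: "real ^ 'm"
 proof -
  let ?h = "%b' y. (if b' = b then ennreal (y\<^sup>2) else 1) * ennreal (?n y)"
  have "(\<integral>\<^sup>+x. (\<Prod>b'\<in>Basis. ennreal (?n (x \<bullet> b'))) * ennreal ((x \<bullet> b)\<^sup>2) \<partial>(lborel :: (real ^ 'm) measure)) =
   (\<integral>\<^sup>+x. (\<Prod>b'\<in>Basis. ?h b' (x \<bullet> b')) \<partial>(lborel :: (real ^ 'm) measure))"
   using b by (intro nn_integral_cong) (simp add: prod.distrib prod.delta mult.commute)
  also have "\<dots> = (\<Prod>b'\<in>(Basis :: (real ^ 'm) set). \<integral>\<^sup>+y. ?h b' y \<partial>lborel)"
   by (rule nn_integral_lborel_prod) auto
  also have "\<dots> = (\<Prod>b'\<in>(Basis :: (real ^ 'm) set). if b' = b then ennreal v else 1)"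
   using nn_integral_normal_moment[OF s] assms by (intro prod.cong) auto
  also have "\<dots> = ennreal v"
   using b by (simp add: prod.delta)
  finally show ?thesis .
 qed
 have "(\<integral>\<^sup>+x. ennreal ((norm x)\<^sup>2) \<partial>(gaussian v :: (real ^ 'm) measure)) =
  (\<integral>\<^sup>+x. (\<Sum>b\<in>Basis. (\<Prod>b'\<in>Basis. ennreal (?n (x \<bullet> b'))) * ennreal ((x \<bullet> b)\<^sup>2)) \<partial>(lborel :: (real ^ 'm) measure))"
  unfolding gaussian_eq_prod_Basis
  by (subst nn_integral_density)
   (auto intro!: nn_integral_cong simp: sum_distrib_left[symmetric] sum_ennreal norm_eq_sqrt_inner
    euclidean_inner[of x x for x] power2_eq_square sum_nonneg)
 also have "\<dots> = (\<Sum>b\<in>(Basis :: (real ^ 'm) set). ennreal v)"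
  by (subst nn_integral_sum) (simp_all add: one)
 also have "\<dots> = ennreal (real CARD('m) * v)"
  using assms by (simp add: ennreal_mult ennreal_of_nat_eq_real_of_nat)
 finally show ?thesis .
qed

section \<open>Path space\<close>

definition path_space :: "real => (real => real ^ 'm) measure" where
 "path_space T = (\<Pi>\<^sub>M t\<in>{0..T}. borel)"

text \<open>The events of path space known at time \<open>t\<close>. They are pulled back along the restriction to
\<open>[0, t]\<close>, so the space itself stays the same for all \<open>t\<close>.\<close>

definition past :: "real => real => (real => real ^ 'm) measure" where
 "past T t = vimage_algebra (space (path_space T)) (%z. restrict z {0..t}) (\<Pi>\<^sub>M s\<in>{0..t}. borel)"

lemma space_past[simp]: "space (past T t) = space (path_space T)"
 by (simp add: past_def)

lemma restrict_past_measurable: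
 assumes "J \<subseteq> {0..t}" "t \<le> T"
 shows "(%z. restrict z J) \<in> measurable (past T t) (\<Pi>\<^sub>M s\<in>J. borel)"
proof -
 have "(%z. restrict z {0..t}) \<in> measurable (past T t) (\<Pi>\<^sub>M s\<in>{0..t}. borel)"
  unfolding past_def by (rule measurable_vimage_algebra1) (auto simp: space_PiM)
 from measurable_compose[OF this measurable_restrict_subset[OF assms(1)]]
 show ?thesis
  using assms(1) by (simp add: Int_absorb1 Int_absorb2)
qed

lemma past_component_measurable:
 assumes "s \<in> {0..t}" "t \<le> T"
 shows "(%z. z s) \<in> borel_measurable (past T t)"
proof -
 have "(%z. (restrict z {s}) s) \<in> borel_measurable (past T t)"
  using assms by (intro measurable_compose[OF restrict_past_measurable]) auto
 then show ?thesis by simp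
qed

lemma subalgebra_past:
 assumes "t \<le> T"
 shows "subalgebra (path_space T) (past T t)"
 unfolding subalgebra_def
proof (intro conjI)
 have "(%z. restrict z {0..t}) \<in> measurable (path_space T) (\<Pi>\<^sub>M s\<in>{0..t}. (borel :: (real ^ 'm) measure))"
  unfolding path_space_def using assms by (intro measurable_restrict_subset) auto
 then show "sets (past T t) \<subseteq> sets (path_space T :: (real => real ^ 'm) measure)"
  unfolding past_def by (rule sets_image_in_sets[rotated]) simp
qed simp

lemma measurable_past:
 assumes "h \<in> space R \<rightarrow> space (path_space T)" "!!s. s \<in> {0..t} ==> (%x. h x s) \<in> borel_measurable R"
 shows "h \<in> measurable R (past T t)"
 unfolding past_def
proof (rule measurable_vimage_algebra2)
 show "h \<in> space R \<rightarrow> space (path_space T)"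
  by (rule assms(1))
 show "(%x. restrict (h x) {0..t}) \<in> measurable R (\<Pi>\<^sub>M s\<in>{0..t}. borel)"
  using assms(2) by (intro measurable_restrict)
qed

lemma past_mono: "t \<le> u ==> u \<le> T ==> (%z. z) \<in> measurable (past T u) (past T t)"
 by (rule measurable_past) (auto intro!: past_component_measurable)

text \<open>Stated for arbitrary measures, since it is applied to path laws weighted by a density known at
time \<open>t\<close>, which have Gaussian increments after \<open>t\<close> only.\<close>

definition gaussian_increments :: "real => real => (real => real ^ 'm) measure => bool" where
 "gaussian_increments T t \<mu> \<longleftrightarrow> (\<forall>s u. t \<le> s \<and> s < u \<and> u \<le> T \<longrightarrow>
   (\<forall>A\<in>sets (past T s). \<forall>B\<in>sets borel.
    emeasure \<mu> (A \<inter> {z\<in>space (path_space T). z u - z s \<in> B}) = emeasure \<mu> A * emeasure (gaussian (u - s)) B))"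

text \<open>A later coordinate is an earlier one plus an independent Gaussian variable.\<close>

lemma gaussian_increments_step:
 fixes \<mu> :: "(real => real ^ 'm) measure"
 assumes fin: "finite_measure \<mu>" and sets: "sets \<mu> = sets (path_space T)"
  and incr: "gaussian_increments T t \<mu>"
  and I: "I \<subseteq> {0..s}" "s \<in> I" and st: "0 \<le> t" "t \<le> s" "s < b" "b \<le> T"
 shows "distr \<mu> (\<Pi>\<^sub>M r\<in>insert b I. borel) (%z. restrict z (insert b I)) =
  distr (distr \<mu> (\<Pi>\<^sub>M r\<in>I. borel) (%z. restrict z I) \<Otimes>\<^sub>M gaussian (b - s))
   (\<Pi>\<^sub>M r\<in>insert b I. borel) (%(y, x). y(b := y s + x))"
proof -
 interpret finite_measure \<mu> by fact
 have bI: "b \<notin> I" using I st by auto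
 have sp: "space \<mu> = space (path_space T)" using sets by (rule sets_eq_imp_space_eq)
 have m[measurable_cong]: "sets \<mu> = sets (\<Pi>\<^sub>M t\<in>{0..T}. borel)"
  using sets by (simp add: path_space_def)
 have c: "(%z. z r) \<in> borel_measurable \<mu>" if "r \<in> {0..T}" for r
  unfolding measurable_cong_sets[OF m refl] using that by (rule measurable_component_singleton)
 have mI: "(%z. restrict z I) \<in> measurable \<mu> (\<Pi>\<^sub>M r\<in>I. borel)"
  unfolding measurable_cong_sets[OF m refl] using I st by (intro measurable_restrict_subset) auto
 have md: "(%z. z b - z s) \<in> borel_measurable \<mu>"
  using st I by (intro borel_measurable_diff c) auto
 have h: "(%(y, x). y(b := y s + x)) \<in> measurable ((\<Pi>\<^sub>M r\<in>I. borel) \<Otimes>\<^sub>M borel) (\<Pi>\<^sub>M r\<in>insert b I. (borel :: (real ^ 'm) measure))"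
 proof -
  have "(%p. fst p s) \<in> borel_measurable ((\<Pi>\<^sub>M r\<in>I. (borel :: (real ^ 'm) measure)) \<Otimes>\<^sub>M (borel :: (real ^ 'm) measure))"
   using I by (intro measurable_compose[OF measurable_fst] measurable_component_singleton)
  then show ?thesis
   unfolding split_beta' by (intro measurable_fun_upd[where J = I] borel_measurable_add) auto
 qed
 have prod: "distr \<mu> (\<Pi>\<^sub>M r\<in>I. borel) (%z. restrict z I) \<Otimes>\<^sub>M gaussian (b - s) =
  distr \<mu> ((\<Pi>\<^sub>M r\<in>I. borel) \<Otimes>\<^sub>M borel) (%z. (restrict z I, z b - z s))"
 proof (rule pair_measure_eqI)
  show "sigma_finite_measure (distr \<mu> (\<Pi>\<^sub>M r\<in>I. borel) (%z. restrict z I))"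
   by (intro finite_measure.sigma_finite_measure finite_measure_distr mI)
  interpret g: prob_space "gaussian (b - s) :: (real ^ 'm) measure"
   using st by (intro prob_space_gaussian) simp
  show "sigma_finite_measure (gaussian (b - s) :: (real ^ 'm) measure)" ..
  fix A :: "(real => real ^ 'm) set" and B :: "(real ^ 'm) set"
  assume A: "A \<in> sets (distr \<mu> (\<Pi>\<^sub>M r\<in>I. borel) (%z. restrict z I))" and B: "B \<in> sets (gaussian (b - s))"
  let ?A = "(%z. restrict z I) -` A \<inter> space (path_space T)"
  have "(%z. restrict z I) -` A \<inter> space (past T s :: (real => real ^ 'm) measure) \<in> sets (past T s)"
   using A I st by (intro measurable_sets[OF restrict_past_measurable]) auto
  then have A': "?A \<in> sets (past T s)" by simp
  have "emeasure (distr \<mu> ((\<Pi>\<^sub>M r\<in>I. borel) \<Otimes>\<^sub>M borel) (%z. (restrict z I, z b - z s))) (A \<times> B) =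
   emeasure \<mu> ((%z. (restrict z I, z b - z s)) -` (A \<times> B) \<inter> space \<mu>)"
   using A B mI md by (intro emeasure_distr measurable_Pair) auto
  also have "(%z. (restrict z I, z b - z s)) -` (A \<times> B) \<inter> space \<mu> = ?A \<inter> {z\<in>space (path_space T). z b - z s \<in> B}"
   by (auto simp: sp)
  also have "emeasure \<mu> \<dots> = emeasure \<mu> ?A * emeasure (gaussian (b - s)) B"
   using incr A' B st unfolding gaussian_increments_def by auto
  also have "emeasure \<mu> ?A = emeasure (distr \<mu> (\<Pi>\<^sub>M r\<in>I. borel) (%z. restrict z I)) A"
   using A by (subst emeasure_distr[OF mI]) (auto simp: sp)
  finally show "emeasure (distr \<mu> (\<Pi>\<^sub>M r\<in>I. borel) (%z. restrict z I)) A * emeasure (gaussian (b - s)) B =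
   emeasure (distr \<mu> ((\<Pi>\<^sub>M r\<in>I. borel) \<Otimes>\<^sub>M borel) (%z. (restrict z I, z b - z s))) (A \<times> B)" ..
 qed simp
 have mp: "(%z. (restrict z I, z b - z s)) \<in> measurable \<mu> ((\<Pi>\<^sub>M r\<in>I. borel) \<Otimes>\<^sub>M borel)"
  using mI md by (intro measurable_Pair) auto
 show ?thesis
  unfolding prod distr_distr[OF h mp]
  using I bI by (intro distr_cong refl) (auto simp: fun_eq_iff restrict_def)
qed

text \<open>Adding the times after \<open>t\<close> one by one, each new coordinate is an old one plus an independent
 Gaussian variable; so the finite dimensional laws are determined by the past of \<open>t\<close>.\<close>

proposition gaussian_increments_unique:
 fixes \<mu> \<nu> :: "(real => real ^ 'm) measure"
 assumes fin: "finite_measure \<mu>" "finite_measure \<nu>"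
  and sets: "sets \<mu> = sets (path_space T)" "sets \<nu> = sets (path_space T)"
  and incr: "gaussian_increments T t \<mu>" "gaussian_increments T t \<nu>"
  and t: "0 \<le> t" "t \<le> T"
  and eq: "!!A. A \<in> sets (past T t) ==> emeasure \<mu> A = emeasure \<nu> A"
 shows "\<mu> = \<nu>"
proof -
 have sp: "space \<mu> = space (path_space T)" "space \<nu> = space (path_space T)"
  by (rule sets[THEN sets_eq_imp_space_eq])+
 have mr: "(%z. restrict z J) \<in> measurable \<kappa> (\<Pi>\<^sub>M r\<in>J. borel)"
  if "J \<subseteq> {0..T}" "sets \<kappa> = sets (path_space T)" for J and \<kappa> :: "(real => real ^ 'm) measure"
  unfolding measurable_cong_sets[OF that(2) refl] path_space_def using that(1) by (rule measurable_restrict_subset)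
 have main: "J \<subseteq> {t<..T} ==>
  distr \<mu> (\<Pi>\<^sub>M r\<in>K \<union> J. borel) (%z. restrict z (K \<union> J)) = distr \<nu> (\<Pi>\<^sub>M r\<in>K \<union> J. borel) (%z. restrict z (K \<union> J))"
  if J: "finite J" and K: "K \<subseteq> {0..t}" "t \<in> K" for J K
  using J
 proof (induction J rule: finite_linorder_max_induct)
  case empty
  have KT: "K \<subseteq> {0..T}" using K t by auto
  show ?case
  proof (rule measure_eqI)
   fix A assume "A \<in> sets (distr \<mu> (\<Pi>\<^sub>M r\<in>K \<union> {}. borel) (%z. restrict z (K \<union> {})))"
   then have A: "A \<in> sets (\<Pi>\<^sub>M r\<in>K. borel)" by simp
   have "(%z. restrict z K) -` A \<inter> space (past T t :: (real => real ^ 'm) measure) \<in> sets (past T t)"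
    using K t A by (intro measurable_sets[OF restrict_past_measurable]) auto
   then show "emeasure (distr \<mu> (\<Pi>\<^sub>M r\<in>K \<union> {}. borel) (%z. restrict z (K \<union> {}))) A =
    emeasure (distr \<nu> (\<Pi>\<^sub>M r\<in>K \<union> {}. borel) (%z. restrict z (K \<union> {}))) A"
    using A eq by (simp add: emeasure_distr mr[OF KT] sets sp)
  qed simp
 next
  case (insert b J)
  define s where "s = Max (insert t J)"
  have s: "s \<in> K \<union> J" "t \<le> s" "s < b" "K \<union> J \<subseteq> {0..s}"
  proof -
   have "s \<in> insert t J" unfolding s_def using insert by (intro Max_in) auto
   then show "s \<in> K \<union> J" "s < b" using K insert t by auto
   have le: "r \<le> s" if "r \<in> insert t J" for r
    unfolding s_def using insert that by (intro Max_ge) auto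
   then show "t \<le> s" by simp
   with le K insert.prems t show "K \<union> J \<subseteq> {0..s}" by fastforce
  qed
  have "K \<union> insert b J = insert b (K \<union> J)" by simp
  moreover have "distr \<mu> (\<Pi>\<^sub>M r\<in>insert b (K \<union> J). borel) (%z. restrict z (insert b (K \<union> J))) =
   distr \<nu> (\<Pi>\<^sub>M r\<in>insert b (K \<union> J). borel) (%z. restrict z (insert b (K \<union> J)))"
  proof -
   have IH: "distr \<mu> (\<Pi>\<^sub>M r\<in>K \<union> J. borel) (%z. restrict z (K \<union> J)) =
    distr \<nu> (\<Pi>\<^sub>M r\<in>K \<union> J. borel) (%z. restrict z (K \<union> J))"
    by (rule insert.IH) (use insert.prems in auto)
   have b: "b \<le> T" using insert.prems by simp
   show ?thesis
    unfolding gaussian_increments_step[OF fin(1) sets(1) incr(1) s(4,1) t(1) s(2,3) b]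
     gaussian_increments_step[OF fin(2) sets(2) incr(2) s(4,1) t(1) s(2,3) b] IH ..
  qed
  ultimately show ?case by (simp only:)
 qed
 show ?thesis
 proof (rule measure_eqI_PiM_infinite)
  show "sets \<mu> = sets (\<Pi>\<^sub>M t\<in>{0..T}. borel)" "sets \<nu> = sets (\<Pi>\<^sub>M t\<in>{0..T}. borel)"
   using sets by (auto simp: path_space_def)
  show "finite_measure \<mu>" by fact
  fix J :: "real set" and A :: "real => (real ^ 'm) set"
  assume J: "finite J" "J \<subseteq> {0..T}" and A: "!!i. i \<in> J ==> A i \<in> sets borel"
  define K where "K = insert t (J \<inter> {0..t})"
  define J' where "J' = J \<inter> {t<..T}"
  have KJ: "finite J'" "K \<subseteq> {0..t}" "t \<in> K" "J' \<subseteq> {t<..T}" "J \<subseteq> K \<union> J'" "K \<union> J' \<subseteq> {0..T}"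
   using J t by (auto simp: K_def J'_def)
  let ?C = "(%y. restrict y J) -` (Pi\<^sub>E J A) \<inter> space (\<Pi>\<^sub>M r\<in>K \<union> J'. (borel :: (real ^ 'm) measure))"
  have C: "?C \<in> sets (\<Pi>\<^sub>M r\<in>K \<union> J'. borel)"
   using J A KJ by (intro measurable_sets[OF measurable_restrict_subset] sets_PiM_I_finite) auto
  have emb: "prod_emb {0..T} (%_. borel) J (Pi\<^sub>E J A) = (%z. restrict z (K \<union> J')) -` ?C \<inter> space (path_space T)"
   using KJ J by (auto simp: prod_emb_def path_space_def space_PiM Int_absorb1 PiE_restrict)
  have e: "emeasure \<kappa> (prod_emb {0..T} (%_. borel) J (Pi\<^sub>E J A)) =
   emeasure (distr \<kappa> (\<Pi>\<^sub>M r\<in>K \<union> J'. borel) (%z. restrict z (K \<union> J'))) ?C"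
   if "sets \<kappa> = sets (path_space T)" for \<kappa>
   unfolding emb emeasure_distr[OF mr[OF KJ(6) that] C] sets_eq_imp_space_eq[OF that] ..
  show "emeasure \<mu> (prod_emb {0..T} (%_. borel) J (Pi\<^sub>E J A)) = emeasure \<nu> (prod_emb {0..T} (%_. borel) J (Pi\<^sub>E J A))"
   unfolding e[OF sets(1)] e[OF sets(2)] main[OF KJ(1-4)] ..
 qed
qed

section \<open>Brownian motions in a filtration\<close>

lemma sets_Collect_mem:
 assumes "f \<in> borel_measurable R" "B \<in> sets borel"
 shows "{x \<in> space R. f x \<in> B} \<in> sets R"
 using measurable_sets[OF assms] by (simp add: vimage_def Int_def conj_commute)

text \<open>A Brownian motion with arbitrary initial law, relative to a filtration \<open>F\<close>. Starting it
 at the initial value of the state makes the state \<open>Z + \<integral> b\<close> a function of a single path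
 and of the drift \<open>b\<close>.\<close>

locale started_bm = prob_space P
 for P :: "'w measure" +
 fixes F :: "real => 'w measure" and T :: real and Z :: "real => 'w => real ^ 'm"
 assumes T_pos: "0 < T"
  and F_sub: "!!t. t \<in> {0..T} ==> subalgebra P (F t)"
  and F_mono: "!!s t. 0 \<le> s ==> s \<le> t ==> t \<le> T ==> sets (F s) \<subseteq> sets (F t)"
  and Z_adapted: "!!t. t \<in> {0..T} ==> Z t \<in> borel_measurable (F t)"
  and Z_continuous: "!!\<omega>. \<omega> \<in> space P ==> continuous_on {0..T} (%t. Z t \<omega>)"
  and Z_increments: "!!s t A B. 0 \<le> s ==> s < t ==> t \<le> T ==> A \<in> sets (F s) ==> B \<in> sets borel ==>
   emeasure P (A \<inter> {\<omega>\<in>space P. Z t \<omega> - Z s \<omega> \<in> B}) = emeasure P A * emeasure (gaussian (t - s)) B"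
  and Z_initial: "sq_int P (Z 0)"
begin

definition path :: "'w => real => real ^ 'm" where
 "path \<omega> = (\<lambda>t\<in>{0..T}. Z t \<omega>)"

lemma space_F: "t \<in> {0..T} ==> space (F t) = space P"
 using F_sub by (auto simp: subalgebra_def)

lemma F_measurable_mono:
 assumes "h \<in> measurable (F s) N" "0 \<le> s" "s \<le> t" "t \<le> T"
 shows "h \<in> measurable (F t) N"
 using assms F_mono[of s t] space_F[of s] space_F[of t]
 by (intro measurable_from_subalg[OF _ assms(1)]) (simp add: subalgebra_def)

lemma F_measurable: "h \<in> measurable (F t) N ==> t \<in> {0..T} ==> h \<in> measurable P N"
 using measurable_from_subalg[OF F_sub] .

lemma Z_measurable: "t \<in> {0..T} ==> Z t \<in> borel_measurable P"
 by (rule F_measurable[OF Z_adapted])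

lemma path_measurable: "path \<in> measurable P (path_space T)"
 unfolding path_def path_space_def by (intro measurable_restrict Z_measurable)

lemma path_past_measurable:
 assumes "t \<in> {0..T}"
 shows "path \<in> measurable (F t) (past T t)"
 unfolding past_def
proof (rule measurable_vimage_algebra2)
 show "path \<in> space (F t) \<rightarrow> space (path_space T)"
  using path_measurable space_F[OF assms] by (auto simp: measurable_def)
 have "(%\<omega>. restrict (path \<omega>) {0..t}) = (%\<omega>. \<lambda>s\<in>{0..t}. Z s \<omega>)"
  using assms by (auto simp: fun_eq_iff path_def restrict_def)
 moreover have "(%\<omega>. \<lambda>s\<in>{0..t}. Z s \<omega>) \<in> measurable (F t) (\<Pi>\<^sub>M s\<in>{0..t}. borel)"
  using assms by (intro measurable_restrict F_measurable_mono[OF Z_adapted]) auto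
 ultimately show "(%\<omega>. restrict (path \<omega>) {0..t}) \<in> measurable (F t) (\<Pi>\<^sub>M s\<in>{0..t}. borel)"
  by simp
qed

definition path_law :: "(real => real ^ 'm) measure" where
 "path_law = distr P (path_space T) path"

lemma sets_path_law[simp, measurable_cong]: "sets path_law = sets (path_space T)"
 by (simp add: path_law_def)

lemma space_path_law[simp]: "space path_law = space (path_space T)"
 by (simp add: path_law_def)

lemma prob_space_path_law: "prob_space path_law"
 unfolding path_law_def by (rule prob_space_distr[OF path_measurable])

lemma nn_integral_increment:
 assumes s: "0 \<le> s" "s < t" "t \<le> T" and B: "B \<in> sets borel"
  and U: "U \<in> borel_measurable (F s)"
 shows "(\<integral>\<^sup>+\<omega>. U \<omega> * indicator {\<omega>\<in>space P. Z t \<omega> - Z s \<omega> \<in> B} \<omega> \<partial>P) = (\<integral>\<^sup>+\<omega>. U \<omega> \<partial>P) * emeasure (gaussian (t - s)) B"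
proof -
 let ?C = "{\<omega>\<in>space P. Z t \<omega> - Z s \<omega> \<in> B}"
 have sub: "subalgebra P (F s)" using F_sub s by simp
 have C[measurable]: "?C \<in> sets P"
  using B s by (intro sets_Collect_mem borel_measurable_diff Z_measurable) auto
 have UP[measurable]: "U \<in> borel_measurable P" using F_measurable[OF U] s by simp
 let ?D = "density P (indicator ?C)"
 have subD: "subalgebra ?D (F s)" using sub by (simp add: subalgebra_def)
 have "restr_to_subalg ?D (F s) = scale_measure (emeasure (gaussian (t - s)) B) (restr_to_subalg P (F s))"
 proof (rule measure_eqI)
  fix A assume "A \<in> sets (restr_to_subalg ?D (F s))"
  then have A: "A \<in> sets (F s)" using subD by (simp add: sets_restr_to_subalg)
  have AP: "A \<in> sets P" using A sub by (auto simp: subalgebra_def)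
  have "emeasure (restr_to_subalg ?D (F s)) A = emeasure P (A \<inter> ?C)"
  proof -
   have "emeasure (restr_to_subalg ?D (F s)) A = (\<integral>\<^sup>+\<omega>. indicator (A \<inter> ?C) \<omega> \<partial>P)"
    using AP by (subst emeasure_restr_to_subalg[OF subD A], subst emeasure_density)
     (auto simp del: nn_integral_indicator intro!: nn_integral_cong split: split_indicator)
   then show ?thesis
    using AP C by (simp only: nn_integral_indicator sets.Int)
  qed
  then show "emeasure (restr_to_subalg ?D (F s)) A =
   emeasure (scale_measure (emeasure (gaussian (t - s)) B) (restr_to_subalg P (F s))) A"
   using Z_increments[OF s A B] A sub by (simp add: emeasure_restr_to_subalg mult.commute)
 qed (simp add: sets_restr_to_subalg sub subD)
 then have "(\<integral>\<^sup>+\<omega>. U \<omega> \<partial>restr_to_subalg ?D (F s)) =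
  (\<integral>\<^sup>+\<omega>. U \<omega> \<partial>scale_measure (emeasure (gaussian (t - s)) B) (restr_to_subalg P (F s)))"
  by simp
 moreover have "(\<integral>\<^sup>+\<omega>. U \<omega> \<partial>restr_to_subalg ?D (F s)) = (\<integral>\<^sup>+\<omega>. U \<omega> * indicator ?C \<omega> \<partial>P)"
  by (subst nn_integral_subalgebra2[OF subD U]) (simp add: nn_integral_density mult.commute)
 moreover have "(\<integral>\<^sup>+\<omega>. U \<omega> \<partial>scale_measure (emeasure (gaussian (t - s)) B) (restr_to_subalg P (F s))) =
  emeasure (gaussian (t - s)) B * (\<integral>\<^sup>+\<omega>. U \<omega> \<partial>P)"
  using U by (simp add: nn_integral_scale_measure measurable_in_subalg[OF sub] nn_integral_subalgebra2[OF sub U])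
 ultimately show ?thesis
  by (simp add: mult.commute)
qed

text \<open>A weight known at time \<open>t\<close> is independent of the increments after \<open>t\<close>.\<close>

lemma gaussian_increments_density:
 assumes t: "t \<in> {0..T}" and U: "U \<in> borel_measurable (F t)"
 shows "gaussian_increments T t (distr (density P U) (path_space T) path)"
 unfolding gaussian_increments_def
proof (intro allI impI ballI, elim conjE)
 fix s u and A :: "(real => real ^ 'm) set" and B :: "(real ^ 'm) set"
 assume su: "t \<le> s" "s < u" "u \<le> T" and A: "A \<in> sets (past T s)" and B: "B \<in> sets borel"
 have s: "s \<in> {0..T}" using su t by auto
 let ?A = "path -` A \<inter> space P"
 let ?C = "{\<omega>\<in>space P. Z u \<omega> - Z s \<omega> \<in> B}"
 have A': "?A \<in> sets (F s)"
  using measurable_sets[OF path_past_measurable[OF s] A] space_F[OF s] by simp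
 have AE: "A \<in> sets (path_space T)"
  using A subalgebra_past[of s T] su by (auto simp: subalgebra_def)
 have UP[measurable]: "U \<in> borel_measurable P" using F_measurable[OF U] t by simp
 have Us: "(%\<omega>. U \<omega> * indicator ?A \<omega>) \<in> borel_measurable (F s)"
  using A' F_measurable_mono[OF U, of s] t su by (intro borel_measurable_times_ennreal borel_measurable_indicator) auto
 have AP[measurable]: "?A \<in> sets P" using A' F_sub[OF s] by (auto simp: subalgebra_def)
 have C[measurable]: "?C \<in> sets P"
  using B s su by (intro sets_Collect_mem borel_measurable_diff Z_measurable) auto
 have m: "path \<in> measurable (density P U) (path_space T)"
  using path_measurable by simp
 have I: "{z\<in>space (path_space T). z u - z s \<in> B} \<in> sets (path_space T)"
  unfolding path_space_def using B s su
  by (intro sets_Collect_mem borel_measurable_diff measurable_component_singleton) auto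
 have eq: "path -` (A \<inter> {z\<in>space (path_space T). z u - z s \<in> B}) \<inter> space P = ?A \<inter> ?C"
  using s su measurable_space[OF path_measurable] by (auto simp: path_def)
 have "emeasure (distr (density P U) (path_space T) path) (A \<inter> {z\<in>space (path_space T). z u - z s \<in> B}) =
  emeasure (density P U) (?A \<inter> ?C)"
  by (subst emeasure_distr[OF m]) (use AE I in \<open>simp_all only: eq space_density sets.Int\<close>)
 also have "\<dots> = (\<integral>\<^sup>+\<omega>. (U \<omega> * indicator ?A \<omega>) * indicator ?C \<omega> \<partial>P)"
  by (simp add: emeasure_density indicator_inter_arith mult.assoc)
 also have "\<dots> = (\<integral>\<^sup>+\<omega>. U \<omega> * indicator ?A \<omega> \<partial>P) * emeasure (gaussian (u - s)) B"
  using s su by (intro nn_integral_increment B Us) auto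
 also have "(\<integral>\<^sup>+\<omega>. U \<omega> * indicator ?A \<omega> \<partial>P) = emeasure (distr (density P U) (path_space T) path) A"
  using AE by (subst emeasure_distr[OF m]) (auto simp: emeasure_density)
 finally show "emeasure (distr (density P U) (path_space T) path) (A \<inter> {z\<in>space (path_space T). z u - z s \<in> B}) =
  emeasure (distr (density P U) (path_space T) path) A * emeasure (gaussian (u - s)) B" .
qed

text \<open>Conditioning a variable known at time \<open>t\<close> on the whole path gives a function of the path
 up to time \<open>t\<close>: the future increments are independent of both.\<close>

proposition adapted_factor:
 assumes t: "t \<in> {0..T}" and U: "U \<in> borel_measurable (F t)" and fin: "(\<integral>\<^sup>+\<omega>. U \<omega> \<partial>P) < \<infinity>"
 obtains V :: "_ => ennreal" where "V \<in> borel_measurable (past T t)"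
  "!!D. D \<in> sets (path_space T) ==>
   (\<integral>\<^sup>+\<omega>. U \<omega> * indicator D (path \<omega>) \<partial>P) = (\<integral>\<^sup>+z. V z * indicator D z \<partial>path_law)"
proof -
 let ?E = "path_space T :: (real => real ^ 'm) measure"
 have UP[measurable]: "U \<in> borel_measurable P" using F_measurable[OF U] t by simp
 note path_measurable[measurable]
 interpret Q: prob_space path_law by (rule prob_space_path_law)
 define \<mu> where "\<mu> = distr (density P U) ?E path"
 have \<mu>: "emeasure \<mu> D = (\<integral>\<^sup>+\<omega>. U \<omega> * indicator D (path \<omega>) \<partial>P)" if "D \<in> sets ?E" for D
  unfolding \<mu>_def using that
  by (subst emeasure_distr) (auto simp: emeasure_density intro!: nn_integral_cong split: split_indicator)
 have fin\<mu>: "finite_measure \<mu>"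
 proof
  have "emeasure \<mu> (space \<mu>) \<le> (\<integral>\<^sup>+\<omega>. U \<omega> \<partial>P)"
   by (subst \<mu>) (auto simp: \<mu>_def intro!: nn_integral_mono split: split_indicator)
  then show "emeasure \<mu> (space \<mu>) \<noteq> \<infinity>" using fin by (auto simp: top_unique)
 qed
 have sub: "subalgebra path_law (past T t)" "subalgebra \<mu> (past T t)"
  using subalgebra_past[of t T] t by (auto simp: subalgebra_def \<mu>_def)
 let ?Q = "restr_to_subalg path_law (past T t)" and ?\<mu> = "restr_to_subalg \<mu> (past T t)"
 interpret Qr: finite_measure ?Q by (intro finite_measure_restr_to_subalg sub Q.finite_measure_axioms)
 have setsQ: "sets ?Q = sets (past T t)" "sets ?\<mu> = sets (past T t)"
  by (simp_all add: sets_restr_to_subalg sub)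
 have ac: "absolutely_continuous ?Q ?\<mu>"
  unfolding absolutely_continuous_def
 proof
  fix D assume "D \<in> null_sets ?Q"
  then have D: "D \<in> sets (past T t)" "emeasure path_law D = 0"
   using sub by (auto simp: null_sets_def setsQ emeasure_restr_to_subalg)
  have DE[measurable]: "D \<in> sets ?E" using D(1) sub by (auto simp: subalgebra_def)
  have "emeasure P (path -` D \<inter> space P) = 0"
   using D(2) by (simp add: path_law_def emeasure_distr)
  then have "AE \<omega> in P. path \<omega> \<notin> D"
   by (subst AE_iff_measurable[of "path -` D \<inter> space P"]) auto
  then have "emeasure \<mu> D = 0"
   unfolding \<mu>[OF DE] by (subst nn_integral_0_iff_AE) (auto elim: AE_mp simp: indicator_def)
  then show "D \<in> null_sets ?\<mu>"
   using D sub by (simp add: null_sets_def setsQ emeasure_restr_to_subalg)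
 qed
 define V where "V = RN_deriv ?Q ?\<mu>"
 have V: "V \<in> borel_measurable (past T t)"
  unfolding V_def
  by (rule measurable_cong_sets[OF setsQ(1) refl, THEN equalityD1, THEN subsetD, OF borel_measurable_RN_deriv])
 have dens: "density ?Q V = ?\<mu>"
  unfolding V_def by (rule Qr.density_RN_deriv[OF ac]) (simp add: setsQ)
 have VE[measurable]: "V \<in> borel_measurable ?E"
  using measurable_from_subalg[OF sub(1) V] by simp
 have past_eq: "emeasure \<mu> D = emeasure (density path_law V) D" if D: "D \<in> sets (past T t)" for D
 proof -
  have DE: "D \<in> sets ?E" using D sub by (auto simp: subalgebra_def)
  have "emeasure \<mu> D = emeasure (density ?Q V) D"
   unfolding dens using D sub by (simp add: emeasure_restr_to_subalg)
  also have "\<dots> = (\<integral>\<^sup>+z. V z * indicator D z \<partial>?Q)"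
   using V D by (subst emeasure_density) (auto simp: setsQ measurable_in_subalg[OF sub(1)])
  also have "\<dots> = (\<integral>\<^sup>+z. V z * indicator D z \<partial>path_law)"
   using V D by (intro nn_integral_subalgebra2[OF sub(1)]) auto
  also have "\<dots> = emeasure (density path_law V) D"
   using DE by (simp add: emeasure_density)
  finally show ?thesis .
 qed
 have VF: "(%\<omega>. V (path \<omega>)) \<in> borel_measurable (F t)"
  by (rule measurable_compose[OF path_past_measurable[OF t] V])
 have dV: "density path_law V = distr (density P (%\<omega>. V (path \<omega>))) ?E path"
  unfolding path_law_def by (rule density_distr) auto
 have "\<mu> = density path_law V"
 proof (rule gaussian_increments_unique[where t = t and T = T])
  show "finite_measure \<mu>" by fact
  show "finite_measure (density path_law V)"
  proof
   have "space (path_space T) \<in> sets (past T t)"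
    using sets.top[of "past T t"] by simp
   from past_eq[OF this] show "emeasure (density path_law V) (space (density path_law V)) \<noteq> \<infinity>"
    using finite_measure.emeasure_finite[OF fin\<mu>, of "space (path_space T)"] by simp
  qed
  show "gaussian_increments T t \<mu>"
   unfolding \<mu>_def by (rule gaussian_increments_density[OF t U])
  show "gaussian_increments T t (density path_law V)"
   unfolding dV by (rule gaussian_increments_density[OF t VF])
 qed (use t past_eq in \<open>auto simp: \<mu>_def\<close>)
 then have "(\<integral>\<^sup>+\<omega>. U \<omega> * indicator D (path \<omega>) \<partial>P) = (\<integral>\<^sup>+z. V z * indicator D z \<partial>path_law)" if "D \<in> sets ?E" for D
  using \<mu>[OF that] that by (simp add: emeasure_density)
 with V show ?thesis by (rule that)
qed

lemma Z_sq_int: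
 assumes t: "t \<in> {0..T}"
 shows "sq_int P (Z t)" "nsq P (Z t) \<le> 2 * nsq P (Z 0) + 2 * (real CARD('m) * T)"
proof -
 have "sq_int P (%\<omega>. Z t \<omega> - Z 0 \<omega>) \<and> nsq P (%\<omega>. Z t \<omega> - Z 0 \<omega>) \<le> real CARD('m) * T"
 proof (cases "t = 0")
  case True
  then show ?thesis using T_pos by (simp add: sq_int_zero nsq_def)
 next
  case False
  then have t0: "t > 0" using t by simp
  have m[measurable]: "(%\<omega>. Z t \<omega> - Z 0 \<omega>) \<in> borel_measurable P"
   using t by (intro borel_measurable_diff Z_measurable) auto
  have "distr P borel (%\<omega>. Z t \<omega> - Z 0 \<omega>) = gaussian t"
  proof (rule measure_eqI)
   fix B assume "B \<in> sets (distr P borel (%\<omega>. Z t \<omega> - Z 0 \<omega>))"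
   then have B: "B \<in> sets borel" by simp
   have "space P \<in> sets (F 0)"
    using sets.top[of "F 0"] space_F[of 0] T_pos by simp
   from Z_increments[OF _ t0 _ this B] t
   have "emeasure P {\<omega>\<in>space P. Z t \<omega> - Z 0 \<omega> \<in> B} = emeasure (gaussian t) B"
    by (simp add: emeasure_space_1 Int_absorb1 subset_iff Collect_restrict)
   then show "emeasure (distr P borel (%\<omega>. Z t \<omega> - Z 0 \<omega>)) B = emeasure (gaussian t) B"
    using B by (simp add: emeasure_distr vimage_def Int_def conj_commute)
  qed simp
  then have n: "(\<integral>\<^sup>+\<omega>. ennreal ((norm (Z t \<omega> - Z 0 \<omega>))\<^sup>2) \<partial>P) = ennreal (real CARD('m) * t)"
   using gaussian_second_moment[OF t0, where 'm = 'm] by (simp add: nn_integral_distr flip: \<open>distr _ _ _ = _\<close>)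
  have i: "integrable P (%\<omega>. (norm (Z t \<omega> - Z 0 \<omega>))\<^sup>2)"
   using n by (intro integrableI_bounded) auto
  have "nsq P (%\<omega>. Z t \<omega> - Z 0 \<omega>) = real CARD('m) * t"
   unfolding nsq_def using n t0 by (intro integral_eq_nn_integral[THEN trans]) auto
  then show ?thesis
   using i t by (auto simp: sq_int_def intro!: mult_left_mono)
 qed
 then have d: "sq_int P (%\<omega>. Z t \<omega> - Z 0 \<omega>)" "nsq P (%\<omega>. Z t \<omega> - Z 0 \<omega>) \<le> real CARD('m) * T" by auto
 show "sq_int P (Z t)"
  using sq_int_add[OF Z_initial d(1)] by simp
 show "nsq P (Z t) \<le> 2 * nsq P (Z 0) + 2 * (real CARD('m) * T)"
  using nsq_add[OF Z_initial d(1)] d(2) by simp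
qed

end

text \<open>The case \<open>t = 0\<close> of \<open>gaussian_increments_unique\<close>; it makes \<open>Q\<close> common to all particles and to the mean
 field problem.\<close>

proposition path_law_unique:
 assumes "started_bm P F T (Z :: real => 'w => real ^ 'm)" "started_bm P' F' T Z'"
  and init: "distr P borel (Z 0) = distr P' borel (Z' 0)"
 shows "started_bm.path_law P T Z = started_bm.path_law P' T Z'"
proof -
 interpret a: started_bm P F T Z by fact
 interpret b: started_bm P' F' T Z' by fact
 have ga: "gaussian_increments T 0 a.path_law"
  using a.gaussian_increments_density[of 0 "%_. 1"] a.T_pos by (simp add: a.path_law_def density_1)
 have gb: "gaussian_increments T 0 b.path_law"
  using b.gaussian_increments_density[of 0 "%_. 1"] a.T_pos by (simp add: b.path_law_def density_1)
 show ?thesis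
 proof (rule gaussian_increments_unique[OF _ _ _ _ ga gb])
  show "finite_measure a.path_law" "finite_measure b.path_law"
   using a.prob_space_path_law b.prob_space_path_law by (auto simp: prob_space_def)
  fix A :: "(real => real ^ 'm) set" assume "A \<in> sets (past T 0)"
  then obtain A' where A': "A' \<in> sets (\<Pi>\<^sub>M s\<in>{0..0}. borel)" "A = (%z. restrict z {0..0}) -` A' \<inter> space (path_space T)"
   unfolding past_def by (subst (asm) sets_vimage_algebra2) (auto simp: space_PiM)
  define B where "B = {x :: real ^ 'm. (\<lambda>r\<in>{0::real}. x) \<in> A'}"
  have "(%x. \<lambda>r\<in>{0::real}. x) \<in> measurable borel (\<Pi>\<^sub>M s\<in>{0}. (borel :: (real ^ 'm) measure))"
   by (intro measurable_restrict) auto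
  from measurable_sets[OF this, of A'] A' have B: "B \<in> sets borel"
   by (simp add: B_def vimage_def)
  have AE: "A \<in> sets (path_space T)"
   using \<open>A \<in> sets (past T 0)\<close> subalgebra_past[of 0 T] a.T_pos by (auto simp: subalgebra_def)
  have e: "emeasure (started_bm.path_law R T Y) A = emeasure (distr R borel (Y 0)) B"
   if "started_bm R G T Y" for R :: "'c measure" and G Y
  proof -
   interpret c: started_bm R G T Y by fact
   have "c.path -` A \<inter> space R = Y 0 -` B \<inter> space R"
    using measurable_space[OF c.path_measurable] a.T_pos
    by (auto simp: A'(2) B_def c.path_def restrict_def cong: if_cong)
   then show ?thesis
    using AE B c.path_measurable c.Z_measurable[of 0] a.T_pos by (simp add: c.path_law_def emeasure_distr)
  qed
  show "emeasure a.path_law A = emeasure b.path_law A"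
   using e[OF assms(1)] e[OF assms(2)] init by simp
 qed (use a.T_pos in auto)
qed

section \<open>Delayed averages\<close>

text \<open>The average over a grid cell, read off one cell later. It only looks into the past, so it
 is adapted whenever the integrals \<open>prim T g\<close> are, and it converges to \<open>g\<close> in
 \<open>L\<^sup>1\<close> as the grid is refined.\<close>

definition delayed_avg :: "real => nat => (real => real) => real => real" where
 "delayed_avg T n P s = (let h = T / real (Suc n) in
   \<Sum>k<n. indicator {real (Suc k) * h..<real (Suc (Suc k)) * h} s * ((P (real (Suc k) * h) - P (real k * h)) / h))"

lemma delayed_avg_measurable[measurable]: "delayed_avg T n P \<in> borel_measurable (time T)"
proof -
 have "delayed_avg T n P \<in> borel_measurable borel"
  unfolding delayed_avg_def Let_def by measurable
 then show ?thesis by (simp add: measurable_restrict_space1)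
qed

lemma prim_diff_cell:
 assumes g: "integrable (time T) (g :: real => real)" and ab: "0 \<le> a" "a \<le> b"
 shows "prim T g b - prim T g a = (\<integral>s. indicator {a<..b} s * g s \<partial>time T)"
proof -
 have "prim T g b - prim T g a = (\<integral>s. indicator {0..b} s *\<^sub>R g s - indicator {0..a} s *\<^sub>R g s \<partial>time T)"
  unfolding prim_def by (intro Bochner_Integration.integral_diff[symmetric] integrable_time_indicator g)
 also have "\<dots> = (\<integral>s. indicator {a<..b} s * g s \<partial>time T)"
  using ab by (intro Bochner_Integration.integral_cong) (auto simp: indicator_def)
 finally show ?thesis .
qed

lemma integrable_time_cell:
 assumes "integrable (time T) (g :: real => real)"
 shows "integrable (time T) (%s. indicator {a<..b} s * g s)"
proof (rule Bochner_Integration.integrable_bound[OF assms])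
 have "indicat_real {a<..b} \<in> borel_measurable (time T)"
  by (simp add: measurable_restrict_space1)
 then show "(%s. indicator {a<..b} s * g s) \<in> borel_measurable (time T)"
  using assms by (intro borel_measurable_times) auto
qed (auto simp: indicator_def)

lemma abs_prim_diff_le:
 assumes g: "integrable (time T) (g :: real => real)" and ab: "0 \<le> a" "a \<le> b"
 shows "\<bar>prim T g b - prim T g a\<bar> \<le> prim T (%s. \<bar>g s\<bar>) b - prim T (%s. \<bar>g s\<bar>) a"
proof -
 have "\<bar>prim T g b - prim T g a\<bar> \<le> (\<integral>s. norm (indicator {a<..b} s * g s) \<partial>time T)"
  unfolding prim_diff_cell[OF assms] using integral_norm_bound[of "time T" "%s. indicator {a<..b} s * g s"] by simp
 also have "\<dots> = (\<integral>s. indicator {a<..b} s * \<bar>g s\<bar> \<partial>time T)"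
  by (intro Bochner_Integration.integral_cong) (auto simp: abs_mult)
 also have "\<dots> = prim T (%s. \<bar>g s\<bar>) b - prim T (%s. \<bar>g s\<bar>) a"
  using g ab by (intro prim_diff_cell[symmetric]) auto
 finally show ?thesis .
qed

lemma measure_time_cell_le:
 assumes "a \<le> b"
 shows "measure (time T) (space (time T) \<inter> {a..<b}) \<le> b - a"
proof -
 have "measure (time T) (space (time T) \<inter> {a..<b}) = measure lborel ({0..T} \<inter> {a..<b})"
  by (subst measure_restrict_space) (auto simp: space_time)
 also have "\<dots> \<le> measure lborel {a..<b}"
  using assms by (intro measure_mono_fmeasurable) (auto simp: fmeasurable_def emeasure_lborel_Ico)
 finally show ?thesis using assms by simp
qed

lemma integral_time_cell:
 assumes "0 \<le> a" "a \<le> b" "b \<le> T"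
 shows "(\<integral>t. indicator {a<..b} t \<partial>time T) = b - a"
proof -
 have sub: "{a<..b} \<inter> {0..T} = {a<..b}" using assms by auto
 have "(\<integral>t. indicator {a<..b} t \<partial>time T) = measure (time T) ({a<..b} \<inter> {0..T})"
  by (simp add: space_time)
 also have "\<dots> = measure lborel {a<..b}"
  unfolding sub using assms by (subst measure_restrict_space) auto
 finally show ?thesis using assms by simp
qed

lemma integrable_delayed_avg: "integrable (time T) (delayed_avg T n P)"
proof -
 interpret finite_measure "time T" by (rule finite_measure_time)
 have "integrable (time T) (indicat_real {a..<b})" for a b
 proof (rule integrable_const_bound)
  show "AE s in time T. norm (indicat_real {a..<b} s) \<le> 1"
   by (simp add: indicator_def)
 qed (simp add: measurable_restrict_space1)
 then show ?thesis
  unfolding delayed_avg_def Let_def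
  by (intro Bochner_Integration.integrable_sum integrable_mult_left)
qed

text \<open>The average over each cell costs at most the integral of the absolute value over that cell, and the
cells are disjoint.\<close>

lemma delayed_avg_contraction:
 assumes T: "T > 0" and g: "integrable (time T) g"
 shows "(\<integral>s. \<bar>delayed_avg T n (prim T g) s\<bar> \<partial>time T) \<le> (\<integral>s. \<bar>g s\<bar> \<partial>time T)"
proof -
 interpret finite_measure "time T" by (rule finite_measure_time)
 define h where "h = T / real (Suc n)"
 have h: "h > 0" using T by (simp add: h_def)
 let ?I = "%k. {real (Suc k) * h..<real (Suc (Suc k)) * h}"
 let ?c = "%k. \<bar>prim T g (real (Suc k) * h) - prim T g (real k * h)\<bar> / h"
 let ?P = "prim T (%s. \<bar>g s\<bar>)"
 have im[measurable]: "indicat_real (?I k) \<in> borel_measurable (time T)" for k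
  by (simp add: measurable_restrict_space1)
 have ii: "integrable (time T) (%s. indicator (?I k) s * ?c k)" for k
  by (intro integrable_mult_left integrable_const_bound[of _ 1]) (auto simp: indicator_def)
 have "(\<integral>s. \<bar>delayed_avg T n (prim T g) s\<bar> \<partial>time T) \<le> (\<integral>s. (\<Sum>k<n. indicator (?I k) s * ?c k) \<partial>time T)"
 proof (rule integral_mono)
  show "integrable (time T) (%s. \<bar>delayed_avg T n (prim T g) s\<bar>)"
   by (intro integrable_abs integrable_delayed_avg)
  show "\<bar>delayed_avg T n (prim T g) s\<bar> \<le> (\<Sum>k<n. indicator (?I k) s * ?c k)" for s
   unfolding delayed_avg_def Let_def h_def[symmetric]
   by (rule order_trans[OF sum_abs]) (use h in \<open>auto intro!: sum_mono simp: abs_mult abs_divide\<close>)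
  show "integrable (time T) (%s. \<Sum>k<n. indicator (?I k) s * ?c k)"
   by (rule Bochner_Integration.integrable_sum) (rule ii)
 qed
 also have "\<dots> = (\<Sum>k<n. (\<integral>s. indicator (?I k) s \<partial>time T) * ?c k)"
  using ii by (subst Bochner_Integration.integral_sum) auto
 also have "\<dots> \<le> (\<Sum>k<n. ?P (real (Suc k) * h) - ?P (real k * h))"
 proof (rule sum_mono)
  fix k
  have "(\<integral>s. indicator (?I k) s \<partial>time T) = measure (time T) (space (time T) \<inter> ?I k)"
   by (subst Bochner_Integration.integral_indicator) (simp add: Int_commute)
  also have "\<dots> \<le> real (Suc (Suc k)) * h - real (Suc k) * h"
   using h by (intro measure_time_cell_le) (simp add: mult_right_mono)
  also have "\<dots> = h" by (simp add: algebra_simps)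
  finally have "(\<integral>s. indicator (?I k) s \<partial>time T) * ?c k \<le> h * ?c k"
   using h by (intro mult_right_mono) auto
  also have "\<dots> \<le> ?P (real (Suc k) * h) - ?P (real k * h)"
   using h abs_prim_diff_le[OF g, of "real k * h" "real (Suc k) * h"] by (simp add: mult_right_mono)
  finally show "(\<integral>s. indicator (?I k) s \<partial>time T) * ?c k \<le> ?P (real (Suc k) * h) - ?P (real k * h)" .
 qed
 also have "\<dots> = ?P (real n * h) - ?P (real 0 * h)"
  by (rule sum_lessThan_telescope)
 also have "\<dots> = ?P (real n * h)" by (simp add: prim_zero_time)
 also have "\<dots> \<le> (\<integral>s. \<bar>g s\<bar> \<partial>time T)"
  using norm_prim_le[of T "%s. \<bar>g s\<bar>" "real n * h"] g by simp
 finally show ?thesis .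
qed

lemma delayed_avg_value:
 assumes "T > 0" and h: "h = T / real (Suc n)" and s: "h \<le> s" "s < T"
 obtains a where "0 \<le> a" "s - 2 * h \<le> a" "a + h \<le> s" "delayed_avg T n P s = (P (a + h) - P a) / h"
proof -
 have h0: "h > 0" using assms by simp
 define j where "j = nat \<lfloor>s / h\<rfloor>"
 have j: "real j \<le> s / h" "s / h < real j + 1"
  using s h0 unfolding j_def by (auto simp: zero_le_divide_iff)
 have "1 \<le> s / h" using s h0 by simp
 then have "j \<ge> 1" unfolding j_def by (simp add: le_nat_iff one_le_floor)
 then obtain k where k: "j = Suc k" by (cases j) auto
 have sj: "real (Suc k) * h \<le> s" "s < real (Suc (Suc k)) * h"
  using j h0 by (auto simp: k field_simps)
 have "real (Suc k) * h < T" using sj s by simp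
 also have "T = real (Suc n) * h" using h by simp
 finally have kn: "k < n" using h0 by simp
 have "delayed_avg T n P s = (\<Sum>i<n. if i = k then (P (real (Suc k) * h) - P (real k * h)) / h else 0)"
  unfolding delayed_avg_def Let_def h[symmetric]
 proof (rule sum.cong)
  fix i assume "i \<in> {..<n}"
  have "i = k" if "real (Suc i) * h \<le> s" "s < real (Suc (Suc i)) * h"
  proof -
   have "real (Suc i) * h < real (Suc (Suc k)) * h" "real (Suc k) * h < real (Suc (Suc i)) * h"
    using that sj by linarith+
   then show ?thesis using h0 by simp
  qed
  then have "indicat_real {real (Suc i) * h..<real (Suc (Suc i)) * h} s = (if i = k then 1 else 0)"
   using sj by (cases "i = k") (auto simp: indicator_def simp del: of_nat_Suc)
  then show "indicator {real (Suc i) * h..<real (Suc (Suc i)) * h} s * ((P (real (Suc i) * h) - P (real i * h)) / h) =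
   (if i = k then (P (real (Suc k) * h) - P (real k * h)) / h else 0)"
   by (simp del: of_nat_Suc)
 qed simp
 also have "\<dots> = (P (real (Suc k) * h) - P (real k * h)) / h"
  using kn by simp
 also have "real (Suc k) * h = real k * h + h" by (simp add: algebra_simps)
 finally have v: "delayed_avg T n P s = (P (real k * h + h) - P (real k * h)) / h" .
 have e: "real (Suc k) * h = real k * h + h" "real (Suc (Suc k)) * h = real k * h + 2 * h"
  by (simp_all add: algebra_simps)
 show ?thesis
 proof (rule that[OF _ _ _ v])
  show "0 \<le> real k * h" using h0 by simp
 qed (use sj e in linarith)+
qed

text \<open>Near a point of continuity the values in the two cells behind it are close to the value there.\<close>

lemma delayed_avg_pointwise:
 assumes T: "T > 0" and g: "integrable (time T) g" and s: "0 < s" "s < T" and c: "isCont g s"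
 shows "(%n. delayed_avg T n (prim T g) s) \<longlonglongrightarrow> g s"
proof (rule LIMSEQ_I)
 interpret finite_measure "time T" by (rule finite_measure_time)
 fix r :: real assume r: "r > 0"
 then obtain d where d: "d > 0" "!!y. \<bar>y - s\<bar> < d ==> \<bar>g y - g s\<bar> < r / 2"
  using c unfolding continuous_at_eps_delta dist_real_def by (meson half_gt_zero)
 obtain N where N: "T / real (Suc N) < min s (d / 2)"
 proof -
  have "min s (d / 2) / T > 0" using s d T by auto
  then obtain N where "inverse (real (Suc N)) < min s (d / 2) / T"
   using reals_Archimedean by blast
  then show ?thesis using T by (intro that[of N]) (simp add: field_simps)
 qed
 show "\<exists>no. \<forall>n\<ge>no. norm (delayed_avg T n (prim T g) s - g s) < r"
 proof (intro exI allI impI)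
  fix n assume "n \<ge> N"
  define h where "h = T / real (Suc n)"
  have h0: "h > 0" using T by (simp add: h_def)
  have "h \<le> T / real (Suc N)"
   unfolding h_def using T \<open>n \<ge> N\<close> by (intro divide_left_mono) auto
  with N have h: "h < s" "2 * h < d" by linarith+
  obtain a where a: "0 \<le> a" "s - 2 * h \<le> a" "a + h \<le> s"
   "delayed_avg T n (prim T g) s = (prim T g (a + h) - prim T g a) / h"
   using delayed_avg_value[OF T h_def, of s] h s by auto
  have eq: "prim T g (a + h) - prim T g a = (\<integral>t. indicator {a<..a + h} t * g t \<partial>time T)"
   using a h0 by (intro prim_diff_cell g) auto
  have m1: "(\<integral>t. indicator {a<..a + h} t \<partial>time T) = h"
   using integral_time_cell[of a "a + h" T] a h0 s by simp
  then have m: "(\<integral>t. indicator {a<..a + h} t * g s \<partial>time T) = h * g s"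
   by simp
  have ig: "integrable (time T) (%t. indicator {a<..a + h} t * g t)"
   by (rule integrable_time_cell[OF g])
  have ic: "integrable (time T) (%t. indicator {a<..a + h} t * c)" for c :: real
   by (rule integrable_time_cell) simp
  have "\<bar>(prim T g (a + h) - prim T g a) - h * g s\<bar> =
   \<bar>\<integral>t. indicator {a<..a + h} t * g t - indicator {a<..a + h} t * g s \<partial>time T\<bar>"
   unfolding eq m[symmetric] using ig ic by simp
  also have "\<dots> \<le> (\<integral>t. norm (indicator {a<..a + h} t * g t - indicator {a<..a + h} t * g s) \<partial>time T)"
   using integral_norm_bound[of "time T" "%t. indicator {a<..a + h} t * g t - indicator {a<..a + h} t * g s"] by simp
  also have "\<dots> \<le> (\<integral>t. indicator {a<..a + h} t * (r / 2) \<partial>time T)"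
  proof (rule integral_mono)
   fix t
   show "norm (indicator {a<..a + h} t * g t - indicator {a<..a + h} t * g s) \<le> indicator {a<..a + h} t * (r / 2)"
    using d(2)[of t] a h by (auto simp: indicator_def intro: less_imp_le)
  qed (use ig ic in auto)
  also have "\<dots> = h * (r / 2)"
   using m1 by simp
  finally have "\<bar>(prim T g (a + h) - prim T g a) - h * g s\<bar> / h \<le> r / 2"
   using h0 by (simp add: field_simps)
  moreover have "\<bar>delayed_avg T n (prim T g) s - g s\<bar> = \<bar>(prim T g (a + h) - prim T g a) - h * g s\<bar> / h"
  proof -
   have "delayed_avg T n (prim T g) s - g s = ((prim T g (a + h) - prim T g a) - h * g s) / h"
    using h0 unfolding a(4) by (simp add: diff_divide_distrib)
   then show ?thesis using h0 by (simp add: abs_divide)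
  qed
  ultimately show "norm (delayed_avg T n (prim T g) s - g s) < r"
   using r unfolding real_norm_def by linarith
 qed
qed

lemma delayed_avg_diff:
 "delayed_avg T n (%t. P t - P' t) s = delayed_avg T n P s - delayed_avg T n P' s"
proof -
 have "i * ((a - a' - (b - b')) / h) = i * ((a - b) / h) - i * ((a' - b') / h)" for i a a' b b' h :: real
  by (simp add: diff_divide_distrib add_divide_distrib algebra_simps)
 then show ?thesis
  unfolding delayed_avg_def Let_def sum_subtractf[symmetric] by (intro sum.cong refl)
qed

lemma delayed_avg_cmult: "delayed_avg T n (%t. c * P t) s = c * delayed_avg T n P s"
proof -
 have "i * ((c * a - c * b) / h) = c * (i * ((a - b) / h))" for i a b h :: real
  by (simp add: diff_divide_distrib algebra_simps)
 then show ?thesis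
  unfolding delayed_avg_def Let_def sum_distrib_left by (intro sum.cong refl)
qed

text \<open>The \<open>L\<^sup>1\<close> distance between a function and its delayed average. It is subadditive and continuous in
\<open>L\<^sup>1\<close>, so its convergence to zero extends from indicators of intervals to all integrable functions.\<close>

definition avg_error :: "real => (real => real) => nat => real" where
 "avg_error T g n = (\<integral>s. \<bar>delayed_avg T n (prim T g) s - g s\<bar> \<partial>time T)"

lemma avg_error_le:
 assumes T: "T > 0" and g: "integrable (time T) g" and f: "integrable (time T) f"
 shows "avg_error T g n \<le> avg_error T f n + 2 * (\<integral>s. \<bar>g s - f s\<bar> \<partial>time T)"
proof -
 have P: "prim T (%s. g s - f s) = (%t. prim T g t - prim T f t)"
  using prim_diff[OF g f] by (simp add: fun_eq_iff)
 note ia = integrable_delayed_avg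
 have "avg_error T g n \<le> (\<integral>s. \<bar>delayed_avg T n (prim T (%s. g s - f s)) s\<bar> + \<bar>delayed_avg T n (prim T f) s - f s\<bar> + \<bar>g s - f s\<bar> \<partial>time T)"
  unfolding avg_error_def
 proof (rule integral_mono)
  show "integrable (time T) (%s. \<bar>delayed_avg T n (prim T g) s - g s\<bar>)"
   by (intro integrable_abs Bochner_Integration.integrable_diff ia g)
  show "integrable (time T) (%s. \<bar>delayed_avg T n (prim T (%s. g s - f s)) s\<bar> + \<bar>delayed_avg T n (prim T f) s - f s\<bar> + \<bar>g s - f s\<bar>)"
   by (intro Bochner_Integration.integrable_add integrable_abs Bochner_Integration.integrable_diff ia g f)
 qed (simp add: P delayed_avg_diff)
 also have "\<dots> = (\<integral>s. \<bar>delayed_avg T n (prim T (%s. g s - f s)) s\<bar> \<partial>time T) + avg_error T f n + (\<integral>s. \<bar>g s - f s\<bar> \<partial>time T)"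
  unfolding avg_error_def using g f ia
  by (subst Bochner_Integration.integral_add; (subst Bochner_Integration.integral_add)?; (intro Bochner_Integration.integrable_add integrable_abs Bochner_Integration.integrable_diff)?; simp)
 also have "(\<integral>s. \<bar>delayed_avg T n (prim T (%s. g s - f s)) s\<bar> \<partial>time T) \<le> (\<integral>s. \<bar>g s - f s\<bar> \<partial>time T)"
  using g f by (intro delayed_avg_contraction T) auto
 finally show ?thesis by simp
qed

lemma avg_error_nonneg: "avg_error T g n \<ge> 0"
 by (simp add: avg_error_def)

lemma avg_error_closed:
 assumes T: "T > 0" and g: "integrable (time T) g" and f: "!!k. integrable (time T) (f k)"
  and lim: "(%k. \<integral>s. \<bar>g s - f k s\<bar> \<partial>time T) \<longlonglongrightarrow> 0"
  and conv: "!!k. (avg_error T (f k)) \<longlonglongrightarrow> 0"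
 shows "avg_error T g \<longlonglongrightarrow> 0"
proof (rule LIMSEQ_I)
 fix r :: real assume r: "r > 0"
 then obtain k where k: "(\<integral>s. \<bar>g s - f k s\<bar> \<partial>time T) < r / 4"
  using LIMSEQ_D[OF lim, of "r / 4"] by (auto dest: spec)
 obtain N where N: "!!n. n \<ge> N ==> avg_error T (f k) n < r / 2"
  using LIMSEQ_D[OF conv[of k], of "r / 2"] r by (auto simp: avg_error_nonneg)
 have "norm (avg_error T g n - 0) < r" if "n \<ge> N" for n
  using avg_error_le[OF T g f[of k], of n] N[OF that] k avg_error_nonneg[of T g n] by simp
 then show "\<exists>no. \<forall>n\<ge>no. norm (avg_error T g n - 0) < r" by blast
qed

lemma avg_error_pointwise:
 assumes T: "T > 0" and g: "integrable (time T) g" and b: "!!s. \<bar>g s\<bar> \<le> B"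
  and c: "AE s in lborel. isCont g s"
 shows "avg_error T g \<longlonglongrightarrow> 0"
proof -
 interpret finite_measure "time T" by (rule finite_measure_time)
 have bound: "\<bar>delayed_avg T n (prim T g) s\<bar> \<le> B" for n s
 proof -
  have B: "B \<ge> 0" using b[of 0] by simp
  define h where "h = T / real (Suc n)"
  have h: "h > 0" using T by (simp add: h_def)
  show ?thesis
  proof (cases "h \<le> s \<and> s < T")
   case True
   then obtain a where a: "0 \<le> a" "a + h \<le> s" "delayed_avg T n (prim T g) s = (prim T g (a + h) - prim T g a) / h"
    using delayed_avg_value[OF T h_def, of s] by blast
   have "\<bar>prim T g (a + h) - prim T g a\<bar> \<le> (\<integral>t. norm (indicator {a<..a + h} t * g t) \<partial>time T)"
    using integral_norm_bound[of "time T" "%t. indicator {a<..a + h} t * g t"] prim_diff_cell[OF g, of a "a + h"] a h by simp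
   also have "\<dots> \<le> (\<integral>t. indicator {a<..a + h} t * B \<partial>time T)"
    using b by (intro integral_mono integrable_norm integrable_time_cell g) (auto simp: indicator_def)
   also have "\<dots> = h * B"
    using integral_time_cell[of a "a + h" T] a h True by simp
   finally show ?thesis using h unfolding a(3) by (simp add: abs_divide field_simps)
  next
   case False
   have "delayed_avg T n (prim T g) s = 0"
    unfolding delayed_avg_def Let_def h_def[symmetric]
   proof (rule sum.neutral, rule ballI)
    fix k assume k: "k \<in> {..<n}"
    have "h \<le> real (Suc k) * h" using h by simp
    moreover have "real (Suc (Suc k)) * h \<le> real (Suc n) * h"
     using k h by (intro mult_right_mono) auto
    moreover have "real (Suc n) * h = T" by (simp add: h_def)
    ultimately have "s \<notin> {real (Suc k) * h..<real (Suc (Suc k)) * h}"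
     using False by auto
    then show "indicator {real (Suc k) * h..<real (Suc (Suc k)) * h} s *
     ((prim T g (real (Suc k) * h) - prim T g (real k * h)) / h) = 0" by simp
   qed
   then show ?thesis using B by simp
  qed
 qed
 have "avg_error T g \<longlonglongrightarrow> (\<integral>s. 0 \<partial>time T)"
  unfolding avg_error_def
 proof (rule integral_dominated_convergence[where w = "%_. 2 * B"])
  have "AE s in lborel. s \<noteq> (0::real)" "AE s in lborel. s \<noteq> (T::real)"
   by (rule AE_lborel_singleton)+
  with c have "AE s in lborel. s \<in> {0..T} \<longrightarrow> 0 < s \<and> s < T \<and> isCont g s"
   by eventually_elim auto
  then have "AE s in time T. 0 < s \<and> s < T \<and> isCont g s"
   by (subst AE_restrict_space_iff) auto
  then show "AE s in time T. (%n. \<bar>delayed_avg T n (prim T g) s - g s\<bar>) \<longlonglongrightarrow> 0"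
  proof eventually_elim
   case (elim s)
   then show ?case
    using delayed_avg_pointwise[OF T g, of s] by (intro tendsto_rabs_zero) (simp add: LIM_zero_iff)
  qed
  show "AE s in time T. norm \<bar>delayed_avg T n (prim T g) s - g s\<bar> \<le> 2 * B" for n
  proof (rule AE_I2)
   fix s show "norm \<bar>delayed_avg T n (prim T g) s - g s\<bar> \<le> 2 * B"
    using bound[of n s] b[of s] by (simp; linarith)
  qed
 qed (use g in auto)
 then show ?thesis by simp
qed

lemma avg_error_diff:
 assumes T: "T > 0" and g: "integrable (time T) g" and f: "integrable (time T) f"
 shows "avg_error T (%s. g s - f s) n \<le> avg_error T g n + avg_error T f n"
proof -
 have P: "prim T (%s. g s - f s) = (%t. prim T g t - prim T f t)"
  using prim_diff[OF g f] by (simp add: fun_eq_iff)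
 note ia = integrable_delayed_avg
 have ig: "integrable (time T) (%s. \<bar>delayed_avg T n (prim T g) s - g s\<bar>)"
  by (intro integrable_abs Bochner_Integration.integrable_diff ia g)
 have if_: "integrable (time T) (%s. \<bar>delayed_avg T n (prim T f) s - f s\<bar>)"
  by (intro integrable_abs Bochner_Integration.integrable_diff ia f)
 have "avg_error T (%s. g s - f s) n \<le> (\<integral>s. \<bar>delayed_avg T n (prim T g) s - g s\<bar> + \<bar>delayed_avg T n (prim T f) s - f s\<bar> \<partial>time T)"
  unfolding avg_error_def
 proof (rule integral_mono)
  show "integrable (time T) (%s. \<bar>delayed_avg T n (prim T (%s. g s - f s)) s - (g s - f s)\<bar>)"
   by (intro integrable_abs Bochner_Integration.integrable_diff ia g f)
 qed (use ig if_ in \<open>auto simp: P delayed_avg_diff\<close>)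
 then show ?thesis
  using ig if_ by (simp add: avg_error_def)
qed

lemma avg_error_cmult:
 assumes g: "integrable (time T) g"
 shows "avg_error T (%s. c * g s) n = \<bar>c\<bar> * avg_error T g n"
proof -
 have "prim T (%s. c * g s) = (%t. c * prim T g t)"
  using prim_scaleR[of T c g] by (simp add: fun_eq_iff)
 then have "\<bar>delayed_avg T n (prim T (%s. c * g s)) s - c * g s\<bar> = \<bar>c\<bar> * \<bar>delayed_avg T n (prim T g) s - g s\<bar>" for s
  by (simp add: delayed_avg_cmult abs_mult right_diff_distrib[symmetric])
 then show ?thesis by (simp add: avg_error_def)
qed

lemma avg_error_cong: "(!!s. s \<in> {0..T} ==> g s = f s) ==> avg_error T g = avg_error T f"
proof -
 assume eq: "!!s. s \<in> {0..T} ==> g s = f s"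
 have "prim T g = prim T f"
  unfolding prim_def using eq by (intro ext Bochner_Integration.integral_cong) (auto simp: space_time)
 then show ?thesis
  unfolding avg_error_def using eq by (intro ext Bochner_Integration.integral_cong) (auto simp: space_time)
qed

lemma avg_error_zero: "avg_error T (%s. 0) = (%n. 0)"
proof -
 have "prim T (%s. 0 :: real) = (%t. 0)" by (simp add: prim_def fun_eq_iff)
 then show ?thesis
  unfolding avg_error_def[abs_def] by (simp only:) (simp add: delayed_avg_def)
qed

text \<open>Intervals are continuous off their end points; the indicators of Borel sets follow by Dynkin's
\<open>\<pi>\<close>-\<open>\<lambda>\<close> theorem.\<close>

lemma avg_error_indicator:
 assumes T: "T > 0" and A: "A \<in> sets borel"
 shows "avg_error T (indicator A) \<longlonglongrightarrow> 0"
proof -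
 interpret finite_measure "time T" by (rule finite_measure_time)
 have ii: "integrable (time T) (indicat_real B)" if "B \<in> sets borel" for B
  by (rule integrable_const_bound[of _ 1]) (use that in \<open>auto simp: indicator_def measurable_restrict_space1\<close>)
 have "Int_stable (range (%a::real. {..a}))"
  by (auto simp: Int_stable_def)
 moreover have "range (%a::real. {..a}) \<subseteq> Pow UNIV" by auto
 moreover have "A \<in> sigma_sets UNIV (range (%a::real. {..a}))"
  using A unfolding borel_eq_atMost by simp
 ultimately show ?thesis
 proof (induction rule: sigma_sets_induct_disjoint)
  case (basic A)
  then obtain a where a: "A = {..a}" by auto
  show ?case
  proof (rule avg_error_pointwise[OF T ii, where B = 1])
   show "AE s in lborel. isCont (indicat_real A) s"
    using AE_lborel_singleton[of a]
   proof eventually_elim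
    case (elim s)
    show ?case
    proof (cases "s < a")
     case True
     then have "eventually (%x. indicat_real A x = 1) (nhds s)"
      using eventually_nhds_in_open[of "{..<a}" s] by (auto simp: a elim!: eventually_mono)
     then show ?thesis by (subst isCont_cong[where g = "%_. 1"]) auto
    next
     case False
     with elim have "eventually (%x. indicat_real A x = 0) (nhds s)"
      using eventually_nhds_in_open[of "{a<..}" s] by (auto simp: a elim!: eventually_mono)
     then show ?thesis by (subst isCont_cong[where g = "%_. 0"]) auto
    qed
   qed
  qed (auto simp: a indicator_def)
 next
  case empty
  show ?case by (simp add: avg_error_zero)
 next
  case (compl A)
  have A: "A \<in> sets borel" using compl(1) unfolding borel_eq_atMost by simp
  have one: "avg_error T (%_. 1) \<longlonglongrightarrow> 0"
   by (rule avg_error_pointwise[OF T _, where B = 1]) auto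
  have "avg_error T (indicat_real (UNIV - A)) = avg_error T (%s. 1 - indicat_real A s)"
   by (intro avg_error_cong) (auto simp: indicator_def)
  moreover have "avg_error T (%s. 1 - indicat_real A s) \<longlonglongrightarrow> 0"
  proof (rule tendsto_sandwich[OF _ _ tendsto_const])
   show "(%n. avg_error T (%_. 1) n + avg_error T (indicat_real A) n) \<longlonglongrightarrow> 0"
    using tendsto_add[OF one compl(2)] by simp
  qed (auto intro!: always_eventually avg_error_nonneg avg_error_diff T ii A)
  ultimately show ?case by simp
 next
  case (union A)
  have A: "A i \<in> sets borel" for i using union(2) unfolding borel_eq_atMost by auto
  let ?f = "%k. indicat_real (\<Union>i<k. A i)"
  have fk: "avg_error T (?f k) \<longlonglongrightarrow> 0" for k
  proof (induction k)
   case 0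
   show ?case by (simp add: avg_error_zero)
  next
   case (Suc k)
   have d: "(\<Union>i<k. A i) \<inter> A k = {}"
   proof -
    have "A i \<inter> A k = {}" if "i < k" for i
     using disjoint_family_onD[OF union(1), of i k] that by simp
    then show ?thesis by blast
   qed
   have "avg_error T (?f (Suc k)) = avg_error T (%s. ?f k s - (-1) * indicat_real (A k) s)"
   proof (rule avg_error_cong)
    fix s :: real
    have U: "(\<Union>i<Suc k. A i) = (\<Union>i<k. A i) \<union> A k"
     by (auto simp: lessThan_Suc)
    have "indicat_real (X \<union> Y) s = indicat_real X s - (-1) * indicat_real Y s" if "X \<inter> Y = {}" for X Y
     using that by (auto simp: indicator_def)
    then show "?f (Suc k) s = ?f k s - (-1) * indicat_real (A k) s"
     unfolding U using d .
   qed
   moreover have "avg_error T (%s. ?f k s - (-1) * indicat_real (A k) s) \<longlonglongrightarrow> 0"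
   proof (rule tendsto_sandwich[OF _ _ tendsto_const])
    show "(%n. avg_error T (?f k) n + avg_error T (%s. (-1) * indicat_real (A k) s) n) \<longlonglongrightarrow> 0"
     using tendsto_add[OF Suc union(3)[of k]] by (subst avg_error_cmult) (auto intro!: ii A)
    show "\<forall>\<^sub>F n in sequentially. avg_error T (%s. ?f k s - (-1) * indicat_real (A k) s) n \<le>
     avg_error T (?f k) n + avg_error T (%s. (-1) * indicat_real (A k) s) n"
     by (intro always_eventually allI avg_error_diff T integrable_mult_right ii A sets.countable_UN') (auto intro: A)
   qed (auto intro!: always_eventually avg_error_nonneg)
   ultimately show ?case by simp
  qed
  show ?case
  proof (rule avg_error_closed[OF T _ _ _ fk])
   have "(%k. \<integral>s. \<bar>indicat_real (\<Union>i. A i) s - ?f k s\<bar> \<partial>time T) \<longlonglongrightarrow> (\<integral>s. 0 \<partial>time T)"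
   proof (rule integral_dominated_convergence[where w = "%_. 1"])
    show "AE s in time T. (%k. \<bar>indicat_real (\<Union>i. A i) s - ?f k s\<bar>) \<longlonglongrightarrow> 0"
    proof (rule AE_I2)
     fix s
     have "(%k. ?f k s) \<longlonglongrightarrow> indicat_real (\<Union>i. A i) s"
      by (rule LIMSEQ_indicator_UN)
     from tendsto_diff[OF tendsto_const[of "indicat_real (\<Union>i. A i) s"] this]
     show "(%k. \<bar>indicat_real (\<Union>i. A i) s - ?f k s\<bar>) \<longlonglongrightarrow> 0"
      by (intro tendsto_rabs_zero) simp
    qed
    show "(%s. \<bar>indicat_real (\<Union>i. A i) s - ?f k s\<bar>) \<in> borel_measurable (time T)" for k
     using A by (intro borel_measurable_integrable integrable_abs Bochner_Integration.integrable_diff ii sets.countable_UN') auto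
   qed (auto simp: indicator_def)
   then show "(%k. \<integral>s. \<bar>indicat_real (\<Union>i. A i) s - ?f k s\<bar> \<partial>time T) \<longlonglongrightarrow> 0" by simp
  qed (use A in \<open>auto intro!: ii sets.countable_UN'\<close>)
 qed
qed

proposition delayed_avg_tendsto:
 assumes T: "T > 0" and g: "integrable (time T) g"
 shows "(%n. \<integral>s. \<bar>delayed_avg T n (prim T g) s - g s\<bar> \<partial>time T) \<longlonglongrightarrow> 0"
proof -
 have "avg_error T g \<longlonglongrightarrow> 0"
  using g
 proof (induction rule: integrable_induct)
  case (base A c)
  interpret finite_measure "time T" by (rule finite_measure_time)
  obtain B where B: "B \<in> sets borel" "A = B \<inter> {0..T}"
   using base by (auto simp: sets_restrict_space)
  have i: "integrable (time T) (indicat_real B)"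
   by (rule integrable_const_bound[of _ 1]) (use B in \<open>auto simp: indicator_def measurable_restrict_space1\<close>)
  have "avg_error T (%s. indicat_real A s *\<^sub>R c) = avg_error T (%s. c * indicat_real B s)"
   by (intro avg_error_cong) (auto simp: B indicator_def)
  also have "\<dots> = (%n. \<bar>c\<bar> * avg_error T (indicat_real B) n)"
   by (intro ext avg_error_cmult i)
  finally have eq: "avg_error T (%s. indicat_real A s *\<^sub>R c) = (%n. \<bar>c\<bar> * avg_error T (indicat_real B) n)" .
  show ?case
   unfolding eq by (rule tendsto_mult_right_zero[OF avg_error_indicator[OF T B(1)]])
 next
  case (add f g)
  have i: "integrable (time T) (%s. (-1) * g s)" using add by simp
  show ?case
  proof (rule tendsto_sandwich[OF _ _ tendsto_const])
   show "(%n. avg_error T f n + avg_error T (%s. (-1) * g s) n) \<longlonglongrightarrow> 0"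
    using tendsto_add[OF add(3,4)] add by (subst avg_error_cmult) auto
   show "\<forall>\<^sub>F n in sequentially. avg_error T (%x. f x + g x) n \<le> avg_error T f n + avg_error T (%s. (-1) * g s) n"
    using avg_error_diff[OF T add(1) i] by simp
  qed (auto intro!: always_eventually avg_error_nonneg)
 next
  case (lim f s)
  show ?case
  proof (rule avg_error_closed[OF T lim(4) lim(1) _ lim(5)])
   have "(%k. \<integral>x. \<bar>f x - s k x\<bar> \<partial>time T) \<longlonglongrightarrow> (\<integral>x. 0 \<partial>time T)"
   proof (rule integral_dominated_convergence[where w = "%x. 3 * \<bar>f x\<bar>"])
    show "AE x in time T. (%k. \<bar>f x - s k x\<bar>) \<longlonglongrightarrow> 0"
    proof (rule AE_I2)
     fix x assume "x \<in> space (time T)"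
     from tendsto_diff[OF tendsto_const[of "f x"] lim(2)[OF this]]
     show "(%k. \<bar>f x - s k x\<bar>) \<longlonglongrightarrow> 0"
      by (intro tendsto_rabs_zero) simp
    qed
    show "AE x in time T. norm \<bar>f x - s k x\<bar> \<le> 3 * \<bar>f x\<bar>" for k
    proof (rule AE_I2)
     fix x assume "x \<in> space (time T)"
     from lim(3)[OF this, of k] show "norm \<bar>f x - s k x\<bar> \<le> 3 * \<bar>f x\<bar>"
      by (simp; linarith)
    qed
   qed (use lim in auto)
   then show "(%k. \<integral>x. \<bar>f x - s k x\<bar> \<partial>time T) \<longlonglongrightarrow> 0" by simp
  qed
 qed
 then show ?thesis unfolding avg_error_def[abs_def] .
qed

section \<open>Processes as functions on time and probability space\<close>

lemma pair_sigma_finite_time: "finite_measure P ==> pair_sigma_finite (time T) P"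
 using finite_measure_time by (simp add: pair_sigma_finite_def finite_measure.sigma_finite_measure)

lemma finite_measure_time_pair: "finite_measure P ==> finite_measure (T \<otimes> P)"
 by (rule finite_measure_pair_measure) (auto simp: finite_measure_time)

lemma AE_snd:
 assumes "finite_measure P" "AE \<omega> in P. Q \<omega>"
 shows "AE x in T \<otimes> P. Q (snd x)"
proof -
 interpret finite_measure P by fact
 obtain N where N: "{\<omega>\<in>space P. \<not> Q \<omega>} \<subseteq> N" "emeasure P N = 0" "N \<in> sets P"
  using assms(2) by (rule AE_E)
 have t: "space (time T) \<in> sets (time T)" by (rule sets.top)
 have "space (time T) \<times> N \<in> null_sets (T \<otimes> P)"
  using N pair_measureI[OF t N(3)] emeasure_pair_measure_Times[OF t N(3)] by (intro null_setsI) simp_all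
 then show ?thesis
  by (rule AE_I') (use N in \<open>auto simp: space_pair_measure\<close>)
qed

lemma integral_time_prod:
 fixes f :: "real \<times> 'w => 'b::euclidean_space"
 assumes P: "finite_measure P" and f: "integrable (T \<otimes> P) f"
 shows "(\<integral>x. f x \<partial>(T \<otimes> P)) = (\<integral>\<omega>. (\<integral>s. f (s, \<omega>) \<partial>time T) \<partial>P)"
  and "(\<integral>x. f x \<partial>(T \<otimes> P)) = (\<integral>s. (\<integral>\<omega>. f (s, \<omega>) \<partial>P) \<partial>time T)"
  and "AE \<omega> in P. integrable (time T) (%s. f (s, \<omega>))"
  and "AE s in time T. integrable P (%\<omega>. f (s, \<omega>))"
  and "integrable P (%\<omega>. \<integral>s. f (s, \<omega>) \<partial>time T)"
  and "integrable (time T) (%s. \<integral>\<omega>. f (s, \<omega>) \<partial>P)"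
proof -
 interpret pair_sigma_finite "time T" P by (rule pair_sigma_finite_time[OF P])
 have f': "integrable (T \<otimes> P) (case_prod (%s \<omega>. f (s, \<omega>)))"
  using f by simp
 show "(\<integral>x. f x \<partial>(T \<otimes> P)) = (\<integral>\<omega>. (\<integral>s. f (s, \<omega>) \<partial>time T) \<partial>P)"
  using integral_snd[OF f'] by simp
 show "(\<integral>x. f x \<partial>(T \<otimes> P)) = (\<integral>s. (\<integral>\<omega>. f (s, \<omega>) \<partial>P) \<partial>time T)"
  using integral_fst[OF f'] by simp
 show "AE \<omega> in P. integrable (time T) (%s. f (s, \<omega>))"
  using AE_integrable_snd[OF f'] by simp
 show "AE s in time T. integrable P (%\<omega>. f (s, \<omega>))"
  using AE_integrable_fst[OF f'] by simp
 show "integrable P (%\<omega>. \<integral>s. f (s, \<omega>) \<partial>time T)"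
  using integrable_snd[OF f'] by simp
 show "integrable (time T) (%s. \<integral>\<omega>. f (s, \<omega>) \<partial>P)"
  using integrable_fst[OF f'] by simp
qed

lemma proc_section_measurable:
 assumes "proc b \<in> borel_measurable (T \<otimes> R)"
 shows "\<omega> \<in> space R ==> (%s. b s \<omega>) \<in> borel_measurable (time T)"
  and "s \<in> {0..T} ==> b s \<in> borel_measurable R"
 using measurable_compose[OF measurable_Pair2' assms] measurable_compose[OF measurable_Pair1' assms]
 by (simp_all add: space_time)

text \<open>Fubini: almost every path and almost every time section of a square integrable process is square
integrable.\<close>

lemma sq_int_paths:
 assumes P: "finite_measure P" and b: "sq_int (T \<otimes> P) (proc b)"
 shows "AE \<omega> in P. sq_int (time T) (%s. b s \<omega>)"
  and "AE s in time T. sq_int P (b s)"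
  and "nsq (T \<otimes> P) (proc b) = (\<integral>\<omega>. nsq (time T) (%s. b s \<omega>) \<partial>P)"
  and "nsq (T \<otimes> P) (proc b) = (\<integral>s. nsq P (b s) \<partial>time T)"
  and "integrable P (%\<omega>. nsq (time T) (%s. b s \<omega>))"
proof -
 have m: "proc b \<in> borel_measurable (T \<otimes> P)" and
  i: "integrable (T \<otimes> P) (%x. (norm (proc b x))\<^sup>2)"
  using b by (auto simp: sq_int_def)
 note m12 = proc_section_measurable[OF m]
 show "AE \<omega> in P. sq_int (time T) (%s. b s \<omega>)"
  using integral_time_prod(3)[OF P i] AE_space by eventually_elim (auto simp: sq_int_def m12)
 show "AE s in time T. sq_int P (b s)"
  using integral_time_prod(4)[OF P i] AE_space by eventually_elim (auto simp: sq_int_def m12 space_time)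
 show "nsq (T \<otimes> P) (proc b) = (\<integral>\<omega>. nsq (time T) (%s. b s \<omega>) \<partial>P)"
  using integral_time_prod(1)[OF P i] by (simp add: nsq_def)
 show "nsq (T \<otimes> P) (proc b) = (\<integral>s. nsq P (b s) \<partial>time T)"
  using integral_time_prod(2)[OF P i] by (simp add: nsq_def)
 show "integrable P (%\<omega>. nsq (time T) (%s. b s \<omega>))"
  using integral_time_prod(5)[OF P i] by (simp add: nsq_def)
qed

lemma prim_proc_measurable:
 fixes b :: "real => 'w => 'b::euclidean_space"
 assumes "proc b \<in> borel_measurable (T \<otimes> R)"
 shows "(%x. prim T (%s. b s (snd x)) (fst x)) \<in> borel_measurable (T \<otimes> R)"
proof -
 interpret finite_measure "time T" by (rule finite_measure_time)
 let ?N = "(T \<otimes> R) \<Otimes>\<^sub>M time T"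
 have "(%y. (snd y, snd (fst y))) \<in> measurable ?N (T \<otimes> R)"
  by measurable
 from measurable_compose[OF this assms]
 have [measurable]: "(%y. b (snd y) (snd (fst y))) \<in> borel_measurable ?N" by simp
 have [measurable]: "(%y. fst (fst y)) \<in> borel_measurable ?N"
  by (rule measurable_compose[OF _ id_time_measurable]) measurable
 have [measurable]: "(%y. snd y) \<in> borel_measurable ?N"
  by (rule measurable_compose[OF _ id_time_measurable]) measurable
 have "(%x. \<integral>s. (if 0 \<le> s \<and> s \<le> fst x then b s (snd x) else 0) \<partial>time T) \<in> borel_measurable (T \<otimes> R)"
  by (rule borel_measurable_lebesgue_integral) (simp add: split_beta')
 moreover have "prim T (%s. b s (snd x)) (fst x) = (\<integral>s. (if 0 \<le> s \<and> s \<le> fst x then b s (snd x) else 0) \<partial>time T)" for x :: "real \<times> 'w"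
  unfolding prim_def by (intro Bochner_Integration.integral_cong) (auto simp: indicator_def)
 ultimately show ?thesis by simp
qed

lemma prim_at_measurable:
 fixes b :: "real => 'w => 'b::euclidean_space"
 assumes "proc b \<in> borel_measurable (T \<otimes> R)" "t \<in> {0..T}"
 shows "(%\<omega>. prim T (%s. b s \<omega>) t) \<in> borel_measurable R"
 by (rule proc_section_measurable(2)[OF prim_proc_measurable[OF assms(1)] assms(2)])

lemma prim_at_sq_int:
 assumes P: "finite_measure P" and T: "T \<ge> 0" and t: "t \<in> {0..T}"
  and b: "sq_int (T \<otimes> P) (proc b)"
 shows "sq_int P (%\<omega>. prim T (%s. b s \<omega>) t)"
  and "nsq P (%\<omega>. prim T (%s. b s \<omega>) t) \<le> T * nsq (T \<otimes> P) (proc b)"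
proof -
 note s = sq_int_paths[OF P b]
 have m: "(%\<omega>. prim T (%s. b s \<omega>) t) \<in> borel_measurable P"
  using b t by (intro prim_at_measurable) (auto simp: sq_int_def)
 have le: "AE \<omega> in P. (norm (prim T (%s. b s \<omega>) t))\<^sup>2 \<le> T * nsq (time T) (%s. b s \<omega>)"
  using s(1) by eventually_elim (intro nsq_prim_path T)
 have i: "integrable P (%\<omega>. (norm (prim T (%s. b s \<omega>) t))\<^sup>2)"
 proof (rule Bochner_Integration.integrable_bound)
  show "integrable P (%\<omega>. T * nsq (time T) (%s. b s \<omega>))" using s(5) by simp
  show "AE \<omega> in P. norm ((norm (prim T (%s. b s \<omega>) t))\<^sup>2) \<le> norm (T * nsq (time T) (%s. b s \<omega>))"
   using le by eventually_elim auto
 qed (use m in auto)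
 with m show "sq_int P (%\<omega>. prim T (%s. b s \<omega>) t)" by (simp add: sq_int_def)
 have "nsq P (%\<omega>. prim T (%s. b s \<omega>) t) \<le> (\<integral>\<omega>. T * nsq (time T) (%s. b s \<omega>) \<partial>P)"
  unfolding nsq_def[of P] using i s(5) le by (intro integral_mono_AE) auto
 then show "nsq P (%\<omega>. prim T (%s. b s \<omega>) t) \<le> T * nsq (T \<otimes> P) (proc b)"
  by (simp add: s(3))
qed

lemma sq_int_proc_bounded:
 fixes X :: "real => 'w => 'b::euclidean_space"
 assumes P: "finite_measure P" and T: "T \<ge> 0" and m: "proc X \<in> borel_measurable (T \<otimes> P)"
  and sq: "!!t. t \<in> {0..T} ==> sq_int P (X t)" and B: "!!t. t \<in> {0..T} ==> nsq P (X t) \<le> B"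
 shows "sq_int (T \<otimes> P) (proc X)" "nsq (T \<otimes> P) (proc X) \<le> T * B"
proof -
 interpret t: finite_measure "time T" by (rule finite_measure_time)
 interpret finite_measure P by fact
 note [measurable] = m
 have B0: "B \<ge> 0" using B[of 0] nsq_nonneg[of P "X 0"] T by simp
 have n: "(\<integral>\<^sup>+\<omega>. ennreal ((norm (X t \<omega>))\<^sup>2) \<partial>P) = ennreal (nsq P (X t))" if "t \<in> {0..T}" for t
  unfolding nsq_def using sq[OF that] by (intro nn_integral_eq_integral) (auto simp: sq_int_def)
 have "(\<integral>\<^sup>+x. ennreal ((norm (proc X x))\<^sup>2) \<partial>(T \<otimes> P)) = (\<integral>\<^sup>+t. (\<integral>\<^sup>+\<omega>. ennreal ((norm (X t \<omega>))\<^sup>2) \<partial>P) \<partial>time T)"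
  by (subst nn_integral_fst[symmetric]) auto
 also have "\<dots> \<le> (\<integral>\<^sup>+t. ennreal B \<partial>time T)"
  using n B by (intro nn_integral_mono) (auto simp: space_time intro!: ennreal_leI)
 also have "\<dots> = ennreal (T * B)"
  using T B0 by (simp add: t.emeasure_eq_measure measure_time space_time ennreal_mult[symmetric] mult.commute)
 finally have le: "(\<integral>\<^sup>+x. ennreal ((norm (proc X x))\<^sup>2) \<partial>(T \<otimes> P)) \<le> ennreal (T * B)" .
 have i: "integrable (T \<otimes> P) (%x. (norm (proc X x))\<^sup>2)"
 proof (rule integrableI_bounded)
  have "(\<integral>\<^sup>+x. ennreal (norm ((norm (proc X x))\<^sup>2)) \<partial>(T \<otimes> P)) \<le> ennreal (T * B)"
   using le by simp
  then show "(\<integral>\<^sup>+x. ennreal (norm ((norm (proc X x))\<^sup>2)) \<partial>(T \<otimes> P)) < \<infinity>"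
   by (rule le_less_trans) simp
 qed measurable
 with m show "sq_int (T \<otimes> P) (proc X)" by (simp add: sq_int_def)
 have "ennreal (nsq (T \<otimes> P) (proc X)) \<le> ennreal (T * B)"
  using le i unfolding nsq_def by (subst (asm) nn_integral_eq_integral) auto
 then show "nsq (T \<otimes> P) (proc X) \<le> T * B"
  using T B0 by (subst (asm) ennreal_le_iff) auto
qed

lemma prim_proc_sq_int:
 assumes P: "finite_measure P" and T: "T \<ge> 0" and b: "sq_int (T \<otimes> P) (proc b)"
 shows "sq_int (T \<otimes> P) (%x. prim T (%s. b s (snd x)) (fst x))"
 using prim_at_sq_int[OF P T _ b] prim_proc_measurable[OF sq_int_measurable[OF b]]
 by (intro sq_int_proc_bounded(1)[OF P T, of "%t \<omega>. prim T (%s. b s \<omega>) t"])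

text \<open>The adjoint of \<open>b \<mapsto> \<integral>\<^sub>0\<^sup>t b\<close> in \<open>L\<^sup>2\<close> integrates from \<open>s\<close> to \<open>T\<close>.\<close>

definition coprim :: "real => (real => 'b::euclidean_space) => real => 'b" where
 "coprim T h s = prim T h T - prim T h s"

text \<open>Fubini on the triangle \<open>s \<le> t\<close>.\<close>

lemma prim_coprim_path:
 fixes g b :: "real => 'b::euclidean_space"
 assumes g: "sq_int (time T) g" and b: "sq_int (time T) b"
 shows "(\<integral>t. g t \<bullet> prim T b t \<partial>time T) = (\<integral>s. coprim T g s \<bullet> b s \<partial>time T)"
proof -
 interpret t: finite_measure "time T" by (rule finite_measure_time)
 interpret tt: pair_sigma_finite "time T" "time T"
  by (rule pair_sigma_finite_time[OF finite_measure_time])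
 have gi: "integrable (time T) g" and bi: "integrable (time T) b"
  using t.sq_int_integrable g b by auto
 note [measurable] = borel_measurable_integrable[OF gi] borel_measurable_integrable[OF bi]
 let ?k = "%t s. (if s \<le> t then 1 else 0 :: real) * (g t \<bullet> b s)"
 have [measurable]: "(%y. fst y) \<in> borel_measurable (T \<otimes> time T)"
  by (rule measurable_compose[OF _ id_time_measurable]) measurable
 have [measurable]: "(%y. snd y) \<in> borel_measurable (T \<otimes> time T)"
  by (rule measurable_compose[OF _ id_time_measurable]) measurable
 have k: "integrable (T \<otimes> time T) (case_prod ?k)"
 proof (rule Bochner_Integration.integrable_bound)
  have "integrable (T \<otimes> time T) (%(x, y). norm (g x) * norm (b y))"
   using gi bi by (intro tt.Fubini_integrable)
    (auto simp: abs_mult intro!: AE_I2 integrable_mult_left integrable_mult_right)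
  then show "integrable (T \<otimes> time T) (%x. norm (g (fst x)) * norm (b (snd x)))"
   by (simp add: split_beta')
  show "AE x in T \<otimes> time T. norm (case_prod ?k x) \<le> norm (norm (g (fst x)) * norm (b (snd x)))"
   by (intro AE_I2) (auto simp: abs_mult Cauchy_Schwarz_ineq2)
 qed (simp add: split_beta')
 have "(\<integral>t. g t \<bullet> prim T b t \<partial>time T) = (\<integral>t. (\<integral>s. ?k t s \<partial>time T) \<partial>time T)"
 proof (rule Bochner_Integration.integral_cong[OF refl])
  fix t
  have "g t \<bullet> prim T b t = (\<integral>s. g t \<bullet> (indicator {0..t} s *\<^sub>R b s) \<partial>time T)"
   unfolding prim_def by (rule integral_inner_right[symmetric]) (rule integrable_time_indicator[OF bi])
  also have "\<dots> = (\<integral>s. ?k t s \<partial>time T)"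
   by (intro Bochner_Integration.integral_cong) (auto simp: space_time indicator_def)
  finally show "g t \<bullet> prim T b t = (\<integral>s. ?k t s \<partial>time T)" .
 qed
 also have "\<dots> = (\<integral>s. (\<integral>t. ?k t s \<partial>time T) \<partial>time T)"
  using tt.integral_fst[OF k] tt.integral_snd[OF k] by simp
 also have "\<dots> = (\<integral>s. coprim T g s \<bullet> b s \<partial>time T)"
 proof (rule Bochner_Integration.integral_cong[OF refl])
  fix s assume s: "s \<in> space (time T)"
  have "coprim T g s = (\<integral>t. indicator {0..T} t *\<^sub>R g t - indicator {0..s} t *\<^sub>R g t \<partial>time T)"
   unfolding coprim_def prim_def
   by (intro Bochner_Integration.integral_diff[symmetric] integrable_time_indicator gi)
  also have "\<dots> = (\<integral>t. (if s \<le> t then 1 else 0) *\<^sub>R g t \<partial>time T)"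
  proof (rule integral_cong_AE)
   have "AE t in lborel. t \<noteq> s" by (rule AE_lborel_singleton)
   then have "AE t in time T. t \<noteq> s" by (subst AE_restrict_space_iff) auto
   then show "AE t in time T. indicator {0..T} t *\<^sub>R g t - indicator {0..s} t *\<^sub>R g t = (if s \<le> t then 1 else 0) *\<^sub>R g t"
    using AE_space by eventually_elim (use s in \<open>auto simp: space_time indicator_def\<close>)
   show "(%t. indicator {0..T} t *\<^sub>R g t - indicator {0..s} t *\<^sub>R g t) \<in> borel_measurable (time T)"
    using integrable_time_indicator[OF gi] by (intro borel_measurable_diff borel_measurable_integrable)
  qed simp
  finally have c: "coprim T g s = (\<integral>t. (if s \<le> t then 1 else 0) *\<^sub>R g t \<partial>time T)" .
  have "integrable (time T) (%t. (if s \<le> t then 1 else 0 :: real) *\<^sub>R g t)"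
   by (rule Bochner_Integration.integrable_bound[OF gi]) auto
  then have "coprim T g s \<bullet> b s = (\<integral>t. ((if s \<le> t then 1 else 0) *\<^sub>R g t) \<bullet> b s \<partial>time T)"
   unfolding c by (intro integral_inner_left[symmetric])
  then show "(\<integral>t. ?k t s \<partial>time T) = coprim T g s \<bullet> b s"
   by simp
 qed
 finally show ?thesis .
qed

lemma coprim_sq_int:
 assumes P: "finite_measure P" and T: "T \<ge> 0" and b: "sq_int (T \<otimes> P) (proc b)"
 shows "sq_int (T \<otimes> P) (%x. coprim T (%s. b s (snd x)) (fst x))"
 unfolding coprim_def
proof (rule sq_int_diff[OF _ prim_proc_sq_int[OF P T b]])
 have "(%\<omega>. prim T (%s. b s \<omega>) T) \<in> borel_measurable P"
  using T by (intro prim_at_measurable sq_int_measurable[OF b]) auto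
 from measurable_compose[OF measurable_snd this]
 have "(%x. prim T (%s. b s (snd x)) T) \<in> borel_measurable (T \<otimes> P)" .
 then show "sq_int (T \<otimes> P) (%x. prim T (%s. b s (snd x)) T)"
  using prim_at_sq_int[OF P T _ b, of T] T
  by (intro sq_int_proc_bounded(1)[OF P T, of "%t \<omega>. prim T (%s. b s \<omega>) T"]) auto
qed

lemma prim_coprim:
 fixes g b :: "real => 'w => 'b::euclidean_space"
 assumes P: "finite_measure P" and T: "T \<ge> 0"
  and g: "sq_int (T \<otimes> P) (proc g)" and b: "sq_int (T \<otimes> P) (proc b)"
 shows "(\<integral>x. proc g x \<bullet> prim T (%s. b s (snd x)) (fst x) \<partial>(T \<otimes> P)) =
  (\<integral>x. coprim T (%s. g s (snd x)) (fst x) \<bullet> proc b x \<partial>(T \<otimes> P))"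
proof -
 have 1: "integrable (T \<otimes> P) (%x. proc g x \<bullet> prim T (%s. b s (snd x)) (fst x))"
  by (intro sq_int_inner g prim_proc_sq_int P T b)
 have 2: "integrable (T \<otimes> P) (%x. coprim T (%s. g s (snd x)) (fst x) \<bullet> proc b x)"
  by (intro sq_int_inner coprim_sq_int P T b g)
 have "(\<integral>\<omega>. (\<integral>s. g s \<omega> \<bullet> prim T (%s. b s \<omega>) s \<partial>time T) \<partial>P) =
  (\<integral>\<omega>. (\<integral>s. coprim T (%s. g s \<omega>) s \<bullet> b s \<omega> \<partial>time T) \<partial>P)"
 proof (rule integral_cong_AE)
  show "AE \<omega> in P. (\<integral>s. g s \<omega> \<bullet> prim T (%s. b s \<omega>) s \<partial>time T) = (\<integral>s. coprim T (%s. g s \<omega>) s \<bullet> b s \<omega> \<partial>time T)"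
   using sq_int_paths(1)[OF P g] sq_int_paths(1)[OF P b] by eventually_elim (rule prim_coprim_path)
  show "(%\<omega>. \<integral>s. g s \<omega> \<bullet> prim T (%s. b s \<omega>) s \<partial>time T) \<in> borel_measurable P"
   using borel_measurable_integrable[OF integral_time_prod(5)[OF P 1]] by simp
  show "(%\<omega>. \<integral>s. coprim T (%s. g s \<omega>) s \<bullet> b s \<omega> \<partial>time T) \<in> borel_measurable P"
   using borel_measurable_integrable[OF integral_time_prod(5)[OF P 2]] by simp
 qed
 then show ?thesis
  using integral_time_prod(1)[OF P 1] integral_time_prod(1)[OF P 2] by simp
qed

section \<open>Projecting a drift onto path space\<close>

text \<open>A function measurable with respect to \<open>h\<close> factors through \<open>h\<close>: it is recovered from
 the sets \<open>A q\<close> whose preimages are its rational sublevel sets.\<close>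

lemma vimage_algebra_factor:
 fixes f :: "'a => real"
 assumes f: "f \<in> borel_measurable (vimage_algebra X h S)" and h: "h \<in> X \<rightarrow> space S"
 obtains g where "g \<in> borel_measurable S" "!!x. x \<in> X ==> f x = g (h x)"
proof -
 have "\<exists>A\<in>sets S. {x\<in>X. f x < q} = h -` A \<inter> X" for q :: real
 proof -
  have "{x \<in> space (vimage_algebra X h S). f x < q} \<in> sets (vimage_algebra X h S)"
   using f by measurable
  then show ?thesis
   using h by (auto simp: sets_vimage_algebra2)
 qed
 then obtain A where A: "!!q::real. A q \<in> sets S" "!!q. {x\<in>X. f x < q} = h -` A q \<inter> X"
  by metis
 define g where "g z = (INF q\<in>\<rat>. if z \<in> A q then ereal q else \<infinity>)" for z
 have "g \<in> borel_measurable S"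
  unfolding g_def using A(1) by (intro borel_measurable_INF countable_rat measurable_If_set) auto
 then have "(%z. real_of_ereal (g z)) \<in> borel_measurable S"
  by measurable
 moreover have "f x = real_of_ereal (g (h x))" if x: "x \<in> X" for x
 proof -
  have mem: "h x \<in> A q \<longleftrightarrow> f x < q" for q
   using A(2)[of q] x by blast
  have "g (h x) = ereal (f x)"
   unfolding g_def
  proof (rule antisym)
   show "ereal (f x) \<le> (INF q\<in>\<rat>. if h x \<in> A q then ereal q else \<infinity>)"
    by (rule INF_greatest) (auto simp: mem)
   show "(INF q\<in>\<rat>. if h x \<in> A q then ereal q else \<infinity>) \<le> ereal (f x)"
   proof (rule ereal_le_epsilon2)
    fix e :: real assume "0 < e"
    then obtain q where q: "q \<in> \<rat>" "f x < q" "q < f x + e"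
     using Rats_dense_in_real[of "f x" "f x + e"] by auto
    have "(INF q\<in>\<rat>. if h x \<in> A q then ereal q else \<infinity>) \<le> (if h x \<in> A q then ereal q else \<infinity>)"
     using q(1) by (rule INF_lower)
    also have "\<dots> \<le> ereal (f x) + ereal e"
     using q by (simp add: mem)
    finally show "(INF q\<in>\<rat>. if h x \<in> A q then ereal q else \<infinity>) \<le> ereal (f x) + ereal e" .
   qed
  qed
  then show ?thesis by simp
 qed
 ultimately show ?thesis by (rule that)
qed

definition progressive_on_paths :: "real => (real => (real => real ^ 'm) => 'b::euclidean_space) => bool" where
 "progressive_on_paths T \<beta> \<longleftrightarrow> (\<forall>u\<in>{0..T}. proc \<beta> \<in> borel_measurable (restrict_space borel {0..u} \<Otimes>\<^sub>M past T u))"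

lemma progressive_on_paths_measurable:
 assumes "progressive_on_paths T \<beta>" "T \<ge> 0"
 shows "proc \<beta> \<in> borel_measurable (T \<otimes> path_space T)"
proof (rule measurable_compose[where g = "proc \<beta>" and f = "%x. x", simplified])
 show "proc \<beta> \<in> borel_measurable (restrict_space borel {0..T} \<Otimes>\<^sub>M past T T)"
  using assms by (auto simp: progressive_on_paths_def)
 have s: "sets (T \<otimes> path_space T) = sets (restrict_space borel {0..T} \<Otimes>\<^sub>M path_space T)"
  by (intro sets_pair_measure_cong sets_time refl)
 have "(%x. (fst x, snd x)) \<in> measurable (restrict_space borel {0..T} \<Otimes>\<^sub>M path_space T) (restrict_space borel {0..T} \<Otimes>\<^sub>M past T T)"
 proof (intro measurable_Pair measurable_fst)
  have "(%z. z) \<in> measurable (path_space T) (past T T)"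
   by (rule measurable_past) (auto simp: path_space_def intro: measurable_component_singleton)
  from measurable_compose[OF measurable_snd this]
  show "(%x. snd x) \<in> measurable (restrict_space borel {0..T} \<Otimes>\<^sub>M path_space T) (past T T)" .
 qed
 then show "(%x. x) \<in> measurable (T \<otimes> path_space T) (restrict_space borel {0..T} \<Otimes>\<^sub>M past T T)"
  unfolding measurable_cong_sets[OF s refl] by simp
qed

context started_bm
begin

lemma fin: "finite_measure P"
 by (rule finite_measure_axioms)

lemma fin_path_law: "finite_measure path_law"
 using prob_space_path_law by (simp add: prob_space_def)

lemma time_path_law: "distr (T \<otimes> P) (T \<otimes> path_space T) (%x. (fst x, path (snd x))) = T \<otimes> path_law"
proof -
 have "sigma_finite_measure (distr P (path_space T) path)"
  using finite_measure.sigma_finite_measure[OF fin_path_law] by (simp add: path_law_def)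
 from pair_measure_distr[OF _ path_measurable this, of "%x. x" "time T" "time T"]
 show ?thesis by (simp add: path_law_def split_beta')
qed

lemma lift_measurable: "(%x. (fst x, path (snd x))) \<in> measurable (T \<otimes> P) (T \<otimes> path_space T)"
 by (intro measurable_Pair measurable_fst measurable_compose[OF measurable_snd path_measurable])

lemma sets_time_path_law[simp]: "sets (T \<otimes> path_law) = sets (T \<otimes> path_space T)"
 by (intro sets_pair_measure_cong refl) simp

lemma measurable_time_path_law: "measurable (T \<otimes> path_law) N = measurable (T \<otimes> path_space T) N"
 by (rule measurable_cong_sets) simp_all

lemma sq_int_lift:
 fixes g :: "real => (real => real ^ 'm) => 'b::euclidean_space"
 assumes "proc g \<in> borel_measurable (T \<otimes> path_space T)"
 shows "sq_int (T \<otimes> path_law) (proc g) \<longleftrightarrow> sq_int (T \<otimes> P) (%x. g (fst x) (path (snd x)))"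
  and "nsq (T \<otimes> path_law) (proc g) = nsq (T \<otimes> P) (%x. g (fst x) (path (snd x)))"
 unfolding time_path_law[symmetric] using sq_int_distr[OF lift_measurable assms] nsq_distr[OF lift_measurable assms] by simp_all

lemma integral_lift:
 fixes g :: "real => (real => real ^ 'm) => 'b::euclidean_space"
 assumes "proc g \<in> borel_measurable (T \<otimes> path_space T)"
 shows "(\<integral>x. proc g x \<partial>(T \<otimes> path_law)) = (\<integral>x. g (fst x) (path (snd x)) \<partial>(T \<otimes> P))"
 unfolding time_path_law[symmetric] using integral_distr[OF lift_measurable assms] by simp

text \<open>Condition on the pair of the time and the path, and factor the conditional expectation through it.\<close>

lemma conditional_drift:
 fixes b :: "real => 'w => real"
 assumes b: "sq_int (T \<otimes> P) (proc b)"
 obtains \<beta> where "sq_int (T \<otimes> path_law) (proc \<beta>)"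
  "!!g. sq_int (T \<otimes> path_law) (proc g) ==>
   (\<integral>x. g (fst x) (path (snd x)) * proc b x \<partial>(T \<otimes> P)) = (\<integral>x. proc g x * proc \<beta> x \<partial>(T \<otimes> path_law))"
proof -
 let ?R = "T \<otimes> P" and ?S = "T \<otimes> path_space T"
 let ?h = "%x. (fst x, path (snd x))"
 let ?G = "vimage_algebra (space ?R) ?h ?S"
 interpret R: finite_measure ?R by (rule finite_measure_time_pair[OF fin])
 have hsp: "?h \<in> space ?R \<rightarrow> space ?S" using lift_measurable by (auto simp: measurable_def)
 have sub: "subalgebra ?R ?G"
  unfolding subalgebra_def
  by (intro conjI sets_image_in_sets[OF _ lift_measurable]) simp_all
 interpret G: finite_measure_subalgebra ?R ?G by unfold_locales (rule sub)
 have bi: "integrable ?R (proc b)" by (rule R.sq_int_integrable[OF b])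
 have bm: "proc b \<in> borel_measurable ?R" using bi by simp
 define c where "c = real_cond_exp ?R ?G (proc b)"
 have cG: "c \<in> borel_measurable ?G" unfolding c_def by simp
 obtain g0 where g0: "g0 \<in> borel_measurable ?S" "!!x. x \<in> space ?R ==> c x = g0 (?h x)"
  by (rule vimage_algebra_factor[OF cG hsp]) blast
 define \<beta> where "\<beta> s z = g0 (s, z)" for s z
 have \<beta>m: "proc \<beta> \<in> borel_measurable ?S" using g0 by (simp add: \<beta>_def)
 have c\<beta>: "c x = \<beta> (fst x) (path (snd x))" if "x \<in> space ?R" for x
  using g0(2)[OF that] by (simp add: \<beta>_def)
 have cm: "c \<in> borel_measurable ?R" using measurable_from_subalg[OF sub cG] .
 have "integrable ?R (%x. (c x)\<^sup>2)"
  unfolding c_def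
 proof (rule G.integrable_convex_cond_exp[where I = UNIV])
  show "integrable ?R (%x. (proc b x)\<^sup>2)" using b by (simp add: sq_int_def)
  show "convex_on UNIV (%x::real. x\<^sup>2)" by (rule convex_power2)
 qed (use bi in auto)
 then have "sq_int ?R c" using cm by (simp add: sq_int_def)
 then have "sq_int ?R (%x. \<beta> (fst x) (path (snd x)))"
  by (subst sq_int_cong_AE[where v = c]) (use c\<beta> measurable_compose[OF lift_measurable \<beta>m] in auto)
 then have sq: "sq_int (T \<otimes> path_law) (proc \<beta>)"
  using sq_int_lift(1)[OF \<beta>m] by simp
 have "(\<integral>x. g (fst x) (path (snd x)) * proc b x \<partial>?R) = (\<integral>x. proc g x * proc \<beta> x \<partial>(T \<otimes> path_law))"
  if g: "sq_int (T \<otimes> path_law) (proc g)" for g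
 proof -
  have gm: "proc g \<in> borel_measurable ?S"
   using sq_int_measurable[OF g] unfolding measurable_time_path_law .
  have gG: "(%x. g (fst x) (path (snd x))) \<in> borel_measurable ?G"
   using measurable_compose[OF measurable_vimage_algebra1[OF hsp] gm] by simp
  have gs: "sq_int ?R (%x. g (fst x) (path (snd x)))"
   using g sq_int_lift(1)[OF gm] by simp
  have "integrable ?R (%x. g (fst x) (path (snd x)) * proc b x)"
   using sq_int_inner[OF gs b] by simp
  from G.real_cond_exp_intg(2)[OF this gG bm]
  have "(\<integral>x. g (fst x) (path (snd x)) * proc b x \<partial>?R) = (\<integral>x. g (fst x) (path (snd x)) * c x \<partial>?R)"
   by (simp add: c_def)
  also have "\<dots> = (\<integral>x. g (fst x) (path (snd x)) * \<beta> (fst x) (path (snd x)) \<partial>?R)"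
   by (intro Bochner_Integration.integral_cong) (auto simp: c\<beta>)
  also have "\<dots> = (\<integral>x. proc g x * proc \<beta> x \<partial>(T \<otimes> path_law))"
   using integral_lift[of "%s z. g s z * \<beta> s z"] gm \<beta>m by simp
  finally show ?thesis .
 qed
 with sq show ?thesis by (rule that)
qed

text \<open>A version of the conditional drift that is progressive on path space: its integrals up to
 \<open>t\<close> depend on the path up to \<open>t\<close> only, and the drift is the limit of their difference
 quotients over past cells.\<close>

proposition progressive_projection_real:
 fixes b :: "real => 'w => real"
 assumes b: "sq_int (T \<otimes> P) (proc b)"
  and adapted: "!!t. t \<in> {0..T} ==> (%\<omega>. prim T (%s. b s \<omega>) t) \<in> borel_measurable (F t)"
 obtains \<beta> where "progressive_on_paths T \<beta>" "sq_int (T \<otimes> path_law) (proc \<beta>)"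
  "!!g. sq_int (T \<otimes> path_law) (proc g) ==>
   (\<integral>x. g (fst x) (path (snd x)) * proc b x \<partial>(T \<otimes> P)) = (\<integral>x. proc g x * proc \<beta> x \<partial>(T \<otimes> path_law))"
proof -
 let ?R = "T \<otimes> P" and ?S = "T \<otimes> path_space T" and ?Q = "T \<otimes> path_law"
 have T0: "T \<ge> 0" using T_pos by simp
 interpret R: finite_measure ?R by (rule finite_measure_time_pair[OF fin])
 interpret Qp: finite_measure ?Q by (rule finite_measure_time_pair[OF fin_path_law])
 interpret Q: prob_space path_law by (rule prob_space_path_law)
 interpret tm: finite_measure "time T" by (rule finite_measure_time)
 obtain \<beta>0 where \<beta>0: "sq_int ?Q (proc \<beta>0)"
  "!!g. sq_int ?Q (proc g) ==> (\<integral>x. g (fst x) (path (snd x)) * proc b x \<partial>?R) = (\<integral>x. proc g x * proc \<beta>0 x \<partial>?Q)"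
  by (rule conditional_drift[OF b]) blast
 have \<beta>0i: "integrable ?Q (proc \<beta>0)" by (rule Qp.sq_int_integrable[OF \<beta>0(1)])
 have \<beta>0m: "proc \<beta>0 \<in> borel_measurable ?Q" using \<beta>0i by simp
 have "\<exists>V. V \<in> borel_measurable (past T t) \<and> (AE z in path_law. V z = prim T (%s. \<beta>0 s z) t)"
  if t: "t \<in> {0..T}" for t
 proof -
  define u where "u \<omega> = prim T (%s. b s \<omega>) t" for \<omega>
  have uF: "u \<in> borel_measurable (F t)" using adapted[OF t] by (simp add: u_def[abs_def])
  have uP[measurable]: "u \<in> borel_measurable P" using F_measurable[OF uF t] .
  have us: "sq_int P u" unfolding u_def[abs_def] by (rule prim_at_sq_int(1)[OF fin T0 t b])
  have ui: "integrable P u" by (rule sq_int_integrable[OF us])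
  have fp: "(\<integral>\<^sup>+\<omega>. ennreal (u \<omega>) \<partial>P) < \<infinity>" "(\<integral>\<^sup>+\<omega>. ennreal (- u \<omega>) \<partial>P) < \<infinity>"
   using ui by (auto simp: real_integrable_def less_top)
  have up: "(%\<omega>. ennreal (u \<omega>)) \<in> borel_measurable (F t)" "(%\<omega>. ennreal (- u \<omega>)) \<in> borel_measurable (F t)"
   using uF by measurable
  obtain V1 where V1: "V1 \<in> borel_measurable (past T t)"
   "!!D. D \<in> sets (path_space T) ==> (\<integral>\<^sup>+\<omega>. ennreal (u \<omega>) * indicator D (path \<omega>) \<partial>P) = (\<integral>\<^sup>+z. V1 z * indicator D z \<partial>path_law)"
   by (rule adapted_factor[OF t up(1) fp(1)]) blast
  obtain V2 where V2: "V2 \<in> borel_measurable (past T t)"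
   "!!D. D \<in> sets (path_space T) ==> (\<integral>\<^sup>+\<omega>. ennreal (- u \<omega>) * indicator D (path \<omega>) \<partial>P) = (\<integral>\<^sup>+z. V2 z * indicator D z \<partial>path_law)"
   by (rule adapted_factor[OF t up(2) fp(2)]) blast
  have sub: "subalgebra path_law (past T t)"
   using subalgebra_past[of t T] t by (auto simp: subalgebra_def)
  define V where "V z = enn2real (V1 z) - enn2real (V2 z)" for z
  have V: "V \<in> borel_measurable (past T t)"
   unfolding V_def using V1(1) V2(1) by measurable
  have Vi: "integrable path_law (%z. enn2real (Vk z)) \<and> (\<forall>D\<in>sets (path_space T).
    (\<integral>z. indicator D z * enn2real (Vk z) \<partial>path_law) = (\<integral>\<omega>. indicator D (path \<omega>) * max 0 (w \<omega>) \<partial>P))"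
   if Vk: "Vk \<in> borel_measurable (past T t)" and w: "integrable P w" and
    eq: "!!D. D \<in> sets (path_space T) ==> (\<integral>\<^sup>+\<omega>. ennreal (w \<omega>) * indicator D (path \<omega>) \<partial>P) = (\<integral>\<^sup>+z. Vk z * indicator D z \<partial>path_law)"
   for Vk and w :: "'w => real"
  proof -
   have Vm[measurable]: "Vk \<in> borel_measurable path_law" using measurable_from_subalg[OF sub Vk] .
   note wm[measurable] = borel_measurable_integrable[OF w]
   note path_measurable[measurable]
   have wi: "integrable P (%\<omega>. max 0 (w \<omega>))" using w by (intro integrable_max) auto
   have "(\<integral>\<^sup>+z. Vk z * indicator (space (path_space T)) z \<partial>path_law) = (\<integral>\<^sup>+\<omega>. ennreal (w \<omega>) * indicator (space (path_space T)) (path \<omega>) \<partial>P)"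
    using eq[OF sets.top] by simp
   also have "\<dots> \<le> (\<integral>\<^sup>+\<omega>. ennreal (w \<omega>) \<partial>P)"
    by (intro nn_integral_mono) (auto split: split_indicator)
   also have "\<dots> < \<infinity>" using w by (auto simp: real_integrable_def less_top)
   finally have "(\<integral>\<^sup>+z. Vk z * indicator (space (path_space T)) z \<partial>path_law) < \<infinity>" .
   moreover have "(\<integral>\<^sup>+z. Vk z * indicator (space (path_space T)) z \<partial>path_law) = (\<integral>\<^sup>+z. Vk z \<partial>path_law)"
    by (intro nn_integral_cong) (auto simp: space_path_law)
   ultimately have fin: "(\<integral>\<^sup>+z. Vk z \<partial>path_law) < \<infinity>" by simp
   then have AEfin: "AE z in path_law. Vk z \<noteq> \<infinity>"
    by (intro nn_integral_PInf_AE) auto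
   have r: "AE z in path_law. ennreal (enn2real (Vk z)) = Vk z"
    using AEfin by eventually_elim (auto simp: less_top)
   have i: "integrable path_law (%z. enn2real (Vk z))"
   proof (rule integrableI_bounded)
    have "(\<integral>\<^sup>+z. ennreal (norm (enn2real (Vk z))) \<partial>path_law) = (\<integral>\<^sup>+z. Vk z \<partial>path_law)"
     using r by (intro nn_integral_cong_AE) auto
    then show "(\<integral>\<^sup>+z. ennreal (norm (enn2real (Vk z))) \<partial>path_law) < \<infinity>" using fin by simp
   qed measurable
   have "(\<integral>z. indicator D z * enn2real (Vk z) \<partial>path_law) = (\<integral>\<omega>. indicator D (path \<omega>) * max 0 (w \<omega>) \<partial>P)"
    if D[measurable]: "D \<in> sets (path_space T)" for D
   proof -
    have "(\<integral>z. indicator D z * enn2real (Vk z) \<partial>path_law) = enn2real (\<integral>\<^sup>+z. ennreal (indicator D z * enn2real (Vk z)) \<partial>path_law)"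
     by (rule integral_eq_nn_integral) auto
    also have "(\<integral>\<^sup>+z. ennreal (indicator D z * enn2real (Vk z)) \<partial>path_law) = (\<integral>\<^sup>+z. Vk z * indicator D z \<partial>path_law)"
     using r by (intro nn_integral_cong_AE) (auto elim!: eventually_mono split: split_indicator)
    also have "\<dots> = (\<integral>\<^sup>+\<omega>. ennreal (indicator D (path \<omega>) * max 0 (w \<omega>)) \<partial>P)"
     unfolding eq[OF D, symmetric] by (intro nn_integral_cong) (auto split: split_indicator simp: max_def ennreal_neg)
    also have "enn2real \<dots> = (\<integral>\<omega>. indicator D (path \<omega>) * max 0 (w \<omega>) \<partial>P)"
     by (rule integral_eq_nn_integral[symmetric]) auto
    finally show ?thesis .
   qed
   with i show ?thesis by blast
  qed
  note i1 = Vi[OF V1(1) ui V1(2)]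
  have "integrable P (%\<omega>. - u \<omega>)" using ui by simp
  note i2 = Vi[OF V2(1) this V2(2)]
  have Vint: "integrable path_law V"
   unfolding V_def using i1 i2 by (intro Bochner_Integration.integrable_diff) auto
  have pi: "integrable path_law (%z. prim T (%s. \<beta>0 s z) t)"
   by (rule Q.sq_int_integrable[OF prim_at_sq_int(1)[OF fin_path_law T0 t \<beta>0(1)]])
  have "AE z in path_law. V z = prim T (%s. \<beta>0 s z) t"
  proof (rule density_unique_real[OF Vint pi])
   fix D assume "D \<in> sets path_law"
   then have D[measurable]: "D \<in> sets (path_space T)" by simp
   have [measurable]: "D \<in> sets path_law" by simp
   note path_measurable[measurable]
   have id: "integrable path_law (%z. indicator D z * h z)" if "integrable path_law h" for h :: "_ => real"
    using integrable_mult_indicator[OF \<open>D \<in> sets path_law\<close> that] by simp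
   have idP: "integrable P (%\<omega>. indicator D (path \<omega>) * h \<omega>)" if h: "integrable P h" for h :: "'w => real"
    by (rule Bochner_Integration.integrable_bound[OF h])
     (use borel_measurable_integrable[OF h] in \<open>auto split: split_indicator\<close>)
   have "(\<integral>z\<in>D. V z \<partial>path_law) = (\<integral>z. indicator D z * enn2real (V1 z) - indicator D z * enn2real (V2 z) \<partial>path_law)"
    unfolding set_lebesgue_integral_def V_def by (simp add: right_diff_distrib)
   also have "\<dots> = (\<integral>\<omega>. indicator D (path \<omega>) * max 0 (u \<omega>) \<partial>P) - (\<integral>\<omega>. indicator D (path \<omega>) * max 0 (- u \<omega>) \<partial>P)"
    using i1 i2 D by (subst Bochner_Integration.integral_diff) (auto intro: id)
   also have "\<dots> = (\<integral>\<omega>. indicator D (path \<omega>) * max 0 (u \<omega>) - indicator D (path \<omega>) * max 0 (- u \<omega>) \<partial>P)"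
    using ui by (intro Bochner_Integration.integral_diff[symmetric] idP integrable_max) auto
   also have "\<dots> = (\<integral>\<omega>. indicator D (path \<omega>) * u \<omega> \<partial>P)"
    by (intro Bochner_Integration.integral_cong) (auto simp: max_def)
   finally have lhs: "(\<integral>z\<in>D. V z \<partial>path_law) = (\<integral>\<omega>. indicator D (path \<omega>) * u \<omega> \<partial>P)" .
   define g where "g s z = (indicator {0..t} s * indicator D z :: real)" for s :: real and z
   have it: "indicat_real {0..t} \<in> borel_measurable (time T)"
    by (simp add: measurable_restrict_space1)
   have gm: "proc g \<in> borel_measurable ?Q"
    unfolding g_def by (intro borel_measurable_times measurable_compose[OF measurable_fst it] measurable_compose[OF measurable_snd borel_measurable_indicator]) simp
   have gs: "sq_int ?Q (proc g)"
    unfolding sq_int_def using gm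
    by (auto intro!: Qp.integrable_const_bound[of _ 1] simp: g_def split: split_indicator)
   have gbi: "integrable ?R (%x. g (fst x) (path (snd x)) * proc b x)"
    using sq_int_inner[OF _ b, of "%x. g (fst x) (path (snd x))"] gs sq_int_lift(1)[of g] gm
    unfolding measurable_time_path_law by simp
   have g\<beta>: "integrable ?Q (%x. proc g x * proc \<beta>0 x)"
    using sq_int_inner[OF gs \<beta>0(1)] by simp
   have pg: "(\<integral>s. (indicator {0..t} s * d) * h s \<partial>time T) = d * prim T h t" for d and h :: "real => real"
    unfolding prim_def by (subst integral_mult_right_zero[symmetric]) (intro Bochner_Integration.integral_cong, auto)
   have "(\<integral>\<omega>. indicator D (path \<omega>) * u \<omega> \<partial>P) = (\<integral>x. g (fst x) (path (snd x)) * proc b x \<partial>?R)"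
    unfolding integral_time_prod(1)[OF fin gbi] by (simp add: g_def pg u_def)
   also have "\<dots> = (\<integral>x. proc g x * proc \<beta>0 x \<partial>?Q)"
    by (rule \<beta>0(2)[OF gs])
   also have "\<dots> = (\<integral>z. indicator D z * prim T (%s. \<beta>0 s z) t \<partial>path_law)"
    unfolding integral_time_prod(1)[OF fin_path_law g\<beta>] by (simp add: g_def pg)
   finally show "(\<integral>z\<in>D. V z \<partial>path_law) = (\<integral>z\<in>D. prim T (%s. \<beta>0 s z) t \<partial>path_law)"
    unfolding lhs by (simp add: set_lebesgue_integral_def)
  qed
  with V show ?thesis by blast
 qed
 then have "\<forall>t. \<exists>V. t \<in> {0..T} \<longrightarrow> V \<in> borel_measurable (past T t) \<and> (AE z in path_law. V z = prim T (%s. \<beta>0 s z) t)"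
  by blast
 from choice[OF this] obtain V where "\<forall>t. t \<in> {0..T} \<longrightarrow>
  V t \<in> borel_measurable (past T t) \<and> (AE z in path_law. V t z = prim T (%s. \<beta>0 s z) t)" ..
 then have V: "!!t. t \<in> {0..T} ==> V t \<in> borel_measurable (past T t)"
  "!!t. t \<in> {0..T} ==> AE z in path_law. V t z = prim T (%s. \<beta>0 s z) t"
  by simp_all
 define \<beta>n where "\<beta>n n s z = delayed_avg T n (%t. V t z) s" for n s z
 have grid: "real k * (T / real (Suc n)) \<in> {0..T}" if "k \<le> Suc n" for k n
 proof -
  have "real k * (T / real (Suc n)) \<le> real (Suc n) * (T / real (Suc n))"
   using that T_pos by (intro mult_right_mono) auto
  then show ?thesis using T_pos by simp
 qed
 have prog: "proc (\<beta>n n) \<in> borel_measurable (restrict_space borel {0..u} \<Otimes>\<^sub>M past T u)" if u: "u \<in> {0..T}" for n u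
  unfolding \<beta>n_def delayed_avg_def Let_def
 proof (rule borel_measurable_sum)
  fix k assume k: "k \<in> {..<n}"
  let ?h = "T / real (Suc n)"
  let ?N = "restrict_space borel {0..u} \<Otimes>\<^sub>M past T u :: (real \<times> (real => real ^ 'm)) measure"
  let ?I = "{real (Suc k) * ?h..<real (Suc (Suc k)) * ?h}"
  show "(%x. indicator ?I (fst x) * ((V (real (Suc k) * ?h) (snd x) - V (real k * ?h) (snd x)) / ?h)) \<in> borel_measurable ?N"
  proof (cases "real (Suc k) * ?h \<le> u")
   case True
   have mono: "V t \<in> borel_measurable (past T u)" if t: "t \<in> {0..T}" "t \<le> u" for t
   proof -
    have "(%z. z) \<in> measurable (past T u) (past T t)"
     using t u by (intro past_mono) auto
    from measurable_compose[OF this V(1)[OF t(1)]] show ?thesis .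
   qed
   have "real k * ?h \<le> real (Suc k) * ?h"
    using T_pos by (intro mult_right_mono) auto
   then have "V (real (Suc k) * ?h) \<in> borel_measurable (past T u)" "V (real k * ?h) \<in> borel_measurable (past T u)"
    using True k grid by (auto intro!: mono simp del: of_nat_Suc)
   moreover have "indicat_real ?I \<in> borel_measurable (restrict_space borel {0..u})"
    by (simp add: measurable_restrict_space1)
   ultimately show ?thesis
    by (intro borel_measurable_times borel_measurable_divide borel_measurable_diff borel_measurable_const
     measurable_compose[OF measurable_fst] measurable_compose[OF measurable_snd])
  next
   case False
   have "indicat_real ?I (fst x) * ((V (real (Suc k) * ?h) (snd x) - V (real k * ?h) (snd x)) / ?h) = 0"
    if "x \<in> space ?N" for x
    using that False by (auto simp: space_pair_measure space_restrict_space indicator_def simp del: of_nat_Suc)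
   then show ?thesis
    by (subst measurable_cong[where g = "%_. 0"]) auto
  qed
 qed
 have \<beta>nm: "proc (\<beta>n n) \<in> borel_measurable ?Q" for n
  unfolding measurable_time_path_law
  by (rule progressive_on_paths_measurable) (use prog T0 in \<open>auto simp: progressive_on_paths_def\<close>)
 have \<beta>nAE: "AE z in path_law. \<forall>n s. \<beta>n n s z = delayed_avg T n (prim T (%s. \<beta>0 s z)) s"
 proof -
  have "AE z in path_law. \<forall>n::nat. \<forall>k\<in>{..Suc n}. V (real k * (T / real (Suc n))) z = prim T (%s. \<beta>0 s z) (real k * (T / real (Suc n)))"
   unfolding AE_all_countable AE_finite_all[OF finite_atMost] using V(2) grid by blast
  then show ?thesis
  proof eventually_elim
   case (elim z)
   show ?case
    unfolding \<beta>n_def delayed_avg_def Let_def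
   proof (intro allI sum.cong refl)
    fix n k :: nat and s :: real assume "k \<in> {..<n}"
    then have "k \<in> {..Suc n}" "Suc k \<in> {..Suc n}" by auto
    then show "indicator {real (Suc k) * (T / real (Suc n))..<real (Suc (Suc k)) * (T / real (Suc n))} s *
     ((V (real (Suc k) * (T / real (Suc n))) z - V (real k * (T / real (Suc n))) z) / (T / real (Suc n))) =
     indicator {real (Suc k) * (T / real (Suc n))..<real (Suc (Suc k)) * (T / real (Suc n))} s *
     ((prim T (%s. \<beta>0 s z) (real (Suc k) * (T / real (Suc n))) - prim T (%s. \<beta>0 s z) (real k * (T / real (Suc n)))) / (T / real (Suc n)))"
     using elim by presburger
   qed
  qed
 qed
 have path_int: "AE z in path_law. integrable (time T) (%s. \<beta>0 s z)"
  using integral_time_prod(3)[OF fin_path_law \<beta>0i] by simp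
 have abs_int: "integrable path_law (%z. \<integral>s. \<bar>\<beta>0 s z\<bar> \<partial>time T)"
  using integral_time_prod(5)[OF fin_path_law integrable_abs[OF \<beta>0i]] by simp
 have bound: "AE z in path_law. (\<integral>s. \<bar>\<beta>n n s z\<bar> \<partial>time T) \<le> (\<integral>s. \<bar>\<beta>0 s z\<bar> \<partial>time T)" for n
  using \<beta>nAE path_int by eventually_elim (simp add: delayed_avg_contraction T_pos)
 have \<beta>ni: "integrable ?Q (proc (\<beta>n n))" for n
 proof -
  have Vsq: "integrable ?Q (%x. V t (snd x))" if t: "t \<in> {0..T}" for t
  proof -
   have sub: "subalgebra path_law (past T t)"
    using subalgebra_past[of t T] t by (auto simp: subalgebra_def)
   have Vm: "V t \<in> borel_measurable path_law" using measurable_from_subalg[OF sub V(1)[OF t]] .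
   have Vs: "sq_int path_law (V t)"
    by (rule sq_int_cong_AE[OF V(2)[OF t] Vm prim_at_sq_int(1)[OF fin_path_law T0 t \<beta>0(1)]])
   show ?thesis
    by (rule Qp.sq_int_integrable, rule sq_int_proc_bounded(1)[OF fin_path_law T0, of "%_. V t"])
     (use Vs measurable_compose[OF measurable_snd Vm] in auto)
  qed
  have im: "(%x. indicat_real {a..<b} (fst x)) \<in> borel_measurable ?Q" for a b
   by (rule measurable_compose[OF measurable_fst]) (simp add: measurable_restrict_space1)
  show ?thesis
   unfolding \<beta>n_def delayed_avg_def Let_def
  proof (rule Bochner_Integration.integrable_sum)
   fix k assume k: "k \<in> {..<n}"
   let ?h = "T / real (Suc n)"
   have i: "integrable ?Q (%x. (V (real (Suc k) * ?h) (snd x) - V (real k * ?h) (snd x)) / ?h)"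
    using k grid by (intro integrable_divide_zero Bochner_Integration.integrable_diff Vsq impI) (auto simp del: of_nat_Suc)
   show "integrable ?Q (%x. indicator {real (Suc k) * ?h..<real (Suc (Suc k)) * ?h} (fst x) *
    ((V (real (Suc k) * ?h) (snd x) - V (real k * ?h) (snd x)) / ?h))"
   proof (rule Bochner_Integration.integrable_bound[OF i])
    show "AE x in ?Q. norm (indicator {real (Suc k) * ?h..<real (Suc (Suc k)) * ?h} (fst x) *
     ((V (real (Suc k) * ?h) (snd x) - V (real k * ?h) (snd x)) / ?h)) \<le> norm ((V (real (Suc k) * ?h) (snd x) - V (real k * ?h) (snd x)) / ?h)"
     by (intro AE_I2) (simp add: indicator_def)
   qed (intro borel_measurable_times im borel_measurable_integrable[OF i])
  qed
 qed
 have di: "integrable ?Q (%x. proc (\<beta>n n) x - proc \<beta>0 x)" for n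
  by (intro Bochner_Integration.integrable_diff \<beta>ni \<beta>0i)
 have ni: "integrable ?Q (%x. norm (proc (\<beta>n n) x - proc \<beta>0 x))" for n
  by (intro integrable_norm di)
 have "(%n. \<integral>z. (\<integral>s. norm (\<beta>n n s z - \<beta>0 s z) \<partial>time T) \<partial>path_law) \<longlonglongrightarrow> (\<integral>z. 0 \<partial>path_law)"
 proof (rule integral_dominated_convergence[where w = "%z. 2 * (\<integral>s. \<bar>\<beta>0 s z\<bar> \<partial>time T)"])
  show "(%z. \<integral>s. norm (\<beta>n n s z - \<beta>0 s z) \<partial>time T) \<in> borel_measurable path_law" for n
   using borel_measurable_integrable[OF integral_time_prod(5)[OF fin_path_law ni[of n]]] by simp
  show "integrable path_law (%z. 2 * (\<integral>s. \<bar>\<beta>0 s z\<bar> \<partial>time T))" using abs_int by simp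
  show "AE z in path_law. (%n. \<integral>s. norm (\<beta>n n s z - \<beta>0 s z) \<partial>time T) \<longlonglongrightarrow> 0"
   using \<beta>nAE path_int
  proof eventually_elim
   case (elim z)
   then show ?case using delayed_avg_tendsto[OF T_pos elim(2)] by simp
  qed
  show "AE z in path_law. norm (\<integral>s. norm (\<beta>n n s z - \<beta>0 s z) \<partial>time T) \<le> 2 * (\<integral>s. \<bar>\<beta>0 s z\<bar> \<partial>time T)" for n
   using bound[of n] path_int \<beta>nAE
  proof eventually_elim
   case (elim z)
   have i1: "integrable (time T) (%s. \<beta>n n s z)"
    using elim(3) integrable_delayed_avg by simp
   have "(\<integral>s. norm (\<beta>n n s z - \<beta>0 s z) \<partial>time T) \<le> (\<integral>s. \<bar>\<beta>n n s z\<bar> + \<bar>\<beta>0 s z\<bar> \<partial>time T)"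
    using i1 elim(2) by (intro integral_mono) auto
   also have "\<dots> = (\<integral>s. \<bar>\<beta>n n s z\<bar> \<partial>time T) + (\<integral>s. \<bar>\<beta>0 s z\<bar> \<partial>time T)"
    using i1 elim(2) by (intro Bochner_Integration.integral_add) auto
   finally have "(\<integral>s. norm (\<beta>n n s z - \<beta>0 s z) \<partial>time T) \<le> 2 * (\<integral>s. \<bar>\<beta>0 s z\<bar> \<partial>time T)"
    using elim(1) by linarith
   moreover have "0 \<le> (\<integral>s. norm (\<beta>n n s z - \<beta>0 s z) \<partial>time T)"
    by (rule Bochner_Integration.integral_nonneg) simp
   ultimately show ?case by simp
  qed
 qed simp
 then have L1: "(%n. \<integral>x. norm (proc (\<beta>n n) x - proc \<beta>0 x) \<partial>?Q) \<longlonglongrightarrow> 0"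
  using integral_time_prod(1)[OF fin_path_law ni] by simp
 obtain r where r: "AE x in ?Q. (%n. proc (\<beta>n (r n)) x - proc \<beta>0 x) \<longlonglongrightarrow> 0"
  using tendsto_L1_AE_subseq[OF di L1] by blast
 define \<beta> where "\<beta> s z = lim (%n. \<beta>n (r n) s z)" for s z
 have AE: "AE x in ?Q. proc \<beta> x = proc \<beta>0 x"
  using r
 proof eventually_elim
  case (elim x)
  then have "(%n. proc (\<beta>n (r n)) x) \<longlonglongrightarrow> proc \<beta>0 x" by (simp add: LIM_zero_iff)
  then show ?case unfolding \<beta>_def by (rule limI)
 qed
 have prog\<beta>: "progressive_on_paths T \<beta>"
  unfolding progressive_on_paths_def \<beta>_def using prog by (intro ballI borel_measurable_lim_metric) auto
 have \<beta>m: "proc \<beta> \<in> borel_measurable ?Q"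
  using progressive_on_paths_measurable[OF prog\<beta> T0] unfolding measurable_time_path_law .
 show ?thesis
 proof (rule that[OF prog\<beta>])
  show "sq_int ?Q (proc \<beta>)" by (rule sq_int_cong_AE[OF AE \<beta>m \<beta>0(1)])
  fix g :: "real => (real => real ^ 'm) => real" assume g: "sq_int ?Q (proc g)"
  have "(\<integral>x. proc g x * proc \<beta> x \<partial>?Q) = (\<integral>x. proc g x * proc \<beta>0 x \<partial>?Q)"
   by (rule integral_cong_AE) (use AE \<beta>m \<beta>0m sq_int_measurable[OF g] in \<open>auto elim!: eventually_mono\<close>)
  then show "(\<integral>x. g (fst x) (path (snd x)) * proc b x \<partial>?R) = (\<integral>x. proc g x * proc \<beta> x \<partial>?Q)"
   using \<beta>0(2)[OF g] by simp
 qed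
qed

end

section \<open>The driving Brownian motions\<close>

text \<open>An event known at time \<open>0\<close> and independent of the starting point is independent of the whole path:
the path law weighted by the event has Gaussian increments and the right initial law.\<close>

lemma (in started_bm) path_indep_event:
 assumes C: "C \<in> sets (F 0)"
  and init: "!!B. B \<in> sets borel ==> emeasure P (C \<inter> {\<omega>\<in>space P. Z 0 \<omega> \<in> B}) = emeasure P C * emeasure P {\<omega>\<in>space P. Z 0 \<omega> \<in> B}"
  and D: "D \<in> sets (path_space T)"
 shows "emeasure P (C \<inter> {\<omega>\<in>space P. path \<omega> \<in> D}) = emeasure P C * emeasure path_law D"
proof -
 have t0: "0 \<in> {0..T}" using T_pos by simp
 have CP[measurable]: "C \<in> sets P" using C F_sub[OF t0] by (auto simp: subalgebra_def)
 note path_measurable[measurable]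
 let ?\<mu> = "distr (density P (indicator C)) (path_space T) path"
 let ?\<nu> = "distr (density P (%_. emeasure P C)) (path_space T) path"
 have pm: "path \<in> measurable (density P U) (path_space T)" for U
  using path_measurable by simp
 have \<mu>: "emeasure ?\<mu> A = emeasure P (C \<inter> {\<omega>\<in>space P. path \<omega> \<in> A})" if "A \<in> sets (path_space T)" for A
 proof -
  have [measurable]: "path -` A \<inter> space P \<in> sets P" using measurable_sets[OF path_measurable that] .
  have "emeasure ?\<mu> A = (\<integral>\<^sup>+\<omega>. indicator C \<omega> * indicator (path -` A \<inter> space P) \<omega> \<partial>P)"
   using that by (subst emeasure_distr[OF pm]) (simp_all add: emeasure_density)
  also have "\<dots> = (\<integral>\<^sup>+\<omega>. indicator (C \<inter> (path -` A \<inter> space P)) \<omega> \<partial>P)"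
   by (simp only: indicator_inter_arith)
  also have "\<dots> = emeasure P (C \<inter> (path -` A \<inter> space P))"
   by (rule nn_integral_indicator) simp
  also have "C \<inter> (path -` A \<inter> space P) = C \<inter> {\<omega>\<in>space P. path \<omega> \<in> A}" by auto
  finally show ?thesis .
 qed
 have \<nu>: "emeasure ?\<nu> A = emeasure P C * emeasure path_law A" if "A \<in> sets (path_space T)" for A
 proof -
  have [measurable]: "path -` A \<inter> space P \<in> sets P" using measurable_sets[OF path_measurable that] .
  have "emeasure ?\<nu> A = (\<integral>\<^sup>+\<omega>. emeasure P C * indicator (path -` A \<inter> space P) \<omega> \<partial>P)"
   using that by (subst emeasure_distr[OF pm]) (simp_all add: emeasure_density)
  also have "\<dots> = emeasure P C * emeasure P (path -` A \<inter> space P)"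
   by (simp add: nn_integral_cmult_indicator)
  finally show ?thesis
   using that by (simp add: path_law_def emeasure_distr path_measurable)
 qed
 have "?\<mu> = ?\<nu>"
 proof (rule gaussian_increments_unique[where t = 0 and T = T])
  show "finite_measure ?\<mu>"
   using \<mu>[OF sets.top] by (intro finite_measureI) simp
  show "finite_measure ?\<nu>"
   using \<nu>[OF sets.top] finite_measure.emeasure_finite[of path_law] prob_space_path_law
   by (intro finite_measureI) (auto simp: prob_space_def ennreal_mult_eq_top_iff)
  show "gaussian_increments T 0 ?\<mu>" "gaussian_increments T 0 ?\<nu>"
   using C by (auto intro!: gaussian_increments_density[OF t0])
  fix A :: "(real => real ^ 'm) set" assume A: "A \<in> sets (past T 0)"
  then obtain A' where A': "A' \<in> sets (\<Pi>\<^sub>M s\<in>{0..0}. borel)" "A = (%z. restrict z {0..0}) -` A' \<inter> space (path_space T)"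
   unfolding past_def by (subst (asm) sets_vimage_algebra2) (auto simp: space_PiM)
  define B where "B = {x :: real ^ 'm. (\<lambda>r\<in>{0::real}. x) \<in> A'}"
  have "(%x. \<lambda>r\<in>{0::real}. x) \<in> measurable borel (\<Pi>\<^sub>M s\<in>{0}. (borel :: (real ^ 'm) measure))"
   by (intro measurable_restrict) auto
  from measurable_sets[OF this, of A'] A' have B: "B \<in> sets borel"
   by (simp add: B_def vimage_def)
  have AE: "A \<in> sets (path_space T)"
   using A subalgebra_past[of 0 T] T_pos by (auto simp: subalgebra_def)
  have eq: "{\<omega>\<in>space P. path \<omega> \<in> A} = {\<omega>\<in>space P. Z 0 \<omega> \<in> B}"
   using measurable_space[OF path_measurable] T_pos
   by (auto simp: A'(2) B_def path_def restrict_def cong: if_cong)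
  have "emeasure path_law A = emeasure P {\<omega>\<in>space P. path \<omega> \<in> A}"
   unfolding path_law_def by (subst emeasure_distr[OF path_measurable AE]) (simp add: vimage_def Int_def conj_commute)
  then show "emeasure ?\<mu> A = emeasure ?\<nu> A"
   unfolding \<mu>[OF AE] \<nu>[OF AE] using init[OF B] by (simp add: eq)
 qed (use T_pos in auto)
 then show ?thesis
  using \<mu>[OF D] \<nu>[OF D] by simp
qed

lemma sigma_algebra_generated: "sigma_algebra (space M) (generated M J Y)"
 unfolding generated_def by (rule sigma_algebra_sigma_sets) auto

lemma generated_mem: "j \<in> J ==> A \<in> sets borel ==> Y j -` A \<inter> space M \<in> generated M J Y"
 unfolding generated_def by (rule sigma_sets.Basic) auto

lemma generated_Pow: "generated M J Y \<subseteq> Pow (space M)"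
 unfolding generated_def by (intro subsetI PowI sigma_sets_into_sp[rotated]) auto

lemma generated_subset:
 assumes "sigma_algebra (space M) S" "!!j A. j \<in> J ==> A \<in> sets borel ==> Y j -` A \<inter> space M \<in> S"
 shows "generated M J Y \<subseteq> S"
 unfolding generated_def using assms by (intro sigma_algebra.sigma_sets_subset) auto

context brownian_setup
begin

abbreviation "P \<equiv> completion M"

lemma prob_space_P: "prob_space P"
 by (rule prob_space_completion)

lemma F0_sets: "A \<in> sets F0 ==> A \<in> events"
 using F0 by (auto simp: subalgebra_def)

lemma W_measurable: "i \<ge> 1 ==> t \<in> {0..T} ==> W i t \<in> borel_measurable M"
 using W by (simp add: brownian_motion_def)

text \<open>The information available just before the increment of \<open>W i\<close> after time \<open>s\<close>: the
 initial \<open>\<sigma>\<close>-field, the other Brownian motions, the past of \<open>W i\<close>, and the null sets.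
 Its sets are, up to null sets, generated by the stable system of intersections used here.\<close>

definition before :: "nat => real => 'w set set" where
 "before i s = {A \<inter> B \<inter> C | A B C. A \<in> sets F0 \<and>
   B \<in> sigma_sets (space M) (\<Union>j\<in>{1..} - {i}. generated M {0..T} (W j)) \<and> C \<in> generated M {0..s} (W i)}"

definition enlarged :: "nat => real => 'w measure" where
 "enlarged i s = sigma (space M) (before i s \<union> null_sets (completion M))"

lemma other_sigma_algebra: "sigma_algebra (space M) (sigma_sets (space M) (\<Union>j\<in>{1..} - {i}. generated M {0..T} (W j)))"
proof (rule sigma_algebra_sigma_sets)
 show "(\<Union>j\<in>{1..} - {i}. generated M {0..T} (W j)) \<subseteq> Pow (space M)"
  using generated_Pow by blast
qed

lemma Int_stable_before: "Int_stable (before i s)"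
 unfolding Int_stable_def
proof (intro ballI)
 fix X Y assume "X \<in> before i s" "Y \<in> before i s"
 then obtain A B C A' B' C' where X: "X = A \<inter> B \<inter> C" "A \<in> sets F0" "C \<in> generated M {0..s} (W i)"
   "B \<in> sigma_sets (space M) (\<Union>j\<in>{1..} - {i}. generated M {0..T} (W j))"
  and Y: "Y = A' \<inter> B' \<inter> C'" "A' \<in> sets F0" "C' \<in> generated M {0..s} (W i)"
   "B' \<in> sigma_sets (space M) (\<Union>j\<in>{1..} - {i}. generated M {0..T} (W j))"
  unfolding before_def by blast
 interpret o: sigma_algebra "space M" "sigma_sets (space M) (\<Union>j\<in>{1..} - {i}. generated M {0..T} (W j))"
  by (rule other_sigma_algebra)
 interpret g: sigma_algebra "space M" "generated M {0..s} (W i)"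
  by (rule sigma_algebra_generated)
 have "X \<inter> Y = (A \<inter> A') \<inter> (B \<inter> B') \<inter> (C \<inter> C')" using X Y by auto
 then show "X \<inter> Y \<in> before i s"
  unfolding before_def using X Y by blast
qed

lemma generated_all: "i \<ge> 1 ==> J \<subseteq> {0..T} ==> generated M J (W i) \<subseteq> generated M ({1..} \<times> {0..T}) (%(i, t). W i t)"
 using generated_mem[of "(i, t)" "{1..} \<times> {0..T}" _ "%(i, t). W i t" M for t]
 by (intro generated_subset sigma_algebra_generated) fastforce

lemma generated_mono: "J \<subseteq> J' ==> generated M J Y \<subseteq> generated M J' Y"
 by (intro generated_subset sigma_algebra_generated) (auto intro: generated_mem)

lemma increment_generated:
 assumes "0 \<le> s" "s < u" "u \<le> T" "i \<ge> 1"
 shows "generated M {()} (%_ \<omega>. W i u \<omega> - W i s \<omega>) \<subseteq> generated M {0..T} (W i)"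
proof (rule generated_subset[OF sigma_algebra_generated])
 fix A :: "(real ^ 'm) set" assume A: "A \<in> sets borel"
 let ?G = "sigma (space M) (generated M {0..T} (W i))"
 have sG: "sets ?G = generated M {0..T} (W i)"
  by (rule sigma_algebra.sets_measure_of_eq[OF sigma_algebra_generated])
 have "W i t \<in> borel_measurable ?G" if "t \<in> {0..T}" for t
  by (rule measurableI) (use generated_mem[OF that] sG in \<open>auto simp: space_measure_of_conv\<close>)
 then have "(%\<omega>. W i u \<omega> - W i s \<omega>) \<in> borel_measurable ?G"
  using assms by (intro borel_measurable_diff) auto
 from measurable_sets[OF this A] show "(%\<omega>. W i u \<omega> - W i s \<omega>) -` A \<inter> space M \<in> generated M {0..T} (W i)"
  using sG by (simp add: space_measure_of_conv)
qed

text \<open>The three sources are independent, and the increment only depends on \<open>W i\<close>, whose past it is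
independent of; so the probability of an intersection factors.\<close>

lemma increment_indep_before:
 assumes su: "0 \<le> s" "s < u" "u \<le> T" and i: "i \<ge> 1"
 shows "indep_set (sigma_sets (space M) (before i s)) (generated M {()} (%_ \<omega>. W i u \<omega> - W i s \<omega>))"
proof -
 let ?D = "generated M {()} (%_ \<omega>. W i u \<omega> - W i s \<omega>)"
 let ?O = "sigma_sets (space M) (\<Union>j\<in>{1..} - {i}. generated M {0..T} (W j))"
 let ?A = "generated M ({1..} \<times> {0..T}) (%(i, t). W i t)"
 have dT: "?D \<subseteq> generated M {0..T} (W i)" by (rule increment_generated[OF su i])
 have cT: "generated M {0..s} (W i) \<subseteq> generated M {0..T} (W i)"
  using su by (intro generated_mono) auto
 have iA: "generated M {0..T} (W i) \<subseteq> ?A" by (rule generated_all[OF i]) simp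
 interpret A: sigma_algebra "space M" ?A by (rule sigma_algebra_generated)
 interpret I: sigma_algebra "space M" "generated M {0..T} (W i)" by (rule sigma_algebra_generated)
 have OA: "?O \<subseteq> ?A"
  by (rule A.sigma_sets_subset) (use generated_all in blast)
 have Iev: "generated M {0..T} (W i) \<subseteq> events"
  using W_indep i by (auto simp: indep_sets_def)
 have F0A: "prob (A \<inter> E) = prob A * prob E" if "A \<in> sets F0" "E \<in> ?A" for A E
  by (rule indep_setD[OF F0_indep that])
 have OI: "prob (B \<inter> E) = prob B * prob E" if B: "B \<in> ?O" and E: "E \<in> generated M {0..T} (W i)" for B E
 proof -
  let ?I = "%b. if b then {i} else {1..} - {i}"
  have "indep_sets (%b. sigma_sets (space M) (\<Union>j\<in>?I b. generated M {0..T} (W j))) UNIV"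
  proof (rule indep_sets_collect_sigma)
   have "(\<Union>b. ?I b) = {1..}" using i by auto
   then show "indep_sets (%j. generated M {0..T} (W j)) (\<Union>b\<in>UNIV. ?I b)"
    using W_indep by simp
   show "Int_stable (generated M {0..T} (W j))" for j
   proof -
    interpret g: sigma_algebra "space M" "generated M {0..T} (W j)" by (rule sigma_algebra_generated)
    show ?thesis by (auto simp: Int_stable_def)
   qed
   show "disjoint_family_on ?I UNIV" by (auto simp: disjoint_family_on_def)
  qed
  moreover have "\<forall>b\<in>UNIV. case_bool E B b \<in> sigma_sets (space M) (\<Union>j\<in>?I b. generated M {0..T} (W j))"
   using B E by (auto split: bool.split)
  ultimately have "prob (\<Inter>b\<in>UNIV. case_bool E B b) = (\<Prod>b\<in>UNIV. prob (case_bool E B b))"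
   by (intro indep_setsD) auto
  then show ?thesis by (simp add: UNIV_bool Int_commute mult.commute)
 qed
 have CD: "prob (C \<inter> D) = prob C * prob D" if "C \<in> generated M {0..s} (W i)" "D \<in> ?D" for C D
 proof (rule indep_setD)
  show "indep_set (generated M {0..s} (W i)) ?D"
   using W[OF i] su by (simp add: brownian_motion_def)
 qed fact+
 have "indep_set (before i s) ?D"
 proof (rule indep_setI)
  show "?D \<subseteq> events" using dT Iev by blast
  have Aev: "?A \<subseteq> events" using F0_indep indep_setD_ev2 by blast
  show "before i s \<subseteq> events"
  proof
   fix X assume "X \<in> before i s"
   then obtain A B C where X: "X = A \<inter> B \<inter> C" "A \<in> sets F0" "C \<in> generated M {0..s} (W i)" "B \<in> ?O"
    unfolding before_def by blast
   have "A \<in> events" "C \<in> events" "B \<in> events"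
    using F0_sets[OF X(2)] X cT Iev OA Aev by blast+
   then show "X \<in> events" using X by simp
  qed
  fix X D assume X: "X \<in> before i s" and D: "D \<in> ?D"
  then obtain A B C where X: "X = A \<inter> B \<inter> C" "A \<in> sets F0" "C \<in> generated M {0..s} (W i)" "B \<in> ?O"
   unfolding before_def by blast
  have C: "C \<in> generated M {0..T} (W i)" using X cT by blast
  have D': "D \<in> generated M {0..T} (W i)" using D dT by blast
  have CDI: "C \<inter> D \<in> generated M {0..T} (W i)" using C D' by (rule I.Int)
  have BCD: "B \<inter> (C \<inter> D) \<in> ?A" "B \<inter> C \<in> ?A"
   using X(4) CDI C OA iA by (blast intro: A.Int)+
  have "prob (X \<inter> D) = prob (A \<inter> (B \<inter> (C \<inter> D)))" using X by (simp add: Int_assoc)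
  also have "\<dots> = prob A * (prob B * (prob C * prob D))"
   by (simp only: F0A[OF X(2) BCD(1)] OI[OF X(4) CDI] CD[OF X(3) D])
  also have "\<dots> = (prob A * (prob B * prob C)) * prob D" by simp
  also have "prob A * (prob B * prob C) = prob (A \<inter> (B \<inter> C))"
   by (simp only: F0A[OF X(2) BCD(2)] OI[OF X(4) C])
  finally show "prob (X \<inter> D) = prob X * prob D" using X by (simp add: Int_assoc)
 qed
 moreover have "Int_stable ?D"
 proof -
  interpret g: sigma_algebra "space M" ?D by (rule sigma_algebra_generated)
  show ?thesis by (auto simp: Int_stable_def)
 qed
 ultimately have "indep_set (sigma_sets (space M) (before i s)) (sigma_sets (space M) ?D)"
  by (intro indep_set_sigma_sets Int_stable_before)
 moreover have "sigma_sets (space M) ?D = ?D"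
  by (rule sigma_algebra.sigma_sets_eq[OF sigma_algebra_generated])
 ultimately show ?thesis by simp
qed

lemma before_events:
 assumes s: "0 \<le> s" "s \<le> T" and i: "i \<ge> 1"
 shows "before i s \<subseteq> events"
proof
 fix X assume "X \<in> before i s"
 then obtain A B C where X: "X = A \<inter> B \<inter> C" "A \<in> sets F0" "C \<in> generated M {0..s} (W i)"
  "B \<in> sigma_sets (space M) (\<Union>j\<in>{1..} - {i}. generated M {0..T} (W j))"
  unfolding before_def by blast
 have Iev: "generated M {0..T} (W j) \<subseteq> events" if "j \<ge> 1" for j
  using W_indep that by (auto simp: indep_sets_def)
 have "generated M {0..s} (W i) \<subseteq> events"
  using generated_mono[of "{0..s}" "{0..T}" "W i"] Iev[OF i] s by auto
 moreover have "sigma_sets (space M) (\<Union>j\<in>{1..} - {i}. generated M {0..T} (W j)) \<subseteq> events"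
  by (rule sets.sigma_sets_subset) (use Iev in auto)
 ultimately show "X \<in> events" using X F0_sets[OF X(2)] by blast
qed

lemma enlarged_ae:
 assumes s: "0 \<le> s" "s \<le> T" and i: "i \<ge> 1" and A: "A \<in> sets (enlarged i s)"
 shows "A \<in> sets P \<and> (\<exists>A'\<in>sigma_sets (space M) (before i s). AE \<omega> in P. \<omega> \<in> A \<longleftrightarrow> \<omega> \<in> A')"
proof -
 interpret P: prob_space P by (rule prob_space_P)
 have ev: "before i s \<subseteq> events" by (rule before_events[OF s i])
 have sub: "before i s \<union> null_sets P \<subseteq> Pow (space M)"
  using ev sets.space_closed[of M] sets.space_closed[of P] by (auto simp: null_sets_def)
 have "A \<in> sigma_sets (space M) (before i s \<union> null_sets P)"
  using A sub by (simp add: enlarged_def)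
 then show ?thesis
 proof induction
  case (Basic a)
  then show ?case
  proof
   assume a: "a \<in> before i s"
   then show ?thesis using ev by (auto intro!: bexI[of _ a] sigma_sets.Basic)
  next
   assume a: "a \<in> null_sets P"
   then have "AE \<omega> in P. \<omega> \<in> a \<longleftrightarrow> \<omega> \<in> {}"
    using AE_not_in[OF a] by auto
   then show ?thesis using a sigma_sets.Empty[of "space M" "before i s"] by auto
  qed
 next
  case Empty
  then show ?case using sigma_sets.Empty by auto
 next
  case (Compl a)
  then obtain a' where a': "a' \<in> sigma_sets (space M) (before i s)" "AE \<omega> in P. \<omega> \<in> a \<longleftrightarrow> \<omega> \<in> a'" "a \<in> sets P"
   by blast
  have "AE \<omega> in P. \<omega> \<in> space M - a \<longleftrightarrow> \<omega> \<in> space M - a'"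
   using a'(2) by eventually_elim auto
  moreover have "space M - a \<in> sets P" using sets.compl_sets[OF a'(3)] by simp
  ultimately show ?case using sigma_sets.Compl[OF a'(1)] by blast
 next
  case (Union a)
  then obtain a' where a': "!!k. a' k \<in> sigma_sets (space M) (before i s)" "!!k. AE \<omega> in P. \<omega> \<in> a k \<longleftrightarrow> \<omega> \<in> a' k"
   by metis
  have "AE \<omega> in P. \<forall>k. \<omega> \<in> a k \<longleftrightarrow> \<omega> \<in> a' k"
   using a'(2) by (simp add: AE_all_countable)
  then have "AE \<omega> in P. \<omega> \<in> (\<Union>k. a k) \<longleftrightarrow> \<omega> \<in> (\<Union>k. a' k)"
   by eventually_elim auto
  then show ?case using Union sigma_sets.Union[of a', OF a'(1)] by blast
 qed
qed

lemma filt_le_enlarged: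
 assumes s: "0 \<le> s" "s \<le> T" and i: "1 \<le> i"
 shows "sets (filt M F0 W N s) \<subseteq> sets (enlarged i s)"
  and "j \<ge> 1 ==> j \<noteq> i ==> t \<in> {0..T} ==> W j t \<in> borel_measurable (enlarged i s)"
  and "t \<in> {0..s} ==> W i t \<in> borel_measurable (enlarged i s)"
  and "A \<in> sets F0 ==> A \<in> sets (enlarged i s)"
  and "A \<in> null_sets P ==> A \<in> sets (enlarged i s)"
  and "space (enlarged i s) = space M"
proof -
 have ev: "before i s \<subseteq> events" by (rule before_events[OF s i])
 have sub: "before i s \<union> null_sets P \<subseteq> Pow (space M)"
  using ev sets.space_closed[of M] sets.space_closed[of P] by (auto simp: null_sets_def)
 have se: "sets (enlarged i s) = sigma_sets (space M) (before i s \<union> null_sets P)"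
  using sub by (simp add: enlarged_def)
 show sp: "space (enlarged i s) = space M" using sub by (simp add: enlarged_def)
 interpret o: sigma_algebra "space M" "sigma_sets (space M) (\<Union>j\<in>{1..} - {i}. generated M {0..T} (W j))"
  by (rule other_sigma_algebra)
 interpret g: sigma_algebra "space M" "generated M {0..s} (W i)"
  by (rule sigma_algebra_generated)
 have spF0: "space M \<in> sets F0" using F0 sets.top[of F0] by (simp add: subalgebra_def)
 have mem: "X \<in> sets (enlarged i s)" if "X \<in> before i s" for X
  unfolding se using that by (intro sigma_sets.Basic) simp
 show F0: "A \<in> sets (enlarged i s)" if "A \<in> sets F0" for A
 proof (rule mem)
  have "A = A \<inter> space M \<inter> space M" using sets.sets_into_space[OF F0_sets[OF that]] by auto
  then show "A \<in> before i s" unfolding before_def using that o.top g.top by blast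
 qed
 show null: "A \<in> null_sets P ==> A \<in> sets (enlarged i s)" for A
  unfolding se by (intro sigma_sets.Basic) simp
 show Wj: "W j t \<in> borel_measurable (enlarged i s)" if "j \<ge> 1" "j \<noteq> i" "t \<in> {0..T}" for j t
 proof (rule measurableI)
  fix A :: "(real ^ 'm) set" assume A: "A \<in> sets borel"
  have "W j t -` A \<inter> space M \<in> generated M {0..T} (W j)" by (rule generated_mem[OF that(3) A])
  then have B: "W j t -` A \<inter> space M \<in> sigma_sets (space M) (\<Union>j\<in>{1..} - {i}. generated M {0..T} (W j))"
   using that by (intro sigma_sets.Basic) auto
  have "W j t -` A \<inter> space M = space M \<inter> (W j t -` A \<inter> space M) \<inter> space M" by auto
  then have "W j t -` A \<inter> space M \<in> before i s" unfolding before_def using spF0 g.top B by blast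
  then show "W j t -` A \<inter> space (enlarged i s) \<in> sets (enlarged i s)" unfolding sp by (rule mem)
 qed simp
 show Wi: "W i t \<in> borel_measurable (enlarged i s)" if "t \<in> {0..s}" for t
 proof (rule measurableI)
  fix A :: "(real ^ 'm) set" assume A: "A \<in> sets borel"
  have B: "W i t -` A \<inter> space M \<in> generated M {0..s} (W i)" by (rule generated_mem[OF that A])
  have "W i t -` A \<inter> space M = space M \<inter> space M \<inter> (W i t -` A \<inter> space M)" by auto
  then have "W i t -` A \<inter> space M \<in> before i s" unfolding before_def using spF0 o.top B by blast
  then show "W i t -` A \<inter> space (enlarged i s) \<in> sets (enlarged i s)" unfolding sp by (rule mem)
 qed simp
 have "generated M ({1..N} \<times> {0..s}) (%(i, s). W i s) \<subseteq> sets (enlarged i s)"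
 proof (rule generated_subset)
  show "sigma_algebra (space M) (sets (enlarged i s))"
   using sets.sigma_algebra_axioms[of "enlarged i s"] by (simp add: sp)
  fix jt and A :: "(real ^ 'm) set" assume jt: "jt \<in> {1..N} \<times> {0..s}" and A: "A \<in> sets borel"
  obtain j t where j: "jt = (j, t)" by (cases jt)
  have "W j t \<in> borel_measurable (enlarged i s)"
   using jt s Wi Wj[of j t] by (cases "j = i") (auto simp: j)
  from measurable_sets[OF this A] show "(case jt of (i, s) => W i s) -` A \<inter> space M \<in> sets (enlarged i s)"
   by (simp add: sp j)
 qed
 then have sub': "generated M ({1..N} \<times> {0..s}) (%(i, s). W i s) \<union> sets F0 \<union> null_sets P \<subseteq> sets (enlarged i s)"
  using F0 null by blast
 then have "generated M ({1..N} \<times> {0..s}) (%(i, s). W i s) \<union> sets F0 \<union> null_sets P \<subseteq> Pow (space M)"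
  using sets.space_closed[of "enlarged i s"] unfolding sp by blast
 then have "sets (filt M F0 W N s) = sigma_sets (space M) (generated M ({1..N} \<times> {0..s}) (%(i, s). W i s) \<union> sets F0 \<union> null_sets P)"
  unfolding filt_def by (rule sets_measure_of)
 then show "sets (filt M F0 W N s) \<subseteq> sets (enlarged i s)"
  using sets.sigma_sets_subset[OF sub'] by (simp add: sp)
qed

text \<open>What is used of the filtration of the statement: it is a filtration, it contains the initial events
and the null sets, and the first \<open>N\<close> Brownian motions are adapted to it.\<close>

lemma filt_facts:
 assumes s: "0 \<le> s" "s \<le> T" and N: "1 \<le> N"
 shows "space (filt M F0 W N s) = space M" and "subalgebra P (filt M F0 W N s)"
  and "A \<in> sets F0 ==> A \<in> sets (filt M F0 W N s)"
  and "A \<in> null_sets P ==> A \<in> sets (filt M F0 W N s)"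
  and "j \<in> {1..N} ==> t \<in> {0..s} ==> W j t \<in> borel_measurable (filt M F0 W N s)"
  and "s \<le> u ==> sets (filt M F0 W N s) \<subseteq> sets (filt M F0 W N u)"
proof -
 let ?G = "%s. generated M ({1..N} \<times> {0..s}) (%(i, s). W i s) \<union> sets F0 \<union> null_sets P"
 have Pow: "?G s \<subseteq> Pow (space M)" for s
  using generated_Pow[of M "{1..N} \<times> {0..s}" "%(i, s). W i s"] sets.space_closed[of F0] F0 sets.space_closed[of P]
  by (auto simp: null_sets_def subalgebra_def)
 have sf: "sets (filt M F0 W N s) = sigma_sets (space M) (?G s)" for s
  unfolding filt_def by (rule sets_measure_of[OF Pow])
 show sp: "space (filt M F0 W N s) = space M"
  unfolding filt_def by (rule space_measure_of[OF Pow])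
 have "sets (filt M F0 W N s) \<subseteq> sets P"
  using filt_le_enlarged(1)[OF s order_refl, of N] enlarged_ae[OF s order_refl] by blast
 then show "subalgebra P (filt M F0 W N s)" by (simp add: subalgebra_def sp)
 show "A \<in> sets F0 ==> A \<in> sets (filt M F0 W N s)" "A \<in> null_sets P ==> A \<in> sets (filt M F0 W N s)"
  unfolding sf by (auto intro: sigma_sets.Basic)
 show "W j t \<in> borel_measurable (filt M F0 W N s)" if "j \<in> {1..N}" "t \<in> {0..s}"
 proof (rule measurableI)
  fix A :: "(real ^ 'm) set" assume "A \<in> sets borel"
  from generated_mem[OF _ this, of "(j, t)" "{1..N} \<times> {0..s}" "%(i, s). W i s" M] that
  show "W j t -` A \<inter> space (filt M F0 W N s) \<in> sets (filt M F0 W N s)"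
   unfolding sp sf by (auto intro: sigma_sets.Basic)
 qed simp
 show "sets (filt M F0 W N s) \<subseteq> sets (filt M F0 W N u)" if "s \<le> u"
  unfolding sf using that by (intro sigma_sets_mono' Un_mono generated_mono order_refl) auto
qed

text \<open>The Brownian motions are continuous almost surely only. On a null set, which belongs to every
\<open>filt M F0 W N t\<close>, the noise is replaced by zero.\<close>

definition bad :: "nat => 'w set" where
 "bad i = (SOME N. N \<in> null_sets M \<and> (\<forall>\<omega>\<in>space M - N. continuous_on {0..T} (%t. W i t \<omega>)))"

lemma bad:
 assumes "i \<ge> 1"
 shows "bad i \<in> null_sets M" "\<omega> \<in> space M ==> \<omega> \<notin> bad i ==> continuous_on {0..T} (%t. W i t \<omega>)"
proof -
 have "AE \<omega> in M. continuous_on {0..T} (%t. W i t \<omega>)"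
  using W[OF assms] by (simp add: brownian_motion_def)
 then obtain N where "{\<omega>\<in>space M. \<not> continuous_on {0..T} (%t. W i t \<omega>)} \<subseteq> N" "emeasure M N = 0" "N \<in> sets M"
  by (rule AE_E)
 then have "\<exists>N. N \<in> null_sets M \<and> (\<forall>\<omega>\<in>space M - N. continuous_on {0..T} (%t. W i t \<omega>))"
  by (intro exI[of _ N]) auto
 from someI_ex[OF this, folded bad_def]
 show "bad i \<in> null_sets M" "\<omega> \<in> space M ==> \<omega> \<notin> bad i ==> continuous_on {0..T} (%t. W i t \<omega>)"
  by auto
qed

definition start :: "nat => ('w => real ^ 'm) => real => 'w => real ^ 'm" where
 "start i X t \<omega> = X \<omega> + (if \<omega> \<in> bad i then 0 else W i t \<omega> - W i 0 \<omega>)"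

lemma start_AE:
 assumes "i \<ge> 1"
 shows "AE \<omega> in P. \<forall>t. start i X t \<omega> = X \<omega> + (W i t \<omega> - W i 0 \<omega>)"
 using AE_not_in[OF null_sets_completionI[OF bad(1)[OF assms]]] by eventually_elim (simp add: start_def)

lemma start_0: "start i X 0 = X"
 by (simp add: start_def fun_eq_iff)

lemma start_measurable:
 assumes R: "space R = space M" "sets F0 \<subseteq> sets R" "null_sets P \<subseteq> sets R"
  and "W i t \<in> borel_measurable R" "W i 0 \<in> borel_measurable R" and i: "i \<ge> 1" and X: "X \<in> borel_measurable F0"
 shows "start i X t \<in> borel_measurable R"
proof -
 have XR: "X \<in> borel_measurable R"
  by (rule measurable_from_subalg[OF _ X]) (use R F0 in \<open>auto simp: subalgebra_def\<close>)
 have badR: "bad i \<in> sets R"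
  using null_sets_completionI[OF bad(1)[OF i]] R by blast
 from badR have "(%\<omega>. if \<omega> \<in> bad i then 0 else W i t \<omega> - W i 0 \<omega>) \<in> borel_measurable R"
  by (intro measurable_If_set borel_measurable_const borel_measurable_diff assms(4,5) sets.Int sets.top)
 with XR show ?thesis
  unfolding start_def[abs_def] by (rule borel_measurable_add)
qed

text \<open>The information \<open>enlarged i\<close> is larger than that of the filtration, and includes the other Brownian
motions up to time \<open>T\<close>; this is what gives the independence of the paths.\<close>

lemma started_bm_enlarged:
 assumes T: "0 < T" and i: "i \<ge> 1" and X: "X \<in> borel_measurable F0" and sq: "sq_int P X"
 shows "started_bm P (enlarged i) T (start i X)"
proof (intro started_bm.intro started_bm_axioms.intro)
 show "prob_space P" by (rule prob_space_P)
 interpret P: prob_space P by (rule prob_space_P)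
 show "0 < T" by fact
 show sub: "subalgebra P (enlarged i t)" if "t \<in> {0..T}" for t
 proof -
  have t: "0 \<le> t" "t \<le> T" using that by auto
  show ?thesis
   unfolding subalgebra_def
  proof (intro conjI subsetI)
   show "space (enlarged i t) = space P" using filt_le_enlarged(6)[OF t i] by simp
   fix A assume "A \<in> sets (enlarged i t)"
   from enlarged_ae[OF t i this] show "A \<in> sets P" ..
  qed
 qed
 show "sets (enlarged i s) \<subseteq> sets (enlarged i t)" if "0 \<le> s" "s \<le> t" "t \<le> T" for s t
 proof -
  have "generated M {0..s} (W i) \<subseteq> generated M {0..t} (W i)"
   using that by (intro generated_mono) auto
  then have "before i s \<subseteq> before i t"
   unfolding before_def by blast
  moreover have "before i r \<union> null_sets P \<subseteq> Pow (space M)" if "0 \<le> r" "r \<le> T" for r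
   using before_events[OF that i] sets.space_closed[of M] sets.space_closed[of P] by (auto simp: null_sets_def)
  ultimately show ?thesis
   using that by (auto simp: enlarged_def intro!: sigma_sets_mono')
 qed
 show "start i X t \<in> borel_measurable (enlarged i t)" if t: "t \<in> {0..T}" for t
  using t i X filt_le_enlarged[of t i] by (intro start_measurable) auto
 show "continuous_on {0..T} (%t. start i X t \<omega>)" if "\<omega> \<in> space P" for \<omega>
  using bad(2)[OF i, of \<omega>] that unfolding start_def
  by (cases "\<omega> \<in> bad i") (auto intro!: continuous_intros)
 show "sq_int P (start i X 0)" by (simp add: start_0 sq)
 fix s t A and B :: "(real ^ 'm) set"
 assume st: "0 \<le> s" "s < t" "t \<le> T" and A: "A \<in> sets (enlarged i s)" and B: "B \<in> sets borel"
 obtain A' where A': "A' \<in> sigma_sets (space M) (before i s)" "AE \<omega> in P. \<omega> \<in> A \<longleftrightarrow> \<omega> \<in> A'" "A \<in> sets P"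
  using enlarged_ae[OF _ _ i A] st by auto
 let ?D = "(%\<omega>. W i t \<omega> - W i s \<omega>) -` B \<inter> space M"
 have D: "?D \<in> generated M {()} (%_ \<omega>. W i t \<omega> - W i s \<omega>)"
  using generated_mem[of "()" "{()}" B "%_ \<omega>. W i t \<omega> - W i s \<omega>" M] B by simp
 note ind = increment_indep_before[OF st i]
 have ev: "A' \<in> events" "?D \<in> events"
  using indep_setD_ev1[OF ind] indep_setD_ev2[OF ind] A' D by auto
 have mW: "(%\<omega>. W i t \<omega> - W i s \<omega>) \<in> borel_measurable M"
  using st i by (intro borel_measurable_diff W_measurable) auto
 have g: "emeasure M ?D = emeasure (gaussian (t - s)) B"
 proof -
  have "distr M borel (%\<omega>. W i t \<omega> - W i s \<omega>) = gaussian (t - s)"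
   using W[OF i] st by (simp add: brownian_motion_def)
  then show ?thesis using emeasure_distr[OF mW B] by simp
 qed
 have st0: "start i X t \<in> borel_measurable P" "start i X s \<in> borel_measurable P"
 proof -
  have *: "start i X r \<in> borel_measurable P" if "r \<in> {0..T}" for r
  proof (rule start_measurable[OF _ _ _ _ _ i X])
   show "W i r \<in> borel_measurable P" "W i 0 \<in> borel_measurable P"
    using that st i by (intro measurable_completion W_measurable; simp)+
  qed (use F0_sets in auto)
  show "start i X t \<in> borel_measurable P" "start i X s \<in> borel_measurable P"
   using st by (intro *; simp)+
 qed
 have "emeasure P (A \<inter> {\<omega>\<in>space P. start i X t \<omega> - start i X s \<omega> \<in> B}) = emeasure P (A' \<inter> ?D)"
 proof (rule emeasure_eq_AE)
  show "AE \<omega> in P. (\<omega> \<in> A \<inter> {\<omega>\<in>space P. start i X t \<omega> - start i X s \<omega> \<in> B}) = (\<omega> \<in> A' \<inter> ?D)"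
   using A'(2) start_AE[OF i, of X] by eventually_elim auto
  show "A \<inter> {\<omega>\<in>space P. start i X t \<omega> - start i X s \<omega> \<in> B} \<in> sets P"
   using A'(3) B st0 by (intro sets.Int sets_Collect_mem borel_measurable_diff) auto
 qed (use ev in auto)
 also have "\<dots> = ennreal (prob (A' \<inter> ?D))"
  using ev by (simp add: emeasure_eq_measure)
 also have "\<dots> = emeasure M A' * emeasure M ?D"
  using indep_setD[OF ind A'(1) D] by (simp add: emeasure_eq_measure ennreal_mult)
 also have "emeasure M A' = emeasure P A"
 proof -
  have "emeasure P A = emeasure P A'"
   by (rule emeasure_eq_AE) (use A' ev in auto)
  then show ?thesis using ev by simp
 qed
 finally show "emeasure P (A \<inter> {\<omega>\<in>space P. start i X t \<omega> - start i X s \<omega> \<in> B}) = emeasure P A * emeasure (gaussian (t - s)) B"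
  by (simp add: g)
qed

lemma started_bm_filt:
 assumes T: "0 < T" and i: "i \<in> {1..N}" and X: "X \<in> borel_measurable F0" and sq: "sq_int P X"
 shows "started_bm P (filt M F0 W N) T (start i X)"
proof -
 have i1: "1 \<le> i" "1 \<le> N" using i by auto
 interpret e: started_bm P "enlarged i" T "start i X"
  by (rule started_bm_enlarged[OF T i1(1) X sq])
 show ?thesis
 proof (intro started_bm.intro started_bm_axioms.intro)
  show "start i X t \<in> borel_measurable (filt M F0 W N t)" if t: "t \<in> {0..T}" for t
   using t i i1 X filt_facts[of t N] by (intro start_measurable) auto
  fix s t A and B :: "(real ^ 'm) set"
  assume st: "0 \<le> s" "s < t" "t \<le> T" and A: "A \<in> sets (filt M F0 W N s)" and B: "B \<in> sets borel"
  have "A \<in> sets (enlarged i s)" using filt_le_enlarged(1)[of s i N] A st i1 by auto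
  then show "emeasure P (A \<inter> {\<omega>\<in>space P. start i X t \<omega> - start i X s \<omega> \<in> B}) = emeasure P A * emeasure (gaussian (t - s)) B"
   using e.Z_increments[OF st _ B] by simp
 qed (use T i1 filt_facts[OF _ _ i1(2)] e.Z_continuous e.Z_initial prob_space_P in auto)
qed

text \<open>At time \<open>0\<close> the enlarged information about particle \<open>i\<close> contains the whole path of particle \<open>j\<close>,
so it is enough that the starting points are independent.\<close>

proposition paths_independent:
 assumes T: "0 < T" and ij: "i \<ge> 1" "j \<ge> 1" "i \<noteq> j"
  and X: "X \<in> borel_measurable F0" "sq_int P X" and Y: "Y \<in> borel_measurable F0" "sq_int P Y"
  and indep: "!!A B. A \<in> sets borel ==> B \<in> sets borel ==>
   emeasure P ({\<omega>\<in>space M. X \<omega> \<in> A} \<inter> {\<omega>\<in>space M. Y \<omega> \<in> B}) = emeasure P {\<omega>\<in>space M. X \<omega> \<in> A} * emeasure P {\<omega>\<in>space M. Y \<omega> \<in> B}"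
  and D: "D \<in> sets (path_space T)" "D' \<in> sets (path_space T)"
 shows "emeasure P ({\<omega>\<in>space M. started_bm.path T (start i X) \<omega> \<in> D} \<inter> {\<omega>\<in>space M. started_bm.path T (start j Y) \<omega> \<in> D'}) =
  emeasure (started_bm.path_law P T (start i X)) D * emeasure (started_bm.path_law P T (start j Y)) D'"
proof -
 interpret a: started_bm P "enlarged i" T "start i X"
  by (rule started_bm_enlarged[OF T ij(1) X])
 interpret b: started_bm P "enlarged j" T "start j Y"
  by (rule started_bm_enlarged[OF T ij(2) Y])
 have 1: "emeasure P ({\<omega>\<in>space M. X \<omega> \<in> A} \<inter> {\<omega>\<in>space M. b.path \<omega> \<in> D'}) = emeasure P {\<omega>\<in>space M. X \<omega> \<in> A} * emeasure b.path_law D'"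
  if A: "A \<in> sets borel" for A
 proof (rule b.path_indep_event[simplified space_completion, OF _ _ D(2)])
  have "X -` A \<inter> space F0 \<in> sets F0" using X(1) A by (rule measurable_sets)
  then have "X -` A \<inter> space M \<in> sets F0" using F0 by (simp add: subalgebra_def)
  from filt_le_enlarged(4)[OF _ _ ij(2) this, of 0] T
  show "{\<omega>\<in>space M. X \<omega> \<in> A} \<in> sets (enlarged j 0)"
   by (simp add: vimage_def Int_def conj_commute)
  fix B :: "(real ^ 'm) set" assume "B \<in> sets borel"
  from indep[OF A this] show "emeasure P ({\<omega>\<in>space M. X \<omega> \<in> A} \<inter> {\<omega>\<in>space M. start j Y 0 \<omega> \<in> B}) =
   emeasure P {\<omega>\<in>space M. X \<omega> \<in> A} * emeasure P {\<omega>\<in>space M. start j Y 0 \<omega> \<in> B}"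
   by (simp add: start_0)
 qed
 have pj: "emeasure P {\<omega>\<in>space M. b.path \<omega> \<in> D'} = emeasure b.path_law D'"
  unfolding b.path_law_def using D(2) by (subst emeasure_distr[OF b.path_measurable]) (simp_all add: vimage_def Int_def conj_commute)
 have pi: "emeasure P {\<omega>\<in>space M. a.path \<omega> \<in> D} = emeasure a.path_law D"
  unfolding a.path_law_def using D(1) by (subst emeasure_distr[OF a.path_measurable]) (simp_all add: vimage_def Int_def conj_commute)
 have "emeasure P ({\<omega>\<in>space M. b.path \<omega> \<in> D'} \<inter> {\<omega>\<in>space M. a.path \<omega> \<in> D}) =
  emeasure P {\<omega>\<in>space M. b.path \<omega> \<in> D'} * emeasure a.path_law D"
 proof (rule a.path_indep_event[simplified space_completion, OF _ _ D(1)])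
  note f = filt_le_enlarged[OF _ _ ij(1), of 0]
  have T0: "0 \<le> T" using T by simp
  have "b.path \<in> measurable (enlarged i 0) (path_space T)"
   unfolding b.path_def path_space_def
  proof (rule measurable_restrict)
   fix t assume t: "t \<in> {0..T}"
   show "start j Y t \<in> borel_measurable (enlarged i 0)"
    using f(2)[OF order_refl T0 ij(2)] ij t T0 f(4)[OF order_refl T0] f(5)[OF order_refl T0] f(6)[OF order_refl T0]
    by (intro start_measurable Y) auto
  qed
  from measurable_sets[OF this D(2)] f(6)[OF order_refl T0]
  show "{\<omega>\<in>space M. b.path \<omega> \<in> D'} \<in> sets (enlarged i 0)"
   by (simp add: vimage_def Int_def conj_commute)
  fix B :: "(real ^ 'm) set" assume "B \<in> sets borel"
  from 1[OF this] show "emeasure P ({\<omega>\<in>space M. b.path \<omega> \<in> D'} \<inter> {\<omega>\<in>space M. start i X 0 \<omega> \<in> B}) =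
   emeasure P {\<omega>\<in>space M. b.path \<omega> \<in> D'} * emeasure P {\<omega>\<in>space M. start i X 0 \<omega> \<in> B}"
   by (simp add: start_0 pj Int_commute mult.commute)
 qed
 then show ?thesis
  by (simp add: pj Int_commute mult.commute)
qed

end

section \<open>States as functions of the path\<close>

text \<open>The coordinate process \<open>z t\<close> is not jointly measurable on the product space of all
 functions. Its limit along grid points below \<open>t\<close> is, it only uses the past, and it agrees
 with \<open>z t\<close> on continuous paths.\<close>

definition grid_time :: "real => nat => real => real" where
 "grid_time T n t = real (nat \<lfloor>t * real (Suc n) / T\<rfloor>) * (T / real (Suc n))"

definition coord :: "real => real => (real => real ^ 'm) => real ^ 'm" where
 "coord T t z = lim (%n. z (grid_time T n t))"

lemma grid_time_bounds:
 assumes T: "T > 0" and t: "0 \<le> t"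
 shows "0 \<le> grid_time T n t" "grid_time T n t \<le> t" "t - T / real (Suc n) < grid_time T n t"
proof -
 have p: "0 \<le> t * real (Suc n) / T" using assms by simp
 then have k: "real (nat \<lfloor>t * real (Suc n) / T\<rfloor>) \<le> t * real (Suc n) / T"
  "t * real (Suc n) / T < real (nat \<lfloor>t * real (Suc n) / T\<rfloor>) + 1"
  by (auto simp: floor_less_iff zero_le_floor)
 have h: "T / real (Suc n) > 0" using T by simp
 have e: "t * real (Suc n) / T * (T / real (Suc n)) = t" using T by simp
 show "0 \<le> grid_time T n t"
  unfolding grid_time_def by (rule mult_nonneg_nonneg[OF of_nat_0_le_iff less_imp_le[OF h]])
 show "grid_time T n t \<le> t"
  unfolding grid_time_def using mult_right_mono[OF k(1), of "T / real (Suc n)"] h e by simp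
 have "t < (real (nat \<lfloor>t * real (Suc n) / T\<rfloor>) + 1) * (T / real (Suc n))"
  using mult_strict_right_mono[OF k(2) h] e by simp
 then show "t - T / real (Suc n) < grid_time T n t"
  unfolding grid_time_def distrib_right mult_1 by linarith
qed

lemma grid_time_tendsto:
 assumes "T > 0" "0 \<le> t"
 shows "(%n. grid_time T n t) \<longlonglongrightarrow> t"
proof (rule tendsto_sandwich)
 have "(%n. t - T * inverse (real (Suc n))) \<longlonglongrightarrow> t - T * 0"
  by (intro tendsto_intros LIMSEQ_inverse_real_of_nat)
 then show "(%n. t - T / real (Suc n)) \<longlonglongrightarrow> t" by (simp add: divide_inverse)
 show "\<forall>\<^sub>F n in sequentially. t - T / real (Suc n) \<le> grid_time T n t"
  by (intro always_eventually allI less_imp_le grid_time_bounds assms)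
 show "\<forall>\<^sub>F n in sequentially. grid_time T n t \<le> t"
  by (intro always_eventually allI grid_time_bounds assms)
qed simp

lemma progressive_coord:
 assumes T: "T > 0"
 shows "progressive_on_paths T (coord T :: real => (real => real ^ 'm) => real ^ 'm)"
 unfolding progressive_on_paths_def coord_def
proof (intro ballI borel_measurable_lim_metric)
 fix u n assume u: "u \<in> {0..T}"
 let ?N = "restrict_space borel {0..u} \<Otimes>\<^sub>M past T u :: (real \<times> (real => real ^ 'm)) measure"
 let ?h = "T / real (Suc n)"
 let ?I = "{k. real k * ?h \<le> u}"
 have tm: "(%x. fst x) \<in> borel_measurable ?N"
  by (rule measurable_compose[OF measurable_fst]) (simp add: measurable_restrict_space1)
 have sub: "nat \<lfloor>fst x * real (Suc n) / T\<rfloor> \<in> ?I" if "x \<in> space ?N" for x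
  using grid_time_bounds(2)[OF T, of "fst x" n] that
  by (auto simp: grid_time_def space_pair_measure space_restrict_space)
 have "(%x. nat \<lfloor>fst x * real (Suc n) / T\<rfloor>) \<in> measurable ?N (count_space UNIV)"
  using tm by measurable
 then have g: "(%x. nat \<lfloor>fst x * real (Suc n) / T\<rfloor>) \<in> measurable ?N (count_space ?I)"
  using sub by (subst measurable_count_space_eq_countable)
   (auto simp: measurable_count_space_eq_countable countable_Collect intro!: countable_subset[OF subset_UNIV])
 have "(%x. (%k x. snd x (real k * ?h)) (nat \<lfloor>fst x * real (Suc n) / T\<rfloor>) x) \<in> borel_measurable ?N"
 proof (rule measurable_compose_countable'[OF _ g])
  fix k assume "k \<in> ?I"
  then have "(%z. z (real k * ?h)) \<in> borel_measurable (past T u :: (real => real ^ 'm) measure)"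
   using u T by (intro past_component_measurable) auto
  then show "(%x. snd x (real k * ?h)) \<in> borel_measurable ?N"
   by (rule measurable_compose[OF measurable_snd])
 qed (rule countable_subset[OF subset_UNIV], simp)
 then show "(%x. snd x (grid_time T n (fst x))) \<in> borel_measurable ?N"
  by (simp add: grid_time_def)
qed

lemma progressive_on_paths_add:
 "progressive_on_paths T \<beta> ==> progressive_on_paths T \<gamma> ==> progressive_on_paths T (%t z. \<beta> t z + \<gamma> t z)"
 unfolding progressive_on_paths_def by (auto intro!: borel_measurable_add)

lemma progressive_on_paths_scaleR:
 "progressive_on_paths T \<beta> ==> progressive_on_paths T (%t z. c *\<^sub>R \<beta> t z)"
 unfolding progressive_on_paths_def by (auto intro!: borel_measurable_scaleR)

lemma progressive_on_paths_sum:
 "(!!i. i \<in> I ==> progressive_on_paths T (\<beta> i)) ==> progressive_on_paths T (%t z. \<Sum>i\<in>I. \<beta> i t z)"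
 unfolding progressive_on_paths_def by (auto intro!: borel_measurable_sum)

lemma progressive_on_paths_time:
 assumes "h \<in> borel_measurable (time T)"
 shows "progressive_on_paths T (%t z. h t)"
 unfolding progressive_on_paths_def
proof
 fix u assume u: "u \<in> {0..T}"
 have "h \<in> borel_measurable (restrict_space borel {0..T})"
  using assms measurable_cong_sets[OF sets_time refl] by auto
 then have "h \<in> borel_measurable (restrict_space borel {0..u})"
  by (rule measurable_restrict_mono) (use u in auto)
 then show "(%x. h (fst x)) \<in> borel_measurable (restrict_space borel {0..u} \<Otimes>\<^sub>M past T u)"
  by (rule measurable_compose[OF measurable_fst])
qed

lemma prim_restrict_time:
 assumes "t \<in> {0..u}" "u \<le> T"
 shows "prim T h t = prim u h t"
 using assms by (simp add: prim_eq)

text \<open>Up to time \<open>u\<close> the primitive only sees the process up to time \<open>u\<close>.\<close>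

lemma prim_progressive:
 fixes b :: "real => 'w => 'b::euclidean_space"
 assumes b: "proc b \<in> borel_measurable (restrict_space borel {0..u} \<Otimes>\<^sub>M R)" and u: "u \<in> {0..T}"
 shows "(%x. prim T (%s. b s (snd x)) (fst x)) \<in> borel_measurable (restrict_space borel {0..u} \<Otimes>\<^sub>M R)"
  and "(%\<omega>. prim T (%s. b s \<omega>) u) \<in> borel_measurable R"
proof -
 have s: "sets (time u \<Otimes>\<^sub>M R) = sets (restrict_space borel {0..u} \<Otimes>\<^sub>M R)"
  by (intro sets_pair_measure_cong sets_time refl)
 have b': "proc b \<in> borel_measurable (time u \<Otimes>\<^sub>M R)"
  unfolding measurable_cong_sets[OF s refl] by (rule b)
 have "(%x. prim u (%s. b s (snd x)) (fst x)) \<in> borel_measurable (restrict_space borel {0..u} \<Otimes>\<^sub>M R)"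
  using prim_proc_measurable[OF b'] unfolding measurable_cong_sets[OF s refl] .
 then show "(%x. prim T (%s. b s (snd x)) (fst x)) \<in> borel_measurable (restrict_space borel {0..u} \<Otimes>\<^sub>M R)"
  by (subst measurable_cong[where g = "%x. prim u (%s. b s (snd x)) (fst x)"])
   (use u in \<open>auto simp: space_pair_measure space_restrict_space intro!: prim_restrict_time\<close>)
 show "(%\<omega>. prim T (%s. b s \<omega>) u) \<in> borel_measurable R"
  using prim_at_measurable[OF b', of u] u by (simp add: prim_restrict_time[of u u T])
qed

lemma progressive_on_paths_prim:
 "progressive_on_paths T \<beta> ==> progressive_on_paths T (%t z. prim T (%s. \<beta> s z) t)"
 unfolding progressive_on_paths_def by (auto intro: prim_progressive)

definition state :: "real => (real => (real => real ^ 'm) => real ^ 'm) => real => (real => real ^ 'm) => real ^ 'm" where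
 "state T \<beta> t z = coord T t z + prim T (%s. \<beta> s z) t"

definition mean_state :: "(real => real ^ 'm) measure => real => (real => (real => real ^ 'm) => real ^ 'm) => real => real ^ 'm" where
 "mean_state Q T \<beta> t = (\<integral>z. state T \<beta> t z \<partial>Q)"

text \<open>The control that produces the drift \<open>\<beta>\<close> in the mean field equation.\<close>

definition feedback :: "(real => real ^ 'm) measure => real => (real => (real => real ^ 'm) => real ^ 'm) =>
  real => (real => real ^ 'm) => real ^ 'm" where
 "feedback Q T \<beta> t z = \<beta> t z + state T \<beta> t z - mean_state Q T \<beta> t"

lemma progressive_state:
 "T > 0 ==> progressive_on_paths T \<beta> ==> progressive_on_paths T (state T \<beta>)"
 unfolding state_def[abs_def] by (intro progressive_on_paths_add progressive_coord progressive_on_paths_prim)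

lemma progressive_transfer:
 assumes bm: "started_bm P F T Z" and \<beta>: "progressive_on_paths T \<beta>"
 shows "progressive F T (%t \<omega>. \<beta> t (started_bm.path T Z \<omega>))"
 unfolding progressive_def
proof
 interpret started_bm P F T Z by fact
 fix t assume t: "t \<in> {0..T}"
 have m: "proc \<beta> \<in> borel_measurable (restrict_space borel {0..t} \<Otimes>\<^sub>M past T t)"
  using \<beta> t by (simp add: progressive_on_paths_def)
 have "(%x. (fst x, path (snd x))) \<in> measurable (restrict_space borel {0..t} \<Otimes>\<^sub>M F t) (restrict_space borel {0..t} \<Otimes>\<^sub>M past T t)"
  by (intro measurable_Pair measurable_fst measurable_compose[OF measurable_snd path_past_measurable[OF t]])
 from measurable_compose[OF this m]
 show "(%(s, \<omega>). \<beta> s (path \<omega>)) \<in> borel_measurable (restrict_space borel {0..t} \<Otimes>\<^sub>M F t)"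
  by (simp add: split_beta')
qed

context started_bm
begin

lemma T0: "0 \<le> T" using T_pos by simp

lemma coord_path:
 assumes "\<omega> \<in> space P" "t \<in> {0..T}"
 shows "coord T t (path \<omega>) = Z t \<omega>"
proof -
 have g: "grid_time T n t \<in> {0..T}" for n
  using grid_time_bounds[OF T_pos, of t n] assms(2) by auto
 have "(%n. Z (grid_time T n t) \<omega>) \<longlonglongrightarrow> Z t \<omega>"
  using Z_continuous[OF assms(1)] g assms(2) grid_time_tendsto[OF T_pos, of t]
  unfolding continuous_on_sequentially comp_def by auto
 then have "(%n. path \<omega> (grid_time T n t)) \<longlonglongrightarrow> Z t \<omega>"
  using g by (simp add: path_def)
 then show ?thesis unfolding coord_def by (rule limI)
qed

lemma progressive_measurable:
 assumes "progressive F T b"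
 shows "t \<in> {0..T} ==> proc b \<in> borel_measurable (restrict_space borel {0..t} \<Otimes>\<^sub>M F t)"
  and "proc b \<in> borel_measurable (T \<otimes> P)"
proof -
 show 1: "proc b \<in> borel_measurable (restrict_space borel {0..t} \<Otimes>\<^sub>M F t)" if "t \<in> {0..T}" for t
  using assms that by (simp add: progressive_def split_beta')
 have "subalgebra P (F T)" using F_sub T0 by simp
 then have "(%\<omega>. \<omega>) \<in> measurable P (F T)"
  by (intro measurable_from_subalg[OF _ measurable_ident, simplified id_def])
 then have m: "(%x. (fst x, snd x)) \<in> measurable (restrict_space borel {0..T} \<Otimes>\<^sub>M P) (restrict_space borel {0..T} \<Otimes>\<^sub>M F T)"
  by (intro measurable_Pair measurable_fst measurable_compose[OF measurable_snd])
 have s: "sets (T \<otimes> P) = sets (restrict_space borel {0..T} \<Otimes>\<^sub>M P)"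
  by (intro sets_pair_measure_cong sets_time refl)
 show "proc b \<in> borel_measurable (T \<otimes> P)"
  unfolding measurable_cong_sets[OF s refl] using measurable_compose[OF m 1[of T]] T0 by simp
qed

text \<open>Coordinate by coordinate.\<close>

proposition progressive_projection:
 fixes b :: "real => 'w => real ^ 'k"
 assumes b: "sq_int (T \<otimes> P) (proc b)" and prog: "progressive F T b"
 obtains \<beta> where "progressive_on_paths T \<beta>" "sq_int (T \<otimes> path_law) (proc \<beta>)"
  "!!g. sq_int (T \<otimes> path_law) (proc g) ==>
   (\<integral>x. g (fst x) (path (snd x)) \<bullet> proc b x \<partial>(T \<otimes> P)) = (\<integral>x. proc g x \<bullet> proc \<beta> x \<partial>(T \<otimes> path_law))"
proof -
 let ?R = "T \<otimes> P" and ?Q = "T \<otimes> path_law"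
 have comp: "sq_int R (%x. h x \<bullet> i)" if "sq_int R h" "i \<in> Basis" for R and h :: "_ => real ^ 'k" and i
 proof (rule sq_int_bound)
  show "(%x. h x \<bullet> i) \<in> borel_measurable R" using that by (auto simp: sq_int_def)
  show "integrable R (%x. (norm (h x))\<^sup>2)" using that by (simp add: sq_int_def)
  show "(norm (h x \<bullet> i))\<^sup>2 \<le> (norm (h x))\<^sup>2" for x
   using Basis_le_norm[OF that(2), of "h x"] by (intro power_mono) auto
 qed
 have ex: "\<exists>\<beta>. progressive_on_paths T \<beta> \<and> sq_int ?Q (proc \<beta>) \<and> (\<forall>g. sq_int ?Q (proc g) \<longrightarrow>
   (\<integral>x. g (fst x) (path (snd x)) * (proc b x \<bullet> i) \<partial>?R) = (\<integral>x. proc g x * proc \<beta> x \<partial>?Q))"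
  if i: "i \<in> Basis" for i :: "real ^ 'k"
 proof -
  have s: "sq_int ?R (proc (%s \<omega>. b s \<omega> \<bullet> i))" using comp[OF b i] .
  have ad: "(%\<omega>. prim T (%s. b s \<omega> \<bullet> i) t) \<in> borel_measurable (F t)" if t: "t \<in> {0..T}" for t
   using progressive_measurable(1)[OF prog t] t by (intro prim_progressive(2)) auto
  show ?thesis
   by (rule progressive_projection_real[OF s ad]) (assumption, blast)
 qed
 then have "\<forall>i. \<exists>\<beta>. i \<in> Basis \<longrightarrow> progressive_on_paths T \<beta> \<and> sq_int ?Q (proc \<beta>) \<and> (\<forall>g. sq_int ?Q (proc g) \<longrightarrow>
   (\<integral>x. g (fst x) (path (snd x)) * (proc b x \<bullet> (i :: real ^ 'k)) \<partial>?R) = (\<integral>x. proc g x * proc \<beta> x \<partial>?Q))"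
  by blast
 from choice[OF this] obtain \<beta>i where \<beta>i: "!!i. i \<in> Basis ==> progressive_on_paths T (\<beta>i i)"
  "!!i. i \<in> Basis ==> sq_int ?Q (proc (\<beta>i i))"
  "!!i g. i \<in> Basis ==> sq_int ?Q (proc g) ==>
   (\<integral>x. g (fst x) (path (snd x)) * (proc b x \<bullet> (i :: real ^ 'k)) \<partial>?R) = (\<integral>x. proc g x * proc (\<beta>i i) x \<partial>?Q)"
  by blast
 define \<beta> where "\<beta> s z = (\<Sum>i\<in>Basis. \<beta>i i s z *\<^sub>R i)" for s z
 show ?thesis
 proof (rule that)
  show "progressive_on_paths T \<beta>"
   unfolding \<beta>_def[abs_def] using \<beta>i(1)
   by (intro progressive_on_paths_sum) (auto simp: progressive_on_paths_def intro!: borel_measurable_scaleR)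
  have one: "sq_int ?Q (%x. proc (\<beta>i i) x *\<^sub>R i)" if "i \<in> Basis" for i
   using \<beta>i(2)[OF that] that by (auto simp: sq_int_def)
  then show "sq_int ?Q (proc \<beta>)"
   unfolding \<beta>_def by (intro sq_int_sum)
  fix g :: "real => (real => real ^ 'm) => real ^ 'k" assume g: "sq_int ?Q (proc g)"
  have gm: "proc g \<in> borel_measurable (T \<otimes> path_space T)"
   using sq_int_measurable[OF g] unfolding measurable_time_path_law .
  have gR: "sq_int ?R (%x. g (fst x) (path (snd x)))" using g sq_int_lift(1)[OF gm] by simp
  have gi: "sq_int ?Q (proc (%s z. g s z \<bullet> i))" if "i \<in> Basis" for i
   using comp[OF g that] .
  have "(\<integral>x. g (fst x) (path (snd x)) \<bullet> proc b x \<partial>?R) =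
   (\<integral>x. (\<Sum>i\<in>Basis. (g (fst x) (path (snd x)) \<bullet> i) * (proc b x \<bullet> i)) \<partial>?R)"
   by (intro Bochner_Integration.integral_cong refl euclidean_inner)
  also have "\<dots> = (\<Sum>i\<in>Basis. \<integral>x. (g (fst x) (path (snd x)) \<bullet> i) * (proc b x \<bullet> i) \<partial>?R)"
   using sq_int_inner[OF comp[OF gR] comp[OF b]] by (intro Bochner_Integration.integral_sum) auto
  also have "\<dots> = (\<Sum>i\<in>Basis. \<integral>x. (proc g x \<bullet> i) * proc (\<beta>i i) x \<partial>?Q)"
   by (intro sum.cong refl \<beta>i(3)[OF _ gi])
  also have "\<dots> = (\<integral>x. (\<Sum>i\<in>Basis. (proc g x \<bullet> i) * proc (\<beta>i i) x) \<partial>?Q)"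
   using sq_int_inner[OF comp[OF g] \<beta>i(2)] by (intro Bochner_Integration.integral_sum[symmetric]) auto
  also have "\<dots> = (\<integral>x. proc g x \<bullet> proc \<beta> x \<partial>?Q)"
   unfolding \<beta>_def by (intro Bochner_Integration.integral_cong refl) (simp add: inner_sum_right mult.commute)
  finally show "(\<integral>x. g (fst x) (path (snd x)) \<bullet> proc b x \<partial>?R) = (\<integral>x. proc g x \<bullet> proc \<beta> x \<partial>?Q)" .
 qed
qed

lemma Z_proc_sq_int: "sq_int (T \<otimes> P) (proc Z)"
proof -
 have "proc (%t \<omega>. coord T t (path \<omega>)) \<in> borel_measurable (T \<otimes> P)"
  using measurable_compose[OF lift_measurable progressive_on_paths_measurable[OF progressive_coord[OF T_pos] T0]] by simp
 then have "proc Z \<in> borel_measurable (T \<otimes> P)"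
  by (subst measurable_cong[where g = "proc (%t \<omega>. coord T t (path \<omega>))"])
   (auto simp: space_pair_measure space_time coord_path)
 then show ?thesis
  using Z_sq_int by (intro sq_int_proc_bounded(1)[OF fin T0]) auto
qed

lemma state_path:
 "\<omega> \<in> space P ==> t \<in> {0..T} ==> state T \<beta> t (path \<omega>) = Z t \<omega> + prim T (%s. \<beta> s (path \<omega>)) t"
 by (simp add: state_def coord_path)

context
 fixes \<beta> :: "real => (real => real ^ 'm) => real ^ 'm"
 assumes prog: "progressive_on_paths T \<beta>" and sq: "sq_int (T \<otimes> path_law) (proc \<beta>)"
begin

lemma \<beta>_path_sq_int: "sq_int (T \<otimes> P) (%x. \<beta> (fst x) (path (snd x)))"
 using sq sq_int_lift(1)[OF progressive_on_paths_measurable[OF prog T0]] by simp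

lemma state_measurable: "proc (state T \<beta>) \<in> borel_measurable (T \<otimes> path_space T)"
 by (rule progressive_on_paths_measurable[OF progressive_state[OF T_pos prog] T0])

lemma state_at_measurable: "t \<in> {0..T} ==> state T \<beta> t \<in> borel_measurable (path_space T)"
 by (rule proc_section_measurable(2)[OF state_measurable])

lemma state_at_sq_int:
 assumes t: "t \<in> {0..T}"
 shows "sq_int path_law (state T \<beta> t)"
  and "nsq path_law (state T \<beta> t) \<le> 2 * (2 * nsq P (Z 0) + 2 * (real CARD('m) * T)) + 2 * (T * nsq (T \<otimes> path_law) (proc \<beta>))"
  and "sq_int P (%\<omega>. state T \<beta> t (path \<omega>))"
proof -
 note m = state_at_measurable[OF t]
 note p = prim_at_sq_int[OF fin T0 t, of "%s \<omega>. \<beta> s (path \<omega>)", OF \<beta>_path_sq_int]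
 have s: "sq_int P (%\<omega>. Z t \<omega> + prim T (%s. \<beta> s (path \<omega>)) t)"
  by (rule sq_int_add[OF Z_sq_int(1)[OF t] p(1)])
 have mP: "(%\<omega>. state T \<beta> t (path \<omega>)) \<in> borel_measurable P"
  by (rule measurable_compose[OF path_measurable m])
 show sP: "sq_int P (%\<omega>. state T \<beta> t (path \<omega>))"
  by (rule sq_int_cong_AE[OF _ mP s]) (auto simp: state_path[OF _ t])
 show "sq_int path_law (state T \<beta> t)"
  unfolding path_law_def using sq_int_distr[OF path_measurable m] sP by simp
 have "nsq path_law (state T \<beta> t) = nsq P (%\<omega>. Z t \<omega> + prim T (%s. \<beta> s (path \<omega>)) t)"
  unfolding path_law_def nsq_distr[OF path_measurable m] by (rule nsq_cong) (simp add: state_path[OF _ t])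
 also have "\<dots> \<le> 2 * nsq P (Z t) + 2 * nsq P (%\<omega>. prim T (%s. \<beta> s (path \<omega>)) t)"
  by (rule nsq_add[OF Z_sq_int(1)[OF t] p(1)])
 also have "\<dots> \<le> 2 * (2 * nsq P (Z 0) + 2 * (real CARD('m) * T)) + 2 * (T * nsq (T \<otimes> P) (%x. \<beta> (fst x) (path (snd x))))"
  using Z_sq_int(2)[OF t] p(2) by simp
 finally show "nsq path_law (state T \<beta> t) \<le> 2 * (2 * nsq P (Z 0) + 2 * (real CARD('m) * T)) + 2 * (T * nsq (T \<otimes> path_law) (proc \<beta>))"
  using sq_int_lift(2)[OF progressive_on_paths_measurable[OF prog T0]] by simp
qed

lemma state_sq_int: "sq_int (T \<otimes> path_law) (proc (state T \<beta>))"
 using state_at_sq_int state_measurable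
 by (intro sq_int_proc_bounded(1)[OF fin_path_law T0]) (auto simp: measurable_time_path_law)

lemma mean_state_measurable: "mean_state path_law T \<beta> \<in> borel_measurable (time T)"
proof -
 interpret finite_measure path_law by (rule fin_path_law)
 have "case_prod (state T \<beta>) \<in> borel_measurable (T \<otimes> path_law)"
  using state_measurable by (simp add: measurable_time_path_law split_beta')
 then show ?thesis
  unfolding mean_state_def by (rule borel_measurable_lebesgue_integral)
qed

lemma mean_state_eq: "t \<in> {0..T} ==> mean_state path_law T \<beta> t = (\<integral>\<omega>. state T \<beta> t (path \<omega>) \<partial>P)"
 unfolding mean_state_def path_law_def by (rule integral_distr[OF path_measurable state_at_measurable])

lemma mean_state_sq_int:
 fixes R :: "'c measure"
 assumes R: "prob_space R"
 shows "sq_int (T \<otimes> R) (%x. mean_state path_law T \<beta> (fst x))"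
proof -
 interpret R: prob_space R by fact
 interpret Q: prob_space path_law by (rule prob_space_path_law)
 have "(norm (mean_state path_law T \<beta> t))\<^sup>2 \<le> nsq path_law (state T \<beta> t)" if "t \<in> {0..T}" for t
  unfolding mean_state_def by (rule Q.norm_expectation_sq_le[OF state_at_sq_int(1)[OF that]])
 then have "nsq R (%_. mean_state path_law T \<beta> t) \<le> 2 * (2 * nsq P (Z 0) + 2 * (real CARD('m) * T)) + 2 * (T * nsq (T \<otimes> path_law) (proc \<beta>))"
  if "t \<in> {0..T}" for t
  using state_at_sq_int(2)[OF that] that by (fastforce simp: nsq_def[of R] R.prob_space)
 then show ?thesis
  by (intro sq_int_proc_bounded(1)[OF R.finite_measure_axioms T0, of "%t _. mean_state path_law T \<beta> t"]
   measurable_compose[OF measurable_fst mean_state_measurable] R.sq_int_const)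
qed

lemma progressive_feedback: "progressive_on_paths T (feedback path_law T \<beta>)"
proof -
 have "progressive_on_paths T (%t z. (\<beta> t z + state T \<beta> t z) + (-1) *\<^sub>R mean_state path_law T \<beta> t)"
  by (intro progressive_on_paths_add progressive_on_paths_scaleR prog progressive_state T_pos
   progressive_on_paths_time mean_state_measurable)
 then show ?thesis by (simp add: feedback_def[abs_def])
qed

lemma feedback_sq_int: "sq_int (T \<otimes> path_law) (proc (feedback path_law T \<beta>))"
 unfolding feedback_def by (intro sq_int_diff sq_int_add sq state_sq_int mean_state_sq_int prob_space_path_law)

end

end

section \<open>Families of independent Brownian motions\<close>

locale bm_family = prob_space P
 for P :: "'w measure" +
 fixes F :: "real => 'w measure" and T :: real and N :: nat
  and Z :: "nat => real => 'w => real ^ 'm" and Q :: "(real => real ^ 'm) measure"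
 assumes N_pos: "1 \<le> N"
  and bm: "i \<in> {1..N} ==> started_bm P F T (Z i)"
  and law: "i \<in> {1..N} ==> started_bm.path_law P T (Z i) = Q"
  and indep: "i \<in> {1..N} ==> j \<in> {1..N} ==> i \<noteq> j ==> D \<in> sets (path_space T) ==> D' \<in> sets (path_space T) ==>
   emeasure P ({\<omega>\<in>space P. started_bm.path T (Z i) \<omega> \<in> D} \<inter> {\<omega>\<in>space P. started_bm.path T (Z j) \<omega> \<in> D'}) =
   emeasure Q D * emeasure Q D'"

text \<open>Jensen's inequality for a maximum of affine functions: on the set where the \<open>k\<close>-th affine
 function attains the maximum, the average commutes with it.\<close>

lemma max_aff_projection:
 fixes X :: "nat => 'w => 'b::euclidean_space" and h :: "'z => 'b"
 assumes N: "1 \<le> (N::nat)" and P: "prob_space P" and Q: "prob_space Q"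
  and h: "integrable Q h" and X: "!!i. i \<in> {1..N} ==> integrable P (X i)"
  and p: "!!i. i \<in> {1..N} ==> p i \<in> measurable P Q" "!!i. i \<in> {1..N} ==> distr P Q (p i) = Q"
  and eq: "!!D w. D \<in> sets Q ==>
   1 / real N * (\<Sum>i=1..N. \<integral>\<omega>. indicator D (p i \<omega>) * (w \<bullet> X i \<omega>) \<partial>P) = (\<integral>z. indicator D z * (w \<bullet> h z) \<partial>Q)"
 shows "(\<integral>z. max_aff c v n (h z) \<partial>Q) \<le> 1 / real N * (\<Sum>i=1..N. \<integral>\<omega>. max_aff c v n (X i \<omega>) \<partial>P)"
proof -
 interpret P: prob_space P by fact
 interpret Q: prob_space Q by fact
 note hm[measurable] = borel_measurable_integrable[OF h]
 define K where "K z = (LEAST k. k \<le> n \<and> max_aff c v n (h z) = c k + v k \<bullet> h z)" for z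
 have K: "K z \<le> n" "max_aff c v n (h z) = c (K z) + v (K z) \<bullet> h z" for z
  using LeastI_ex[OF max_aff_attained[of n c v "h z"]] by (auto simp: K_def)
 have Km[measurable]: "K \<in> measurable Q (count_space UNIV)"
  unfolding K_def by measurable
 define D where "D k = {z\<in>space Q. K z = k}" for k
 have D[measurable]: "D k \<in> sets Q" for k unfolding D_def by measurable
 have part: "(\<Sum>k\<le>n. indicator (D k) z * g k) = (g (K z) :: real)" if "z \<in> space Q" for z g
 proof -
  have "(\<Sum>k\<le>n. indicator (D k) z * g k) = (\<Sum>k\<le>n. if k = K z then g k else 0)"
   using that by (intro sum.cong) (auto simp: D_def)
  then show ?thesis using K(1) by simp
 qed
 have iQ: "integrable Q (%z. indicator (D k) z * g z)" if "integrable Q g" for k and g :: "'z => real"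
  using integrable_mult_indicator[OF D that] by simp
 have ip: "integrable P (%\<omega>. indicator (D k) (p i \<omega>) * g \<omega>)" if g: "integrable P g" and i: "i \<in> {1..N}" for k i and g :: "'w => real"
 proof (rule Bochner_Integration.integrable_bound[OF g])
  note [measurable] = borel_measurable_integrable[OF g] p(1)[OF i]
  show "(%\<omega>. indicator (D k) (p i \<omega>) * g \<omega>) \<in> borel_measurable P" by measurable
 qed (auto split: split_indicator)
 have hv: "integrable Q (%z. v k \<bullet> h z)" for k using h by simp
 have Xv: "integrable P (%\<omega>. v k \<bullet> X i \<omega>)" if "i \<in> {1..N}" for k i using X[OF that] by simp
 have "(\<integral>z. max_aff c v n (h z) \<partial>Q) = (\<integral>z. (\<Sum>k\<le>n. indicator (D k) z * c k + indicator (D k) z * (v k \<bullet> h z)) \<partial>Q)"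
  using part by (intro Bochner_Integration.integral_cong refl) (simp add: K(2) distrib_left[symmetric])
 also have "\<dots> = (\<Sum>k\<le>n. (\<integral>z. indicator (D k) z * c k \<partial>Q) + (\<integral>z. indicator (D k) z * (v k \<bullet> h z) \<partial>Q))"
  using iQ[OF hv] iQ[of "%_. c k" k for k] by (subst Bochner_Integration.integral_sum) (auto simp: Bochner_Integration.integral_add)
 also have "\<dots> = (\<Sum>k\<le>n. 1 / real N * (\<Sum>i=1..N. (\<integral>\<omega>. indicator (D k) (p i \<omega>) * c k \<partial>P)) +
   1 / real N * (\<Sum>i=1..N. \<integral>\<omega>. indicator (D k) (p i \<omega>) * (v k \<bullet> X i \<omega>) \<partial>P))"
 proof (intro sum.cong refl arg_cong2[where f = "(+)"] eq[symmetric] D)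
  fix k
  have *: "(\<integral>z. indicator (D k) z * c k \<partial>Q) = (\<integral>\<omega>. indicator (D k) (p i \<omega>) * c k \<partial>P)" if i: "i \<in> {1..N}" for i
  proof -
   have "(\<integral>z. indicator (D k) z * c k \<partial>Q) = (\<integral>z. indicator (D k) z * c k \<partial>distr P Q (p i))"
    using p(2)[OF i] by simp
   also have "\<dots> = (\<integral>\<omega>. indicator (D k) (p i \<omega>) * c k \<partial>P)"
    by (rule integral_distr[OF p(1)[OF i]]) simp
   finally show ?thesis .
  qed
  have "(\<Sum>i=1..N. (\<integral>\<omega>. indicator (D k) (p i \<omega>) * c k \<partial>P)) = (\<Sum>i=1..N. \<integral>z. indicator (D k) z * c k \<partial>Q)"
   by (rule sum.cong[OF refl]) (rule *[symmetric])
  then show "(\<integral>z. indicator (D k) z * c k \<partial>Q) = 1 / real N * (\<Sum>i=1..N. (\<integral>\<omega>. indicator (D k) (p i \<omega>) * c k \<partial>P))"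
   using N by simp
 qed
 also have "\<dots> = 1 / real N * (\<Sum>k\<le>n. \<Sum>i=1..N. (\<integral>\<omega>. indicator (D k) (p i \<omega>) * (c k + v k \<bullet> X i \<omega>) \<partial>P))"
  using ip[OF Xv] ip[of "%_. c k" for k]
  by (simp add: sum_distrib_left sum.distrib[symmetric] distrib_left Bochner_Integration.integral_add)
 also have "\<dots> = 1 / real N * (\<Sum>i=1..N. \<Sum>k\<le>n. (\<integral>\<omega>. indicator (D k) (p i \<omega>) * (c k + v k \<bullet> X i \<omega>) \<partial>P))"
  by (subst sum.swap) simp
 also have "\<dots> \<le> 1 / real N * (\<Sum>i=1..N. \<integral>\<omega>. max_aff c v n (X i \<omega>) \<partial>P)"
 proof (intro mult_left_mono sum_mono)
  fix i assume i: "i \<in> {1..N}"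
  have ii: "integrable P (%\<omega>. indicator (D k) (p i \<omega>) * (c k + v k \<bullet> X i \<omega>))" for k
   by (intro ip i Bochner_Integration.integrable_add Xv) auto
  have "(\<Sum>k\<le>n. (\<integral>\<omega>. indicator (D k) (p i \<omega>) * (c k + v k \<bullet> X i \<omega>) \<partial>P)) =
   (\<integral>\<omega>. (\<Sum>k\<le>n. indicator (D k) (p i \<omega>) * (c k + v k \<bullet> X i \<omega>)) \<partial>P)"
   using ii by (intro Bochner_Integration.integral_sum[symmetric]) auto
  also have "\<dots> \<le> (\<integral>\<omega>. max_aff c v n (X i \<omega>) \<partial>P)"
  proof (rule integral_mono)
   show "integrable P (%\<omega>. \<Sum>k\<le>n. indicator (D k) (p i \<omega>) * (c k + v k \<bullet> X i \<omega>))"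
    by (intro Bochner_Integration.integrable_sum ii)
   show "integrable P (%\<omega>. max_aff c v n (X i \<omega>))"
    by (rule P.integrable_max_aff[OF X[OF i]])
   fix \<omega> assume "\<omega> \<in> space P"
   then have "p i \<omega> \<in> space Q" using measurable_space[OF p(1)[OF i]] by auto
   then show "(\<Sum>k\<le>n. indicator (D k) (p i \<omega>) * (c k + v k \<bullet> X i \<omega>)) \<le> max_aff c v n (X i \<omega>)"
    by (subst part, assumption) (rule max_aff_ge[OF K(1)])
  qed
  finally show "(\<Sum>k\<le>n. (\<integral>\<omega>. indicator (D k) (p i \<omega>) * (c k + v k \<bullet> X i \<omega>) \<partial>P)) \<le> (\<integral>\<omega>. max_aff c v n (X i \<omega>) \<partial>P)" .
 qed simp
 finally show ?thesis .
qed

text \<open>A test function of the form \<open>1\<^bsub>[0, t]\<^esub> 1\<^bsub>C\<^esub> w\<close> turns the duality between drifts into one between states at time \<open>t\<close>.\<close>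

lemma integral_prim_test:
 fixes h :: "real => 'w => 'b::euclidean_space"
 assumes R: "finite_measure R" and h: "sq_int (T \<otimes> R) (proc h)" and C: "C \<in> sets R"
 shows "(\<integral>x. ((indicator {0..t} (fst x) * indicator C (snd x)) *\<^sub>R w) \<bullet> proc h x \<partial>(T \<otimes> R)) =
  (\<integral>\<omega>. indicator C \<omega> * (w \<bullet> prim T (%s. h s \<omega>) t) \<partial>R)"
  and "sq_int (T \<otimes> R) (%x. (indicator {0..t} (fst x) * indicator C (snd x) :: real) *\<^sub>R w)"
proof -
 interpret S: finite_measure "T \<otimes> R" by (rule finite_measure_time_pair[OF R])
 interpret t: finite_measure "time T" by (rule finite_measure_time)
 have it: "indicat_real {0..t} \<in> borel_measurable (time T)" by (simp add: measurable_restrict_space1)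
 have m: "(%x. (indicator {0..t} (fst x) * indicator C (snd x) :: real)) \<in> borel_measurable (T \<otimes> R)"
  by (intro borel_measurable_times measurable_compose[OF measurable_fst it]
   measurable_compose[OF measurable_snd borel_measurable_indicator[OF C]])
 show sq: "sq_int (T \<otimes> R) (%x. (indicator {0..t} (fst x) * indicator C (snd x) :: real) *\<^sub>R w)"
 proof (rule sq_int_bound)
  show "integrable (T \<otimes> R) (%x. (norm w)\<^sup>2)" by simp
  show "(norm ((indicator {0..t} (fst x) * indicator C (snd x) :: real) *\<^sub>R w))\<^sup>2 \<le> (norm w)\<^sup>2" for x
   by (auto split: split_indicator)
 qed (use m in measurable)
 note i = sq_int_inner[OF sq h]
 have inner: "AE \<omega> in R. (\<integral>s. ((indicator {0..t} s * indicator C \<omega>) *\<^sub>R w) \<bullet> h s \<omega> \<partial>time T) = indicator C \<omega> * (w \<bullet> prim T (%s. h s \<omega>) t)"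
  using sq_int_paths(1)[OF R h]
 proof eventually_elim
  case (elim \<omega>)
  have hi: "integrable (time T) (%s. h s \<omega>)" by (rule t.sq_int_integrable[OF elim])
  have "(\<integral>s. ((indicator {0..t} s * indicator C \<omega>) *\<^sub>R w) \<bullet> h s \<omega> \<partial>time T) =
   (\<integral>s. (indicator C \<omega> *\<^sub>R w) \<bullet> (indicator {0..t} s *\<^sub>R h s \<omega>) \<partial>time T)"
   by (intro Bochner_Integration.integral_cong) auto
  also have "\<dots> = (indicator C \<omega> *\<^sub>R w) \<bullet> prim T (%s. h s \<omega>) t"
   unfolding prim_def by (rule integral_inner_right) (rule integrable_time_indicator[OF hi])
  finally show ?case by simp
 qed
 have pm2: "(%\<omega>. prim T (%s. h s \<omega>) t) \<in> borel_measurable R"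
  unfolding prim_def
 proof (rule t.borel_measurable_lebesgue_integral)
  have "(%x. indicator {0..t} (fst x) *\<^sub>R proc h x) \<in> borel_measurable (T \<otimes> R)"
   by (intro borel_measurable_scaleR measurable_compose[OF measurable_fst it] sq_int_measurable[OF h])
  from measurable_compose[OF measurable_pair_swap' this]
  show "(%(\<omega>, s). indicator {0..t} s *\<^sub>R h s \<omega>) \<in> borel_measurable (R \<Otimes>\<^sub>M time T)"
   by (simp add: split_beta')
 qed
 have pm: "(%\<omega>. \<integral>s. ((indicator {0..t} s * indicator C \<omega>) *\<^sub>R w) \<bullet> h s \<omega> \<partial>time T) \<in> borel_measurable R"
  using borel_measurable_integrable[OF integral_time_prod(5)[OF R i]] by simp
 have "(\<integral>\<omega>. (\<integral>s. ((indicator {0..t} s * indicator C \<omega>) *\<^sub>R w) \<bullet> h s \<omega> \<partial>time T) \<partial>R) =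
  (\<integral>\<omega>. indicator C \<omega> * (w \<bullet> prim T (%s. h s \<omega>) t) \<partial>R)"
  by (intro integral_cong_AE[OF pm _ inner] borel_measurable_times borel_measurable_inner
   borel_measurable_indicator C borel_measurable_const pm2)
 then show "(\<integral>x. ((indicator {0..t} (fst x) * indicator C (snd x)) *\<^sub>R w) \<bullet> proc h x \<partial>(T \<otimes> R)) =
  (\<integral>\<omega>. indicator C \<omega> * (w \<bullet> prim T (%s. h s \<omega>) t) \<partial>R)"
  unfolding integral_time_prod(1)[OF R i] by simp
qed

context bm_family
begin

abbreviation pth :: "nat => 'w => real => real ^ 'm" where
 "pth i \<equiv> started_bm.path T (Z i)"

lemma T_pos: "0 < T"
 using bm[of 1] N_pos by (auto simp: started_bm_def started_bm_axioms_def)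

lemma T0: "0 \<le> T" using T_pos by simp

lemma finP: "finite_measure P" by (rule finite_measure_axioms)

lemma prob_Q: "prob_space Q"
 using started_bm.prob_space_path_law[OF bm[of 1]] law[of 1] N_pos by simp

lemma finQ: "finite_measure Q" using prob_Q by (simp add: prob_space_def)

lemma sets_Q[simp, measurable_cong]: "sets Q = sets (path_space T)"
 using started_bm.sets_path_law[OF bm[of 1]] law[of 1] N_pos by simp

lemma space_Q[simp]: "space Q = space (path_space T)"
 by (rule sets_eq_imp_space_eq) simp

lemma measurable_time_Q: "measurable (T \<otimes> Q) S = measurable (T \<otimes> path_space T) S"
 by (intro measurable_cong_sets sets_pair_measure_cong) simp_all

lemma pth_measurable: "i \<in> {1..N} ==> pth i \<in> measurable P (path_space T)"
 by (rule started_bm.path_measurable[OF bm])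

lemma distr_pth: "i \<in> {1..N} ==> distr P (path_space T) (pth i) = Q"
 using law[of i] started_bm.path_law_def[OF bm] by simp

lemma lift_measurable: "i \<in> {1..N} ==> (%x. (fst x, pth i (snd x))) \<in> measurable (T \<otimes> P) (T \<otimes> path_space T)"
 by (rule started_bm.lift_measurable[OF bm])

lemma sq_int_lift:
 fixes g :: "real => (real => real ^ 'm) => 'b::euclidean_space"
 assumes "i \<in> {1..N}" "sq_int (T \<otimes> Q) (proc g)"
 shows "sq_int (T \<otimes> P) (%x. g (fst x) (pth i (snd x)))"
  and "nsq (T \<otimes> P) (%x. g (fst x) (pth i (snd x))) = nsq (T \<otimes> Q) (proc g)"
 using started_bm.sq_int_lift[OF bm, of i g] assms law[of i] sq_int_measurable[OF assms(2)]
 unfolding measurable_time_Q by auto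

lemma integral_lift:
 fixes g :: "real => (real => real ^ 'm) => 'b::euclidean_space"
 assumes "i \<in> {1..N}" "proc g \<in> borel_measurable (T \<otimes> path_space T)"
 shows "(\<integral>x. proc g x \<partial>(T \<otimes> Q)) = (\<integral>x. g (fst x) (pth i (snd x)) \<partial>(T \<otimes> P))"
 using started_bm.integral_lift[OF bm, of i g] assms law[of i] by simp

lemma average_const: "1 / real N * (\<Sum>i=1..N. c) = (c::real)"
 using N_pos by simp

lemma pth_product_law:
 assumes ij: "i \<in> {1..N}" "j \<in> {1..N}" "i \<noteq> j"
 shows "distr P (path_space T \<Otimes>\<^sub>M path_space T) (%\<omega>. (pth i \<omega>, pth j \<omega>)) = Q \<Otimes>\<^sub>M Q"
proof (rule pair_measure_eqI[symmetric])
 show "sigma_finite_measure Q" "sigma_finite_measure Q"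
  using finQ by (auto intro: finite_measure.sigma_finite_measure)
 show "sets (Q \<Otimes>\<^sub>M Q) = sets (distr P (path_space T \<Otimes>\<^sub>M path_space T) (%\<omega>. (pth i \<omega>, pth j \<omega>)))"
  using sets_pair_measure_cong[OF sets_Q sets_Q] by simp
 fix A B assume AB: "A \<in> sets Q" "B \<in> sets Q"
 have "emeasure (distr P (path_space T \<Otimes>\<^sub>M path_space T) (%\<omega>. (pth i \<omega>, pth j \<omega>))) (A \<times> B) =
  emeasure P ((%\<omega>. (pth i \<omega>, pth j \<omega>)) -` (A \<times> B) \<inter> space P)"
  using AB ij pth_measurable by (intro emeasure_distr measurable_Pair) auto
 also have "(%\<omega>. (pth i \<omega>, pth j \<omega>)) -` (A \<times> B) \<inter> space P = {\<omega>\<in>space P. pth i \<omega> \<in> A} \<inter> {\<omega>\<in>space P. pth j \<omega> \<in> B}"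
  by auto
 finally show "emeasure Q A * emeasure Q B = emeasure (distr P (path_space T \<Otimes>\<^sub>M path_space T) (%\<omega>. (pth i \<omega>, pth j \<omega>))) (A \<times> B)"
  using indep[OF ij, of A B] AB by simp
qed

text \<open>Pairwise independence of the paths makes the cross terms in the variance of an average vanish.\<close>

lemma uncorrelated:
 fixes h :: "(real => real ^ 'm) => real ^ 'm"
 assumes ij: "i \<in> {1..N}" "j \<in> {1..N}" "i \<noteq> j" and h: "sq_int Q h" and 0: "(\<integral>z. h z \<partial>Q) = 0"
 shows "(\<integral>\<omega>. h (pth i \<omega>) \<bullet> h (pth j \<omega>) \<partial>P) = 0"
proof -
 interpret Q: prob_space Q by (rule prob_Q)
 interpret QQ: pair_prob_space Q Q ..
 have hi: "integrable Q h" by (rule Q.sq_int_integrable[OF h])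
 have hm: "h \<in> borel_measurable (path_space T)" using borel_measurable_integrable[OF hi] by simp
 have km: "(%x. h (fst x) \<bullet> h (snd x)) \<in> borel_measurable (path_space T \<Otimes>\<^sub>M path_space T)"
  by (intro borel_measurable_inner measurable_compose[OF measurable_fst hm] measurable_compose[OF measurable_snd hm])
 have s: "sets (Q \<Otimes>\<^sub>M Q) = sets (path_space T \<Otimes>\<^sub>M path_space T)" by (intro sets_pair_measure_cong sets_Q)
 have kQ: "(%x. h (fst x) \<bullet> h (snd x)) \<in> borel_measurable (Q \<Otimes>\<^sub>M Q)"
  using km unfolding measurable_cong_sets[OF s refl] .
 have "(\<integral>\<omega>. h (pth i \<omega>) \<bullet> h (pth j \<omega>) \<partial>P) = (\<integral>x. h (fst x) \<bullet> h (snd x) \<partial>(Q \<Otimes>\<^sub>M Q))"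
  unfolding pth_product_law[OF ij, symmetric]
  using ij pth_measurable by (subst integral_distr[OF _ km]) (auto intro: measurable_Pair)
 also have "\<dots> = (\<integral>x. (\<integral>y. h x \<bullet> h y \<partial>Q) \<partial>Q)"
 proof -
  have "integrable (Q \<Otimes>\<^sub>M Q) (%x. h (fst x) \<bullet> h (snd x))"
  proof (rule QQ.Fubini_integrable[OF kQ])
   show "integrable Q (%x. \<integral>y. norm (h (fst (x, y)) \<bullet> h (snd (x, y))) \<partial>Q)"
   proof (rule Bochner_Integration.integrable_bound)
    show "integrable Q (%x. norm (h x) * (\<integral>y. norm (h y) \<partial>Q))" using hi by simp
    show "AE x in Q. norm (\<integral>y. norm (h (fst (x, y)) \<bullet> h (snd (x, y))) \<partial>Q) \<le> norm (norm (h x) * (\<integral>y. norm (h y) \<partial>Q))"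
    proof (rule AE_I2)
     fix x
     have "(\<integral>y. norm (h x \<bullet> h y) \<partial>Q) \<le> (\<integral>y. norm (h x) * norm (h y) \<partial>Q)"
      using hi by (intro integral_mono) (auto simp: Cauchy_Schwarz_ineq2)
     moreover have "0 \<le> (\<integral>y. norm (h x \<bullet> h y) \<partial>Q)" by simp
     moreover have "0 \<le> (\<integral>y. norm (h y) \<partial>Q)" by simp
     ultimately show "norm (\<integral>y. norm (h (fst (x, y)) \<bullet> h (snd (x, y))) \<partial>Q) \<le> norm (norm (h x) * (\<integral>y. norm (h y) \<partial>Q))"
      by simp
    qed
    show "(%x. \<integral>y. norm (h (fst (x, y)) \<bullet> h (snd (x, y))) \<partial>Q) \<in> borel_measurable Q"
     using kQ by (intro Q.borel_measurable_lebesgue_integral) (simp add: split_beta')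
   qed
   show "AE x in Q. integrable Q (%y. h (fst (x, y)) \<bullet> h (snd (x, y)))" using hi by simp
  qed
  from QQ.integral_fst'[OF this] show ?thesis by simp
 qed
 also have "\<dots> = 0" using hi 0 by simp
 finally show ?thesis .
qed

lemma variance_at:
 fixes g :: "(real => real ^ 'm) => real ^ 'm"
 assumes g: "sq_int Q g"
 shows "nsq P (%\<omega>. (1 / real N) *\<^sub>R (\<Sum>i=1..N. g (pth i \<omega>)) - (\<integral>z. g z \<partial>Q)) \<le> nsq Q g / real N"
  and "sq_int P (%\<omega>. (1 / real N) *\<^sub>R (\<Sum>i=1..N. g (pth i \<omega>)) - (\<integral>z. g z \<partial>Q))"
proof -
 interpret Q: prob_space Q by (rule prob_Q)
 define m where "m = (\<integral>z. g z \<partial>Q)"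
 define h where "h z = g z - m" for z
 have gi: "integrable Q g" by (rule Q.sq_int_integrable[OF g])
 have h: "sq_int Q h" unfolding h_def by (intro sq_int_diff g Q.sq_int_const)
 have h0: "(\<integral>z. h z \<partial>Q) = 0" unfolding h_def using gi by (simp add: m_def Q.prob_space[unfolded space_Q])
 have hm: "h \<in> borel_measurable (path_space T)" using sq_int_measurable[OF h] by simp
 have hP: "sq_int P (%\<omega>. h (pth i \<omega>))" "nsq P (%\<omega>. h (pth i \<omega>)) = nsq Q h" if i: "i \<in> {1..N}" for i
  using sq_int_distr[OF pth_measurable[OF i] hm] nsq_distr[OF pth_measurable[OF i] hm] h by (simp_all add: distr_pth[OF i])
 have eq: "(1 / real N) *\<^sub>R (\<Sum>i=1..N. g (pth i \<omega>)) - m = (1 / real N) *\<^sub>R (\<Sum>i=1..N. h (pth i \<omega>))" for \<omega>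
  using N_pos by (simp add: h_def sum_subtractf scaleR_diff_right sum_constant_scaleR del: sum_constant)
 have sq: "sq_int P (%\<omega>. (1 / real N) *\<^sub>R (\<Sum>i=1..N. h (pth i \<omega>)))"
  by (intro sq_int_scaleR sq_int_sum hP)
 then show "sq_int P (%\<omega>. (1 / real N) *\<^sub>R (\<Sum>i=1..N. g (pth i \<omega>)) - (\<integral>z. g z \<partial>Q))"
  unfolding m_def[symmetric] eq .
 have "nsq P (%\<omega>. \<Sum>i=1..N. h (pth i \<omega>)) = (\<integral>\<omega>. (\<Sum>i=1..N. \<Sum>j=1..N. h (pth i \<omega>) \<bullet> h (pth j \<omega>)) \<partial>P)"
  unfolding nsq_def by (intro Bochner_Integration.integral_cong refl)
   (simp add: power2_norm_eq_inner inner_sum_left inner_sum_right, rule sum.swap)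
 also have "\<dots> = (\<Sum>i=1..N. \<Sum>j=1..N. \<integral>\<omega>. h (pth i \<omega>) \<bullet> h (pth j \<omega>) \<partial>P)"
  using sq_int_inner[OF hP(1) hP(1)] by (subst Bochner_Integration.integral_sum) (auto simp: Bochner_Integration.integral_sum)
 also have "\<dots> = (\<Sum>i=1..N. \<Sum>j=1..N. if j = i then nsq Q h else 0)"
 proof (intro sum.cong refl)
  fix i j assume ij: "i \<in> {1..N}" "j \<in> {1..N}"
  show "(\<integral>\<omega>. h (pth i \<omega>) \<bullet> h (pth j \<omega>) \<partial>P) = (if j = i then nsq Q h else 0)"
   using uncorrelated[OF ij _ h h0] hP(2)[OF ij(1)] by (auto simp: nsq_def power2_norm_eq_inner)
 qed
 also have "\<dots> = real N * nsq Q h" by (simp add: sum.delta)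
 finally have "nsq P (%\<omega>. (1 / real N) *\<^sub>R (\<Sum>i=1..N. h (pth i \<omega>))) = nsq Q h / real N"
  unfolding nsq_scaleR using N_pos by (simp add: power2_eq_square field_simps)
 moreover have "nsq Q h \<le> nsq Q g"
 proof -
  have "nsq Q h = (\<integral>z. (norm (g z))\<^sup>2 - 2 * (g z \<bullet> m) + (norm m)\<^sup>2 \<partial>Q)"
   unfolding nsq_def h_def by (intro Bochner_Integration.integral_cong refl)
    (simp add: power2_norm_eq_inner inner_diff_left inner_diff_right inner_commute)
  also have "\<dots> = nsq Q g - 2 * (m \<bullet> m) + (norm m)\<^sup>2"
   using g gi by (simp add: nsq_def sq_int_def Q.prob_space[unfolded space_Q] m_def)
  also have "\<dots> \<le> nsq Q g" by (simp add: power2_norm_eq_inner)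
  finally show ?thesis .
 qed
 ultimately show "nsq P (%\<omega>. (1 / real N) *\<^sub>R (\<Sum>i=1..N. g (pth i \<omega>)) - (\<integral>z. g z \<partial>Q)) \<le> nsq Q g / real N"
  unfolding m_def[symmetric] eq using N_pos by (simp only:) (simp add: divide_right_mono)
qed

text \<open>The average over \<open>N\<close> uncorrelated copies has variance at most \<open>1 / N\<close> of that of one copy, at almost
every time.\<close>

lemma variance:
 fixes g :: "real => (real => real ^ 'm) => real ^ 'm"
 assumes g: "sq_int (T \<otimes> Q) (proc g)"
  and D: "sq_int (T \<otimes> P) (%x. (1 / real N) *\<^sub>R (\<Sum>i=1..N. g (fst x) (pth i (snd x))) - (\<integral>z. g (fst x) z \<partial>Q))"
 shows "nsq (T \<otimes> P) (%x. (1 / real N) *\<^sub>R (\<Sum>i=1..N. g (fst x) (pth i (snd x))) - (\<integral>z. g (fst x) z \<partial>Q))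
  \<le> nsq (T \<otimes> Q) (proc g) / real N"
proof -
 have "nsq (T \<otimes> P) (%x. (1 / real N) *\<^sub>R (\<Sum>i=1..N. g (fst x) (pth i (snd x))) - (\<integral>z. g (fst x) z \<partial>Q)) =
  (\<integral>t. nsq P (%\<omega>. (1 / real N) *\<^sub>R (\<Sum>i=1..N. g t (pth i \<omega>)) - (\<integral>z. g t z \<partial>Q)) \<partial>time T)"
  using sq_int_paths(4)[OF finP, of T "%t \<omega>. (1 / real N) *\<^sub>R (\<Sum>i=1..N. g t (pth i \<omega>)) - (\<integral>z. g t z \<partial>Q)"] D by simp
 also have "\<dots> \<le> (\<integral>t. nsq Q (g t) / real N \<partial>time T)"
 proof (rule integral_mono_AE)
  have "integrable (T \<otimes> P) (%x. (norm ((1 / real N) *\<^sub>R (\<Sum>i=1..N. g (fst x) (pth i (snd x))) - (\<integral>z. g (fst x) z \<partial>Q)))\<^sup>2)"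
   using D by (simp add: sq_int_def)
  from integral_time_prod(6)[OF finP this]
  show "integrable (time T) (%t. nsq P (%\<omega>. (1 / real N) *\<^sub>R (\<Sum>i=1..N. g t (pth i \<omega>)) - (\<integral>z. g t z \<partial>Q)))"
   by (simp add: nsq_def)
  have "integrable (T \<otimes> Q) (%x. (norm (proc g x))\<^sup>2)" using g by (simp add: sq_int_def)
  from integral_time_prod(6)[OF finQ this]
  show "integrable (time T) (%t. nsq Q (g t) / real N)" by (simp add: nsq_def)
  show "AE t in time T. nsq P (%\<omega>. (1 / real N) *\<^sub>R (\<Sum>i=1..N. g t (pth i \<omega>)) - (\<integral>z. g t z \<partial>Q)) \<le> nsq Q (g t) / real N"
   using sq_int_paths(2)[OF finQ g] by eventually_elim (rule variance_at(1))
 qed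
 also have "\<dots> = nsq (T \<otimes> Q) (proc g) / real N"
  using sq_int_paths(4)[OF finQ g] by simp
 finally show ?thesis .
qed

text \<open>The drift of each particle is projected onto the path of that particle; since all paths have
the law \<open>Q\<close>, the projections live on the same space and can be averaged. The third property
is duality: testing with functions of the path does not distinguish the drifts from their projection.\<close>

proposition averaged_projection:
 fixes b :: "nat => real => 'w => real ^ 'm"
 assumes b: "!!i. i \<in> {1..N} ==> sq_int (T \<otimes> P) (proc (b i))"
  and prog: "!!i. i \<in> {1..N} ==> progressive F T (b i)"
 obtains \<beta> where "progressive_on_paths T \<beta>" "sq_int (T \<otimes> Q) (proc \<beta>)"
  "!!g. sq_int (T \<otimes> Q) (proc g) ==>
   1 / real N * (\<Sum>i=1..N. \<integral>x. g (fst x) (pth i (snd x)) \<bullet> proc (b i) x \<partial>(T \<otimes> P)) =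
   (\<integral>x. proc g x \<bullet> proc \<beta> x \<partial>(T \<otimes> Q))"
proof -
 let ?Q = "T \<otimes> Q"
 have "\<forall>i. \<exists>\<beta>. i \<in> {1..N} \<longrightarrow> progressive_on_paths T \<beta> \<and> sq_int ?Q (proc \<beta>) \<and> (\<forall>g. sq_int ?Q (proc g) \<longrightarrow>
  (\<integral>x. g (fst x) (pth i (snd x)) \<bullet> proc (b i) x \<partial>(T \<otimes> P)) = (\<integral>x. proc g x \<bullet> proc \<beta> x \<partial>?Q))"
 proof
  fix i
  show "\<exists>\<beta>. i \<in> {1..N} \<longrightarrow> progressive_on_paths T \<beta> \<and> sq_int ?Q (proc \<beta>) \<and> (\<forall>g. sq_int ?Q (proc g) \<longrightarrow>
   (\<integral>x. g (fst x) (pth i (snd x)) \<bullet> proc (b i) x \<partial>(T \<otimes> P)) = (\<integral>x. proc g x \<bullet> proc \<beta> x \<partial>?Q))"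
  proof (cases "i \<in> {1..N}")
   case True
   show ?thesis
    by (rule started_bm.progressive_projection[OF bm[OF True] b[OF True] prog[OF True], unfolded law[OF True]]) blast
  qed blast
 qed
 from choice[OF this] obtain \<beta>i where \<beta>i: "!!i. i \<in> {1..N} ==> progressive_on_paths T (\<beta>i i)"
  "!!i. i \<in> {1..N} ==> sq_int ?Q (proc (\<beta>i i))"
  "!!i g. i \<in> {1..N} ==> sq_int ?Q (proc g) ==>
   (\<integral>x. g (fst x) (pth i (snd x)) \<bullet> proc (b i) x \<partial>(T \<otimes> P)) = (\<integral>x. proc g x \<bullet> proc (\<beta>i i) x \<partial>?Q)"
  by blast
 define \<beta> where "\<beta> t z = (1 / real N) *\<^sub>R (\<Sum>i=1..N. \<beta>i i t z)" for t z
 show ?thesis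
 proof (rule that)
  show "progressive_on_paths T \<beta>"
   unfolding \<beta>_def[abs_def] by (intro progressive_on_paths_scaleR progressive_on_paths_sum \<beta>i)
  show "sq_int ?Q (proc \<beta>)"
   unfolding \<beta>_def by (intro sq_int_scaleR sq_int_sum \<beta>i)
  fix g :: "real => (real => real ^ 'm) => real ^ 'm" assume g: "sq_int ?Q (proc g)"
  have "1 / real N * (\<Sum>i=1..N. \<integral>x. g (fst x) (pth i (snd x)) \<bullet> proc (b i) x \<partial>(T \<otimes> P)) =
   1 / real N * (\<Sum>i=1..N. \<integral>x. proc g x \<bullet> proc (\<beta>i i) x \<partial>?Q)"
   using \<beta>i(3)[OF _ g] by simp
  also have "\<dots> = 1 / real N * (\<integral>x. (\<Sum>i=1..N. proc g x \<bullet> proc (\<beta>i i) x) \<partial>?Q)"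
   using sq_int_inner[OF g \<beta>i(2)] by (subst Bochner_Integration.integral_sum) auto
  also have "\<dots> = (\<integral>x. proc g x \<bullet> proc \<beta> x \<partial>?Q)"
   unfolding \<beta>_def by (subst integral_mult_right_zero[symmetric])
    (intro Bochner_Integration.integral_cong refl, simp add: inner_sum_right)
  finally show "1 / real N * (\<Sum>i=1..N. \<integral>x. g (fst x) (pth i (snd x)) \<bullet> proc (b i) x \<partial>(T \<otimes> P)) =
   (\<integral>x. proc g x \<bullet> proc \<beta> x \<partial>?Q)" .
 qed
qed

end

context bm_family
begin

context
 fixes b :: "nat => real => 'w => real ^ 'm" and \<beta> :: "real => (real => real ^ 'm) => real ^ 'm"
 assumes b: "!!i. i \<in> {1..N} ==> sq_int (T \<otimes> P) (proc (b i))"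
  and prog: "progressive_on_paths T \<beta>" and sq: "sq_int (T \<otimes> Q) (proc \<beta>)"
  and proj: "!!g. sq_int (T \<otimes> Q) (proc g) ==>
   1 / real N * (\<Sum>i=1..N. \<integral>x. g (fst x) (pth i (snd x)) \<bullet> proc (b i) x \<partial>(T \<otimes> P)) =
   (\<integral>x. proc g x \<bullet> proc \<beta> x \<partial>(T \<otimes> Q))"
begin

definition X :: "nat => real => 'w => real ^ 'm" where
 "X i t \<omega> = Z i t \<omega> + prim T (%s. b i s \<omega>) t"

lemma X_sq_int: "i \<in> {1..N} ==> sq_int (T \<otimes> P) (proc (X i))"
 unfolding X_def by (intro sq_int_add started_bm.Z_proc_sq_int[OF bm] prim_proc_sq_int[OF finP T0] b)

lemma X_at_sq_int: "i \<in> {1..N} ==> t \<in> {0..T} ==> sq_int P (X i t)"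
 unfolding X_def by (intro sq_int_add started_bm.Z_sq_int(1)[OF bm] prim_at_sq_int(1)[OF finP T0] b)

lemma coord_measurable: "proc (coord T) \<in> borel_measurable (T \<otimes> path_space T)"
 by (rule progressive_on_paths_measurable[OF progressive_coord[OF T_pos] T0])

lemma coord_sq_int: "sq_int (T \<otimes> Q) (proc (coord T))"
 and integral_coord: "i \<in> {1..N} ==> sq_int (T \<otimes> Q) (proc g) ==>
  (\<integral>x. g (fst x) (pth i (snd x)) \<bullet> proc (Z i) x \<partial>(T \<otimes> P)) = (\<integral>x. proc g x \<bullet> proc (coord T) x \<partial>(T \<otimes> Q))"
proof -
 have eq: "coord T (fst x) (pth i (snd x)) = proc (Z i) x" if "i \<in> {1..N}" "x \<in> space (T \<otimes> P)" for i x
  using started_bm.coord_path[OF bm[OF that(1)]] that(2) by (auto simp: space_pair_measure space_time)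
 have 1: "1 \<in> {1..N}" using N_pos by simp
 have "sq_int (T \<otimes> P) (%x. coord T (fst x) (pth 1 (snd x)))"
  by (rule sq_int_cong_AE[OF _ _ started_bm.Z_proc_sq_int[OF bm[OF 1]]])
   (use eq[OF 1] measurable_compose[OF lift_measurable[OF 1] coord_measurable] in auto)
 then show "sq_int (T \<otimes> Q) (proc (coord T))"
  using started_bm.sq_int_lift(1)[OF bm[OF 1] coord_measurable] law[OF 1] by simp
 assume i: "i \<in> {1..N}" and g: "sq_int (T \<otimes> Q) (proc g)"
 have gm: "proc g \<in> borel_measurable (T \<otimes> path_space T)"
  using sq_int_measurable[OF g] unfolding measurable_time_Q .
 have m: "proc (%t z. g t z \<bullet> coord T t z) \<in> borel_measurable (T \<otimes> path_space T)"
  using gm coord_measurable by (rule borel_measurable_inner)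
 show "(\<integral>x. g (fst x) (pth i (snd x)) \<bullet> proc (Z i) x \<partial>(T \<otimes> P)) = (\<integral>x. proc g x \<bullet> proc (coord T) x \<partial>(T \<otimes> Q))"
  unfolding integral_lift[OF i m] by (intro Bochner_Integration.integral_cong refl) (simp add: eq[OF i])
qed

lemma average_sum: "1 / real N * (\<Sum>i=1..N. x i + y i) = 1 / real N * (\<Sum>i=1..N. x i) + 1 / real N * (\<Sum>i=1..N. y i :: real)"
 by (simp add: sum.distrib distrib_left)

text \<open>The state is the path plus the primitive of the drift, and the adjoint \<open>coprim\<close> moves the primitive
to the test function; so the duality of the drifts passes to the states.\<close>

lemma projected_state:
 assumes g: "sq_int (T \<otimes> Q) (proc g)"
 shows "1 / real N * (\<Sum>i=1..N. \<integral>x. g (fst x) (pth i (snd x)) \<bullet> proc (X i) x \<partial>(T \<otimes> P)) =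
  (\<integral>x. proc g x \<bullet> proc (state T \<beta>) x \<partial>(T \<otimes> Q))"
proof -
 define cg where "cg s z = coprim T (%t. g t z) s" for s z
 have cg: "sq_int (T \<otimes> Q) (proc cg)"
  unfolding cg_def by (rule coprim_sq_int[OF finQ T0 g])
 have gP: "sq_int (T \<otimes> P) (proc (%t \<omega>. g t (pth i \<omega>)))" if "i \<in> {1..N}" for i
  by (rule sq_int_lift(1)[OF that g])
 have split: "(\<integral>x. g (fst x) (pth i (snd x)) \<bullet> proc (X i) x \<partial>(T \<otimes> P)) =
  (\<integral>x. proc g x \<bullet> proc (coord T) x \<partial>(T \<otimes> Q)) + (\<integral>x. cg (fst x) (pth i (snd x)) \<bullet> proc (b i) x \<partial>(T \<otimes> P))"
  if i: "i \<in> {1..N}" for i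
 proof -
  have "(\<integral>x. g (fst x) (pth i (snd x)) \<bullet> proc (X i) x \<partial>(T \<otimes> P)) =
   (\<integral>x. g (fst x) (pth i (snd x)) \<bullet> proc (Z i) x + g (fst x) (pth i (snd x)) \<bullet> prim T (%s. b i s (snd x)) (fst x) \<partial>(T \<otimes> P))"
   by (simp add: X_def inner_add_right)
  also have "\<dots> = (\<integral>x. g (fst x) (pth i (snd x)) \<bullet> proc (Z i) x \<partial>(T \<otimes> P)) +
   (\<integral>x. g (fst x) (pth i (snd x)) \<bullet> prim T (%s. b i s (snd x)) (fst x) \<partial>(T \<otimes> P))"
   by (intro Bochner_Integration.integral_add sq_int_inner gP i started_bm.Z_proc_sq_int[OF bm] prim_proc_sq_int[OF finP T0] b)
  also have "(\<integral>x. g (fst x) (pth i (snd x)) \<bullet> prim T (%s. b i s (snd x)) (fst x) \<partial>(T \<otimes> P)) =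
   (\<integral>x. cg (fst x) (pth i (snd x)) \<bullet> proc (b i) x \<partial>(T \<otimes> P))"
   unfolding cg_def using prim_coprim[OF finP T0 gP[OF i] b[OF i]] by simp
  finally show ?thesis using integral_coord[OF i g] by simp
 qed
 have "1 / real N * (\<Sum>i=1..N. \<integral>x. g (fst x) (pth i (snd x)) \<bullet> proc (X i) x \<partial>(T \<otimes> P)) =
  1 / real N * (\<Sum>i=1..N. (\<integral>x. proc g x \<bullet> proc (coord T) x \<partial>(T \<otimes> Q)) + (\<integral>x. cg (fst x) (pth i (snd x)) \<bullet> proc (b i) x \<partial>(T \<otimes> P)))"
  using split by (intro arg_cong2[where f = "(*)"] sum.cong refl) blast
 also have "\<dots> = (\<integral>x. proc g x \<bullet> proc (coord T) x \<partial>(T \<otimes> Q)) + (\<integral>x. proc cg x \<bullet> proc \<beta> x \<partial>(T \<otimes> Q))"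
  unfolding average_sum proj[OF cg] average_const ..
 also have "(\<integral>x. proc cg x \<bullet> proc \<beta> x \<partial>(T \<otimes> Q)) = (\<integral>x. proc g x \<bullet> prim T (%s. \<beta> s (snd x)) (fst x) \<partial>(T \<otimes> Q))"
  unfolding cg_def using prim_coprim[OF finQ T0 g sq] by simp
 also have "(\<integral>x. proc g x \<bullet> proc (coord T) x \<partial>(T \<otimes> Q)) + \<dots> = (\<integral>x. proc g x \<bullet> proc (state T \<beta>) x \<partial>(T \<otimes> Q))"
  unfolding state_def inner_add_right
  by (intro Bochner_Integration.integral_add[symmetric] sq_int_inner g coord_sq_int prim_proc_sq_int[OF finQ T0 sq])
 finally show ?thesis .
qed

lemma projected_state_at:
 assumes t: "t \<in> {0..T}" and D: "D \<in> sets (path_space T)"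
 shows "1 / real N * (\<Sum>i=1..N. \<integral>\<omega>. indicator D (pth i \<omega>) * (w \<bullet> X i t \<omega>) \<partial>P) = (\<integral>z. indicator D z * (w \<bullet> state T \<beta> t z) \<partial>Q)"
proof -
 define g where "g s z = (indicator {0..t} s * indicator D z :: real) *\<^sub>R w" for s z
 have DQ: "D \<in> sets Q" using D by simp
 have g: "sq_int (T \<otimes> Q) (proc g)"
  unfolding g_def by (rule integral_prim_test(2)[OF finQ sq DQ])
 interpret Q: prob_space Q by (rule prob_Q)
 have cm: "coord T t \<in> borel_measurable (path_space T)"
  by (rule proc_section_measurable(2)[OF coord_measurable t])
 have cP: "(%\<omega>. coord T t (pth i \<omega>)) \<in> borel_measurable P" if "i \<in> {1..N}" for i
  by (rule measurable_compose[OF pth_measurable[OF that] cm])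
 have c1: "sq_int P (%\<omega>. coord T t (pth i \<omega>))" if i: "i \<in> {1..N}" for i
  by (rule sq_int_cong_AE[OF _ cP[OF i] started_bm.Z_sq_int(1)[OF bm[OF i] t]])
   (use started_bm.coord_path[OF bm[OF i] _ t] in auto)
 have 1: "1 \<in> {1..N}" using N_pos by simp
 have cQ: "sq_int Q (coord T t)"
  using sq_int_distr[OF pth_measurable[OF 1] cm, unfolded distr_pth[OF 1]] c1[OF 1] by simp
 have iD: "integrable R (%x. indicator C x * (w \<bullet> h x))" if "integrable R h" "C \<in> sets R" for R :: "'c measure" and h C
  using integrable_mult_indicator[OF that(2), of "%x. w \<bullet> h x"] that(1) by simp
 have split: "(\<integral>\<omega>. indicator D (pth i \<omega>) * (w \<bullet> X i t \<omega>) \<partial>P) =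
  (\<integral>z. indicator D z * (w \<bullet> coord T t z) \<partial>Q) + (\<integral>x. g (fst x) (pth i (snd x)) \<bullet> proc (b i) x \<partial>(T \<otimes> P))"
  if i: "i \<in> {1..N}" for i
 proof -
  let ?C = "pth i -` D \<inter> space P"
  have C: "?C \<in> sets P" by (rule measurable_sets[OF pth_measurable[OF i] D])
  have "(\<integral>\<omega>. indicator D (pth i \<omega>) * (w \<bullet> X i t \<omega>) \<partial>P) =
   (\<integral>\<omega>. indicator ?C \<omega> * (w \<bullet> Z i t \<omega>) + indicator ?C \<omega> * (w \<bullet> prim T (%s. b i s \<omega>) t) \<partial>P)"
   by (intro Bochner_Integration.integral_cong refl) (auto simp: X_def inner_add_right split: split_indicator)
  also have "\<dots> = (\<integral>\<omega>. indicator ?C \<omega> * (w \<bullet> Z i t \<omega>) \<partial>P) + (\<integral>\<omega>. indicator ?C \<omega> * (w \<bullet> prim T (%s. b i s \<omega>) t) \<partial>P)"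
   using i t by (intro Bochner_Integration.integral_add iD C sq_int_integrable started_bm.Z_sq_int(1)[OF bm] prim_at_sq_int(1)[OF finP T0] b)
  also have "(\<integral>\<omega>. indicator ?C \<omega> * (w \<bullet> Z i t \<omega>) \<partial>P) = (\<integral>\<omega>. indicator D (pth i \<omega>) * (w \<bullet> coord T t (pth i \<omega>)) \<partial>P)"
   by (intro Bochner_Integration.integral_cong refl)
    (auto simp: started_bm.coord_path[OF bm[OF i] _ t] split: split_indicator)
  also have "\<dots> = (\<integral>z. indicator D z * (w \<bullet> coord T t z) \<partial>distr P (path_space T) (pth i))"
   using D cm by (subst integral_distr[OF pth_measurable[OF i]]) (intro borel_measurable_times borel_measurable_indicator D borel_measurable_inner borel_measurable_const cm, simp_all)
  also have "distr P (path_space T) (pth i) = Q" by (rule distr_pth[OF i])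
  also have "(\<integral>\<omega>. indicator ?C \<omega> * (w \<bullet> prim T (%s. b i s \<omega>) t) \<partial>P) =
   (\<integral>x. ((indicator {0..t} (fst x) * indicator ?C (snd x)) *\<^sub>R w) \<bullet> proc (b i) x \<partial>(T \<otimes> P))"
   by (rule integral_prim_test(1)[OF finP b[OF i] C, symmetric])
  also have "\<dots> = (\<integral>x. g (fst x) (pth i (snd x)) \<bullet> proc (b i) x \<partial>(T \<otimes> P))"
   by (intro Bochner_Integration.integral_cong refl) (auto simp: g_def space_pair_measure split: split_indicator)
  finally show ?thesis .
 qed
 have "1 / real N * (\<Sum>i=1..N. \<integral>\<omega>. indicator D (pth i \<omega>) * (w \<bullet> X i t \<omega>) \<partial>P) =
  1 / real N * (\<Sum>i=1..N. (\<integral>z. indicator D z * (w \<bullet> coord T t z) \<partial>Q) + (\<integral>x. g (fst x) (pth i (snd x)) \<bullet> proc (b i) x \<partial>(T \<otimes> P)))"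
  using split by (intro arg_cong2[where f = "(*)"] sum.cong refl) blast
 also have "\<dots> = (\<integral>z. indicator D z * (w \<bullet> coord T t z) \<partial>Q) + (\<integral>x. proc g x \<bullet> proc \<beta> x \<partial>(T \<otimes> Q))"
  unfolding average_sum proj[OF g] average_const ..
 also have "(\<integral>x. proc g x \<bullet> proc \<beta> x \<partial>(T \<otimes> Q)) = (\<integral>z. indicator D z * (w \<bullet> prim T (%s. \<beta> s z) t) \<partial>Q)"
  unfolding g_def by (rule integral_prim_test(1)[OF finQ sq DQ])
 also have "(\<integral>z. indicator D z * (w \<bullet> coord T t z) \<partial>Q) + \<dots> = (\<integral>z. indicator D z * (w \<bullet> state T \<beta> t z) \<partial>Q)"
  unfolding state_def inner_add_right distrib_left
  using t by (intro Bochner_Integration.integral_add[symmetric] iD DQ Q.sq_int_integrable cQ prim_at_sq_int(1)[OF finQ T0 _ sq])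
 finally show ?thesis .
qed

lemma state_at_integrable: "t \<in> {0..T} ==> integrable Q (state T \<beta> t)" "t \<in> {0..T} ==> sq_int Q (state T \<beta> t)"
proof -
 interpret Q: prob_space Q by (rule prob_Q)
 have 1: "1 \<in> {1..N}" using N_pos by simp
 show *: "sq_int Q (state T \<beta> t)" if "t \<in> {0..T}" for t
  using started_bm.state_at_sq_int(1)[OF bm[OF 1] prog _ that] sq law[OF 1] by simp
 show "t \<in> {0..T} ==> integrable Q (state T \<beta> t)" by (rule Q.sq_int_integrable[OF *])
qed

text \<open>Test with constants: the projection preserves the average of the means.\<close>

lemma mean_state_average:
 assumes t: "t \<in> {0..T}"
 shows "mean_state Q T \<beta> t = (1 / real N) *\<^sub>R (\<Sum>i=1..N. \<integral>\<omega>. X i t \<omega> \<partial>P)"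
proof (rule euclidean_eqI)
 fix w :: "real ^ 'm"
 have D: "space (path_space T) \<in> sets (path_space T :: (real => real ^ 'm) measure)" by (rule sets.top)
 have Xi: "integrable P (X i t)" if "i \<in> {1..N}" for i by (rule sq_int_integrable[OF X_at_sq_int[OF that t]])
 have "mean_state Q T \<beta> t \<bullet> w = (\<integral>z. w \<bullet> state T \<beta> t z \<partial>Q)"
  unfolding mean_state_def using state_at_integrable(1)[OF t] by (simp add: inner_commute)
 also have "\<dots> = (\<integral>z. indicator (space (path_space T)) z * (w \<bullet> state T \<beta> t z) \<partial>Q)"
  by (intro Bochner_Integration.integral_cong) auto
 also have "\<dots> = 1 / real N * (\<Sum>i=1..N. \<integral>\<omega>. indicator (space (path_space T)) (pth i \<omega>) * (w \<bullet> X i t \<omega>) \<partial>P)"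
  by (rule projected_state_at[OF t D, symmetric])
 also have "\<dots> = 1 / real N * (\<Sum>i=1..N. \<integral>\<omega>. w \<bullet> X i t \<omega> \<partial>P)"
  by (intro arg_cong2[where f = "(*)"] sum.cong refl Bochner_Integration.integral_cong)
   (use measurable_space[OF pth_measurable] in auto)
 also have "\<dots> = ((1 / real N) *\<^sub>R (\<Sum>i=1..N. \<integral>\<omega>. X i t \<omega> \<partial>P)) \<bullet> w"
  using Xi by (simp add: inner_sum_left inner_sum_right inner_commute)
 finally show "mean_state Q T \<beta> t \<bullet> w = ((1 / real N) *\<^sub>R (\<Sum>i=1..N. \<integral>\<omega>. X i t \<omega> \<partial>P)) \<bullet> w" .
qed

lemma state_at_measurable_Q: "t \<in> {0..T} ==> state T \<beta> t \<in> borel_measurable Q"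
 using state_at_integrable(1) by (rule borel_measurable_integrable)

text \<open>Jensen's inequality: the canonical terminal state is an average of conditional expectations of the
terminal states of the particles, each of which is below \<open>\<mu>\<close>.\<close>

lemma projected_state_cvx_le:
 assumes \<mu>: "prob_space \<mu>" "integrable \<mu> (%x. x)"
  and le: "!!i. i \<in> {1..N} ==> distr P borel (X i T) \<le>\<^sub>c\<^sub>v\<^sub>x \<mu>"
 shows "distr Q borel (state T \<beta> T) \<le>\<^sub>c\<^sub>v\<^sub>x \<mu>"
proof (rule cvx_leI)
 interpret Q: prob_space Q by (rule prob_Q)
 interpret \<mu>: prob_space \<mu> by (rule \<mu>(1))
 have T: "T \<in> {0..T}" using T0 by simp
 have sm: "state T \<beta> T \<in> borel_measurable Q" by (rule state_at_measurable_Q[OF T])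
 have si: "integrable Q (state T \<beta> T)" by (rule state_at_integrable(1)[OF T])
 have Xi: "integrable P (X i T)" if "i \<in> {1..N}" for i by (rule sq_int_integrable[OF X_at_sq_int[OF that T]])
 show "finite_measure (distr Q borel (state T \<beta> T))" by (rule Q.finite_measure_distr[OF sm])
 show "finite_measure \<mu>" by (rule \<mu>.finite_measure_axioms)
 show "integrable (distr Q borel (state T \<beta> T)) (%x. x)"
  using si sm by (subst integrable_distr_eq) auto
 show "integrable \<mu> (%x. x)" by (rule \<mu>(2))
 fix c v n
 have "(\<integral>x. max_aff c v n x \<partial>distr Q borel (state T \<beta> T)) = (\<integral>z. max_aff c v n (state T \<beta> T z) \<partial>Q)"
  by (rule integral_distr[OF sm]) simp
 also have "\<dots> \<le> 1 / real N * (\<Sum>i=1..N. \<integral>\<omega>. max_aff c v n (X i T \<omega>) \<partial>P)"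
 proof (rule max_aff_projection[OF N_pos prob_space_axioms prob_Q si Xi])
  fix i assume i: "i \<in> {1..N}"
  show "pth i \<in> measurable P Q"
   using pth_measurable[OF i] measurable_cong_sets[OF refl sets_Q] by blast
  show "distr P Q (pth i) = Q"
   using distr_pth[OF i] distr_cong[OF refl sets_Q, of P "pth i" "pth i"] by simp
 next
  fix D and w :: "real ^ 'm" assume "D \<in> sets Q"
  then show "1 / real N * (\<Sum>i=1..N. \<integral>\<omega>. indicator D (pth i \<omega>) * (w \<bullet> X i T \<omega>) \<partial>P) = (\<integral>z. indicator D z * (w \<bullet> state T \<beta> T z) \<partial>Q)"
   by (intro projected_state_at[OF T]) simp
 qed
 also have "\<dots> \<le> 1 / real N * (\<Sum>i=1..N. (\<integral>x. max_aff c v n x \<partial>\<mu>))"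
 proof (intro mult_left_mono sum_mono)
  fix i assume i: "i \<in> {1..N}"
  have Xm: "X i T \<in> borel_measurable P" using Xi[OF i] by simp
  have "(\<integral>\<omega>. max_aff c v n (X i T \<omega>) \<partial>P) = (\<integral>x. max_aff c v n x \<partial>distr P borel (X i T))"
   by (rule integral_distr[OF Xm, symmetric]) simp
  also have "\<dots> \<le> (\<integral>x. max_aff c v n x \<partial>\<mu>)"
  proof (rule cvx_leD[OF finite_measure_distr[OF Xm] \<mu>.finite_measure_axioms _ \<mu>(2) le[OF i]])
   show "integrable (distr P borel (X i T)) (%x. x)"
    using Xi[OF i] Xm by (subst integrable_distr_eq) auto
  qed
  finally show "(\<integral>\<omega>. max_aff c v n (X i T \<omega>) \<partial>P) \<le> (\<integral>x. max_aff c v n x \<partial>\<mu>)" .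
 qed simp
 also have "\<dots> = (\<integral>x. max_aff c v n x \<partial>\<mu>)" by (rule average_const)
 finally show "(\<integral>x. max_aff c v n x \<partial>distr Q borel (state T \<beta> T)) \<le> (\<integral>x. max_aff c v n x \<partial>\<mu>)" .
qed simp

end

end

section \<open>The running cost\<close>

text \<open>Strong convexity makes the cost grow quadratically (\<open>lower\<close>), and the quadratic upper bound makes its
gradient grow linearly (\<open>gradient_bound\<close>); so \<open>L\<^sup>2\<close> is the natural space of controls.\<close>

locale cost =
 fixes T lf lam :: real and f :: "real => real ^ 'm => real"
 assumes T_pos: "0 < T" and lf_pos: "0 < lf" and lam_pos: "0 < lam"
  and f_measurable: "(%(t, a). f t a) \<in> borel_measurable (restrict_space borel ({0..T} \<times> UNIV))"
  and f_diff: "t \<in> {0..T} ==> f t differentiable at a"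
  and f_convex: "t \<in> {0..T} ==> convex_on UNIV (f t)"
  and f_nonneg: "t \<in> {0..T} ==> 0 \<le> f t a"
  and f_zero: "t \<in> {0..T} ==> f t 0 = 0"
  and f_upper: "t \<in> {0..T} ==> f t a \<le> lf + lf * (norm a)\<^sup>2"
  and f_strong: "t \<in> {0..T} ==> (gradient (f t) a - gradient (f t) a') \<bullet> (a - a') \<ge> lam * (norm (a - a'))\<^sup>2"
begin

lemma f_GDERIV: "t \<in> {0..T} ==> GDERIV (f t) a :> gradient (f t) a"
 by (intro GDERIV_gradient f_diff)

lemma tangent: "t \<in> {0..T} ==> f t a + gradient (f t) a \<bullet> (a' - a) \<le> f t a'"
 using convex_above_gradient[OF f_convex f_GDERIV] by simp

lemma gradient_bound: "t \<in> {0..T} ==> norm (gradient (f t) a) \<le> 5 * lf * (1 + norm a)"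
 by (rule quadratic_gradient_bound[OF f_convex f_GDERIV f_nonneg f_upper lf_pos])

lemma lower: "t \<in> {0..T} ==> lam / 4 * (norm a)\<^sup>2 \<le> f t a"
 by (rule strongly_convex_lower[OF f_convex f_GDERIV f_nonneg f_zero f_strong])

lemma f_measurable': "(%x. f (fst x) (snd x)) \<in> borel_measurable (T \<otimes> borel)"
proof -
 have "(%x. (fst x, snd x)) \<in> measurable (T \<otimes> (borel :: (real ^ 'm) measure)) (borel \<Otimes>\<^sub>M borel)"
  by (intro measurable_Pair measurable_compose[OF measurable_fst id_time_measurable] measurable_snd)
 then have "(%x. (fst x, snd x)) \<in> borel_measurable (T \<otimes> (borel :: (real ^ 'm) measure))"
  by (simp add: borel_prod)
 then have "(%x. (fst x, snd x)) \<in> measurable (T \<otimes> (borel :: (real ^ 'm) measure)) (restrict_space borel ({0..T} \<times> UNIV))"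
  by (intro measurable_restrict_space2) (auto simp: space_pair_measure space_time)
 from measurable_compose[OF this f_measurable] show ?thesis by simp
qed

lemma f_process_measurable:
 assumes "proc u \<in> borel_measurable (T \<otimes> R)"
 shows "(%x. f (fst x) (proc u x)) \<in> borel_measurable (T \<otimes> R)"
 using measurable_compose[OF measurable_Pair[OF measurable_fst assms] f_measurable'] by simp

text \<open>The gradient is a pointwise limit of difference quotients of the cost.\<close>

lemma gradient_measurable: "(%x. gradient (f (fst x)) (snd x)) \<in> borel_measurable (T \<otimes> borel)"
proof (rule borel_measurable_euclidean_space[THEN iffD2], intro ballI)
 fix h :: "real ^ 'm" assume "h \<in> Basis"
 show "(%x. gradient (f (fst x)) (snd x) \<bullet> h) \<in> borel_measurable (T \<otimes> borel)"
 proof (rule borel_measurable_LIMSEQ_real)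
  fix x assume "x \<in> space (T \<otimes> (borel :: (real ^ 'm) measure))"
  then have t: "fst x \<in> {0..T}" by (auto simp: space_pair_measure space_time)
  have "((%s. (f (fst x) (snd x + s *\<^sub>R h) - f (fst x) (snd x)) / s) \<longlongrightarrow> gradient (f (fst x)) (snd x) \<bullet> h) (at 0)"
   using GDERIV_line[OF f_GDERIV[OF t], of "snd x" h] by (simp add: has_field_derivative_iff)
  moreover have "filterlim (%n. inverse (real (Suc n))) (at 0) sequentially"
   unfolding filterlim_at using LIMSEQ_inverse_real_of_nat by auto
  ultimately show "(%n. (f (fst x) (snd x + inverse (real (Suc n)) *\<^sub>R h) - f (fst x) (snd x)) / inverse (real (Suc n))) \<longlonglongrightarrow>
   gradient (f (fst x)) (snd x) \<bullet> h"
   by (rule filterlim_compose)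
 next
  fix n
  have "(%x. (fst x, snd x + inverse (real (Suc n)) *\<^sub>R h)) \<in> measurable (T \<otimes> borel) (T \<otimes> borel)"
   by measurable
  from measurable_compose[OF this f_measurable']
  show "(%x. (f (fst x) (snd x + inverse (real (Suc n)) *\<^sub>R h) - f (fst x) (snd x)) / inverse (real (Suc n))) \<in> borel_measurable (T \<otimes> borel)"
   using f_measurable' by (intro borel_measurable_divide borel_measurable_diff) auto
 qed
qed

lemma f_integrable:
 assumes R: "finite_measure R" and u: "sq_int (T \<otimes> R) (proc u)"
 shows "integrable (T \<otimes> R) (%x. f (fst x) (proc u x))"
proof (rule Bochner_Integration.integrable_bound)
 interpret finite_measure "T \<otimes> R" by (rule finite_measure_time_pair[OF R])
 show "integrable (T \<otimes> R) (%x. lf + lf * (norm (proc u x))\<^sup>2)" using u by (simp add: sq_int_def)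
 show "AE x in T \<otimes> R. norm (f (fst x) (proc u x)) \<le> norm (lf + lf * (norm (proc u x))\<^sup>2)"
 proof (rule AE_I2)
  fix x assume "x \<in> space (T \<otimes> R)"
  then have t: "fst x \<in> {0..T}" by (auto simp: space_pair_measure space_time)
  show "norm (f (fst x) (proc u x)) \<le> norm (lf + lf * (norm (proc u x))\<^sup>2)"
   using f_nonneg[OF t, of "proc u x"] f_upper[OF t, of "proc u x"] by simp
 qed
qed (rule f_process_measurable[OF sq_int_measurable[OF u]])

lemma gradient_sq_int:
 assumes R: "prob_space R" and u: "sq_int (T \<otimes> R) (proc u)"
 shows "sq_int (T \<otimes> R) (%x. gradient (f (fst x)) (proc u x))"
  and "nsq (T \<otimes> R) (%x. gradient (f (fst x)) (proc u x)) \<le> 50 * lf\<^sup>2 * (T + nsq (T \<otimes> R) (proc u))"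
proof -
 interpret R: prob_space R by fact
 interpret finite_measure "T \<otimes> R" by (rule finite_measure_time_pair[OF R.finite_measure_axioms])
 have m: "measure (T \<otimes> R) (space (T \<otimes> R)) = T"
 proof -
  have "emeasure (T \<otimes> R) (space (time T) \<times> space R) = emeasure (time T) (space (time T)) * emeasure R (space R)"
   by (rule R.emeasure_pair_measure_Times[OF sets.top sets.top])
  also have "\<dots> = ennreal T"
   using T_pos by (simp add: R.emeasure_space_1 finite_measure.emeasure_eq_measure[OF finite_measure_time] measure_time space_time)
  finally show ?thesis using T_pos by (simp add: space_pair_measure measure_def)
 qed
 have i: "integrable (T \<otimes> R) (%x. 50 * lf\<^sup>2 * (1 + (norm (proc u x))\<^sup>2))" using u by (simp add: sq_int_def)
 have le: "(norm (gradient (f (fst x)) (proc u x)))\<^sup>2 \<le> 50 * lf\<^sup>2 * (1 + (norm (proc u x))\<^sup>2)"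
  if "x \<in> space (T \<otimes> R)" for x
 proof -
  have t: "fst x \<in> {0..T}" using that by (auto simp: space_pair_measure space_time)
  have "(norm (gradient (f (fst x)) (proc u x)))\<^sup>2 \<le> (5 * lf * (1 + norm (proc u x)))\<^sup>2"
   by (intro power_mono gradient_bound[OF t]) simp
  also have "\<dots> = 25 * lf\<^sup>2 * (1 + norm (proc u x))\<^sup>2" by (simp add: power_mult_distrib)
  also have "\<dots> \<le> 25 * lf\<^sup>2 * (2 * (1 + (norm (proc u x))\<^sup>2))"
   using norm_add_sq_le[of "1::real" "norm (proc u x)"] by (intro mult_left_mono) auto
  finally show ?thesis by (simp add: algebra_simps)
 qed
 show s: "sq_int (T \<otimes> R) (%x. gradient (f (fst x)) (proc u x))"
  using measurable_compose[OF measurable_Pair[OF measurable_fst sq_int_measurable[OF u]] gradient_measurable]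
  by (intro sq_int_bound[OF _ i le]) simp
 have "nsq (T \<otimes> R) (%x. gradient (f (fst x)) (proc u x)) \<le> (\<integral>x. 50 * lf\<^sup>2 * (1 + (norm (proc u x))\<^sup>2) \<partial>(T \<otimes> R))"
  unfolding nsq_def using s i le by (intro integral_mono) (auto simp: sq_int_def)
 also have "\<dots> = 50 * lf\<^sup>2 * (T + nsq (T \<otimes> R) (proc u))"
  using u m by (simp add: nsq_def sq_int_def)
 finally show "nsq (T \<otimes> R) (%x. gradient (f (fst x)) (proc u x)) \<le> 50 * lf\<^sup>2 * (T + nsq (T \<otimes> R) (proc u))" .
qed

text \<open>Real valued, for square integrable controls; \<open>running_cost_sq_int\<close> relates it to the
extended real running cost.\<close>

definition total_cost :: "'c measure => (real => 'c => real ^ 'm) => real" where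
 "total_cost R u = (\<integral>x. f (fst x) (proc u x) \<partial>(T \<otimes> R))"

lemma total_cost_lower:
 assumes R: "finite_measure R" and u: "sq_int (T \<otimes> R) (proc u)"
 shows "lam / 4 * nsq (T \<otimes> R) (proc u) \<le> total_cost R u"
proof -
 have "(\<integral>x. lam / 4 * (norm (proc u x))\<^sup>2 \<partial>(T \<otimes> R)) \<le> total_cost R u"
  unfolding total_cost_def using u
  by (intro integral_mono f_integrable[OF R u] lower) (auto simp: sq_int_def space_pair_measure space_time)
 then show ?thesis by (simp add: nsq_def)
qed

lemma total_cost_tangent:
 assumes R: "prob_space R" and u: "sq_int (T \<otimes> R) (proc u)" and v: "sq_int (T \<otimes> R) (proc v)"
 shows "total_cost R u + (\<integral>x. gradient (f (fst x)) (proc u x) \<bullet> (proc v x - proc u x) \<partial>(T \<otimes> R)) \<le> total_cost R v"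
proof -
 have fin: "finite_measure R" using R by (simp add: prob_space_def)
 note g = sq_int_inner[OF gradient_sq_int(1)[OF R u] sq_int_diff[OF v u]]
 have "(\<integral>x. f (fst x) (proc u x) + gradient (f (fst x)) (proc u x) \<bullet> (proc v x - proc u x) \<partial>(T \<otimes> R)) \<le> total_cost R v"
  unfolding total_cost_def
  by (intro integral_mono Bochner_Integration.integrable_add f_integrable[OF fin] u v g tangent)
   (auto simp: space_pair_measure space_time)
 then show ?thesis
  using f_integrable[OF fin u] g by (simp add: total_cost_def)
qed

end

section \<open>Square integrability of the state\<close>

context started_bm
begin

text \<open>An adapted process with almost surely continuous paths is changed on a null set. Read along
its path, a continuous process is the coordinate process, and this one is progressive.\<close>

lemma continuous_version:
 fixes X :: "real => 'w => real ^ 'm"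
 assumes null: "!!t A. t \<in> {0..T} ==> A \<in> null_sets P ==> A \<in> sets (F t)"
  and X: "!!t. t \<in> {0..T} ==> X t \<in> borel_measurable (F t)"
  and cont: "AE \<omega> in P. continuous_on {0..T} (%t. X t \<omega>)"
 obtains X' where "progressive F T X'" "AE \<omega> in P. \<forall>t. X' t \<omega> = X t \<omega>"
  "!!\<omega>. \<omega> \<in> space P ==> continuous_on {0..T} (%t. X' t \<omega>)"
proof -
 obtain B where B: "{\<omega>\<in>space P. \<not> continuous_on {0..T} (%t. X t \<omega>)} \<subseteq> B" "emeasure P B = 0" "B \<in> sets P"
  using cont by (rule AE_E)
 have Bn: "B \<in> null_sets P" using B by auto
 define X' where "X' t \<omega> = (if \<omega> \<in> B then 0 else X t \<omega>)" for t \<omega>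
 have c: "continuous_on {0..T} (%t. X' t \<omega>)" if "\<omega> \<in> space P" for \<omega>
  using B(1) that by (cases "\<omega> \<in> B") (auto simp: X'_def)
 have ad: "X' t \<in> borel_measurable (F t)" if t: "t \<in> {0..T}" for t
  unfolding X'_def[abs_def] using null[OF t Bn]
  by (intro measurable_If_set borel_measurable_const X t sets.Int sets.top)
 define q where "q \<omega> = (\<lambda>t\<in>{0..T}. X' t \<omega>)" for \<omega>
 have "proc X' \<in> borel_measurable (restrict_space borel {0..u} \<Otimes>\<^sub>M F u)" if u: "u \<in> {0..T}" for u
 proof -
  have "q \<in> measurable (F u) (past T u)"
  proof (rule measurable_past)
   show "q \<in> space (F u) \<rightarrow> space (path_space T)" by (auto simp: q_def path_space_def space_PiM)
   fix s assume s: "s \<in> {0..u}"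
   then have "(%x. q x s) = X' s" using u by (auto simp: q_def fun_eq_iff)
   then show "(%x. q x s) \<in> borel_measurable (F u)"
    using F_measurable_mono[OF ad, of s u] s u by simp
  qed
  then have qm: "(%x. (fst x, q (snd x))) \<in> measurable (restrict_space borel {0..u} \<Otimes>\<^sub>M F u) (restrict_space borel {0..u} \<Otimes>\<^sub>M past T u)"
   by (intro measurable_Pair measurable_fst measurable_compose[OF measurable_snd])
  have cm: "proc (coord T) \<in> borel_measurable (restrict_space borel {0..u} \<Otimes>\<^sub>M (past T u :: (real => real ^ 'm) measure))"
   using progressive_coord[OF T_pos] u by (auto simp: progressive_on_paths_def)
  have m: "(%x. coord T (fst x) (q (snd x))) \<in> borel_measurable (restrict_space borel {0..u} \<Otimes>\<^sub>M F u)"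
   using measurable_compose[OF qm cm] by simp
  have eq: "coord T t (q \<omega>) = X' t \<omega>" if "\<omega> \<in> space P" "t \<in> {0..T}" for \<omega> t
  proof -
   have g: "grid_time T n t \<in> {0..T}" for n
    using grid_time_bounds[OF T_pos, of t n] that(2) by auto
   have "(%n. X' (grid_time T n t) \<omega>) \<longlonglongrightarrow> X' t \<omega>"
    using c[OF that(1)] g that(2) grid_time_tendsto[OF T_pos, of t]
    unfolding continuous_on_sequentially comp_def by auto
   then have "(%n. q \<omega> (grid_time T n t)) \<longlonglongrightarrow> X' t \<omega>"
    using g by (simp add: q_def)
   then show ?thesis unfolding coord_def by (rule limI)
  qed
  show ?thesis
   by (subst measurable_cong[where g = "%x. coord T (fst x) (q (snd x))"])
    (use m u space_F[OF u] in \<open>auto simp: space_pair_measure space_restrict_space eq\<close>)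
 qed
 then have "progressive F T X'" by (simp add: progressive_def split_beta')
 moreover have "AE \<omega> in P. \<forall>t. X' t \<omega> = X t \<omega>"
  using AE_not_in[OF Bn] by eventually_elim (simp add: X'_def)
 ultimately show ?thesis using c by (rule that)
qed

text \<open>Mean reversion: the state is controlled by the free motion \<open>Z + \<integral> u\<close>, whatever its own
 integrability was.\<close>

lemma mean_reverting_sq_int:
 fixes X u :: "real => 'w => real ^ 'm"
 assumes Xm: "proc X \<in> borel_measurable (T \<otimes> P)"
  and cont: "!!\<omega>. \<omega> \<in> space P ==> continuous_on {0..T} (%t. X t \<omega>)"
  and um: "proc u \<in> borel_measurable (T \<otimes> P)"
  and ui: "AE \<omega> in P. integrable (time T) (%s. u s \<omega>)"
  and eq: "AE \<omega> in P. \<forall>t\<in>{0..T}. X t \<omega> = Z t \<omega> + prim T (%s. u s \<omega> - X s \<omega>) t"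
  and v: "!!t. t \<in> {0..T} ==> sq_int P (%\<omega>. prim T (%s. u s \<omega>) t)"
  and vB: "!!t. t \<in> {0..T} ==> nsq P (%\<omega>. prim T (%s. u s \<omega>) t) \<le> B"
 shows "\<exists>B'. \<forall>t\<in>{0..T}. sq_int P (X t) \<and> nsq P (X t) \<le> B'"
proof -
 interpret tm: finite_measure "time T" by (rule finite_measure_time)
 define c where "c t \<omega> = Z t \<omega> + prim T (%s. u s \<omega>) t" for t \<omega>
 define C where "C = 2 * (2 * nsq P (Z 0) + 2 * (real CARD('m) * T)) + 2 * B"
 have c: "sq_int P (c t)" "nsq P (c t) \<le> C" if t: "t \<in> {0..T}" for t
 proof -
  show "sq_int P (c t)" unfolding c_def[abs_def] by (rule sq_int_add[OF Z_sq_int(1)[OF t] v[OF t]])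
  show "nsq P (c t) \<le> C"
   unfolding c_def[abs_def] C_def using nsq_add[OF Z_sq_int(1)[OF t] v[OF t]] Z_sq_int(2)[OF t] vB[OF t] by simp
 qed
 have cm: "proc c \<in> borel_measurable (T \<otimes> P)"
  unfolding c_def using sq_int_measurable[OF Z_proc_sq_int] prim_proc_measurable[OF um] by (rule borel_measurable_add)
 have cs: "sq_int (T \<otimes> P) (proc c)" "nsq (T \<otimes> P) (proc c) \<le> T * C"
  using sq_int_proc_bounded[where X = c and B = C, OF fin T0 cm c] by blast+
 define n where "n \<omega> = (\<integral>s. norm (c s \<omega>) \<partial>time T)" for \<omega>
 have nsq_n: "AE \<omega> in P. (n \<omega>)\<^sup>2 \<le> T * nsq (time T) (%s. c s \<omega>)"
  using sq_int_paths(1)[OF fin cs(1)]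
 proof eventually_elim
  case (elim \<omega>)
  have "\<bar>\<integral>x. norm (c x \<omega>) \<bullet> (1::real) \<partial>time T\<bar> \<le> sqrt (nsq (time T) (%s. norm (c s \<omega>))) * sqrt (nsq (time T) (%x. 1::real))"
   by (intro Cauchy_Schwarz_integral sq_int_norm elim tm.sq_int_const)
  then have "\<bar>n \<omega>\<bar> \<le> sqrt (nsq (time T) (%s. c s \<omega>)) * sqrt T"
   using T0 by (simp add: nsq_def n_def measure_time space_time)
  then have "\<bar>n \<omega>\<bar>\<^sup>2 \<le> (sqrt (nsq (time T) (%s. c s \<omega>)) * sqrt T)\<^sup>2"
   by (intro power_mono) auto
  then show ?case using T0 by (simp add: power_mult_distrib nsq_nonneg mult.commute)
 qed
 have bound: "AE \<omega> in P. \<forall>t\<in>{0..T}. norm (X t \<omega>) \<le> norm (c t \<omega>) + n \<omega>"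
  using ui eq AE_space
 proof eventually_elim
  case (elim \<omega>)
  have Xi: "integrable (time T) (%s. X s \<omega>)"
   unfolding integrable_time_iff set_integrable_def
   by (intro borel_integrable_compact cont[OF elim(3)]) simp
  have cc: "continuous_on {0..T} (%t. c t \<omega>)"
   unfolding c_def by (intro continuous_on_add Z_continuous elim continuous_on_prim)
  show ?case
   unfolding n_def
  proof (intro ballI volterra_bound[OF cont[OF elim(3)] cc])
   fix t assume "t \<in> {0..T}"
   then show "X t \<omega> = c t \<omega> - prim T (%s. X s \<omega>) t"
    using elim(2) by (simp add: c_def prim_diff[OF elim(1) Xi])
  qed
 qed
 have nm: "n \<in> borel_measurable P"
 proof -
  have "(%\<omega>. \<integral>s. norm (proc c (s, \<omega>)) \<partial>time T) \<in> borel_measurable P"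
  proof (rule tm.borel_measurable_lebesgue_integral)
   have "(%x. norm (proc c x)) \<in> borel_measurable (T \<otimes> P)" using cm by simp
   from measurable_compose[OF measurable_pair_swap' this]
   show "(%(\<omega>, s). norm (proc c (s, \<omega>))) \<in> borel_measurable (P \<Otimes>\<^sub>M time T)"
    by (simp add: split_beta')
  qed
  then show ?thesis by (simp add: n_def[abs_def])
 qed
 have ni: "integrable P (%\<omega>. (n \<omega>)\<^sup>2)"
 proof (rule Bochner_Integration.integrable_bound)
  show "integrable P (%\<omega>. T * nsq (time T) (%s. c s \<omega>))" using sq_int_paths(5)[OF fin cs(1)] by simp
  show "AE \<omega> in P. norm ((n \<omega>)\<^sup>2) \<le> norm (T * nsq (time T) (%s. c s \<omega>))"
   using nsq_n by eventually_elim auto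
 qed (use nm in measurable)
 have ns: "sq_int P n" using nm ni by (simp add: sq_int_def)
 have nB: "nsq P n \<le> T * (T * C)"
 proof -
  have "nsq P n \<le> (\<integral>\<omega>. T * nsq (time T) (%s. c s \<omega>) \<partial>P)"
   unfolding nsq_def[of P] using nsq_n ni sq_int_paths(5)[OF fin cs(1)] by (intro integral_mono_AE) auto
  also have "\<dots> = T * nsq (T \<otimes> P) (proc c)"
   using sq_int_paths(3)[OF fin cs(1)] by simp
  finally show ?thesis using mult_left_mono[OF cs(2) T0] by linarith
 qed
 have "sq_int P (X t) \<and> nsq P (X t) \<le> 2 * C + 2 * (T * (T * C))" if t: "t \<in> {0..T}" for t
 proof -
  have m: "X t \<in> borel_measurable P" by (rule proc_section_measurable(2)[OF Xm t])
  have le: "AE \<omega> in P. (norm (X t \<omega>))\<^sup>2 \<le> 2 * (norm (c t \<omega>))\<^sup>2 + 2 * (n \<omega>)\<^sup>2"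
   using bound
  proof eventually_elim
   case (elim \<omega>)
   then have "(norm (X t \<omega>))\<^sup>2 \<le> (norm (c t \<omega>) + n \<omega>)\<^sup>2"
    using t by (intro power_mono) auto
   also have "\<dots> \<le> 2 * (norm (c t \<omega>))\<^sup>2 + 2 * (n \<omega>)\<^sup>2"
    using norm_add_sq_le[of "norm (c t \<omega>)" "n \<omega>"] by simp
   finally show ?case .
  qed
  have bi: "integrable P (%\<omega>. 2 * (norm (c t \<omega>))\<^sup>2 + 2 * (n \<omega>)\<^sup>2)"
   using c(1)[OF t] ni by (auto simp: sq_int_def)
  have i: "integrable P (%\<omega>. (norm (X t \<omega>))\<^sup>2)"
  proof (rule Bochner_Integration.integrable_bound[OF bi])
   show "AE \<omega> in P. norm ((norm (X t \<omega>))\<^sup>2) \<le> norm (2 * (norm (c t \<omega>))\<^sup>2 + 2 * (n \<omega>)\<^sup>2)"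
    using le by eventually_elim simp
  qed (use m in measurable)
  have "nsq P (X t) \<le> (\<integral>\<omega>. 2 * (norm (c t \<omega>))\<^sup>2 + 2 * (n \<omega>)\<^sup>2 \<partial>P)"
   unfolding nsq_def using le i bi by (intro integral_mono_AE)
  also have "\<dots> = 2 * nsq P (c t) + 2 * nsq P n"
   using c(1)[OF t] ni by (simp add: nsq_def sq_int_def)
  finally show ?thesis using m i c(2)[OF t] nB by (simp add: sq_int_def)
 qed
 then show ?thesis by blast
qed

end

section \<open>The cost of a control\<close>

context cost
begin

lemma running_cost_time: "running_cost T f \<alpha> \<omega> = (\<integral>\<^sup>+t. ennreal (f t (\<alpha> t \<omega>)) \<partial>time T)"
 unfolding running_cost_def by (subst nn_integral_restrict_space) (auto simp: mult.commute)

lemma running_cost_measurable: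
 assumes R: "finite_measure R" and \<alpha>: "proc \<alpha> \<in> borel_measurable (T \<otimes> R)"
 shows "running_cost T f \<alpha> \<in> borel_measurable R"
  and "(\<integral>\<^sup>+\<omega>. running_cost T f \<alpha> \<omega> \<partial>R) = (\<integral>\<^sup>+x. ennreal (f (fst x) (proc \<alpha> x)) \<partial>(T \<otimes> R))"
proof -
 interpret tm: finite_measure "time T" by (rule finite_measure_time)
 interpret pair_sigma_finite "time T" R by (rule pair_sigma_finite_time[OF R])
 have m: "(%x. ennreal (f (fst x) (proc \<alpha> x))) \<in> borel_measurable (T \<otimes> R)"
  using f_process_measurable[OF \<alpha>] by simp
 have m': "(%x. ennreal (f (snd x) (\<alpha> (snd x) (fst x)))) \<in> borel_measurable (R \<Otimes>\<^sub>M time T)"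
  using measurable_compose[OF measurable_pair_swap' m] by (simp add: split_beta')
 show "running_cost T f \<alpha> \<in> borel_measurable R"
  unfolding running_cost_time[abs_def] using m' by (intro tm.borel_measurable_nn_integral) (simp add: split_beta')
 show "(\<integral>\<^sup>+\<omega>. running_cost T f \<alpha> \<omega> \<partial>R) = (\<integral>\<^sup>+x. ennreal (f (fst x) (proc \<alpha> x)) \<partial>(T \<otimes> R))"
  unfolding running_cost_time using nn_integral_snd[of "%x. ennreal (f (fst x) (proc \<alpha> x))", OF m] by simp
qed

lemma running_cost_sq_int:
 assumes R: "finite_measure R" and \<alpha>: "sq_int (T \<otimes> R) (proc \<alpha>)"
 shows "(\<integral>\<^sup>+\<omega>. running_cost T f \<alpha> \<omega> \<partial>R) = ennreal (total_cost R \<alpha>)"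
 unfolding running_cost_measurable(2)[OF R sq_int_measurable[OF \<alpha>]] total_cost_def
 by (intro nn_integral_eq_integral f_integrable[OF R \<alpha>] AE_I2 f_nonneg) (auto simp: space_pair_measure space_time)

lemma finite_cost_sq_int:
 assumes R: "finite_measure R" and \<alpha>: "proc \<alpha> \<in> borel_measurable (T \<otimes> R)"
  and fin: "(\<integral>\<^sup>+\<omega>. running_cost T f \<alpha> \<omega> \<partial>R) < \<infinity>"
 shows "sq_int (T \<otimes> R) (proc \<alpha>)"
proof -
 have "(\<integral>\<^sup>+x. ennreal (norm ((norm (proc \<alpha> x))\<^sup>2)) \<partial>(T \<otimes> R)) \<le>
  (\<integral>\<^sup>+x. ennreal (4 / lam) * ennreal (f (fst x) (proc \<alpha> x)) \<partial>(T \<otimes> R))"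
 proof (rule nn_integral_mono)
  fix x assume "x \<in> space (T \<otimes> R)"
  then have t: "fst x \<in> {0..T}" by (auto simp: space_pair_measure space_time)
  have "(norm (proc \<alpha> x))\<^sup>2 \<le> 4 / lam * f (fst x) (proc \<alpha> x)"
   using lower[OF t, of "proc \<alpha> x"] lam_pos by (simp add: field_simps)
  then show "ennreal (norm ((norm (proc \<alpha> x))\<^sup>2)) \<le> ennreal (4 / lam) * ennreal (f (fst x) (proc \<alpha> x))"
   using lam_pos f_nonneg[OF t] by (simp add: ennreal_mult[symmetric] ennreal_leI)
 qed
 also have "\<dots> = ennreal (4 / lam) * (\<integral>\<^sup>+x. ennreal (f (fst x) (proc \<alpha> x)) \<partial>(T \<otimes> R))"
  using f_process_measurable[OF \<alpha>] by (intro nn_integral_cmult) simp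
 also have "\<dots> < \<infinity>"
  using fin unfolding running_cost_measurable(2)[OF R \<alpha>] by (simp add: ennreal_mult_less_top)
 finally have "integrable (T \<otimes> R) (%x. (norm (proc \<alpha> x))\<^sup>2)"
  using \<alpha> by (intro integrableI_bounded) simp_all
 then show ?thesis using \<alpha> by (simp add: sq_int_def)
qed

lemma total_cost_nonneg: "total_cost R u \<ge> 0"
 unfolding total_cost_def
 by (intro Bochner_Integration.integral_nonneg f_nonneg) (auto simp: space_pair_measure space_time)

end

section \<open>Comparing the particles with a canonical drift\<close>

text \<open>Convexity of the square.\<close>

lemma nsq_average_le:
 fixes u :: "nat => 'a => 'b::euclidean_space"
 assumes N: "1 \<le> N" and u: "!!i. i \<in> {1..N} ==> sq_int R (u i)"
 shows "nsq R (%x. (1 / real N) *\<^sub>R (\<Sum>i=1..N. u i x)) \<le> 1 / real N * (\<Sum>i=1..N. nsq R (u i))"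
proof -
 have le: "(norm ((1 / real N) *\<^sub>R (\<Sum>i=1..N. u i x)))\<^sup>2 \<le> 1 / real N * (\<Sum>i=1..N. (norm (u i x))\<^sup>2)" for x
 proof -
  have "(norm (\<Sum>i=1..N. u i x))\<^sup>2 \<le> (\<Sum>i=1..N. norm (u i x))\<^sup>2"
   by (intro power_mono norm_sum) simp
  also have "\<dots> \<le> real (card {1..N}) * (\<Sum>i=1..N. (norm (u i x))\<^sup>2)"
   using sum_squared_le_sum_of_squares[of "%i. norm (u i x)" "{1..N}"] by (simp add: mult.commute)
  finally have "(1 / real N)\<^sup>2 * (norm (\<Sum>i=1..N. u i x))\<^sup>2 \<le> (1 / real N)\<^sup>2 * (real N * (\<Sum>i=1..N. (norm (u i x))\<^sup>2))"
   by (intro mult_left_mono) auto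
  also have "\<dots> = 1 / real N * (\<Sum>i=1..N. (norm (u i x))\<^sup>2)"
   using N by (simp add: power2_eq_square)
  finally show ?thesis by (simp add: power_mult_distrib power_divide)
 qed
 have i: "integrable R (%x. (norm (u i x))\<^sup>2)" if "i \<in> {1..N}" for i
  using u[OF that] by (simp add: sq_int_def)
 have a: "sq_int R (%x. (1 / real N) *\<^sub>R (\<Sum>i=1..N. u i x))"
  by (intro sq_int_scaleR sq_int_sum u)
 have "nsq R (%x. (1 / real N) *\<^sub>R (\<Sum>i=1..N. u i x)) \<le> (\<integral>x. 1 / real N * (\<Sum>i=1..N. (norm (u i x))\<^sup>2) \<partial>R)"
  unfolding nsq_def[of _ "%x. (1 / real N) *\<^sub>R _ x"]
  by (intro integral_mono le Bochner_Integration.integrable_mult_right Bochner_Integration.integrable_sum i)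
   (use a in \<open>simp add: sq_int_def\<close>)
 also have "\<dots> = 1 / real N * (\<Sum>i=1..N. nsq R (u i))"
  unfolding nsq_def by (subst integral_mult_right_zero, subst Bochner_Integration.integral_sum[OF i]) auto
 finally show ?thesis .
qed

lemma sq_int_time_lift:
 fixes h :: "real => 'b::euclidean_space"
 assumes R: "prob_space R" and h: "sq_int (time T) h"
 shows "sq_int (T \<otimes> R) (%x. h (fst x))"
proof -
 interpret prob_space R by fact
 have "distr (T \<otimes> R) (time T) fst = time T" by (rule distr_pair_fst)
 then show ?thesis
  using sq_int_distr[OF measurable_fst sq_int_measurable[OF h], of R] h by simp
qed

lemma mean_sq_int:
 fixes g :: "real => 'z => 'b::euclidean_space"
 assumes Q: "prob_space Q" and g: "sq_int (T \<otimes> Q) (proc g)"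
 shows "sq_int (time T) (%t. \<integral>z. g t z \<partial>Q)"
proof -
 interpret Q: prob_space Q by fact
 have fin: "finite_measure Q" by (rule Q.finite_measure_axioms)
 have m: "(%t. \<integral>z. g t z \<partial>Q) \<in> borel_measurable (time T)"
  using sq_int_measurable[OF g] by (intro Q.borel_measurable_lebesgue_integral) (simp add: split_beta')
 have i: "integrable (time T) (%t. nsq Q (g t))"
  using integral_time_prod(6)[OF fin, of T "%x. (norm (proc g x))\<^sup>2"] g by (simp add: sq_int_def nsq_def)
 have "AE t in time T. norm ((norm (\<integral>z. g t z \<partial>Q))\<^sup>2) \<le> norm (nsq Q (g t))"
  using sq_int_paths(2)[OF fin g] by eventually_elim (simp add: Q.norm_expectation_sq_le nsq_nonneg)
 from Bochner_Integration.integrable_bound[OF i _ this] m show ?thesis by (simp add: sq_int_def)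
qed

locale particle_cost = bm_family P F T N Z Q + cost T lf lam f
 for P :: "'w measure" and F T N and Z :: "nat => real => 'w => real ^ 'm" and Q
  and lf lam :: real and f :: "real => real ^ 'm => real"
begin

lemma one_mem: "1 \<in> {1..N}" using N_pos by simp

context
 fixes \<beta> :: "real => (real => real ^ 'm) => real ^ 'm"
 assumes prog: "progressive_on_paths T \<beta>" and sq: "sq_int (T \<otimes> Q) (proc \<beta>)"
begin

lemma feedback_sq_int_Q: "sq_int (T \<otimes> Q) (proc (feedback Q T \<beta>))"
 using started_bm.feedback_sq_int[OF bm[OF one_mem] prog] sq law[OF one_mem] by simp

lemma state_sq_int_Q: "sq_int (T \<otimes> Q) (proc (state T \<beta>))"
 using started_bm.state_sq_int[OF bm[OF one_mem] prog] sq law[OF one_mem] by simp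

lemma mean_state_sq_int_P: "sq_int (T \<otimes> P) (%x. mean_state Q T \<beta> (fst x))"
 using started_bm.mean_state_sq_int[OF bm[OF one_mem] prog _ prob_space_axioms] sq law[OF one_mem] by simp

lemma total_cost_lift:
 assumes a: "sq_int (T \<otimes> Q) (proc a)" and i: "i \<in> {1..N}"
 shows "total_cost P (%t \<omega>. a t (pth i \<omega>)) = total_cost Q a"
proof -
 have "proc (%t z. f t (a t z)) \<in> borel_measurable (T \<otimes> path_space T)"
  using f_process_measurable[OF sq_int_measurable[OF a]] unfolding measurable_time_Q .
 from integral_lift[OF i this] show ?thesis by (simp add: total_cost_def)
qed

text \<open>The control with which particle \<open>i\<close> realises the drift \<open>\<beta>\<close> along its own path.\<close>

definition swarm_control :: "nat => real => 'w => real ^ 'm" where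
 "swarm_control i t \<omega> = \<beta> t (pth i \<omega>) + state T \<beta> t (pth i \<omega>) - (1 / real N) *\<^sub>R (\<Sum>j=1..N. state T \<beta> t (pth j \<omega>))"

lemma progressive_swarm_control: "i \<in> {1..N} ==> progressive F T (swarm_control i)"
proof -
 assume i: "i \<in> {1..N}"
 have s: "progressive F T (%t \<omega>. state T \<beta> t (pth j \<omega>))" if "j \<in> {1..N}" for j
  by (rule progressive_transfer[OF bm[OF that] progressive_state[OF T_pos prog]])
 have b: "progressive F T (%t \<omega>. \<beta> t (pth i \<omega>))"
  by (rule progressive_transfer[OF bm[OF i] prog])
 show "progressive F T (swarm_control i)"
  unfolding progressive_def split_beta'
 proof
  fix t assume t: "t \<in> {0..T}"
  show "(%x. proc (swarm_control i) x) \<in> borel_measurable (restrict_space borel {0..t} \<Otimes>\<^sub>M F t)"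
   unfolding swarm_control_def using s b i t
   by (intro borel_measurable_diff borel_measurable_add borel_measurable_scaleR borel_measurable_const borel_measurable_sum)
    (auto simp: progressive_def split_beta')
 qed
qed

text \<open>The control is \<open>feedback Q T \<beta>\<close> along the path of the particle, up to the deviation of the barycenter from its mean.
The tangent at the control itself bounds the difference of the costs by a product of two \<open>L\<^sup>2\<close>
norms; the deviation contributes \<open>1 / sqrt N\<close>.\<close>

lemma swarm_cost:
 assumes i: "i \<in> {1..N}"
 shows "sq_int (T \<otimes> P) (proc (swarm_control i))"
  and "total_cost P (swarm_control i) \<le> total_cost Q (feedback Q T \<beta>) +
   sqrt (50 * lf\<^sup>2 * (T + 2 * nsq (T \<otimes> Q) (proc (feedback Q T \<beta>)) + 2 * nsq (T \<otimes> Q) (proc (state T \<beta>)))) *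
   sqrt (nsq (T \<otimes> Q) (proc (state T \<beta>)) / real N)"
proof -
 let ?a = "feedback Q T \<beta>" and ?TP = "T \<otimes> P" and ?TQ = "T \<otimes> Q"
 define d where "d x = (1 / real N) *\<^sub>R (\<Sum>j=1..N. state T \<beta> (fst x) (pth j (snd x))) - mean_state Q T \<beta> (fst x)" for x
 have d: "sq_int ?TP d"
  unfolding d_def[abs_def]
  by (intro sq_int_diff sq_int_scaleR sq_int_sum sq_int_lift(1)[OF _ state_sq_int_Q] mean_state_sq_int_P)
 have dN: "nsq ?TP d \<le> nsq ?TQ (proc (state T \<beta>)) / real N"
  using variance[OF state_sq_int_Q] d unfolding d_def[abs_def] mean_state_def by blast
 have d1: "nsq ?TP d \<le> nsq ?TQ (proc (state T \<beta>))"
  by (rule order_trans[OF dN]) (use N_pos nsq_nonneg[of ?TQ "proc (state T \<beta>)"] in \<open>simp add: divide_le_eq mult_le_cancel_left1\<close>)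
 have eq: "proc (swarm_control i) x = ?a (fst x) (pth i (snd x)) - d x" for x
  by (simp add: swarm_control_def feedback_def d_def)
 note aP = sq_int_lift[OF i feedback_sq_int_Q]
 show u: "sq_int ?TP (proc (swarm_control i))"
  unfolding eq by (rule sq_int_diff[OF aP(1) d])
 have un: "nsq ?TP (proc (swarm_control i)) \<le> 2 * nsq ?TQ (proc ?a) + 2 * nsq ?TQ (proc (state T \<beta>))"
  using nsq_diff[OF aP(1) d] d1 unfolding eq aP(2) by linarith
 let ?G = "%x. gradient (f (fst x)) (proc (swarm_control i) x)"
 note G = gradient_sq_int[OF prob_space_axioms u]
 have Gn: "nsq ?TP ?G \<le> 50 * lf\<^sup>2 * (T + 2 * nsq ?TQ (proc ?a) + 2 * nsq ?TQ (proc (state T \<beta>)))"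
  by (rule order_trans[OF G(2)]) (intro mult_left_mono, use un in auto)
 have "\<bar>\<integral>x. ?G x \<bullet> d x \<partial>?TP\<bar> \<le> sqrt (nsq ?TP ?G) * sqrt (nsq ?TP d)"
  by (rule Cauchy_Schwarz_integral[OF G(1) d])
 also have "\<dots> \<le> sqrt (50 * lf\<^sup>2 * (T + 2 * nsq ?TQ (proc ?a) + 2 * nsq ?TQ (proc (state T \<beta>)))) *
   sqrt (nsq ?TQ (proc (state T \<beta>)) / real N)"
  by (intro mult_mono real_sqrt_le_mono Gn dN real_sqrt_ge_zero nsq_nonneg order_trans[OF nsq_nonneg Gn])
 finally have e: "\<bar>\<integral>x. ?G x \<bullet> d x \<partial>?TP\<bar> \<le> \<dots>" .
 have "total_cost P (swarm_control i) + (\<integral>x. ?G x \<bullet> d x \<partial>?TP) \<le> total_cost P (%t \<omega>. ?a t (pth i \<omega>))"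
  using total_cost_tangent[OF prob_space_axioms u aP(1)] by (simp add: eq)
 then show "total_cost P (swarm_control i) \<le> total_cost Q ?a +
   sqrt (50 * lf\<^sup>2 * (T + 2 * nsq ?TQ (proc ?a) + 2 * nsq ?TQ (proc (state T \<beta>)))) *
   sqrt (nsq ?TQ (proc (state T \<beta>)) / real N)"
  unfolding total_cost_lift[OF feedback_sq_int_Q i] using e by linarith
qed

end

context
 fixes b :: "nat => real => 'w => real ^ 'm" and \<beta> :: "real => (real => real ^ 'm) => real ^ 'm"
 assumes b: "!!i. i \<in> {1..N} ==> sq_int (T \<otimes> P) (proc (b i))"
  and prog: "progressive_on_paths T \<beta>" and sq: "sq_int (T \<otimes> Q) (proc \<beta>)"
  and proj: "!!g. sq_int (T \<otimes> Q) (proc g) ==>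
   1 / real N * (\<Sum>i=1..N. \<integral>x. g (fst x) (pth i (snd x)) \<bullet> proc (b i) x \<partial>(T \<otimes> P)) =
   (\<integral>x. proc g x \<bullet> proc \<beta> x \<partial>(T \<otimes> Q))"
begin

lemma particle_eq: "X b i t \<omega> = Z i t \<omega> + prim T (%s. b i s \<omega>) t"
 by (rule X_def[OF b prog sq proj])

lemma particle_sq_int: "i \<in> {1..N} ==> sq_int (T \<otimes> P) (proc (X b i))"
 by (rule X_sq_int[OF b prog sq proj])

lemma particle_at_sq_int: "i \<in> {1..N} ==> t \<in> {0..T} ==> sq_int P (X b i t)"
 by (rule X_at_sq_int[OF b prog sq proj])

definition barycenter :: "real => 'w => real ^ 'm" where
 "barycenter t \<omega> = (1 / real N) *\<^sub>R (\<Sum>j=1..N. X b j t \<omega>)"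

definition control :: "nat => real => 'w => real ^ 'm" where
 "control i t \<omega> = b i t \<omega> + X b i t \<omega> - barycenter t \<omega>"

lemma barycenter_sq_int: "sq_int (T \<otimes> P) (proc barycenter)"
 unfolding barycenter_def by (intro sq_int_scaleR sq_int_sum particle_sq_int)

lemma barycenter_at_sq_int: "t \<in> {0..T} ==> sq_int P (barycenter t)"
 unfolding barycenter_def[abs_def] by (intro sq_int_scaleR sq_int_sum particle_at_sq_int)

lemma control_sq_int: "i \<in> {1..N} ==> sq_int (T \<otimes> P) (proc (control i))"
 unfolding control_def by (intro sq_int_diff sq_int_add b particle_sq_int barycenter_sq_int)

lemma control_eq: "control i t \<omega> = b i t \<omega> + (Z i t \<omega> + prim T (%s. b i s \<omega>) t) -
  (1 / real N) *\<^sub>R (\<Sum>j=1..N. Z j t \<omega> + prim T (%s. b j s \<omega>) t)"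
 unfolding control_def barycenter_def particle_eq ..

text \<open>The attraction of the particles to their barycenter cancels in the mean.\<close>

lemma mean_control: "(1 / real N) *\<^sub>R (\<Sum>i=1..N. control i t \<omega>) = (1 / real N) *\<^sub>R (\<Sum>i=1..N. b i t \<omega>)"
proof -
 have "(\<Sum>i=1..N. control i t \<omega>) = (\<Sum>i=1..N. b i t \<omega>) + ((\<Sum>i=1..N. X b i t \<omega>) - real N *\<^sub>R barycenter t \<omega>)"
  by (simp add: control_def sum.distrib sum_subtractf sum_constant_scaleR del: sum_constant)
 also have "(\<Sum>i=1..N. X b i t \<omega>) - real N *\<^sub>R barycenter t \<omega> = 0"
  using N_pos by (simp add: barycenter_def)
 finally show ?thesis by simp
qed

text \<open>By \<open>mean_control\<close> the barycenter is the mean of the paths plus the primitive of the mean control, so it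
is bounded by the cost alone, uniformly in \<open>N\<close>.\<close>

lemma barycenter_nsq:
 assumes S: "!!i. i \<in> {1..N} ==> nsq P (Z i 0) \<le> S"
  and K: "1 / real N * (\<Sum>i=1..N. total_cost P (control i)) \<le> K"
 shows "nsq (T \<otimes> P) (proc barycenter) \<le> T * (2 * (2 * S + 2 * (real CARD('m) * T)) + 2 * (T * (4 / lam * K)))"
proof (rule sq_int_proc_bounded(2)[OF finP T0 sq_int_measurable[OF barycenter_sq_int] barycenter_at_sq_int])
 let ?mb = "%t \<omega>. (1 / real N) *\<^sub>R (\<Sum>i=1..N. b i t \<omega>)"
 have mb: "sq_int (T \<otimes> P) (proc ?mb)"
  by (intro sq_int_scaleR sq_int_sum b)
 have "nsq (T \<otimes> P) (proc ?mb) = nsq (T \<otimes> P) (%x. (1 / real N) *\<^sub>R (\<Sum>i=1..N. proc (control i) x))"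
  unfolding mean_control ..
 also have "\<dots> \<le> 1 / real N * (\<Sum>i=1..N. nsq (T \<otimes> P) (proc (control i)))"
  by (rule nsq_average_le[OF N_pos control_sq_int])
 also have "\<dots> \<le> 1 / real N * (\<Sum>i=1..N. 4 / lam * total_cost P (control i))"
 proof (intro mult_left_mono sum_mono)
  fix i assume i: "i \<in> {1..N}"
  show "nsq (T \<otimes> P) (proc (control i)) \<le> 4 / lam * total_cost P (control i)"
   using total_cost_lower[OF finP control_sq_int[OF i]] lam_pos by (simp add: field_simps)
 qed simp
 also have "\<dots> = 4 / lam * (1 / real N * (\<Sum>i=1..N. total_cost P (control i)))"
  by (simp add: sum_distrib_left mult.commute)
 also have "\<dots> \<le> 4 / lam * K"
  using K lam_pos by (intro mult_left_mono) auto
 finally have mbK: "nsq (T \<otimes> P) (proc ?mb) \<le> 4 / lam * K" .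
 fix t assume t: "t \<in> {0..T}"
 let ?mZ = "%\<omega>. (1 / real N) *\<^sub>R (\<Sum>i=1..N. Z i t \<omega>)"
 have ae: "AE \<omega> in P. \<forall>i\<in>{1..N}. sq_int (time T) (%s. b i s \<omega>)"
  by (intro AE_finite_allI finite_atLeastAtMost sq_int_paths(1)[OF finP b])
 have "AE \<omega> in P. barycenter t \<omega> = ?mZ \<omega> + prim T (%s. ?mb s \<omega>) t"
  using ae
 proof eventually_elim
  case (elim \<omega>)
  then have i: "integrable (time T) (%s. b i s \<omega>)" if "i \<in> {1..N}" for i
   using finite_measure.sq_int_integrable[OF finite_measure_time] that by blast
  have "prim T (%s. ?mb s \<omega>) t = (1 / real N) *\<^sub>R (\<Sum>i=1..N. prim T (%s. b i s \<omega>) t)"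
   unfolding prim_scaleR by (subst prim_sum[OF i]) auto
  then show ?case by (simp add: barycenter_def particle_eq sum.distrib scaleR_add_right)
 qed
 moreover have pm: "sq_int P (%\<omega>. prim T (%s. ?mb s \<omega>) t)" by (rule prim_at_sq_int(1)[OF finP T0 t mb])
 moreover have mZ: "sq_int P ?mZ"
  using t by (intro sq_int_scaleR sq_int_sum started_bm.Z_sq_int(1)[OF bm])
 ultimately have "nsq P (barycenter t) = nsq P (%\<omega>. ?mZ \<omega> + prim T (%s. ?mb s \<omega>) t)"
  by (intro nsq_cong_AE sq_int_measurable sq_int_add barycenter_at_sq_int[OF t])
 also have "\<dots> \<le> 2 * nsq P ?mZ + 2 * nsq P (%\<omega>. prim T (%s. ?mb s \<omega>) t)"
  by (rule nsq_add[OF mZ pm])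
 also have "nsq P ?mZ \<le> 1 / real N * (\<Sum>i=1..N. nsq P (Z i t))"
  using t by (intro nsq_average_le[OF N_pos] started_bm.Z_sq_int(1)[OF bm])
 also have "\<dots> \<le> 1 / real N * (\<Sum>i=1..N. 2 * S + 2 * (real CARD('m) * T))"
 proof (intro mult_left_mono sum_mono)
  fix i assume i: "i \<in> {1..N}"
  show "nsq P (Z i t) \<le> 2 * S + 2 * (real CARD('m) * T)"
   using started_bm.Z_sq_int(2)[OF bm[OF i] t] S[OF i] by linarith
 qed simp
 also have "\<dots> = 2 * S + 2 * (real CARD('m) * T)" by (rule average_const)
 also have "nsq P (%\<omega>. prim T (%s. ?mb s \<omega>) t) \<le> T * (4 / lam * K)"
  by (rule order_trans[OF prim_at_sq_int(2)[OF finP T0 t mb] mult_left_mono[OF mbK T0]])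
 finally show "nsq P (barycenter t) \<le> 2 * (2 * S + 2 * (real CARD('m) * T)) + 2 * (T * (4 / lam * K))"
  by simp
qed

text \<open>The barycenter and the canonical state have the same mean at each time.\<close>

lemma barycenter_centered:
 fixes h :: "real => real ^ 'm"
 assumes h: "sq_int (time T) h"
 shows "(\<integral>x. h (fst x) \<bullet> (proc barycenter x - mean_state Q T \<beta> (fst x)) \<partial>(T \<otimes> P)) = 0"
proof -
 have i: "integrable (T \<otimes> P) (%x. h (fst x) \<bullet> (proc barycenter x - mean_state Q T \<beta> (fst x)))"
  by (intro sq_int_inner sq_int_time_lift[OF prob_space_axioms h] sq_int_diff barycenter_sq_int mean_state_sq_int_P prog sq)
 have "(\<integral>x. h (fst x) \<bullet> (proc barycenter x - mean_state Q T \<beta> (fst x)) \<partial>(T \<otimes> P)) =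
  (\<integral>t. (\<integral>\<omega>. h t \<bullet> (barycenter t \<omega> - mean_state Q T \<beta> t) \<partial>P) \<partial>time T)"
  using integral_time_prod(2)[OF finP i] by simp
 also have "\<dots> = (\<integral>t. 0 \<partial>time T)"
 proof (intro Bochner_Integration.integral_cong refl)
  fix t assume "t \<in> space (time T)"
  then have t: "t \<in> {0..T}" by (simp add: space_time)
  have Xi: "integrable P (X b i t)" if "i \<in> {1..N}" for i
   by (rule sq_int_integrable[OF particle_at_sq_int[OF that t]])
  have bi: "integrable P (barycenter t)" by (rule sq_int_integrable[OF barycenter_at_sq_int[OF t]])
  have "(\<integral>\<omega>. barycenter t \<omega> \<partial>P) = (1 / real N) *\<^sub>R (\<Sum>i=1..N. \<integral>\<omega>. X b i t \<omega> \<partial>P)"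
   unfolding barycenter_def integral_scaleR_right by (subst Bochner_Integration.integral_sum[OF Xi]) auto
  also have "\<dots> = mean_state Q T \<beta> t"
   by (rule mean_state_average[OF b prog sq proj t, symmetric])
  finally have m: "(\<integral>\<omega>. barycenter t \<omega> \<partial>P) = mean_state Q T \<beta> t" .
  show "(\<integral>\<omega>. h t \<bullet> (barycenter t \<omega> - mean_state Q T \<beta> t) \<partial>P) = 0"
   using bi m by (simp add: prob_space)
 qed
 finally show ?thesis by simp
qed

text \<open>The variance is at most the second moment.\<close>

lemma barycenter_fluctuation:
 "nsq (T \<otimes> P) (%x. proc barycenter x - mean_state Q T \<beta> (fst x)) \<le> nsq (T \<otimes> P) (proc barycenter)"
proof -
 let ?TP = "T \<otimes> P" and ?d = "%x. proc barycenter x - mean_state Q T \<beta> (fst x)" and ?m = "%x. mean_state Q T \<beta> (fst x)"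
 have m: "sq_int (time T) (mean_state Q T \<beta>)"
  unfolding mean_state_def[abs_def] by (rule mean_sq_int[OF prob_Q state_sq_int_Q[OF prog sq]])
 note mP = mean_state_sq_int_P[OF prog sq]
 have d: "sq_int ?TP ?d" by (rule sq_int_diff[OF barycenter_sq_int mP])
 have "nsq ?TP (proc barycenter) = (\<integral>x. (norm (?d x))\<^sup>2 + 2 * (?m x \<bullet> ?d x) + (norm (?m x))\<^sup>2 \<partial>?TP)"
  unfolding nsq_def
  by (intro Bochner_Integration.integral_cong refl) (simp add: power2_norm_eq_inner algebra_simps inner_commute)
 also have "\<dots> = nsq ?TP ?d + 2 * (\<integral>x. ?m x \<bullet> ?d x \<partial>?TP) + nsq ?TP ?m"
  using d mP sq_int_inner[OF mP d] by (simp add: nsq_def sq_int_def)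
 also have "(\<integral>x. ?m x \<bullet> ?d x \<partial>?TP) = 0" by (rule barycenter_centered[OF m])
 finally show ?thesis using nsq_nonneg[of ?TP ?m] by linarith
qed

text \<open>The convex cost lies above its tangent at \<open>feedback Q T \<beta>\<close>. By duality the contributions of drifts and
states to the linear term vanish on average, and only the reference point \<open>r\<close> remains: the mean in
the mean field problem, where nothing is left, and the barycenter for the particles.\<close>

lemma projected_cost_relative:
 fixes r :: "real => 'w => real ^ 'm"
 assumes r: "sq_int (T \<otimes> P) (proc r)"
 defines "g \<equiv> %t z. gradient (f t) (feedback Q T \<beta> t z)"
 shows "total_cost Q (feedback Q T \<beta>) \<le> 1 / real N * (\<Sum>i=1..N. total_cost P (%t \<omega>. b i t \<omega> + X b i t \<omega> - r t \<omega>)) +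
  1 / real N * (\<Sum>i=1..N. \<integral>x. g (fst x) (pth i (snd x)) \<bullet> (proc r x - mean_state Q T \<beta> (fst x)) \<partial>(T \<otimes> P))"
proof -
 let ?TP = "T \<otimes> P" and ?TQ = "T \<otimes> Q" and ?a = "feedback Q T \<beta>"
 define u where "u i t \<omega> = b i t \<omega> + X b i t \<omega> - r t \<omega>" for i t \<omega>
 define d where "d x = proc r x - mean_state Q T \<beta> (fst x)" for x
 have u: "sq_int ?TP (proc (u i))" if "i \<in> {1..N}" for i
  unfolding u_def by (intro sq_int_diff sq_int_add b particle_sq_int r that)
 note a = feedback_sq_int_Q[OF prog sq]
 have g: "sq_int ?TQ (proc g)"
  using gradient_sq_int(1)[OF prob_Q a] by (simp add: g_def)
 note gP = sq_int_lift(1)[OF _ g] and sP = sq_int_lift(1)[OF _ state_sq_int_Q[OF prog sq]]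
  and bP = sq_int_lift(1)[OF _ sq]
 have d: "sq_int ?TP d"
  unfolding d_def[abs_def] by (intro sq_int_diff r mean_state_sq_int_P prog sq)
 have each: "total_cost Q ?a + ((\<integral>x. g (fst x) (pth i (snd x)) \<bullet> proc (b i) x \<partial>?TP) +
   (\<integral>x. g (fst x) (pth i (snd x)) \<bullet> proc (X b i) x \<partial>?TP) - (\<integral>x. g (fst x) (pth i (snd x)) \<bullet> d x \<partial>?TP))
   \<le> total_cost P (u i) + ((\<integral>x. proc g x \<bullet> proc \<beta> x \<partial>?TQ) + (\<integral>x. proc g x \<bullet> proc (state T \<beta>) x \<partial>?TQ))"
  if i: "i \<in> {1..N}" for i
 proof -
  let ?g = "%x. g (fst x) (pth i (snd x))"
  have gi: "proc (%t z. g t z \<bullet> h t z) \<in> borel_measurable (T \<otimes> path_space T)" if "sq_int ?TQ (proc h)" for h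
   using borel_measurable_inner[OF sq_int_measurable[OF g] sq_int_measurable[OF that]] unfolding measurable_time_Q .
  note lb = integral_lift[OF i gi[OF sq]] and ls = integral_lift[OF i gi[OF state_sq_int_Q[OF prog sq]]]
  have eq: "?g x \<bullet> (proc (u i) x - ?a (fst x) (pth i (snd x))) =
   ?g x \<bullet> proc (b i) x + ?g x \<bullet> proc (X b i) x - ?g x \<bullet> d x - (?g x \<bullet> \<beta> (fst x) (pth i (snd x)) + ?g x \<bullet> state T \<beta> (fst x) (pth i (snd x)))" for x
   by (simp add: u_def feedback_def d_def algebra_simps)
  note I = sq_int_inner[OF gP[OF i] b[OF i]] sq_int_inner[OF gP[OF i] particle_sq_int[OF i]] sq_int_inner[OF gP[OF i] d]
   sq_int_inner[OF gP[OF i] bP[OF i]] sq_int_inner[OF gP[OF i] sP[OF i]]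
  have "(\<integral>x. ?g x \<bullet> (proc (u i) x - ?a (fst x) (pth i (snd x))) \<partial>?TP) =
   (\<integral>x. ?g x \<bullet> proc (b i) x \<partial>?TP) + (\<integral>x. ?g x \<bullet> proc (X b i) x \<partial>?TP) - (\<integral>x. ?g x \<bullet> d x \<partial>?TP)
   - ((\<integral>x. proc g x \<bullet> proc \<beta> x \<partial>?TQ) + (\<integral>x. proc g x \<bullet> proc (state T \<beta>) x \<partial>?TQ))"
   unfolding eq lb ls using I by simp
  moreover have "total_cost Q ?a + (\<integral>x. ?g x \<bullet> (proc (u i) x - ?a (fst x) (pth i (snd x))) \<partial>?TP) \<le> total_cost P (u i)"
   using total_cost_tangent[OF prob_space_axioms sq_int_lift(1)[OF i a] u[OF i]]
   by (simp add: g_def total_cost_lift[OF prog sq a i])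
  ultimately show ?thesis by linarith
 qed
 have "1 / real N * (\<Sum>i=1..N. total_cost Q ?a + ((\<integral>x. g (fst x) (pth i (snd x)) \<bullet> proc (b i) x \<partial>?TP) +
   (\<integral>x. g (fst x) (pth i (snd x)) \<bullet> proc (X b i) x \<partial>?TP) - (\<integral>x. g (fst x) (pth i (snd x)) \<bullet> d x \<partial>?TP)))
  \<le> 1 / real N * (\<Sum>i=1..N. total_cost P (u i) + ((\<integral>x. proc g x \<bullet> proc \<beta> x \<partial>?TQ) + (\<integral>x. proc g x \<bullet> proc (state T \<beta>) x \<partial>?TQ)))"
  by (intro mult_left_mono sum_mono each) auto
 moreover have "1 / real N * (\<Sum>i=1..N. \<integral>x. g (fst x) (pth i (snd x)) \<bullet> proc (X b i) x \<partial>?TP) = (\<integral>x. proc g x \<bullet> proc (state T \<beta>) x \<partial>?TQ)"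
  by (rule projected_state[OF b prog sq proj g])
 ultimately have J: "total_cost Q ?a \<le> 1 / real N * (\<Sum>i=1..N. total_cost P (u i)) + 1 / real N * (\<Sum>i=1..N. \<integral>x. g (fst x) (pth i (snd x)) \<bullet> d x \<partial>?TP)"
  unfolding sum.distrib sum_subtractf distrib_left right_diff_distrib average_const
   proj[OF g] by linarith
 show ?thesis using J unfolding u_def d_def .
qed

text \<open>The remaining linear term pairs the averaged gradient with the centered process \<open>Y - E Y\<close>. Subtracting
from the averaged gradient its mean, a function of time, does not change this, and what is left
is an average of independent centered terms.\<close>

proposition projected_cost:
 shows "total_cost Q (feedback Q T \<beta>) \<le> 1 / real N * (\<Sum>i=1..N. total_cost P (control i)) +
  sqrt (50 * lf\<^sup>2 * (T + 4 / lam * total_cost Q (feedback Q T \<beta>))) * sqrt (nsq (T \<otimes> P) (proc barycenter)) / sqrt (real N)"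
proof -
 let ?TP = "T \<otimes> P" and ?TQ = "T \<otimes> Q" and ?a = "feedback Q T \<beta>"
 define g where "g t z = gradient (f t) (?a t z)" for t z
 define d where "d x = proc barycenter x - mean_state Q T \<beta> (fst x)" for x
 define gm where "gm x = (1 / real N) *\<^sub>R (\<Sum>i=1..N. g (fst x) (pth i (snd x))) - (\<integral>z. g (fst x) z \<partial>Q)" for x
 note a = feedback_sq_int_Q[OF prog sq]
 have g: "sq_int ?TQ (proc g)" and gn: "nsq ?TQ (proc g) \<le> 50 * lf\<^sup>2 * (T + nsq ?TQ (proc ?a))"
  using gradient_sq_int[OF prob_Q a] by (simp_all add: g_def)
 have gn': "nsq ?TQ (proc g) \<le> 50 * lf\<^sup>2 * (T + 4 / lam * total_cost Q ?a)"
 proof (rule order_trans[OF gn], intro mult_left_mono add_left_mono)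
  show "nsq ?TQ (proc ?a) \<le> 4 / lam * total_cost Q ?a"
   using total_cost_lower[OF finQ a] lam_pos by (simp add: field_simps)
 qed simp
 note gP = sq_int_lift(1)[OF _ g]
 have d: "sq_int ?TP d"
  unfolding d_def[abs_def] by (intro sq_int_diff barycenter_sq_int mean_state_sq_int_P prog sq)
 have mg: "sq_int (time T) (%t. \<integral>z. g t z \<partial>Q)" by (rule mean_sq_int[OF prob_Q g])
 have gm: "sq_int ?TP gm"
  unfolding gm_def[abs_def]
  by (intro sq_int_diff sq_int_scaleR sq_int_sum gP sq_int_time_lift[OF prob_space_axioms mg])
 have gmN: "nsq ?TP gm \<le> nsq ?TQ (proc g) / real N"
  using variance[OF g] gm unfolding gm_def[abs_def] by blast
 have J: "total_cost Q ?a \<le> 1 / real N * (\<Sum>i=1..N. total_cost P (control i)) + 1 / real N * (\<Sum>i=1..N. \<integral>x. g (fst x) (pth i (snd x)) \<bullet> d x \<partial>?TP)"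
  using projected_cost_relative[OF barycenter_sq_int] unfolding g_def d_def control_def[abs_def] .
 have "1 / real N * (\<Sum>i=1..N. \<integral>x. g (fst x) (pth i (snd x)) \<bullet> d x \<partial>?TP) = (\<integral>x. ((1 / real N) *\<^sub>R (\<Sum>i=1..N. g (fst x) (pth i (snd x)))) \<bullet> d x \<partial>?TP)"
  unfolding inner_scaleR_left inner_sum_left integral_mult_right_zero
  by (subst Bochner_Integration.integral_sum[OF sq_int_inner[OF gP d]]) auto
 also have "\<dots> = (\<integral>x. gm x \<bullet> d x + (\<integral>z. g (fst x) z \<partial>Q) \<bullet> d x \<partial>?TP)"
  by (simp add: gm_def inner_diff_left)
 also have "\<dots> = (\<integral>x. gm x \<bullet> d x \<partial>?TP) + (\<integral>x. (\<integral>z. g (fst x) z \<partial>Q) \<bullet> d x \<partial>?TP)"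
  by (intro Bochner_Integration.integral_add sq_int_inner gm d sq_int_time_lift[OF prob_space_axioms mg])
 also have "(\<integral>x. (\<integral>z. g (fst x) z \<partial>Q) \<bullet> d x \<partial>?TP) = 0"
  unfolding d_def by (rule barycenter_centered[OF mg])
 also have "(\<integral>x. gm x \<bullet> d x \<partial>?TP) \<le> sqrt (nsq ?TP gm) * sqrt (nsq ?TP d)"
  using Cauchy_Schwarz_integral[OF gm d] by linarith
 also have "\<dots> \<le> sqrt (50 * lf\<^sup>2 * (T + 4 / lam * total_cost Q ?a) / real N) * sqrt (nsq ?TP (proc barycenter))"
  using order_trans[OF gmN divide_right_mono[OF gn']] barycenter_fluctuation
  by (intro mult_mono real_sqrt_le_mono) (auto simp: d_def[abs_def] nsq_nonneg intro!: real_sqrt_ge_zero order_trans[OF nsq_nonneg])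
 finally have "1 / real N * (\<Sum>i=1..N. \<integral>x. g (fst x) (pth i (snd x)) \<bullet> d x \<partial>?TP) \<le>
  sqrt (50 * lf\<^sup>2 * (T + 4 / lam * total_cost Q ?a)) * sqrt (nsq ?TP (proc barycenter)) / sqrt (real N)"
  by (simp add: real_sqrt_divide)
 with J show ?thesis by linarith
qed

end

end

section \<open>Admissible controls and canonical drifts\<close>

context brownian_setup
begin

lemma F0_measurable_P:
 assumes "\<xi> \<in> borel_measurable F0"
 shows "\<xi> \<in> borel_measurable P"
 by (rule measurable_from_subalg[OF _ assms]) (use F0 in \<open>auto simp: subalgebra_def\<close>)

lemma initial_sq_int:
 fixes \<xi> :: "'w => real ^ 'm"
 assumes "\<xi> \<in> borel_measurable F0" "law M \<xi> \<in> P2"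
 shows "sq_int P \<xi>" and "nsq P \<xi> = (\<integral>x. (norm x)\<^sup>2 \<partial>law M \<xi>)"
proof -
 note m = F0_measurable_P[OF assms(1)]
 have "sq_int (law M \<xi>) (%x. x)" using assms(2) by (simp add: P2_def sq_int_def law_def)
 then show "sq_int P \<xi>" using sq_int_distr[OF m, of "%x. x"] by (simp add: law_def)
 show "nsq P \<xi> = (\<integral>x. (norm x)\<^sup>2 \<partial>law M \<xi>)"
  using nsq_distr[OF m, of "%x. x"] by (simp add: law_def nsq_def)
qed

lemma indep_vars_initial:
 fixes \<xi> :: "nat => 'w => real ^ 'm"
 assumes ind: "indep_vars (%_. borel) \<xi> {1..N}" and ij: "i \<in> {1..N}" "j \<in> {1..N}" "i \<noteq> j"
  and AB: "A \<in> sets borel" "B \<in> sets borel"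
 shows "emeasure P ({\<omega>\<in>space M. \<xi> i \<omega> \<in> A} \<inter> {\<omega>\<in>space M. \<xi> j \<omega> \<in> B}) =
  emeasure P {\<omega>\<in>space M. \<xi> i \<omega> \<in> A} * emeasure P {\<omega>\<in>space M. \<xi> j \<omega> \<in> B}"
proof -
 let ?A = "%k. if k = i then A else B"
 have m: "\<xi> k \<in> borel_measurable M" if "k \<in> {1..N}" for k
  using ind that by (auto simp: indep_vars_def)
 have "prob (\<Inter>k\<in>{i, j}. \<xi> k -` ?A k \<inter> space M) = (\<Prod>k\<in>{i, j}. prob (\<xi> k -` ?A k \<inter> space M))"
  using ij AB by (intro indep_varsD[OF ind]) auto
 then have p: "prob ({\<omega>\<in>space M. \<xi> i \<omega> \<in> A} \<inter> {\<omega>\<in>space M. \<xi> j \<omega> \<in> B}) = prob {\<omega>\<in>space M. \<xi> i \<omega> \<in> A} * prob {\<omega>\<in>space M. \<xi> j \<omega> \<in> B}"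
  using ij by (simp add: vimage_def Int_def conj_commute conj_left_commute)
 have s: "{\<omega>\<in>space M. \<xi> i \<omega> \<in> A} \<in> sets M" "{\<omega>\<in>space M. \<xi> j \<omega> \<in> B} \<in> sets M"
  using sets_Collect_mem[OF m AB(1)] sets_Collect_mem[OF m AB(2)] ij by auto
 from p show ?thesis
  using s sets.Int[OF s] by (simp add: emeasure_completion emeasure_eq_measure ennreal_mult)
qed

end

lemma prim_cong: "(!!s. s \<in> {0..T} ==> g s = h s) ==> prim T g t = prim T h t"
 unfolding prim_def by (intro Bochner_Integration.integral_cong refl) (simp add: space_time)

lemma progressive_scaleR: "progressive F T a ==> progressive F T (%t \<omega>. c *\<^sub>R a t \<omega>)"
 unfolding progressive_def split_beta' by (auto intro!: borel_measurable_scaleR)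

lemma progressive_diff:
 assumes "progressive F T a" "progressive F T b"
 shows "progressive F T (%t \<omega>. a t \<omega> - b t \<omega>)"
 using assms unfolding progressive_def split_beta' by (auto intro!: borel_measurable_diff)

lemma progressive_sum:
 assumes "!!i. i \<in> I ==> progressive F T (a i)"
 shows "progressive F T (%t \<omega>. \<Sum>i\<in>I. a i t \<omega>)"
 using assms unfolding progressive_def split_beta' by (auto intro!: borel_measurable_sum)

lemma progressive_time:
 assumes m: "m \<in> borel_measurable (time T)"
 shows "progressive F T (%t \<omega>. m t)"
 unfolding progressive_def split_beta'
proof
 fix t assume t: "t \<in> {0..T}"
 have "m \<in> borel_measurable (restrict_space borel {0..T})"
  using m measurable_cong_sets[OF sets_time refl] by blast
 then have "m \<in> borel_measurable (restrict_space borel {0..t})"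
  by (rule measurable_restrict_mono) (use t in auto)
 from measurable_compose[OF measurable_fst this] show "(%x. m (fst x)) \<in> borel_measurable (restrict_space borel {0..t} \<Otimes>\<^sub>M F t)" .
qed

text \<open>The point \<open>\<xi>0\<close> is any admissible starting point; it only serves to define the path law \<open>Q\<close>, which depends
on \<open>\<mu>_in\<close> alone.\<close>

locale control_problem = brownian_setup M F0 W T + cost T lf lam f
 for M F0 :: "'w::polish_space measure" and W :: "nat => real => 'w => real ^ 'm" and T lf lam
  and f :: "real => real ^ 'm => real" +
 fixes \<mu>_in \<mu>_fin :: "(real ^ 'm) measure" and \<xi>0 :: "'w => real ^ 'm"
 assumes \<mu>_in: "\<mu>_in \<in> P2" and \<mu>_fin: "\<mu>_fin \<in> P2"
  and \<xi>0: "\<xi>0 \<in> borel_measurable F0" "law M \<xi>0 = \<mu>_in"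
begin

definition Q :: "(real => real ^ 'm) measure" where
 "Q = started_bm.path_law P T (start 1 \<xi>0)"

abbreviation half_sq :: "real ^ 'm => real" where "half_sq \<equiv> %x. (norm x)\<^sup>2 / 2"

definition initial_moment :: real where "initial_moment = (\<integral>x. (norm x)\<^sup>2 \<partial>\<mu>_in)"

definition canonical_drift :: "(real => (real => real ^ 'm) => real ^ 'm) => bool" where
 "canonical_drift \<beta> \<longleftrightarrow> progressive_on_paths T \<beta> \<and> sq_int (T \<otimes> Q) (proc \<beta>) \<and>
   distr Q borel (state T \<beta> T) \<le>\<^sub>c\<^sub>v\<^sub>x \<mu>_fin"

lemma started:
 assumes "i \<in> {1..N}" "\<xi> \<in> borel_measurable F0" "law M \<xi> = \<mu>_in"
 shows "started_bm P (filt M F0 W N) T (start i \<xi>)" and "started_bm.path_law P T (start i \<xi>) = Q"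
  and "nsq P (start i \<xi> 0) \<le> initial_moment"
proof -
 have sq: "sq_int P \<xi>" "sq_int P \<xi>0" using initial_sq_int(1) assms \<xi>0 \<mu>_in by auto
 show a: "started_bm P (filt M F0 W N) T (start i \<xi>)"
  by (rule started_bm_filt[OF T_pos assms(1,2) sq(1)])
 have b: "started_bm P (filt M F0 W 1) T (start 1 \<xi>0)"
  by (rule started_bm_filt[OF T_pos _ \<xi>0(1) sq(2)]) simp
 show "started_bm.path_law P T (start i \<xi>) = Q"
  unfolding Q_def by (rule path_law_unique[OF a b]) (use assms(3) \<xi>0(2) in \<open>simp add: start_0 law_def\<close>)
 show "nsq P (start i \<xi> 0) \<le> initial_moment"
  using initial_sq_int(2)[OF assms(2)] assms(3) \<mu>_in by (simp add: start_0 initial_moment_def)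
qed

lemma particle_family:
 assumes N: "1 \<le> N" and \<xi>: "!!i. i \<in> {1..N} ==> \<xi> i \<in> borel_measurable F0" "!!i. i \<in> {1..N} ==> law M (\<xi> i) = \<mu>_in"
  and ind: "indep_vars (%_. borel) \<xi> {1..N}"
 shows "particle_cost P (filt M F0 W N) T N (%i. start i (\<xi> i)) Q lf lam f"
proof (intro particle_cost.intro bm_family.intro bm_family_axioms.intro prob_space_P cost_axioms N)
 fix i assume i: "i \<in> {1..N}"
 note st = started[OF i \<xi>[OF i]]
 show "started_bm P (filt M F0 W N) T (start i (\<xi> i))" by (rule st(1))
 show "started_bm.path_law P T (start i (\<xi> i)) = Q" by (rule st(2))
 fix j and D D' :: "(real => real ^ 'm) set" assume j: "j \<in> {1..N}" and ne: "i \<noteq> j" and D: "D \<in> sets (path_space T)" "D' \<in> sets (path_space T)"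
 have sq: "sq_int P (\<xi> k)" if "k \<in> {1..N}" for k
  using initial_sq_int(1)[OF \<xi>(1)[OF that]] \<xi>(2)[OF that] \<mu>_in by simp
 have ij: "1 \<le> i" "1 \<le> j" using i j by auto
 have "emeasure P ({\<omega>\<in>space M. started_bm.path T (start i (\<xi> i)) \<omega> \<in> D} \<inter> {\<omega>\<in>space M. started_bm.path T (start j (\<xi> j)) \<omega> \<in> D'}) =
   emeasure (started_bm.path_law P T (start i (\<xi> i))) D * emeasure (started_bm.path_law P T (start j (\<xi> j))) D'"
  by (rule paths_independent[OF T_pos ij ne \<xi>(1)[OF i] sq[OF i] \<xi>(1)[OF j] sq[OF j] indep_vars_initial[OF ind i j ne] D])
 then show "emeasure P ({\<omega>\<in>space P. started_bm.path T (start i (\<xi> i)) \<omega> \<in> D} \<inter> {\<omega>\<in>space P. started_bm.path T (start j (\<xi> j)) \<omega> \<in> D'}) =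
   emeasure Q D * emeasure Q D'"
  unfolding st(2) started(2)[OF j \<xi>[OF j]] space_completion .
qed

lemma indep_vars_single:
 assumes "\<xi> \<in> borel_measurable M"
 shows "indep_vars (%_. borel) (%_. \<xi>) {1..1::nat}"
 unfolding indep_vars_def2
proof (intro conjI ballI indep_setsI)
 show "\<xi> \<in> borel_measurable M" by fact
 show "{\<xi> -` A \<inter> space M |A. A \<in> sets borel} \<subseteq> events"
  using assms by (auto intro: measurable_sets)
 fix A and J :: "nat set" assume "J \<noteq> {}" "J \<subseteq> {1..1}"
 then have "J = {1}" by auto
 then show "prob (\<Inter>j\<in>J. A j) = (\<Prod>j\<in>J. prob (A j))" by simp
qed

lemma single_family:
 assumes \<xi>: "\<xi> \<in> borel_measurable F0" "law M \<xi> = \<mu>_in"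
 shows "particle_cost P (filt M F0 W 1) T 1 (%i. start i \<xi>) Q lf lam f"
proof (rule particle_family)
 show "indep_vars (%_. borel) (%_. \<xi>) {1..1::nat}"
  by (rule indep_vars_single[OF measurable_from_subalg[OF F0 \<xi>(1)]])
qed (use \<xi> in auto)

text \<open>A drift that follows \<open>\<beta>\<close> along the path solves the equation, and its state at each time is the
canonical state evaluated at the path.\<close>

lemma path_solution:
 assumes i: "i \<in> {1..N}" and \<xi>: "\<xi> \<in> borel_measurable F0" "law M \<xi> = \<mu>_in" and \<beta>: "canonical_drift \<beta>"
  and d: "!!s \<omega>. s \<in> {0..T} ==> \<omega> \<in> space M ==> d s \<omega> = \<beta> s (started_bm.path T (start i \<xi>) \<omega>)"
 defines "X \<equiv> %t \<omega>. start i \<xi> t \<omega> + prim T (%s. \<beta> s (started_bm.path T (start i \<xi>) \<omega>)) t"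
 shows "X 0 = \<xi>" and "solves_sde M (filt M F0 W N) T (W i) d X" and "law M (X T) \<le>\<^sub>c\<^sub>v\<^sub>x \<mu>_fin"
  and "t \<in> {0..T} ==> \<omega> \<in> space M ==> X t \<omega> = state T \<beta> t (started_bm.path T (start i \<xi>) \<omega>)"
  and "t \<in> {0..T} ==> X t \<in> borel_measurable P"
  and "t \<in> {0..T} ==> integrable P (X t)" and "t \<in> {0..T} ==> (\<integral>\<omega>. X t \<omega> \<partial>P) = mean_state Q T \<beta> t"
proof -
 interpret a: started_bm P "filt M F0 W N" T "start i \<xi>" by (rule started[OF i \<xi>])
 have Q: "a.path_law = Q" by (rule started[OF i \<xi>])
 have prog: "progressive_on_paths T \<beta>" and sq: "sq_int (T \<otimes> a.path_law) (proc \<beta>)"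
  and le: "distr Q borel (state T \<beta> T) \<le>\<^sub>c\<^sub>v\<^sub>x \<mu>_fin"
  using \<beta> by (auto simp: canonical_drift_def Q)
 have i1: "1 \<le> i" using i by simp
 show 0: "X 0 = \<xi>" by (simp add: X_def start_0 prim_zero_time fun_eq_iff)
 show st: "X t \<omega> = state T \<beta> t (a.path \<omega>)" if "t \<in> {0..T}" "\<omega> \<in> space M" for t \<omega>
  using a.state_path[of \<omega> t \<beta>] that by (simp add: X_def)
 have pb: "progressive (filt M F0 W N) T (%t \<omega>. \<beta> t (a.path \<omega>))"
  by (rule progressive_transfer[OF a.started_bm_axioms prog])
 have ad: "X t \<in> borel_measurable (filt M F0 W N t)" if t: "t \<in> {0..T}" for t
  unfolding X_def
  by (intro borel_measurable_add a.Z_adapted[OF t] prim_progressive(2)[OF a.progressive_measurable(1)[OF pb t] t])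
 then show Xm: "X t \<in> borel_measurable P" if "t \<in> {0..T}" for t
  using a.F_measurable that by blast
 have "sq_int P (X t)" if t: "t \<in> {0..T}" for t
  by (rule sq_int_cong_AE[OF _ Xm[OF t] a.state_at_sq_int(3)[OF prog sq t]]) (use st[OF t] in auto)
 then show "integrable P (X t)" if "t \<in> {0..T}" for t
  using a.sq_int_integrable that by blast
 show "(\<integral>\<omega>. X t \<omega> \<partial>P) = mean_state Q T \<beta> t" if t: "t \<in> {0..T}" for t
  unfolding Q[symmetric] a.mean_state_eq[OF prog sq t]
  by (intro Bochner_Integration.integral_cong refl) (simp add: st[OF t])
 have "AE \<omega> in P. sq_int (time T) (%s. \<beta> s (a.path \<omega>))"
  using sq_int_paths(1)[OF a.fin, of T "%t \<omega>. \<beta> t (a.path \<omega>)"] a.\<beta>_path_sq_int[OF prog sq] by simp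
 with start_AE[OF i1, of \<xi>] AE_space
 have "AE \<omega> in P. set_integrable lborel {0..T} (%s. d s \<omega>) \<and>
   (\<forall>t\<in>{0..T}. X t \<omega> = X 0 \<omega> + (LINT s:{0..t}|lborel. d s \<omega>) + (W i t \<omega> - W i 0 \<omega>))"
 proof eventually_elim
  case (elim \<omega>)
  then have \<omega>: "\<omega> \<in> space M" by simp
  have "integrable (time T) (%s. \<beta> s (a.path \<omega>))"
   by (rule finite_measure.sq_int_integrable[OF finite_measure_time elim(3)])
  then have "set_integrable lborel {0..T} (%s. \<beta> s (a.path \<omega>))"
   by (simp add: integrable_time_iff)
  also have "?this \<longleftrightarrow> set_integrable lborel {0..T} (%s. d s \<omega>)"
   by (intro set_integrable_cong refl) (simp add: d[OF _ \<omega>])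
  finally have si: "set_integrable lborel {0..T} (%s. d s \<omega>)" .
  have "prim T (%s. \<beta> s (a.path \<omega>)) t = (LINT s:{0..t}|lborel. d s \<omega>)" if t: "t \<in> {0..T}" for t
   unfolding prim_eq[OF t] using t
   by (intro set_lebesgue_integral_cong) (auto simp: d[OF _ \<omega>])
  then show ?case using si elim(1) by (simp add: X_def start_0 prim_zero_time)
 qed
 then show "solves_sde M (filt M F0 W N) T (W i) d X"
  using ad by (simp add: solves_sde_def AE_completion_iff)
 have T: "T \<in> {0..T}" using T_pos by simp
 have "law M (X T) = distr P borel (%\<omega>. state T \<beta> T (a.path \<omega>))"
  unfolding law_def by (intro distr_cong refl) (simp add: st[OF T])
 also have "\<dots> = distr Q borel (state T \<beta> T)"
  unfolding Q[symmetric] a.path_law_def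
  by (subst distr_distr[OF a.state_at_measurable[OF prog sq T] a.path_measurable]) (simp add: comp_def)
 finally show "law M (X T) \<le>\<^sub>c\<^sub>v\<^sub>x \<mu>_fin" using le by simp
qed

lemma solution_path:
 assumes i: "i \<in> {1..N}" and sol: "solves_sde M (filt M F0 W N) T (W i) d X"
 shows "AE \<omega> in P. integrable (time T) (%s. d s \<omega>) \<and> (\<forall>t\<in>{0..T}. X t \<omega> = start i (X 0) t \<omega> + prim T (%s. d s \<omega>) t)"
proof -
 have i1: "1 \<le> i" using i by simp
 have "AE \<omega> in P. set_integrable lborel {0..T} (%s. d s \<omega>) \<and>
   (\<forall>t\<in>{0..T}. X t \<omega> = X 0 \<omega> + (LINT s:{0..t}|lborel. d s \<omega>) + (W i t \<omega> - W i 0 \<omega>))"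
  using sol by (simp add: solves_sde_def AE_completion_iff)
 with start_AE[OF i1, of "X 0"] show ?thesis
 proof eventually_elim
  case (elim \<omega>)
  have "X t \<omega> = start i (X 0) t \<omega> + prim T (%s. d s \<omega>) t" if t: "t \<in> {0..T}" for t
  proof -
   have "X t \<omega> = X 0 \<omega> + (LINT s:{0..t}|lborel. d s \<omega>) + (W i t \<omega> - W i 0 \<omega>)" using elim(2) t by blast
   moreover have "start i (X 0) t \<omega> = X 0 \<omega> + (W i t \<omega> - W i 0 \<omega>)" using elim(1) by blast
   ultimately show ?thesis by (simp add: prim_eq[OF t])
  qed
  then show ?case using elim(2) unfolding integrable_time_iff by blast
 qed
qed

lemma solution_version:
 assumes i: "i \<in> {1..N}" and sol: "solves_sde M (filt M F0 W N) T (W i) d X"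
  and \<xi>: "X 0 \<in> borel_measurable F0" "law M (X 0) = \<mu>_in"
 obtains X' where "progressive (filt M F0 W N) T X'" "AE \<omega> in P. \<forall>t. X' t \<omega> = X t \<omega>"
  "\<forall>\<omega>\<in>space P. continuous_on {0..T} (%t. X' t \<omega>)"
proof -
 interpret a: started_bm P "filt M F0 W N" T "start i (X 0)" by (rule started[OF i \<xi>])
 show ?thesis
 proof (rule a.continuous_version)
  show "A \<in> sets (filt M F0 W N t)" if "t \<in> {0..T}" "A \<in> null_sets P" for t A
   using filt_facts(4)[of t N A] that i by auto
  show "X t \<in> borel_measurable (filt M F0 W N t)" if "t \<in> {0..T}" for t
   using sol that by (simp add: solves_sde_def)
  show "AE \<omega> in P. continuous_on {0..T} (%t. X t \<omega>)"
   using solution_path[OF i sol] AE_space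
  proof eventually_elim
   case (elim \<omega>)
   have "continuous_on {0..T} (%t. start i (X 0) t \<omega> + prim T (%s. d s \<omega>) t)"
    using elim by (intro continuous_on_add a.Z_continuous continuous_on_prim) auto
   moreover have "continuous_on {0..T} (%t. start i (X 0) t \<omega> + prim T (%s. d s \<omega>) t) \<longleftrightarrow> continuous_on {0..T} (%t. X t \<omega>)"
    using elim(1) by (intro continuous_on_cong refl) simp
   ultimately show ?case by simp
  qed
 next
  fix X' assume X': "progressive (filt M F0 W N) T X'" "AE \<omega> in P. \<forall>t. X' t \<omega> = X t \<omega>"
   and c: "!!\<omega>. \<omega> \<in> space P ==> continuous_on {0..T} (%t. X' t \<omega>)"
  have "\<forall>\<omega>\<in>space P. continuous_on {0..T} (%t. X' t \<omega>)" by (intro ballI c)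
  with X' show thesis by (rule that)
 qed
qed

text \<open>The step common to both problems: drifts are projected, and the constraint on the terminal law is kept. The
mean field problem is the case of one path.\<close>

lemma canonical_projection:
 fixes \<xi> :: "nat => 'w => real ^ 'm"
 assumes fam: "particle_cost P (filt M F0 W N) T N (%i. start i (\<xi> i)) Q lf lam f"
  and b: "!!i. i \<in> {1..N} ==> sq_int (T \<otimes> P) (proc (b i))" "!!i. i \<in> {1..N} ==> progressive (filt M F0 W N) T (b i)"
  and X: "!!i. i \<in> {1..N} ==> AE \<omega> in P. \<forall>t\<in>{0..T}. X i t \<omega> = start i (\<xi> i) t \<omega> + prim T (%s. b i s \<omega>) t"
  and Xm: "!!i. i \<in> {1..N} ==> X i T \<in> borel_measurable P"
  and le: "!!i. i \<in> {1..N} ==> law M (X i T) \<le>\<^sub>c\<^sub>v\<^sub>x \<mu>_fin"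
 obtains \<beta> where "canonical_drift \<beta>" "!!g. sq_int (T \<otimes> Q) (proc g) ==>
   1 / real N * (\<Sum>i=1..N. \<integral>x. g (fst x) (started_bm.path T (start i (\<xi> i)) (snd x)) \<bullet> proc (b i) x \<partial>(T \<otimes> P)) =
   (\<integral>x. proc g x \<bullet> proc \<beta> x \<partial>(T \<otimes> Q))"
proof -
 interpret c: particle_cost P "filt M F0 W N" T N "%i. start i (\<xi> i)" Q lf lam f by (rule fam)
 show ?thesis
 proof (rule c.averaged_projection[where b = b, OF b])
 fix \<beta> assume \<beta>: "progressive_on_paths T \<beta>" "sq_int (T \<otimes> Q) (proc \<beta>)"
  and proj: "!!g. sq_int (T \<otimes> Q) (proc g) ==>
   1 / real N * (\<Sum>i=1..N. \<integral>x. g (fst x) (c.pth i (snd x)) \<bullet> proc (b i) x \<partial>(T \<otimes> P)) =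
   (\<integral>x. proc g x \<bullet> proc \<beta> x \<partial>(T \<otimes> Q))"
 have T: "T \<in> {0..T}" using T_pos by simp
 have fin: "prob_space \<mu>_fin" "integrable \<mu>_fin (%x. x)"
 proof -
  show "prob_space \<mu>_fin" using \<mu>_fin by (simp add: P2_def)
  then interpret m: prob_space \<mu>_fin .
  have "sets \<mu>_fin = sets borel" using \<mu>_fin by (simp add: P2_def)
  then have "(%x. x) \<in> borel_measurable \<mu>_fin" by (intro measurable_ident_sets)
  then have "sq_int \<mu>_fin (%x. x)" using \<mu>_fin by (simp add: sq_int_def P2_def)
  then show "integrable \<mu>_fin (%x. x)" by (rule m.sq_int_integrable)
 qed
 have "distr Q borel (state T \<beta> T) \<le>\<^sub>c\<^sub>v\<^sub>x \<mu>_fin"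
 proof (rule c.projected_state_cvx_le[OF b(1) \<beta> proj fin])
  fix i assume i: "i \<in> {1..N}"
  have eq: "c.X b i T \<omega> = start i (\<xi> i) T \<omega> + prim T (%s. b i s \<omega>) T" for \<omega>
   by (rule c.particle_eq[OF b(1) \<beta> proj])
  have "distr P borel (c.X b i T) = law M (X i T)"
   unfolding law_def
  proof (rule distr_cong_AE[OF refl refl _ _ Xm[OF i]])
   show "AE \<omega> in P. c.X b i T \<omega> = X i T \<omega>"
    using X[OF i] by eventually_elim (use T in \<open>simp add: eq\<close>)
   show "c.X b i T \<in> borel_measurable P"
    by (rule sq_int_measurable[OF c.particle_at_sq_int[OF b(1) \<beta> proj i T]])
  qed
  then show "distr P borel (c.X b i T) \<le>\<^sub>c\<^sub>v\<^sub>x \<mu>_fin" using le[OF i] by simp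
 qed
 then have "canonical_drift \<beta>" using \<beta> by (simp add: canonical_drift_def)
 then show ?thesis using proj by (rule that)
 qed
qed

text \<open>At first the mean \<open>m\<close> of the state is not even known to be
measurable in time; but by the equation it differs from the drift by functions of one good path, which
makes it integrable. Mean reversion then makes the state square integrable and \<open>m\<close> bounded.\<close>

proposition mf_to_canonical:
 assumes adm: "\<alpha> \<in> mf_admissible M F0 W T half_sq f \<mu>_in \<mu>_fin"
 obtains \<beta> where "canonical_drift \<beta>"
  "ennreal (total_cost Q (feedback Q T \<beta>)) \<le> (\<integral>\<^sup>+\<omega>. running_cost T f \<alpha> \<omega> \<partial>P)"
proof -
 let ?F = "filt M F0 W 1"
 have 1: "1 \<in> {1..1::nat}" by simp
 obtain X where \<alpha>p: "progressive ?F T \<alpha>" and cost: "(\<integral>\<^sup>+\<omega>. running_cost T f \<alpha> \<omega> \<partial>P) < \<infinity>"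
  and \<xi>: "X 0 \<in> borel_measurable F0" "law M (X 0) = \<mu>_in"
  and int: "!!t. t \<in> {0..T} ==> AE \<omega> in M. integrable (law M (X t)) (%z. X t \<omega> - z)"
  and sol: "solves_sde M ?F T (W 1) (%t \<omega>. \<alpha> t \<omega> - (\<integral>z. X t \<omega> - z \<partial>law M (X t))) X"
  and le: "law M (X T) \<le>\<^sub>c\<^sub>v\<^sub>x \<mu>_fin"
  using adm unfolding mf_admissible_def gradient_half_norm_sq by blast
 interpret a: started_bm P ?F T "start 1 (X 0)" by (rule started[OF 1 \<xi>])
 interpret tm: finite_measure "time T" by (rule finite_measure_time)
 have ad: "X t \<in> borel_measurable (?F t)" if "t \<in> {0..T}" for t
  using sol that by (simp add: solves_sde_def)
 have XP: "X t \<in> borel_measurable P" if "t \<in> {0..T}" for t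
  by (rule a.F_measurable[OF ad[OF that] that])
 define m where "m t = (\<integral>\<omega>. X t \<omega> \<partial>P)" for t
 have Xint: "integrable P (X t)" and drift: "(\<integral>z. X t \<omega> - z \<partial>law M (X t)) = X t \<omega> - m t"
  if t: "t \<in> {0..T}" for t \<omega>
 proof -
  interpret l: prob_space "law M (X t)" unfolding law_def by (rule a.prob_space_distr[OF XP[OF t]])
  have "AE \<omega> in M. integrable (law M (X t)) (%z. z)"
   using int[OF t]
  proof eventually_elim
   case (elim \<omega>)
   have "integrable (law M (X t)) (%z. X t \<omega> - (X t \<omega> - z))"
    by (intro Bochner_Integration.integrable_diff elim) simp
   then show ?case by simp
  qed
  then have i: "integrable (law M (X t)) (%z. z)" by simp
  then show "integrable P (X t)" using integrable_distr_eq[OF XP[OF t], of "%z. z"] by (simp add: law_def)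
  have "(\<integral>z. z \<partial>law M (X t)) = m t" using integral_distr[OF XP[OF t], of "%z. z"] by (simp add: law_def m_def)
  then show "(\<integral>z. X t \<omega> - z \<partial>law M (X t)) = X t \<omega> - m t" using i by (simp add: l.prob_space)
 qed
 obtain X' where X'p: "progressive ?F T X'" and X': "AE \<omega> in P. \<forall>t. X' t \<omega> = X t \<omega>"
  and X'c: "\<forall>\<omega>\<in>space P. continuous_on {0..T} (%t. X' t \<omega>)"
  using solution_version[OF 1 sol \<xi>] by blast
 note X'c = X'c[rule_format]
 note X'm = a.progressive_measurable(2)[OF X'p] and \<alpha>m = a.progressive_measurable(2)[OF \<alpha>p]
 have \<alpha>2: "sq_int (T \<otimes> P) (proc \<alpha>)" by (rule finite_cost_sq_int[OF a.fin \<alpha>m cost])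
 have \<alpha>i: "AE \<omega> in P. integrable (time T) (%s. \<alpha> s \<omega>)"
  using sq_int_paths(1)[OF a.fin \<alpha>2] by eventually_elim (rule tm.sq_int_integrable)
 have path: "AE \<omega> in P. integrable (time T) (%s. \<alpha> s \<omega> - (X' s \<omega> - m s)) \<and>
   (\<forall>t\<in>{0..T}. X' t \<omega> = start 1 (X 0) t \<omega> + prim T (%s. \<alpha> s \<omega> - (X' s \<omega> - m s)) t)"
  using solution_path[OF 1 sol] X'
 proof eventually_elim
  case (elim \<omega>)
  let ?d = "%t. \<alpha> t \<omega> - (\<integral>z. X t \<omega> - z \<partial>law M (X t))" and ?e = "%s. \<alpha> s \<omega> - (X' s \<omega> - m s)"
  have eq: "?d s = ?e s" if "s \<in> {0..T}" for s using drift[OF that] elim(2) by simp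
  have "integrable (time T) ?d \<longleftrightarrow> integrable (time T) ?e"
   by (intro Bochner_Integration.integrable_cong refl eq) (simp add: space_time)
  moreover have "prim T ?d t = prim T ?e t" for t by (rule prim_cong[OF eq])
  ultimately show ?case using elim by simp
 qed
 \<comment> \<open>A statement about \<open>m\<close> alone: one path on which everything holds is enough\<close>
 have "AE \<omega> in P. integrable (time T) m"
  using path \<alpha>i AE_space
 proof eventually_elim
  case (elim \<omega>)
  have "integrable (time T) (%s. X' s \<omega>)"
   unfolding integrable_time_iff set_integrable_def
   by (intro borel_integrable_compact X'c[OF elim(3)]) simp
  then have "integrable (time T) (%s. (\<alpha> s \<omega> - (X' s \<omega> - m s)) - \<alpha> s \<omega> + X' s \<omega>)"
   by (rule Bochner_Integration.integrable_add[OF Bochner_Integration.integrable_diff[OF conjunct1[OF elim(1)] elim(2)]])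
  moreover have "(%s. (\<alpha> s \<omega> - (X' s \<omega> - m s)) - \<alpha> s \<omega> + X' s \<omega>) = m" by (simp add: fun_eq_iff)
  ultimately show ?case by (simp only:)
 qed
 then have mi: "integrable (time T) m" by simp
 then have mm: "m \<in> borel_measurable (time T)" by (rule borel_measurable_integrable)
 define u where "u s \<omega> = \<alpha> s \<omega> + m s" for s \<omega>
 have um: "proc u \<in> borel_measurable (T \<otimes> P)"
  unfolding u_def by (intro borel_measurable_add \<alpha>m measurable_compose[OF measurable_fst mm])
 have prim_u: "AE \<omega> in P. prim T (%s. u s \<omega>) t = prim T (%s. \<alpha> s \<omega>) t + prim T m t" for t
  using \<alpha>i unfolding u_def by eventually_elim (simp add: prim_add mi)
 have "\<exists>B'. \<forall>t\<in>{0..T}. sq_int P (X' t) \<and> nsq P (X' t) \<le> B'"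
 proof (rule a.mean_reverting_sq_int[OF X'm X'c um])
  show "AE \<omega> in P. integrable (time T) (%s. u s \<omega>)"
   using \<alpha>i unfolding u_def by eventually_elim (simp add: mi)
  show "AE \<omega> in P. \<forall>t\<in>{0..T}. X' t \<omega> = start 1 (X 0) t \<omega> + prim T (%s. u s \<omega> - X' s \<omega>) t"
   using path by eventually_elim (simp add: u_def algebra_simps)
  fix t assume t: "t \<in> {0..T}"
  have s: "sq_int P (%\<omega>. prim T (%s. \<alpha> s \<omega>) t + prim T m t)"
   by (intro sq_int_add prim_at_sq_int(1)[OF a.fin a.T0 t \<alpha>2] a.sq_int_const)
  show p: "sq_int P (%\<omega>. prim T (%s. u s \<omega>) t)"
   by (rule sq_int_cong_AE[OF prim_u prim_at_measurable[OF um t] s])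
  have "nsq P (%\<omega>. prim T (%s. u s \<omega>) t) = nsq P (%\<omega>. prim T (%s. \<alpha> s \<omega>) t + prim T m t)"
   by (rule nsq_cong_AE[OF prim_u sq_int_measurable[OF p] sq_int_measurable[OF s]])
  also have "\<dots> \<le> 2 * nsq P (%\<omega>. prim T (%s. \<alpha> s \<omega>) t) + 2 * nsq P (%\<omega>. prim T m t)"
   by (intro nsq_add prim_at_sq_int(1)[OF a.fin a.T0 t \<alpha>2] a.sq_int_const)
  also have "nsq P (%\<omega>. prim T m t) = (norm (prim T m t))\<^sup>2" by (simp add: nsq_def a.prob_space[simplified])
  also have "\<dots> \<le> (\<integral>s. norm (m s) \<partial>time T)\<^sup>2" by (intro power_mono norm_prim_le mi) simp
  finally show "nsq P (%\<omega>. prim T (%s. u s \<omega>) t) \<le> 2 * (T * nsq (T \<otimes> P) (proc \<alpha>)) + 2 * (\<integral>s. norm (m s) \<partial>time T)\<^sup>2"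
   using prim_at_sq_int(2)[OF a.fin a.T0 t \<alpha>2] by simp
 qed
 then obtain B where B: "!!t. t \<in> {0..T} ==> sq_int P (X' t)" "!!t. t \<in> {0..T} ==> nsq P (X' t) \<le> B" by blast
 have X'2: "sq_int (T \<otimes> P) (proc X')"
  using sq_int_proc_bounded(1)[where X = X' and B = B, OF a.fin a.T0 X'm B] by blast
 have m': "m t = (\<integral>\<omega>. X' t \<omega> \<partial>P)" if t: "t \<in> {0..T}" for t
  unfolding m_def
  by (rule integral_cong_AE[OF XP[OF t] sq_int_measurable[OF B(1)[OF t]]]) (use X' in eventually_elim, simp)
 have m2: "sq_int (time T) m"
 proof (rule sq_int_bound[OF mm, of "%_. B"])
  show "(norm (m t))\<^sup>2 \<le> B" if "t \<in> space (time T)" for t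
   using a.norm_expectation_sq_le[OF B(1)] B(2) that m' by (fastforce simp: space_time)
 qed simp
 define b where "b s \<omega> = \<alpha> s \<omega> - (X' s \<omega> - m s)" for s \<omega>
 note mP = sq_int_time_lift[OF prob_space_P m2]
 have b: "sq_int (T \<otimes> P) (proc b)" "progressive ?F T b"
  unfolding b_def
  by (intro sq_int_diff \<alpha>2 X'2 mP) (intro progressive_diff \<alpha>p X'p progressive_time mm)
 have Xb: "AE \<omega> in P. \<forall>t\<in>{0..T}. X t \<omega> = start 1 (X 0) t \<omega> + prim T (%s. b s \<omega>) t"
  using path X' by eventually_elim (simp add: b_def)
 note fam = single_family[OF \<xi>]
 interpret c: particle_cost P ?F T 1 "%i. start i (X 0)" Q lf lam f by (rule fam)
 have T: "T \<in> {0..T}" using T_pos by simp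
 show ?thesis
 proof (rule canonical_projection[OF fam, where b = "%_. b" and X = "%_. X"])
  fix \<beta> assume \<beta>: "canonical_drift \<beta>" and proj: "!!g. sq_int (T \<otimes> Q) (proc g) ==>
   1 / real 1 * (\<Sum>i=1..1. \<integral>x. g (fst x) (started_bm.path T (start i (X 0)) (snd x)) \<bullet> proc b x \<partial>(T \<otimes> P)) =
   (\<integral>x. proc g x \<bullet> proc \<beta> x \<partial>(T \<otimes> Q))"
  have \<beta>': "progressive_on_paths T \<beta>" "sq_int (T \<otimes> Q) (proc \<beta>)" using \<beta> by (auto simp: canonical_drift_def)
  note ctx = b(1) \<beta>' proj
  have eq: "c.X (%_. b) 1 t \<omega> = start 1 (X 0) t \<omega> + prim T (%s. b s \<omega>) t" for t \<omega>
   by (rule c.particle_eq[OF ctx])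
  have cX: "AE \<omega> in P. \<forall>t\<in>{0..T}. c.X (%_. b) 1 t \<omega> = X' t \<omega>"
   using Xb X' by eventually_elim (simp add: eq del: One_nat_def)
  have mean: "mean_state Q T \<beta> t = m t" if t: "t \<in> {0..T}" for t
  proof -
   have "mean_state Q T \<beta> t = (\<integral>\<omega>. c.X (%_. b) 1 t \<omega> \<partial>P)"
    using c.mean_state_average[OF ctx t] by simp
   also have "\<dots> = m t"
    unfolding m'[OF t]
   proof (rule integral_cong_AE)
    show "c.X (%_. b) 1 t \<in> borel_measurable P" by (rule sq_int_measurable[OF c.particle_at_sq_int[OF ctx 1 t]])
    show "X' t \<in> borel_measurable P" by (rule sq_int_measurable[OF B(1)[OF t]])
    show "AE \<omega> in P. c.X (%_. b) 1 t \<omega> = X' t \<omega>" using cX by eventually_elim (use t in blast)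
   qed
   finally show ?thesis .
  qed
  have z: "(\<integral>x. gradient (f (fst x)) (feedback Q T \<beta> (fst x) (h (snd x))) \<bullet> (m (fst x) - mean_state Q T \<beta> (fst x)) \<partial>(T \<otimes> P)) = 0" for h
   by (rule integral_eq_zero_AE, rule AE_I2) (auto simp: space_pair_measure space_time mean)
  have tc: "total_cost P (%t \<omega>. b t \<omega> + c.X (%_. b) 1 t \<omega> - m t) = total_cost P \<alpha>"
   unfolding total_cost_def
  proof (rule integral_cong_AE)
   show "(%x. f (fst x) (b (fst x) (snd x) + c.X (%_. b) 1 (fst x) (snd x) - m (fst x))) \<in> borel_measurable (T \<otimes> P)"
    using f_process_measurable[of "%t \<omega>. b t \<omega> + c.X (%_. b) 1 t \<omega> - m t" P]
     sq_int_measurable[OF sq_int_diff[OF sq_int_add[OF b(1) c.particle_sq_int[OF ctx 1]] mP]] by simp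
   show "(%x. f (fst x) (proc \<alpha> x)) \<in> borel_measurable (T \<otimes> P)" by (rule f_process_measurable[OF \<alpha>m])
   show "AE x in T \<otimes> P. f (fst x) (b (fst x) (snd x) + c.X (%_. b) 1 (fst x) (snd x) - m (fst x)) = f (fst x) (proc \<alpha> x)"
    using AE_snd[OF a.fin cX] AE_space
    by eventually_elim (auto simp: space_pair_measure space_time b_def)
  qed
  have "total_cost Q (feedback Q T \<beta>) \<le> total_cost P \<alpha>"
   using c.projected_cost_relative[OF ctx, of "%t \<omega>. m t"] mP z tc by simp
  then have "ennreal (total_cost Q (feedback Q T \<beta>)) \<le> (\<integral>\<^sup>+\<omega>. running_cost T f \<alpha> \<omega> \<partial>P)"
   unfolding running_cost_sq_int[OF a.fin \<alpha>2] by (rule ennreal_leI)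
  with \<beta> show thesis by (rule that)
 qed (use b Xb XP[OF T] le in auto)
qed

end

context control_problem
begin

text \<open>The control \<open>feedback Q T \<beta>\<close> along the path realises the drift \<open>\<beta>\<close>, as the law of the state has the
mean \<open>mean_state Q T \<beta>\<close>.\<close>

proposition canonical_to_mf:
 assumes \<beta>: "canonical_drift \<beta>"
 shows "mf_value M F0 W T half_sq f \<mu>_in \<mu>_fin \<le> ennreal (total_cost Q (feedback Q T \<beta>))"
proof -
 let ?F = "filt M F0 W 1" and ?p = "started_bm.path T (start 1 \<xi>0)"
 have i: "1 \<in> {1..1::nat}" by simp
 interpret c: particle_cost P ?F T 1 "%i. start i \<xi>0" Q lf lam f by (rule single_family[OF \<xi>0])
 have \<beta>': "progressive_on_paths T \<beta>" "sq_int (T \<otimes> Q) (proc \<beta>)" using \<beta> by (auto simp: canonical_drift_def)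
 interpret a: started_bm P ?F T "start 1 \<xi>0" by (rule started[OF i \<xi>0])
 have Q: "a.path_law = Q" by (rule started[OF i \<xi>0])
 define \<alpha> where "\<alpha> t \<omega> = feedback Q T \<beta> t (?p \<omega>)" for t \<omega>
 define X where "X t \<omega> = start 1 \<xi>0 t \<omega> + prim T (%s. \<beta> s (?p \<omega>)) t" for t \<omega>
 define d where "d t \<omega> = \<alpha> t \<omega> - (\<integral>z. X t \<omega> - z \<partial>law M (X t))" for t \<omega>
 have Xdef: "X = (%t \<omega>. start 1 \<xi>0 t \<omega> + prim T (%s. \<beta> s (?p \<omega>)) t)" by (simp add: X_def fun_eq_iff)
 note ps = path_solution[OF i \<xi>0 \<beta>]
 have st: "X t \<omega> = state T \<beta> t (?p \<omega>)" if "t \<in> {0..T}" "\<omega> \<in> space M" for t \<omega>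
  unfolding Xdef by (rule ps(4)[OF refl that])
 have Xm: "X t \<in> borel_measurable P" if "t \<in> {0..T}" for t
  unfolding Xdef by (rule ps(5)[OF refl that])
 have Xi: "integrable P (X t)" if "t \<in> {0..T}" for t
  unfolding Xdef by (rule ps(6)[OF refl that])
 have Xe: "(\<integral>\<omega>. X t \<omega> \<partial>P) = mean_state Q T \<beta> t" if "t \<in> {0..T}" for t
  unfolding Xdef by (rule ps(7)[OF refl that])
 have li: "integrable (law M (X t)) (%z. X t \<omega> - z)" and ld: "(\<integral>z. X t \<omega> - z \<partial>law M (X t)) = X t \<omega> - mean_state Q T \<beta> t"
  if t: "t \<in> {0..T}" for t \<omega>
 proof -
  interpret l: prob_space "law M (X t)" unfolding law_def by (rule prob_space.prob_space_distr[OF prob_space_P Xm[OF t]])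
  have i: "integrable (law M (X t)) (%z. z)"
   using integrable_distr_eq[OF Xm[OF t], of "%z. z"] Xi[OF t] by (simp add: law_def)
  then show "integrable (law M (X t)) (%z. X t \<omega> - z)" by simp
  have "(\<integral>z. z \<partial>law M (X t)) = mean_state Q T \<beta> t"
   using integral_distr[OF Xm[OF t], of "%z. z"] Xe[OF t] by (simp add: law_def)
  then show "(\<integral>z. X t \<omega> - z \<partial>law M (X t)) = X t \<omega> - mean_state Q T \<beta> t" using i by (simp add: l.prob_space)
 qed
 have d: "d s \<omega> = \<beta> s (?p \<omega>)" if "s \<in> {0..T}" "\<omega> \<in> space M" for s \<omega>
 proof -
  have "d s \<omega> = \<alpha> s \<omega> - (X s \<omega> - mean_state Q T \<beta> s)" unfolding d_def by (simp only: ld[OF that(1)])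
  then show ?thesis unfolding \<alpha>_def st[OF that] by (simp add: feedback_def)
 qed
 have \<alpha>p: "progressive ?F T \<alpha>"
  unfolding \<alpha>_def using progressive_transfer[OF a.started_bm_axioms a.progressive_feedback[OF \<beta>'(1) \<beta>'(2)[folded Q]]]
  unfolding Q .
 have \<alpha>2: "sq_int (T \<otimes> P) (proc \<alpha>)"
  unfolding \<alpha>_def using c.sq_int_lift(1)[OF i c.feedback_sq_int_Q[OF \<beta>']] .
 have cost: "(\<integral>\<^sup>+\<omega>. running_cost T f \<alpha> \<omega> \<partial>P) = ennreal (total_cost Q (feedback Q T \<beta>))"
  unfolding running_cost_sq_int[OF a.fin \<alpha>2]
  using c.total_cost_lift[OF \<beta>' c.feedback_sq_int_Q[OF \<beta>'] i] by (simp add: \<alpha>_def[abs_def])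
 have ae: "\<forall>t\<in>{0..T}. AE \<omega> in M. integrable (law M (X t)) (%z. X t \<omega> - z)"
  using li by (intro ballI AE_I2) blast
 have sol: "solves_sde M ?F T (W 1) (%t \<omega>. \<alpha> t \<omega> - (\<integral>z. X t \<omega> - z \<partial>law M (X t))) X"
 proof -
  have "solves_sde M ?F T (W 1) d X" unfolding Xdef by (rule ps(2)[OF d])
  moreover have "d = (%t \<omega>. \<alpha> t \<omega> - (\<integral>z. X t \<omega> - z \<partial>law M (X t)))" by (simp add: d_def fun_eq_iff)
  ultimately show ?thesis by (simp only:)
 qed
 have "\<alpha> \<in> mf_admissible M F0 W T half_sq f \<mu>_in \<mu>_fin"
  unfolding mf_admissible_def gradient_half_norm_sq mem_Collect_eq
 proof (intro conjI exI[of _ X] \<alpha>p ae sol)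
  show "(\<integral>\<^sup>+\<omega>. running_cost T f \<alpha> \<omega> \<partial>P) < \<infinity>" unfolding cost by simp
  have "X 0 = \<xi>0" unfolding Xdef by (rule ps(1)[OF refl])
  then show "X 0 \<in> borel_measurable F0" "law M (X 0) = \<mu>_in" using \<xi>0 by simp_all
  show "law M (X T) \<le>\<^sub>c\<^sub>v\<^sub>x \<mu>_fin" unfolding Xdef by (rule ps(3)[OF refl])
 qed
 then show ?thesis
  unfolding mf_value_def cost[symmetric] by (rule INF_lower)
qed

lemma particle_cost_integral:
 assumes \<alpha>: "!!i. i \<in> {1..N} ==> sq_int (T \<otimes> P) (proc (\<alpha> i))"
 shows "(\<integral>\<^sup>+\<omega>. ennreal (1 / real N) * (\<Sum>i=1..N. running_cost T f (\<alpha> i) \<omega>) \<partial>P) =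
  ennreal (1 / real N * (\<Sum>i=1..N. total_cost P (\<alpha> i)))"
proof -
 interpret P: prob_space P by (rule prob_space_P)
 note fin = P.finite_measure_axioms
 have m: "running_cost T f (\<alpha> i) \<in> borel_measurable P" if "i \<in> {1..N}" for i
  by (rule running_cost_measurable(1)[OF fin sq_int_measurable[OF \<alpha>[OF that]]])
 have "(\<integral>\<^sup>+\<omega>. ennreal (1 / real N) * (\<Sum>i=1..N. running_cost T f (\<alpha> i) \<omega>) \<partial>P) =
  ennreal (1 / real N) * (\<integral>\<^sup>+\<omega>. (\<Sum>i=1..N. running_cost T f (\<alpha> i) \<omega>) \<partial>P)"
  by (intro nn_integral_cmult borel_measurable_sum m)
 also have "(\<integral>\<^sup>+\<omega>. (\<Sum>i=1..N. running_cost T f (\<alpha> i) \<omega>) \<partial>P) = (\<Sum>i=1..N. \<integral>\<^sup>+\<omega>. running_cost T f (\<alpha> i) \<omega> \<partial>P)"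
  by (rule nn_integral_sum[OF m])
 also have "\<dots> = (\<Sum>i=1..N. ennreal (total_cost P (\<alpha> i)))"
  by (intro sum.cong refl running_cost_sq_int[OF fin \<alpha>])
 also have "\<dots> = ennreal (\<Sum>i=1..N. total_cost P (\<alpha> i))"
  by (rule sum_ennreal) (rule total_cost_nonneg)
 finally show ?thesis
  by (simp add: ennreal_mult[symmetric] sum_nonneg total_cost_nonneg)
qed

definition swarm_error :: "(real => (real => real ^ 'm) => real ^ 'm) => real" where
 "swarm_error \<beta> = sqrt (50 * lf\<^sup>2 * (T + 2 * nsq (T \<otimes> Q) (proc (feedback Q T \<beta>)) + 2 * nsq (T \<otimes> Q) (proc (state T \<beta>)))) *
   sqrt (nsq (T \<otimes> Q) (proc (state T \<beta>)))"

proposition canonical_to_particles: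
 fixes \<xi> :: "nat => 'w => real ^ 'm"
 assumes \<beta>: "canonical_drift \<beta>" and N: "1 \<le> N"
  and \<xi>: "!!i. i \<in> {1..N} ==> \<xi> i \<in> borel_measurable F0" "!!i. i \<in> {1..N} ==> law M (\<xi> i) = \<mu>_in"
  and ind: "indep_vars (%_. borel) \<xi> {1..N}"
 shows "particle_value M F0 W T half_sq f \<mu>_in \<mu>_fin N \<le>
  ennreal (total_cost Q (feedback Q T \<beta>) + swarm_error \<beta> / sqrt (real N))"
proof -
 let ?F = "filt M F0 W N" and ?p = "%i. started_bm.path T (start i (\<xi> i))"
 interpret c: particle_cost P ?F T N "%i. start i (\<xi> i)" Q lf lam f by (rule particle_family[OF N \<xi> ind])
 have \<beta>': "progressive_on_paths T \<beta>" "sq_int (T \<otimes> Q) (proc \<beta>)" using \<beta> by (auto simp: canonical_drift_def)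
 define \<alpha> where "\<alpha> = c.swarm_control \<beta>"
 have \<alpha>_eq: "\<alpha> i t \<omega> = \<beta> t (?p i \<omega>) + state T \<beta> t (?p i \<omega>) - (1 / real N) *\<^sub>R (\<Sum>j=1..N. state T \<beta> t (?p j \<omega>))" for i t \<omega>
  unfolding \<alpha>_def by (rule c.swarm_control_def[OF \<beta>'])
 define X where "X i t \<omega> = start i (\<xi> i) t \<omega> + prim T (%s. \<beta> s (?p i \<omega>)) t" for i t \<omega>
 have Xdef: "X i = (%t \<omega>. start i (\<xi> i) t \<omega> + prim T (%s. \<beta> s (?p i \<omega>)) t)" for i by (simp add: X_def fun_eq_iff)
 have st: "X i t \<omega> = state T \<beta> t (?p i \<omega>)" if "i \<in> {1..N}" "t \<in> {0..T}" "\<omega> \<in> space M" for i t \<omega>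
  unfolding Xdef by (rule path_solution(4)[OF that(1) \<xi>[OF that(1)] \<beta> refl that(2,3)])
 have d: "\<alpha> i s \<omega> - (1 / real N) *\<^sub>R (\<Sum>j=1..N. X i s \<omega> - X j s \<omega>) = \<beta> s (?p i \<omega>)"
  if i: "i \<in> {1..N}" and s: "s \<in> {0..T}" and \<omega>: "\<omega> \<in> space M" for i s \<omega>
 proof -
  have "(\<Sum>j=1..N. X i s \<omega> - X j s \<omega>) = real N *\<^sub>R X i s \<omega> - (\<Sum>j=1..N. X j s \<omega>)"
   by (simp add: sum_subtractf sum_constant_scaleR del: sum_constant)
  also have "(\<Sum>j=1..N. X j s \<omega>) = (\<Sum>j=1..N. state T \<beta> s (?p j \<omega>))"
   by (intro sum.cong refl st[OF _ s \<omega>])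
  finally show ?thesis
   using N unfolding \<alpha>_eq by (simp add: st[OF i s \<omega>] scaleR_diff_right)
 qed
 have init: "X i 0 = \<xi> i" if "i \<in> {1..N}" for i
  unfolding Xdef by (rule path_solution(1)[OF that \<xi>[OF that] \<beta> refl])
 have cost: "(\<integral>\<^sup>+\<omega>. running_cost T f (\<alpha> i) \<omega> \<partial>P) = ennreal (total_cost P (\<alpha> i))" if "i \<in> {1..N}" for i
  unfolding \<alpha>_def by (rule running_cost_sq_int[OF c.finP c.swarm_cost(1)[OF \<beta>' that]])
 have sol: "solves_sde M ?F T (W i) (%t \<omega>. \<alpha> i t \<omega> - (1 / real N) *\<^sub>R (\<Sum>j=1..N. X i t \<omega> - X j t \<omega>)) (X i)"
  if "i \<in> {1..N}" for i
  unfolding Xdef[of i] by (rule path_solution(2)[OF that \<xi>[OF that] \<beta> d[OF that, unfolded Xdef[of i]]])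
 have "\<alpha> \<in> particle_admissible M F0 W T half_sq f \<mu>_in \<mu>_fin N"
  unfolding particle_admissible_def gradient_half_norm_sq mem_Collect_eq
 proof (intro conjI ballI exI[of _ X])
  show "indep_vars (%_. borel) (%i. X i 0) {1..N}"
   using ind by (rule indep_vars_cong[THEN iffD1, rotated -1]) (use init in auto)
  fix i assume i: "i \<in> {1..N}"
  show "progressive ?F T (\<alpha> i)" unfolding \<alpha>_def by (rule c.progressive_swarm_control[OF \<beta>' i])
  show "(\<integral>\<^sup>+\<omega>. running_cost T f (\<alpha> i) \<omega> \<partial>P) < \<infinity>" unfolding cost[OF i] by simp
  show "X i 0 \<in> borel_measurable F0" "law M (X i 0) = \<mu>_in" using init[OF i] \<xi>[OF i] by simp_all
  show "solves_sde M ?F T (W i) (%t \<omega>. \<alpha> i t \<omega> - (1 / real N) *\<^sub>R (\<Sum>j=1..N. X i t \<omega> - X j t \<omega>)) (X i)" by (rule sol[OF i])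
  show "law M (X i T) \<le>\<^sub>c\<^sub>v\<^sub>x \<mu>_fin" unfolding Xdef by (rule path_solution(3)[OF i \<xi>[OF i] \<beta> refl])
 qed
 then have "particle_value M F0 W T half_sq f \<mu>_in \<mu>_fin N \<le> (\<integral>\<^sup>+\<omega>. ennreal (1 / real N) * (\<Sum>i=1..N. running_cost T f (\<alpha> i) \<omega>) \<partial>P)"
  unfolding particle_value_def by (rule INF_lower)
 also have "\<dots> = ennreal (1 / real N * (\<Sum>i=1..N. total_cost P (\<alpha> i)))"
  by (rule particle_cost_integral) (simp only: \<alpha>_def c.swarm_cost(1)[OF \<beta>'])
 also have "\<dots> \<le> ennreal (total_cost Q (feedback Q T \<beta>) + swarm_error \<beta> / sqrt (real N))"
 proof (rule ennreal_leI)
  have "1 / real N * (\<Sum>i=1..N. total_cost P (\<alpha> i)) \<le> 1 / real N * (\<Sum>i=1..N. total_cost Q (feedback Q T \<beta>) + swarm_error \<beta> / sqrt (real N))"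
  proof (intro mult_left_mono sum_mono)
   fix i assume i: "i \<in> {1..N}"
   show "total_cost P (\<alpha> i) \<le> total_cost Q (feedback Q T \<beta>) + swarm_error \<beta> / sqrt (real N)"
    using c.swarm_cost(2)[OF \<beta>' i] unfolding \<alpha>_def swarm_error_def by (simp add: real_sqrt_divide)
  qed simp
  then show "1 / real N * (\<Sum>i=1..N. total_cost P (\<alpha> i)) \<le> total_cost Q (feedback Q T \<beta>) + swarm_error \<beta> / sqrt (real N)"
   unfolding c.average_const .
 qed
 finally show ?thesis .
qed

text \<open>The barycenter of the particles is explicit, because the attraction cancels in the mean; so it is
square integrable, and mean reversion gives the same for each state. Then \<open>projected_cost\<close> applies.\<close>

proposition particles_to_canonical:
 assumes N: "1 \<le> N" and adm: "\<alpha> \<in> particle_admissible M F0 W T half_sq f \<mu>_in \<mu>_fin N"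
 obtains \<beta> K where "canonical_drift \<beta>" "0 \<le> K"
  "(\<integral>\<^sup>+\<omega>. ennreal (1 / real N) * (\<Sum>i=1..N. running_cost T f (\<alpha> i) \<omega>) \<partial>P) = ennreal K"
  "total_cost Q (feedback Q T \<beta>) \<le> K + sqrt (50 * lf\<^sup>2 * (T + 4 / lam * total_cost Q (feedback Q T \<beta>))) *
   sqrt (T * (2 * (2 * initial_moment + 2 * (real CARD('m) * T)) + 2 * (T * (4 / lam * K)))) / sqrt (real N)"
proof -
 let ?F = "filt M F0 W N" and ?TP = "T \<otimes> P"
 have a: "\<forall>i\<in>{1..N}. progressive ?F T (\<alpha> i) \<and> (\<integral>\<^sup>+\<omega>. running_cost T f (\<alpha> i) \<omega> \<partial>P) < \<infinity>"
  and "\<exists>X. (\<forall>i\<in>{1..N}. X i 0 \<in> borel_measurable F0) \<and> indep_vars (%_. borel) (%i. X i 0) {1..N} \<and>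
   (\<forall>i\<in>{1..N}. law M (X i 0) = \<mu>_in \<and>
    solves_sde M ?F T (W i) (%t \<omega>. \<alpha> i t \<omega> - (1 / real N) *\<^sub>R (\<Sum>j=1..N. X i t \<omega> - X j t \<omega>)) (X i) \<and>
    law M (X i T) \<le>\<^sub>c\<^sub>v\<^sub>x \<mu>_fin)"
  using adm unfolding particle_admissible_def gradient_half_norm_sq mem_Collect_eq by simp_all
 then obtain X where x1: "\<forall>i\<in>{1..N}. X i 0 \<in> borel_measurable F0" and ind: "indep_vars (%_. borel) (%i. X i 0) {1..N}"
  and x2: "\<forall>i\<in>{1..N}. law M (X i 0) = \<mu>_in \<and>
    solves_sde M ?F T (W i) (%t \<omega>. \<alpha> i t \<omega> - (1 / real N) *\<^sub>R (\<Sum>j=1..N. X i t \<omega> - X j t \<omega>)) (X i) \<and>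
    law M (X i T) \<le>\<^sub>c\<^sub>v\<^sub>x \<mu>_fin"
  by (elim exE conjE)
 have \<alpha>p: "!!i. i \<in> {1..N} ==> progressive ?F T (\<alpha> i)"
  and cost: "!!i. i \<in> {1..N} ==> (\<integral>\<^sup>+\<omega>. running_cost T f (\<alpha> i) \<omega> \<partial>P) < \<infinity>"
  and \<xi>: "!!i. i \<in> {1..N} ==> X i 0 \<in> borel_measurable F0" "!!i. i \<in> {1..N} ==> law M (X i 0) = \<mu>_in"
  and sol: "!!i. i \<in> {1..N} ==> solves_sde M ?F T (W i) (%t \<omega>. \<alpha> i t \<omega> - (1 / real N) *\<^sub>R (\<Sum>j=1..N. X i t \<omega> - X j t \<omega>)) (X i)"
  and le: "!!i. i \<in> {1..N} ==> law M (X i T) \<le>\<^sub>c\<^sub>v\<^sub>x \<mu>_fin"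
  by (fact conjunct1[OF bspec[OF a]] conjunct2[OF bspec[OF a]] bspec[OF x1] conjunct1[OF bspec[OF x2]]
   conjunct1[OF conjunct2[OF bspec[OF x2]]] conjunct2[OF conjunct2[OF bspec[OF x2]]])+
 note fam = particle_family[OF N \<xi> ind]
 interpret c: particle_cost P ?F T N "%i. start i (X i 0)" Q lf lam f by (rule fam)
 interpret tm: finite_measure "time T" by (rule finite_measure_time)
 have T: "T \<in> {0..T}" using T_pos by simp
 have XP: "X i T \<in> borel_measurable P" if "i \<in> {1..N}" for i
  by (rule started_bm.F_measurable[OF c.bm[OF that] _ T]) (use sol[OF that] T in \<open>simp add: solves_sde_def\<close>)
 have "\<forall>i\<in>{1..N}. \<exists>X'. progressive ?F T X' \<and> (AE \<omega> in P. \<forall>t. X' t \<omega> = X i t \<omega>) \<and> (\<forall>\<omega>\<in>space P. continuous_on {0..T} (%t. X' t \<omega>))"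
 proof
  fix i assume i: "i \<in> {1..N}"
  show "\<exists>X'. progressive ?F T X' \<and> (AE \<omega> in P. \<forall>t. X' t \<omega> = X i t \<omega>) \<and> (\<forall>\<omega>\<in>space P. continuous_on {0..T} (%t. X' t \<omega>))"
   using solution_version[OF i sol[OF i] \<xi>[OF i]] by blast
 qed
 from bchoice[OF this] obtain X' where X'p: "!!i. i \<in> {1..N} ==> progressive ?F T (X' i)"
  and X': "!!i. i \<in> {1..N} ==> AE \<omega> in P. \<forall>t. X' i t \<omega> = X i t \<omega>"
  and X'c: "!!i \<omega>. i \<in> {1..N} ==> \<omega> \<in> space P ==> continuous_on {0..T} (%t. X' i t \<omega>)"
  by blast
 have all': "AE \<omega> in P. \<forall>i\<in>{1..N}. \<forall>t. X' i t \<omega> = X i t \<omega>"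
  by (intro AE_finite_allI finite_atLeastAtMost X')
 define Y where "Y t \<omega> = (1 / real N) *\<^sub>R (\<Sum>j=1..N. X' j t \<omega>)" for t \<omega>
 define b where "b i t \<omega> = \<alpha> i t \<omega> - (X' i t \<omega> - Y t \<omega>)" for i t \<omega>
 define mZ where "mZ t \<omega> = (1 / real N) *\<^sub>R (\<Sum>i=1..N. start i (X i 0) t \<omega>)" for t \<omega>
 define ma where "ma t \<omega> = (1 / real N) *\<^sub>R (\<Sum>i=1..N. \<alpha> i t \<omega>)" for t \<omega>
 have Yp: "progressive ?F T Y"
  unfolding Y_def[abs_def] by (intro progressive_scaleR progressive_sum X'p)
 have bp: "progressive ?F T (b i)" if "i \<in> {1..N}" for i
  unfolding b_def[abs_def] by (intro progressive_diff \<alpha>p X'p Yp that)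
 note pm = started_bm.progressive_measurable(2)[OF c.bm]
 have \<alpha>2: "sq_int ?TP (proc (\<alpha> i))" if i: "i \<in> {1..N}" for i
  by (rule finite_cost_sq_int[OF c.finP pm[OF i \<alpha>p[OF i]] cost[OF i]])
 have mb: "(1 / real N) *\<^sub>R (\<Sum>i=1..N. b i t \<omega>) = ma t \<omega>" for t \<omega>
 proof -
  have "(\<Sum>i=1..N. b i t \<omega>) = (\<Sum>i=1..N. \<alpha> i t \<omega>) - ((\<Sum>i=1..N. X' i t \<omega>) - real N *\<^sub>R Y t \<omega>)"
   by (simp add: b_def sum_subtractf sum_constant_scaleR del: sum_constant)
  also have "(\<Sum>i=1..N. X' i t \<omega>) - real N *\<^sub>R Y t \<omega> = 0" using N by (simp add: Y_def)
  finally show ?thesis by (simp add: ma_def)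
 qed
 have "AE \<omega> in P. \<forall>i\<in>{1..N}. integrable (time T) (%s. \<alpha> i s \<omega> - (1 / real N) *\<^sub>R (\<Sum>j=1..N. X i s \<omega> - X j s \<omega>)) \<and>
   (\<forall>t\<in>{0..T}. X i t \<omega> = start i (X i 0) t \<omega> + prim T (%s. \<alpha> i s \<omega> - (1 / real N) *\<^sub>R (\<Sum>j=1..N. X i s \<omega> - X j s \<omega>)) t)"
 proof (intro AE_finite_allI finite_atLeastAtMost)
  fix i assume i: "i \<in> {1..N}"
  show "AE \<omega> in P. integrable (time T) (%s. \<alpha> i s \<omega> - (1 / real N) *\<^sub>R (\<Sum>j=1..N. X i s \<omega> - X j s \<omega>)) \<and>
   (\<forall>t\<in>{0..T}. X i t \<omega> = start i (X i 0) t \<omega> + prim T (%s. \<alpha> i s \<omega> - (1 / real N) *\<^sub>R (\<Sum>j=1..N. X i s \<omega> - X j s \<omega>)) t)"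
   by (rule solution_path[OF i sol[OF i]])
 qed
 with all' have path: "AE \<omega> in P. \<forall>i\<in>{1..N}. integrable (time T) (%s. b i s \<omega>) \<and>
   (\<forall>t\<in>{0..T}. X' i t \<omega> = start i (X i 0) t \<omega> + prim T (%s. b i s \<omega>) t)"
 proof eventually_elim
  case (elim \<omega>)
  have eq: "(%s. \<alpha> i s \<omega> - (1 / real N) *\<^sub>R (\<Sum>j=1..N. X i s \<omega> - X j s \<omega>)) = (%s. b i s \<omega>)" if i: "i \<in> {1..N}" for i
  proof
   fix s
   have "(\<Sum>j=1..N. X i s \<omega> - X j s \<omega>) = real N *\<^sub>R X' i s \<omega> - (\<Sum>j=1..N. X' j s \<omega>)"
    using elim(1) i by (simp add: sum_subtractf sum_constant_scaleR del: sum_constant)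
   then show "\<alpha> i s \<omega> - (1 / real N) *\<^sub>R (\<Sum>j=1..N. X i s \<omega> - X j s \<omega>) = b i s \<omega>"
    using N by (simp add: b_def Y_def scaleR_diff_right)
  qed
  show ?case
  proof
   fix i assume i: "i \<in> {1..N}"
   show "integrable (time T) (%s. b i s \<omega>) \<and> (\<forall>t\<in>{0..T}. X' i t \<omega> = start i (X i 0) t \<omega> + prim T (%s. b i s \<omega>) t)"
    using bspec[OF elim(2) i] bspec[OF elim(1) i] unfolding eq[OF i] by simp
  qed
 qed
 have Y_eq: "AE \<omega> in P. \<forall>t\<in>{0..T}. Y t \<omega> = mZ t \<omega> + prim T (%s. ma s \<omega>) t"
  using path
 proof eventually_elim
  case (elim \<omega>)
  have i: "integrable (time T) (%s. b i s \<omega>)" if "i \<in> {1..N}" for i using elim that by blast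
  have p: "prim T (%s. ma s \<omega>) t = (1 / real N) *\<^sub>R (\<Sum>i=1..N. prim T (%s. b i s \<omega>) t)" for t
   unfolding mb[symmetric] prim_scaleR by (subst prim_sum[OF i]) auto
  show ?case
  proof
   fix t assume t: "t \<in> {0..T}"
   have "(\<Sum>i=1..N. X' i t \<omega>) = (\<Sum>i=1..N. start i (X i 0) t \<omega> + prim T (%s. b i s \<omega>) t)"
    by (intro sum.cong refl) (use elim t in blast)
   then show "Y t \<omega> = mZ t \<omega> + prim T (%s. ma s \<omega>) t"
    unfolding p by (simp add: Y_def mZ_def sum.distrib scaleR_add_right)
  qed
 qed
 have Y2: "sq_int ?TP (proc Y)"
 proof (rule sq_int_cong_AE)
  show "AE x in ?TP. proc Y x = mZ (fst x) (snd x) + prim T (%s. ma s (snd x)) (fst x)"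
   using AE_snd[OF c.finP Y_eq] AE_space by eventually_elim (auto simp: space_pair_measure space_time)
  show "proc Y \<in> borel_measurable ?TP" by (rule pm[OF c.one_mem Yp])
  show "sq_int ?TP (%x. mZ (fst x) (snd x) + prim T (%s. ma s (snd x)) (fst x))"
   unfolding mZ_def ma_def
   by (intro sq_int_add sq_int_scaleR sq_int_sum started_bm.Z_proc_sq_int[OF c.bm] prim_proc_sq_int[OF c.finP c.T0] \<alpha>2)
 qed
 have X'2: "sq_int ?TP (proc (X' i))" if i: "i \<in> {1..N}" for i
 proof -
  define u where "u s \<omega> = \<alpha> i s \<omega> + Y s \<omega>" for s \<omega>
  have u2: "sq_int ?TP (proc u)" unfolding u_def by (intro sq_int_add \<alpha>2 i Y2)
  have "\<exists>B'. \<forall>t\<in>{0..T}. sq_int P (X' i t) \<and> nsq P (X' i t) \<le> B'"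
  proof (rule started_bm.mean_reverting_sq_int[OF c.bm[OF i] pm[OF i X'p[OF i]] X'c[OF i] sq_int_measurable[OF u2]])
   show "AE \<omega> in P. integrable (time T) (%s. u s \<omega>)"
    using sq_int_paths(1)[OF c.finP u2] by eventually_elim (rule tm.sq_int_integrable)
   show "AE \<omega> in P. \<forall>t\<in>{0..T}. X' i t \<omega> = start i (X i 0) t \<omega> + prim T (%s. u s \<omega> - X' i s \<omega>) t"
    using path
   proof eventually_elim
    case (elim \<omega>)
    have "(%s. u s \<omega> - X' i s \<omega>) = (%s. b i s \<omega>)" by (simp add: u_def b_def fun_eq_iff)
    with bspec[OF elim i] show ?case by simp
   qed
   fix t assume t: "t \<in> {0..T}"
   show "sq_int P (%\<omega>. prim T (%s. u s \<omega>) t)" by (rule prim_at_sq_int(1)[OF c.finP c.T0 t u2])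
   show "nsq P (%\<omega>. prim T (%s. u s \<omega>) t) \<le> T * nsq ?TP (proc u)" by (rule prim_at_sq_int(2)[OF c.finP c.T0 t u2])
  qed
  then obtain B where B: "!!t. t \<in> {0..T} ==> sq_int P (X' i t)" "!!t. t \<in> {0..T} ==> nsq P (X' i t) \<le> B" by blast
  show ?thesis
   using sq_int_proc_bounded(1)[where X = "X' i" and B = B, OF c.finP c.T0 pm[OF i X'p[OF i]] B] by blast
 qed
 have b2: "sq_int ?TP (proc (b i))" if "i \<in> {1..N}" for i
  unfolding b_def by (intro sq_int_diff \<alpha>2 X'2 Y2 that)
 have Xb: "AE \<omega> in P. \<forall>t\<in>{0..T}. X i t \<omega> = start i (X i 0) t \<omega> + prim T (%s. b i s \<omega>) t" if i: "i \<in> {1..N}" for i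
  using path X'[OF i]
 proof eventually_elim
  case (elim \<omega>)
  then show ?case using bspec[OF elim(1) i] by simp
 qed
 show ?thesis
 proof (rule canonical_projection[OF fam, where b = b and X = X])
  fix \<beta> assume \<beta>: "canonical_drift \<beta>" and proj: "!!g. sq_int (T \<otimes> Q) (proc g) ==>
   1 / real N * (\<Sum>i=1..N. \<integral>x. g (fst x) (started_bm.path T (start i (X i 0)) (snd x)) \<bullet> proc (b i) x \<partial>?TP) =
   (\<integral>x. proc g x \<bullet> proc \<beta> x \<partial>(T \<otimes> Q))"
  have \<beta>': "progressive_on_paths T \<beta>" "sq_int (T \<otimes> Q) (proc \<beta>)" using \<beta> by (auto simp: canonical_drift_def)
  note ctx = b2 \<beta>' proj
  have tc: "total_cost P (c.control b i) = total_cost P (\<alpha> i)" if i: "i \<in> {1..N}" for i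
   unfolding total_cost_def
  proof (rule integral_cong_AE)
   show "(%x. f (fst x) (proc (c.control b i) x)) \<in> borel_measurable ?TP"
    by (rule f_process_measurable[OF sq_int_measurable[OF c.control_sq_int[OF ctx i]]])
   show "(%x. f (fst x) (proc (\<alpha> i) x)) \<in> borel_measurable ?TP"
    by (rule f_process_measurable[OF sq_int_measurable[OF \<alpha>2[OF i]]])
   have "AE \<omega> in P. \<forall>t\<in>{0..T}. c.control b i t \<omega> = \<alpha> i t \<omega>"
    using path
   proof eventually_elim
    case (elim \<omega>)
    show ?case
    proof
     fix t assume t: "t \<in> {0..T}"
     have x: "start j (X j 0) t \<omega> + prim T (%s. b j s \<omega>) t = X' j t \<omega>" if "j \<in> {1..N}" for j
      using elim t that by simp
     have "(\<Sum>j=1..N. start j (X j 0) t \<omega> + prim T (%s. b j s \<omega>) t) = (\<Sum>j=1..N. X' j t \<omega>)"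
      by (intro sum.cong refl x)
     moreover have "c.control b i t \<omega> = b i t \<omega> + (start i (X i 0) t \<omega> + prim T (%s. b i s \<omega>) t) -
       (1 / real N) *\<^sub>R (\<Sum>j=1..N. start j (X j 0) t \<omega> + prim T (%s. b j s \<omega>) t)"
      by (rule c.control_eq[OF ctx])
     ultimately show "c.control b i t \<omega> = \<alpha> i t \<omega>"
      using x[OF i] by (simp add: b_def Y_def)
    qed
   qed
   from AE_snd[OF c.finP this] AE_space
   show "AE x in ?TP. f (fst x) (proc (c.control b i) x) = f (fst x) (proc (\<alpha> i) x)"
    by eventually_elim (auto simp: space_pair_measure space_time)
  qed
  define K where "K = 1 / real N * (\<Sum>i=1..N. total_cost P (\<alpha> i))"
  have Kc: "1 / real N * (\<Sum>i=1..N. total_cost P (c.control b i)) = K"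
   unfolding K_def by (intro arg_cong2[where f = "(*)"] sum.cong refl tc)
  have K0: "0 \<le> K" unfolding K_def by (intro mult_nonneg_nonneg sum_nonneg total_cost_nonneg) simp
  have bary: "nsq ?TP (proc (c.barycenter b)) \<le> T * (2 * (2 * initial_moment + 2 * (real CARD('m) * T)) + 2 * (T * (4 / lam * K)))"
  proof (rule c.barycenter_nsq[OF ctx])
   show "nsq P (start i (X i 0) 0) \<le> initial_moment" if "i \<in> {1..N}" for i
    by (rule started(3)[OF that \<xi>[OF that]])
   show "1 / real N * (\<Sum>i=1..N. total_cost P (c.control b i)) \<le> K" using Kc by simp
  qed
  have "total_cost Q (feedback Q T \<beta>) \<le> K + sqrt (50 * lf\<^sup>2 * (T + 4 / lam * total_cost Q (feedback Q T \<beta>))) *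
   sqrt (nsq ?TP (proc (c.barycenter b))) / sqrt (real N)"
   using c.projected_cost[OF ctx] unfolding Kc .
  also have "\<dots> \<le> K + sqrt (50 * lf\<^sup>2 * (T + 4 / lam * total_cost Q (feedback Q T \<beta>))) *
   sqrt (T * (2 * (2 * initial_moment + 2 * (real CARD('m) * T)) + 2 * (T * (4 / lam * K)))) / sqrt (real N)"
   using lam_pos T_pos total_cost_nonneg[of Q "feedback Q T \<beta>"]
   by (intro add_left_mono divide_right_mono mult_left_mono real_sqrt_le_mono bary) auto
  finally have fin: "total_cost Q (feedback Q T \<beta>) \<le> \<dots>" .
  show thesis
   by (rule that[OF \<beta> K0 _ fin]) (simp only: particle_cost_integral[OF \<alpha>2] K_def)
 qed (use b2 bp Xb XP le in auto)
qed

end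

section \<open>The limit\<close>

text \<open>The error term contains the quantity \<open>J\<close> that it bounds, but only under a square root. By Young's
inequality \<open>J\<close> has an a priori bound, which is put back into the error.\<close>

lemma quadratic_self_bound:
 fixes A B R J K v s :: real
 assumes A: "0 \<le> A" and B: "0 < B" and R: "0 \<le> R" and J: "0 \<le> J" and s: "1 \<le> s" and K: "K \<le> v"
  and le: "J \<le> K + sqrt (A + B * J) * sqrt R / s"
 shows "J \<le> K + sqrt (A + B * (2 * v + A / B + B * R)) * sqrt R / s"
proof -
 define q where "q = A / B"
 have AJ: "0 \<le> A + B * J" using A B J by simp
 have "sqrt (A + B * J) * sqrt R / s \<le> sqrt (A + B * J) * sqrt R"
 proof -
  have "0 \<le> sqrt (A + B * J) * sqrt R" using AJ R by (intro mult_nonneg_nonneg real_sqrt_ge_zero)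
  then have "sqrt (A + B * J) * sqrt R * 1 \<le> sqrt (A + B * J) * sqrt R * s" using s by (intro mult_left_mono)
  then show ?thesis using s by (simp add: divide_le_eq)
 qed
 \<comment> \<open>Young's inequality, with the weight that leaves \<open>J / 2\<close> on the right\<close>
 also have "\<dots> \<le> (A + B * J) / (2 * B) + B * R / 2"
 proof -
  have "0 \<le> (sqrt (A + B * J) - B * sqrt R)\<^sup>2" by simp
  also have "\<dots> = (A + B * J) + B\<^sup>2 * R - 2 * B * (sqrt (A + B * J) * sqrt R)"
   using AJ R by (simp add: power2_diff power_mult_distrib algebra_simps)
  finally show ?thesis using B by (simp add: field_simps power2_eq_square)
 qed
 also have "\<dots> = q / 2 + J / 2 + B * R / 2" using B by (simp add: field_simps q_def)
 finally have "J \<le> 2 * v + A / B + B * R" using le K unfolding q_def[symmetric] by linarith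
 then have "sqrt (A + B * J) \<le> sqrt (A + B * (2 * v + A / B + B * R))"
  using B by (intro real_sqrt_le_mono add_left_mono mult_left_mono) auto
 then have "sqrt (A + B * J) * sqrt R / s \<le> sqrt (A + B * (2 * v + A / B + B * R)) * sqrt R / s"
  using s R by (intro divide_right_mono mult_right_mono) auto
 with le show ?thesis by linarith
qed

context control_problem
begin

text \<open>Controls that cost more than \<open>v\<close> satisfy the inequality trivially; for the others the error is uniform.\<close>

lemma particle_value_lower:
 assumes v: "0 \<le> v" "mf_value M F0 W T half_sq f \<mu>_in \<mu>_fin = ennreal v"
 shows "\<exists>C. \<forall>N\<ge>1. ennreal (v - C / sqrt (real N)) \<le> particle_value M F0 W T half_sq f \<mu>_in \<mu>_fin N"
proof -
 define A where "A = 50 * lf\<^sup>2 * T"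
 define B where "B = 50 * lf\<^sup>2 * (4 / lam)"
 define R where "R K = T * (2 * (2 * initial_moment + 2 * (real CARD('m) * T)) + 2 * (T * (4 / lam * K)))" for K
 define C where "C = sqrt (A + B * (2 * v + A / B + B * R v)) * sqrt (R v)"
 have A0: "0 \<le> A" and B0: "0 < B" using T_pos lf_pos lam_pos by (simp_all add: A_def B_def)
 have im: "0 \<le> initial_moment" by (simp add: initial_moment_def)
 have R0: "0 \<le> R v" unfolding R_def using T_pos lam_pos im v(1) by (intro mult_nonneg_nonneg add_nonneg_nonneg) auto
 have C0: "0 \<le> C"
  unfolding C_def using A0 B0 R0 v(1) by (intro mult_nonneg_nonneg real_sqrt_ge_zero add_nonneg_nonneg divide_nonneg_pos) auto
 have "ennreal (v - C / sqrt (real N)) \<le> particle_value M F0 W T half_sq f \<mu>_in \<mu>_fin N" if N: "1 \<le> N" for N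
  unfolding particle_value_def
 proof (rule INF_greatest)
  fix \<alpha> assume adm: "\<alpha> \<in> particle_admissible M F0 W T half_sq f \<mu>_in \<mu>_fin N"
  obtain \<beta> K where \<beta>: "canonical_drift \<beta>" and K: "0 \<le> K"
   and cost: "(\<integral>\<^sup>+\<omega>. ennreal (1 / real N) * (\<Sum>i=1..N. running_cost T f (\<alpha> i) \<omega>) \<partial>P) = ennreal K"
   and le: "total_cost Q (feedback Q T \<beta>) \<le> K + sqrt (50 * lf\<^sup>2 * (T + 4 / lam * total_cost Q (feedback Q T \<beta>))) *
    sqrt (T * (2 * (2 * initial_moment + 2 * (real CARD('m) * T)) + 2 * (T * (4 / lam * K)))) / sqrt (real N)"
   by (rule particles_to_canonical[OF N adm])
  have s: "1 \<le> sqrt (real N)" using N by simp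
  have "v - C / sqrt (real N) \<le> K"
  proof (cases "K \<le> v")
   case False
   moreover have "0 \<le> C / sqrt (real N)" using C0 by simp
   ultimately show ?thesis by linarith
  next
   case True
   let ?J = "total_cost Q (feedback Q T \<beta>)"
   have AB: "50 * lf\<^sup>2 * (T + 4 / lam * ?J) = A + B * ?J" by (simp add: A_def B_def algebra_simps)
   have "R K \<le> R v"
    unfolding R_def using T_pos lam_pos True by (intro mult_left_mono add_left_mono) auto
   then have "sqrt (A + B * ?J) * sqrt (R K) / sqrt (real N) \<le> sqrt (A + B * ?J) * sqrt (R v) / sqrt (real N)"
    using A0 B0 total_cost_nonneg[of Q "feedback Q T \<beta>"]
    by (intro divide_right_mono mult_left_mono real_sqrt_le_mono real_sqrt_ge_zero) auto
   then have "?J \<le> K + sqrt (A + B * ?J) * sqrt (R v) / sqrt (real N)"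
    using le unfolding AB R_def[symmetric] by linarith
   from quadratic_self_bound[OF A0 B0 R0 total_cost_nonneg s True this]
   have J: "?J \<le> K + C / sqrt (real N)" by (simp add: C_def)
   have "ennreal v \<le> ennreal ?J" using canonical_to_mf[OF \<beta>] v(2) by simp
   then have "v \<le> ?J" using total_cost_nonneg[of Q "feedback Q T \<beta>"] ennreal_le_iff by blast
   with J show ?thesis by linarith
  qed
  then show "ennreal (v - C / sqrt (real N)) \<le> (\<integral>\<^sup>+\<omega>. ennreal (1 / real N) * (\<Sum>i=1..N. running_cost T f (\<alpha> i) \<omega>) \<partial>P)"
   unfolding cost by (rule ennreal_leI)
 qed
 then show ?thesis by blast
qed

lemma particle_value_upper:
 assumes \<beta>: "canonical_drift \<beta>" and N: "1 \<le> N"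
  and fin: "particle_value M F0 W T half_sq f \<mu>_in \<mu>_fin N < \<infinity>"
 shows "particle_value M F0 W T half_sq f \<mu>_in \<mu>_fin N \<le> ennreal (total_cost Q (feedback Q T \<beta>) + swarm_error \<beta> / sqrt (real N))"
proof -
 have "particle_admissible M F0 W T half_sq f \<mu>_in \<mu>_fin N \<noteq> {}"
  using fin by (auto simp: particle_value_def)
 then obtain \<alpha> where "\<alpha> \<in> particle_admissible M F0 W T half_sq f \<mu>_in \<mu>_fin N" by blast
 then have "\<exists>X :: nat => real => 'w => real ^ 'm. (\<forall>i\<in>{1..N}. X i 0 \<in> borel_measurable F0 \<and> law M (X i 0) = \<mu>_in) \<and> indep_vars (%_. borel) (%i. X i 0) {1..N}"
  unfolding particle_admissible_def mem_Collect_eq by blast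
 then obtain X :: "nat => real => 'w => real ^ 'm" where X: "\<forall>i\<in>{1..N}. X i 0 \<in> borel_measurable F0 \<and> law M (X i 0) = \<mu>_in"
  and ind: "indep_vars (%_. borel) (%i. X i 0) {1..N}" by blast
 show ?thesis
  by (rule canonical_to_particles[OF \<beta> N _ _ ind]) (use X in blast)+
qed

proposition particle_value_tendsto:
 assumes mf: "mf_value M F0 W T half_sq f \<mu>_in \<mu>_fin < \<infinity>"
  and fin: "\<forall>N\<ge>1. particle_value M F0 W T half_sq f \<mu>_in \<mu>_fin N < \<infinity>"
 shows "(%N. particle_value M F0 W T half_sq f \<mu>_in \<mu>_fin N) \<longlonglongrightarrow> mf_value M F0 W T half_sq f \<mu>_in \<mu>_fin"
proof (rule order_tendstoI)
 have inv: "(%N. c / sqrt (real N)) \<longlonglongrightarrow> 0" for c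
  by (intro real_tendsto_divide_at_top[OF tendsto_const] filterlim_compose[OF sqrt_at_top filterlim_real_sequentially])
 fix a assume a: "a < mf_value M F0 W T half_sq f \<mu>_in \<mu>_fin"
 obtain v where v: "0 \<le> v" "mf_value M F0 W T half_sq f \<mu>_in \<mu>_fin = ennreal v"
  using mf by (cases "mf_value M F0 W T half_sq f \<mu>_in \<mu>_fin") auto
 obtain C where C: "\<forall>N\<ge>1. ennreal (v - C / sqrt (real N)) \<le> particle_value M F0 W T half_sq f \<mu>_in \<mu>_fin N"
  using particle_value_lower[OF v] by blast
 have "(%N. ennreal (v - C / sqrt (real N))) \<longlonglongrightarrow> ennreal (v - 0)"
  by (intro tendsto_ennrealI tendsto_diff tendsto_const inv)
 then have "\<forall>\<^sub>F N in sequentially. a < ennreal (v - C / sqrt (real N))"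
  by (rule order_tendstoD(1)) (use a v in simp)
 with eventually_ge_at_top[of 1] show "\<forall>\<^sub>F N in sequentially. a < particle_value M F0 W T half_sq f \<mu>_in \<mu>_fin N"
  by eventually_elim (use C in \<open>auto intro: less_le_trans\<close>)
next
 have inv: "(%N. c / sqrt (real N)) \<longlonglongrightarrow> 0" for c
  by (intro real_tendsto_divide_at_top[OF tendsto_const] filterlim_compose[OF sqrt_at_top filterlim_real_sequentially])
 fix a assume "mf_value M F0 W T half_sq f \<mu>_in \<mu>_fin < a"
 then obtain \<alpha> where adm: "\<alpha> \<in> mf_admissible M F0 W T half_sq f \<mu>_in \<mu>_fin"
  and less: "(\<integral>\<^sup>+\<omega>. running_cost T f \<alpha> \<omega> \<partial>P) < a"
  unfolding mf_value_def INF_less_iff by blast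
 obtain \<beta> where \<beta>: "canonical_drift \<beta>" and le: "ennreal (total_cost Q (feedback Q T \<beta>)) \<le> (\<integral>\<^sup>+\<omega>. running_cost T f \<alpha> \<omega> \<partial>P)"
  by (rule mf_to_canonical[OF adm])
 have "(%N. ennreal (total_cost Q (feedback Q T \<beta>) + swarm_error \<beta> / sqrt (real N))) \<longlonglongrightarrow> ennreal (total_cost Q (feedback Q T \<beta>) + 0)"
  by (intro tendsto_ennrealI tendsto_add tendsto_const inv)
 then have "\<forall>\<^sub>F N in sequentially. ennreal (total_cost Q (feedback Q T \<beta>) + swarm_error \<beta> / sqrt (real N)) < a"
  by (rule order_tendstoD(2)) (use le less in auto)
 with eventually_ge_at_top[of 1] show "\<forall>\<^sub>F N in sequentially. particle_value M F0 W T half_sq f \<mu>_in \<mu>_fin N < a"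
 proof eventually_elim
  case (elim N)
  show ?case
   by (rule le_less_trans[OF particle_value_upper[OF \<beta> elim(1)] elim(2)]) (use fin elim(1) in blast)
 qed
qed

end

theorem theorem1p2:
 fixes M F0 :: "'w::polish_space measure"
  and W :: "nat \<Rightarrow> real \<Rightarrow> 'w \<Rightarrow> real ^ 'm"
  and T p C1 C2 lf lam :: real
  and \<mu>_in \<mu>_fin :: "(real ^ 'm) measure"
  and \<Psi> :: "real ^ 'm \<Rightarrow> real"
  and f1 :: "real \<Rightarrow> real ^ 'm \<Rightarrow> real"
 assumes "T > 0"
  and "brownian_setup M F0 W T"
  and "\<mu>_in \<in> P2" and "\<mu>_fin \<in> P2"
  and "\<Psi> = (\<lambda>x. (norm x)\<^sup>2 / 2)"
  and "(\<lambda>(t, a). f1 t a) \<in> borel_measurable (restrict_space borel ({0..T} \<times> UNIV))"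
  and "\<forall>t\<in>{0..T}. (\<forall>a. f1 t differentiable at a) \<and> continuous_on UNIV (gradient (f1 t))"
  and "\<forall>t\<in>{0..T}. convex_on UNIV (f1 t)"
  and "\<forall>t\<in>{0..T}. \<forall>a. 0 \<le> f1 t a"
  and "\<forall>t\<in>{0..T}. f1 t 0 = 0"
  and "p > 1" and "C2 > 0" and "lf > 0"
  and "\<forall>t\<in>{0..T}. \<forall>a. C1 + C2 * norm a powr p \<le> f1 t a \<and> f1 t a \<le> lf + lf * (norm a)\<^sup>2"
  and "lam > 0"
  and "\<forall>t\<in>{0..T}. \<forall>a a'.
      (gradient (f1 t) a - gradient (f1 t) a') \<bullet> (a - a') \<ge> lam * (norm (a - a'))\<^sup>2"
  and "mf_value M F0 W T \<Psi> f1 \<mu>_in \<mu>_fin < \<infinity>"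
  and "\<forall>N\<ge>1. particle_value M F0 W T \<Psi> f1 \<mu>_in \<mu>_fin N < \<infinity>"
 shows "(\<lambda>N. particle_value M F0 W T \<Psi> f1 \<mu>_in \<mu>_fin N)
      \<longlonglongrightarrow> mf_value M F0 W T \<Psi> f1 \<mu>_in \<mu>_fin"
proof -
 interpret brownian_setup M F0 W T by fact
 interpret cost T lf lam f1
 proof
  show "0 < T" "0 < lf" "0 < lam" by fact+
  show "(%(t, a). f1 t a) \<in> borel_measurable (restrict_space borel ({0..T} \<times> UNIV))" by fact
 qed (use assms in auto)
 have "mf_admissible M F0 W T \<Psi> f1 \<mu>_in \<mu>_fin \<noteq> {}"
  using assms(17) by (auto simp: mf_value_def)
 then obtain X :: "real => 'w => real ^ 'm" where "X 0 \<in> borel_measurable F0" "law M (X 0) = \<mu>_in"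
  unfolding mf_admissible_def by blast
 then interpret control_problem M F0 W T lf lam f1 \<mu>_in \<mu>_fin "X 0"
  by unfold_locales (use assms in auto)
 show ?thesis
  using particle_value_tendsto assms(17,18) unfolding \<open>\<Psi> = (%x. (norm x)\<^sup>2 / 2)\<close> by blast
qed

end
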